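(* Assume that $K=\mathbb C$. Let $C$ be a symmetrizable generalized Cartan matrix with symmetrizer $D$ and orientation $\Omega$, and let $H(k)=H(C,kD,\Omega)$ for $k\ge 1$. Then for all sequences $\underline{\mathbf r}=(\mathbf r_1,\ldots,\mathbf r_l)$ of rank vectors ($l\ge 2$) the topological Euler characteristic $\chi(\mathrm{Flf}^{H(k)}_{\underline{\mathbf r}})$ does not depend on $k$, i.e. $\chi(\mathrm{Flf}^{H(k)}_{\underline{\mathbf r}})=\chi(\mathrm{Flf}^{H(k')}_{\underline{\mathbf r}})$ for all $k,k'\ge 1$.
   Context: $\mathbb N=\{0,1,2,\ldots\}$; modules are finite-dimensional left modules; $K=\mathbb C$. The algebra $H(C,D,\Omega)$: $C=(c_{ij})\in M_n(\mathbb Z)$ satisfies $c_{ii}=2$ and $c_{ij}\le 0$ for $i\ne j$; a symmetrizer is $D=\mathrm{diag}(c_1,\ldots,c_n)$ with $c_i\in\mathbb Z_{>0}$ and $c_ic_{ij}=c_jc_{ji}$ for all $i,j$. When $c_{ij}<0$ put $g_{ij}=|\gcd(c_{ij},c_{ji})|$, $f_{ij}=|c_{ij}|/g_{ij}$. An orientation is a subset $\Omega\subset\{1,\ldots,n\}^2$ such that $\{(i,j),(j,i)\}\cap\Omega\neq\varnothing$ iff $c_{ij}<0$, and such that for each sequence $(i_1,i_2),(i_2,i_3),\ldots,(i_t,i_{t+1})$ of elements of $\Omega$ with $t\ge 1$ one has $i_1\neq i_{t+1}$. Let $Q$ be the quiver with vertices $1,\ldots,n$ and arrows $\alpha_{ij}^{(g)}\colon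 j\to i$ for $(i,j)\in\Omega$, $1\le g\le g_{ij}$, and loops $\varepsilon_i\colon i\to i$ for $1\le i\le n$. Then $H(C,D,\Omega)=KQ/I$, where $I$ is generated by the relations $\varepsilon_i^{c_i}=0$ for all $i$ and $\varepsilon_i^{f_{ji}}\alpha_{ij}^{(g)}=\alpha_{ij}^{(g)}\varepsilon_j^{f_{ij}}$ for all $(i,j)\in\Omega$, $1\le g\le g_{ij}$. The algebra $H(k)=H(C,kD,\Omega)$ is defined in the same way with each $c_i$ in $D$ replaced by $kc_i$. Let $H_i(k)\cong K[x]/(x^{kc_i})$ be the subalgebra of $H(k)$ generated by $\varepsilon_i$. An $H(k)$-module $M$, viewed as a representation $(M_i,M(\varepsilon_i),M(\alpha_{ij}^{(g)}))$, is locally free if each $M_i$ is a free $H_i(k)$-module; its rank vector is $\underline{\mathrm{rank}}_{H(k)}(M)=(\mathrm{rank}(M_1),\ldots,\mathrm{rank}(M_n))\in\mathbb N^n$. A module $M$ is rigid if $\mathrm{Ext}^1_{H(k)}(M,M)=0$. For a locally free $H(k)$-module $M$ and rank vectors $\mathbf r_1,\ldots,\mathbf r_l\in\mathbb N^n$, $\mathrm{Flf}^{H(k)}_{\underline{\mathbf r}}(M)$ is the quasi-projective variety of flags $0=U_0\subset U_1\subset\cdots\subset U_l=M$ of locally free submodules with $\underline{\mathrm{rank}}_{H(k)}(U_j/U_{j-1})=\mathbf r_j$ for $j=1,\ldots,l$. Put $\mathbf m=\mathbf r_1+\cdots+\mathbf r_l$. There is up to isomorphism at most one rigid locally free $H(k)$-module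 with rank vector $\mathbf m$; it is denoted $M_{\mathbf m,k}$, and one sets $M_{\mathbf m,k}=0$ if there is none. Put $\mathrm{Flf}^{H(k)}_{\underline{\mathbf r}}:=\mathrm{Flf}^{H(k)}_{\underline{\mathbf r}}(M_{\mathbf m,k})$. *)

theory Defs
  imports
    "HOL-Analysis.Analysis"
    "HOL-Homology.Homology"
    "HOL-Algebra.QuotRing"
    "HOL-Algebra.Module"
begin

section \<open>Cartan data\<close>

text \<open>Matrices in \<open>M\<^sub>n(\<int>)\<close> are functions on indices, only the values on \<open>{1..n}\<close> being relevant;
  the diagonal matrix \<open>D\<close> is given by its diagonal \<open>c\<close>.\<close>

definition generalized_cartan_matrix :: "nat \<Rightarrow> (nat \<Rightarrow> nat \<Rightarrow> int) \<Rightarrow> bool" where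
  "generalized_cartan_matrix n C \<longleftrightarrow>
     (\<forall>i\<in>{1..n}. C i i = 2) \<and> (\<forall>i\<in>{1..n}. \<forall>j\<in>{1..n}. i \<noteq> j \<longrightarrow> C i j \<le> 0)"

definition symmetrizer :: "nat \<Rightarrow> (nat \<Rightarrow> nat \<Rightarrow> int) \<Rightarrow> (nat \<Rightarrow> nat) \<Rightarrow> bool" where
  "symmetrizer n C c \<longleftrightarrow>
     (\<forall>i\<in>{1..n}. c i > 0) \<and> (\<forall>i\<in>{1..n}. \<forall>j\<in>{1..n}. int (c i) * C i j = int (c j) * C j i)"

definition orientation :: "nat \<Rightarrow> (nat \<Rightarrow> nat \<Rightarrow> int) \<Rightarrow> (nat \<times> nat) set \<Rightarrow> bool" where
  "orientation n C \<Omega> \<longleftrightarrow>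
     \<Omega> \<subseteq> {1..n} \<times> {1..n} \<and>
     (\<forall>i\<in>{1..n}. \<forall>j\<in>{1..n}. {(i, j), (j, i)} \<inter> \<Omega> \<noteq> {} \<longleftrightarrow> C i j < 0) \<and>
     acyclic \<Omega>"


section \<open>Left modules over a ring\<close>

text \<open>The locale \<^locale>\<open>module\<close> of the library requires a commutative ring. As there, the fields
  \<^const>\<open>mult\<close> and \<^const>\<open>one\<close> of the module record carry no meaning.\<close>

locale left_module = R?: ring R + M?: abelian_group M
    for R :: "('r, 's) ring_scheme" (structure) and M :: "('r, 'v, 't) module_scheme" (structure) +
  assumes smult_closed:
      "\<lbrakk>a \<in> carrier R; x \<in> carrier M\<rbrakk> \<Longrightarrow> a \<odot>\<^bsub>M\<^esub> x \<in> carrier M"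
    and smult_l_distr:
      "\<lbrakk>a \<in> carrier R; b \<in> carrier R; x \<in> carrier M\<rbrakk> \<Longrightarrow>
         (a \<oplus>\<^bsub>R\<^esub> b) \<odot>\<^bsub>M\<^esub> x = a \<odot>\<^bsub>M\<^esub> x \<oplus>\<^bsub>M\<^esub> b \<odot>\<^bsub>M\<^esub> x"
    and smult_r_distr:
      "\<lbrakk>a \<in> carrier R; x \<in> carrier M; y \<in> carrier M\<rbrakk> \<Longrightarrow>
         a \<odot>\<^bsub>M\<^esub> (x \<oplus>\<^bsub>M\<^esub> y) = a \<odot>\<^bsub>M\<^esub> x \<oplus>\<^bsub>M\<^esub> a \<odot>\<^bsub>M\<^esub> y"
    and smult_assoc:
      "\<lbrakk>a \<in> carrier R; b \<in> carrier R; x \<in> carrier M\<rbrakk> \<Longrightarrow>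
         (a \<otimes>\<^bsub>R\<^esub> b) \<odot>\<^bsub>M\<^esub> x = a \<odot>\<^bsub>M\<^esub> (b \<odot>\<^bsub>M\<^esub> x)"
    and smult_one:
      "x \<in> carrier M \<Longrightarrow> \<one>\<^bsub>R\<^esub> \<odot>\<^bsub>M\<^esub> x = x"

definition lmod_hom ::
    "('r, 's) ring_scheme \<Rightarrow> ('r, 'v) module \<Rightarrow> ('r, 'w) module \<Rightarrow> ('v \<Rightarrow> 'w) set" where
  "lmod_hom R M N = {f \<in> hom (add_monoid M) (add_monoid N).
     \<forall>a\<in>carrier R. \<forall>x\<in>carrier M. f (a \<odot>\<^bsub>M\<^esub> x) = a \<odot>\<^bsub>N\<^esub> f x}"

definition quotient_module :: "('r, 'v) module \<Rightarrow> 'v set \<Rightarrow> ('r, 'v set) module" where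
  "quotient_module M U =
     \<lparr>carrier = a_rcosets\<^bsub>M\<^esub> U, mult = undefined, one = undefined, zero = U, add = set_add M,
      smult = (\<lambda>a X. set_add M U ((\<lambda>x. a \<odot>\<^bsub>M\<^esub> x) ` X))\<rparr>"

text \<open>\<open>Ext\<^sup>1\<^sub>R(M, N)\<close> in Yoneda's description: classes of short exact sequences
  \<open>0 \<rightarrow> N \<rightarrow> E \<rightarrow> M \<rightarrow> 0\<close>. The middle terms range over the modules whose elements have the same type
  \<^typ>\<open>'v\<close> as those of \<open>M\<close> and \<open>N\<close>, so this is the right notion only when \<^typ>\<open>'v\<close> is large enough
  to hold a copy of \<open>M \<times> N\<close>; below it is used for finite-dimensional modules with
  \<open>'v = nat \<Rightarrow> complex\<close>.\<close>

definition extensions ::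
    "('r, 's) ring_scheme \<Rightarrow> ('r, 'v) module \<Rightarrow> ('r, 'v) module \<Rightarrow>
     (('r, 'v) module \<times> ('v \<Rightarrow> 'v) \<times> ('v \<Rightarrow> 'v)) set" where
  "extensions R M N = {(E, f, g). left_module R E \<and>
     f \<in> lmod_hom R N E \<and> inj_on f (carrier N) \<and>
     g \<in> lmod_hom R E M \<and> g ` carrier E = carrier M \<and>
     f ` carrier N = a_kernel E M g}"

definition yoneda_equiv ::
    "('r, 's) ring_scheme \<Rightarrow> ('r, 'v) module \<Rightarrow> ('r, 'v) module \<Rightarrow>
     (('r, 'v) module \<times> ('v \<Rightarrow> 'v) \<times> ('v \<Rightarrow> 'v)) rel" where
  "yoneda_equiv R M N = {((E, f, g), (E', f', g')).
     (E, f, g) \<in> extensions R M N \<and> (E', f', g') \<in> extensions R M N \<and>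
     (\<exists>\<phi>\<in>lmod_hom R E E'. (\<forall>x\<in>carrier N. \<phi> (f x) = f' x) \<and> (\<forall>y\<in>carrier E. g' (\<phi> y) = g y))}"

definition Ext1 ::
    "('r, 's) ring_scheme \<Rightarrow> ('r, 'v) module \<Rightarrow> ('r, 'v) module \<Rightarrow>
     (('r, 'v) module \<times> ('v \<Rightarrow> 'v) \<times> ('v \<Rightarrow> 'v)) set set" where
  "Ext1 R M N = extensions R M N // yoneda_equiv R M N"

text \<open>The group \<open>Ext\<^sup>1(M, M)\<close> is zero iff it has exactly one element.\<close>

definition rigid :: "('r, 's) ring_scheme \<Rightarrow> ('r, 'v) module \<Rightarrow> bool" where
  "rigid R M \<longleftrightarrow> is_singleton (Ext1 R M M)"


section \<open>Topological Euler characteristic\<close>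

text \<open>Rank of an abelian group (written multiplicatively): the maximal number of
  \<open>\<int>\<close>-linearly independent elements. It is meaningful only if this number is finite.\<close>

definition int_independent :: "('g, 'm) monoid_scheme \<Rightarrow> 'g set \<Rightarrow> bool" where
  "int_independent G S \<longleftrightarrow> finite S \<and> S \<subseteq> carrier G \<and>
     (\<forall>z :: 'g \<Rightarrow> int. (\<Otimes>\<^bsub>G\<^esub>s\<in>S. s [^]\<^bsub>G\<^esub> z s) = \<one>\<^bsub>G\<^esub> \<longrightarrow> (\<forall>s\<in>S. z s = 0))"

definition abelian_group_rank :: "('g, 'm) monoid_scheme \<Rightarrow> nat" where
  "abelian_group_rank G = Sup {card S | S. int_independent G S}"

definition betti_number :: "nat \<Rightarrow> 'x topology \<Rightarrow> nat" where
  "betti_number p X = abelian_group_rank (homology_group (int p) X)"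

text \<open>Meaningful for spaces whose total singular homology has finite rank, such as complex
  algebraic varieties.\<close>

definition euler_characteristic :: "'x topology \<Rightarrow> int" where
  "euler_characteristic X =
     (\<Sum>p | betti_number p X \<noteq> 0. (-1) ^ p * int (betti_number p X))"


section \<open>Topology on spaces of subspaces and flags\<close>

text \<open>\<open>\<complex>\<^sup>N\<close>, realised as the sequences vanishing from position \<open>N\<close> on.\<close>

definition coord_space :: "nat \<Rightarrow> (nat \<Rightarrow> complex) set" where
  "coord_space N = {v. \<forall>a\<ge>N. v a = 0}"

text \<open>Ordered \<open>d\<close>-tuples of linearly independent vectors, padded with zeros.\<close>

definition frames :: "(nat \<Rightarrow> complex) set \<Rightarrow> nat \<Rightarrow> (nat \<Rightarrow> nat \<Rightarrow> complex) set" where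
  "frames V d = {b. (\<forall>a<d. b a \<in> V) \<and> (\<forall>a\<ge>d. b a = (\<lambda>_. 0)) \<and>
     (\<forall>z :: nat \<Rightarrow> complex. (\<forall>x. (\<Sum>a<d. z a * b a x) = 0) \<longrightarrow> (\<forall>a<d. z a = 0))}"

definition frame_span :: "nat \<Rightarrow> (nat \<Rightarrow> nat \<Rightarrow> complex) \<Rightarrow> (nat \<Rightarrow> complex) set" where
  "frame_span d b = {(\<lambda>x. \<Sum>a<d. z a * b a x) | z. True}"

text \<open>The disjoint union over \<open>d\<close> of the Grassmannians \<open>Gr\<^sub>d(V)\<close>, \<open>V\<close> a finite-dimensional subspace,
  each with the quotient of the Euclidean topology along \<open>frames V d \<rightarrow> Gr\<^sub>d(V)\<close>.
  The instance topology on \<^typ>\<open>nat \<Rightarrow> nat \<Rightarrow> complex\<close> is the product topology, which on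
  \<open>frames (coord_space N) d\<close> is that of \<open>N \<times> d\<close> matrices.\<close>

definition open_in_grassmannian :: "(nat \<Rightarrow> complex) set \<Rightarrow> (nat \<Rightarrow> complex) set set \<Rightarrow> bool" where
  "open_in_grassmannian V W \<longleftrightarrow> W \<subseteq> (\<Union>d. frame_span d ` frames V d) \<and>
     (\<forall>d. openin (top_of_set (frames V d)) {b \<in> frames V d. frame_span d b \<in> W})"

definition grassmannian :: "(nat \<Rightarrow> complex) set \<Rightarrow> (nat \<Rightarrow> complex) set topology" where
  "grassmannian V = topology (open_in_grassmannian V)"

lemma openin_grassmannian: "openin (grassmannian V) W \<longleftrightarrow> open_in_grassmannian V W"
proof -
  have "istopology (open_in_grassmannian V)"
    unfolding istopology_def
  proof (intro conjI allI impI)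
    fix S T assume S: "open_in_grassmannian V S" and T: "open_in_grassmannian V T"
    have eq: "{b \<in> frames V d. frame_span d b \<in> S \<inter> T} =
        {b \<in> frames V d. frame_span d b \<in> S} \<inter> {b \<in> frames V d. frame_span d b \<in> T}" for d
      by auto
    show "open_in_grassmannian V (S \<inter> T)"
      using S T unfolding open_in_grassmannian_def eq by (auto intro: openin_Int)
  next
    fix \<K> assume K: "\<forall>S\<in>\<K>. open_in_grassmannian V S"
    have eq: "{b \<in> frames V d. frame_span d b \<in> \<Union>\<K>} =
        \<Union>((\<lambda>S. {b \<in> frames V d. frame_span d b \<in> S}) ` \<K>)" for d
      by auto
    show "open_in_grassmannian V (\<Union>\<K>)"
      using K unfolding open_in_grassmannian_def eq by (fastforce intro: openin_Union)
  qed
  then show ?thesis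
    by (simp add: grassmannian_def topology_inverse')
qed


section \<open>The quiver and its path algebra\<close>

text \<open>\<open>Alpha i j g\<close> is the arrow \<open>\<alpha>\<^sub>i\<^sub>j\<^sup>(\<^sup>g\<^sup>)\<close> from \<open>j\<close> to \<open>i\<close>.\<close>

datatype arrow = Eps nat | Alpha nat nat nat

primrec arrow_target :: "arrow \<Rightarrow> nat" where
  "arrow_target (Eps i) = i"
| "arrow_target (Alpha i j g) = i"

primrec arrow_source :: "arrow \<Rightarrow> nat" where
  "arrow_source (Eps i) = i"
| "arrow_source (Alpha i j g) = j"

text \<open>A path is a pair \<open>(i, [a\<^sub>1, \<dots>, a\<^sub>m])\<close> standing for \<open>a\<^sub>1 \<cdots> a\<^sub>m\<close>, where arrows compose like maps:
  \<open>i\<close> is the target of \<open>a\<^sub>1\<close> (and of the path), and the source of each arrow is the target of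
  the next one.\<close>

type_synonym path = "nat \<times> arrow list"

primrec path_source :: "nat \<Rightarrow> arrow list \<Rightarrow> nat" where
  "path_source i [] = i"
| "path_source i (a # as) = path_source (arrow_source a) as"

primrec composable :: "nat \<Rightarrow> arrow list \<Rightarrow> bool" where
  "composable i [] \<longleftrightarrow> True"
| "composable i (a # as) \<longleftrightarrow> arrow_target a = i \<and> composable (arrow_source a) as"

lemma path_source_append: "path_source i (as @ bs) = path_source (path_source i as) bs"
  by (induction as arbitrary: i) auto

lemma composable_append:
  "composable i (as @ bs) \<longleftrightarrow> composable i as \<and> composable (path_source i as) bs"
  by (induction as arbitrary: i) auto

definition path_vector :: "path \<Rightarrow> path \<Rightarrow> complex" where
  "path_vector p = (\<lambda>q. if q = p then 1 else 0)"

text \<open>In this locale \<open>c\<close> is the diagonal of the symmetrizer actually used; \<open>H(k)\<close> is obtained by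
  instantiating it with \<open>\<lambda>i. k * c i\<close>.\<close>

locale gls =
  fixes n :: nat and C :: "nat \<Rightarrow> nat \<Rightarrow> int" and c :: "nat \<Rightarrow> nat" and \<Omega> :: "(nat \<times> nat) set"
begin

definition g :: "nat \<Rightarrow> nat \<Rightarrow> nat" where
  "g i j = nat \<bar>gcd (C i j) (C j i)\<bar>"

definition f :: "nat \<Rightarrow> nat \<Rightarrow> nat" where
  "f i j = nat \<bar>C i j\<bar> div g i j"

definition arrows :: "arrow set" where
  "arrows = {Eps i | i. i \<in> {1..n}} \<union> {Alpha i j h | i j h. (i, j) \<in> \<Omega> \<and> 1 \<le> h \<and> h \<le> g i j}"

definition paths :: "path set" where
  "paths = {(i, as). i \<in> {1..n} \<and> set as \<subseteq> arrows \<and> composable i as}"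

text \<open>\<open>KQ\<close>: finitely supported functions on paths. A path has one factorisation into two paths for
  each position at which it can be cut, whence the convolution formula.\<close>

definition path_algebra :: "(path \<Rightarrow> complex) ring" where
  "path_algebra =
     \<lparr>carrier = {u. finite {p. u p \<noteq> 0} \<and> {p. u p \<noteq> 0} \<subseteq> paths},
      mult = (\<lambda>u v (i, as). \<Sum>m\<le>length as. u (i, take m as) * v (path_source i (take m as), drop m as)),
      one = (\<lambda>(i, as). if i \<in> {1..n} \<and> as = [] then 1 else 0),
      zero = (\<lambda>_. 0),
      add = (\<lambda>u v p. u p + v p)\<rparr>"

lemma path_source_in:
  assumes "\<Omega> \<subseteq> {1..n} \<times> {1..n}" "i \<in> {1..n}" "set as \<subseteq> arrows"
  shows "path_source i as \<in> {1..n}"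
  using assms(2,3)
proof (induction as arbitrary: i)
  case (Cons a as)
  have "arrow_source a \<in> {1..n}"
    using Cons.prems assms(1) by (auto simp: arrows_def)
  then show ?case using Cons.IH[of "arrow_source a"] Cons.prems(2) by simp
qed simp

lemma path_algebra_carrier:
  "u \<in> carrier path_algebra \<longleftrightarrow> finite {p. u p \<noteq> 0} \<and> {p. u p \<noteq> 0} \<subseteq> paths"
  by (simp add: path_algebra_def)

lemma path_algebra_mult: "(u \<otimes>\<^bsub>path_algebra\<^esub> v) (i, as) =
    (\<Sum>m\<le>length as. u (i, take m as) * v (path_source i (take m as), drop m as))"
  by (simp add: path_algebra_def)

lemma path_algebra_add: "(u \<oplus>\<^bsub>path_algebra\<^esub> v) p = u p + v p"
  by (simp add: path_algebra_def)

lemma path_algebra_ring: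
  assumes om: "\<Omega> \<subseteq> {1..n} \<times> {1..n}"
  shows "ring path_algebra"
proof (rule ringI)
  show "abelian_group path_algebra"
  proof (rule abelian_groupI, goal_cases)
    case (1 x y)
    have "{p. x p + y p \<noteq> 0} \<subseteq> {p. x p \<noteq> 0} \<union> {p. y p \<noteq> 0}" by auto
    then show ?case using 1 by (auto simp: path_algebra_def intro: finite_subset)
  next
    case (6 x)
    then show ?case
      by (intro bexI[of _ "\<lambda>p. - x p"]) (auto simp: path_algebra_def)
  qed (auto simp: path_algebra_def fun_eq_iff)
next
  show "monoid path_algebra"
  proof (rule monoidI, goal_cases)
    case (1 x y)
    let ?P = "{p. x p \<noteq> 0}" and ?Q = "{p. y p \<noteq> 0}"
    let ?S = "{((i, as), (j, bs)). (i, as) \<in> ?P \<and> (j, bs) \<in> ?Q \<and> j = path_source i as}"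
    have fin: "finite ?P" "finite ?Q" and sub: "?P \<subseteq> paths" "?Q \<subseteq> paths"
      using 1 by (auto simp: path_algebra_def)
    have "finite ?S" by (rule finite_subset[of _ "?P \<times> ?Q"]) (use fin in auto)
    moreover have s: "{p. (x \<otimes>\<^bsub>path_algebra\<^esub> y) p \<noteq> 0} \<subseteq> (\<lambda>(p, q). (fst p, snd p @ snd q)) ` ?S"
    proof
      fix p assume "p \<in> {p. (x \<otimes>\<^bsub>path_algebra\<^esub> y) p \<noteq> 0}"
      then obtain i as where p: "p = (i, as)" and
        "(\<Sum>m\<le>length as. x (i, take m as) * y (path_source i (take m as), drop m as)) \<noteq> 0"
        by (cases p) (auto simp: path_algebra_def)
      then obtain m where "x (i, take m as) * y (path_source i (take m as), drop m as) \<noteq> 0"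
        by (meson sum.neutral)
      then show "p \<in> (\<lambda>(p, q). (fst p, snd p @ snd q)) ` ?S"
        unfolding p by (intro image_eqI[of _ _ "((i, take m as), (path_source i (take m as), drop m as))"]) auto
    qed
    ultimately have "finite {p. (x \<otimes>\<^bsub>path_algebra\<^esub> y) p \<noteq> 0}" by (meson finite_imageI finite_subset)
    moreover have "(\<lambda>(p, q). (fst p, snd p @ snd q)) ` ?S \<subseteq> paths"
    proof -
      have "i \<in> {1..n} \<and> set as \<subseteq> arrows \<and> composable i as" if "x (i, as) \<noteq> 0 \<or> y (i, as) \<noteq> 0" for i as
        using sub that by (auto simp: paths_def)
      then show ?thesis by (fastforce simp: paths_def composable_append)
    qed
    ultimately show ?case using s by (auto simp: path_algebra_def)
  next
    case 2
    have "{p. \<one>\<^bsub>path_algebra\<^esub> p \<noteq> 0} \<subseteq> (\<lambda>i. (i, [])) ` {1..n}"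
      by (auto simp: path_algebra_def split: if_splits)
    moreover from this have "finite {p. \<one>\<^bsub>path_algebra\<^esub> p \<noteq> 0}"
      using finite_subset by blast
    moreover have "(\<lambda>i. (i, [])) ` {1..n} \<subseteq> paths" by (auto simp: paths_def)
    ultimately show ?case unfolding path_algebra_carrier by blast
  next
    case (3 x y z)
    show ?case
    proof (rule ext, clarify)
      fix i :: nat and as :: "arrow list"
      let ?L = "length as"
      let ?t = "\<lambda>q s. x (i, take q as) * (y (path_source i (take q as), take s (drop q as)) *
          z (path_source i (take (q + s) as), drop (q + s) as))"
      have "(x \<otimes>\<^bsub>path_algebra\<^esub> y \<otimes>\<^bsub>path_algebra\<^esub> z) (i, as) =
        (\<Sum>m\<le>?L. \<Sum>q\<le>m. ?t q (m - q))"
        unfolding path_algebra_def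
        by (auto simp: sum_distrib_right min_def drop_take mult.assoc intro!: sum.cong)
      also have "\<dots> = (\<Sum>(q, s) | q + s \<le> ?L. ?t q s)"
        by (rule sum.triangle_reindex_eq[symmetric])
      also have "{(q, s). q + s \<le> ?L} = Sigma {..?L} (\<lambda>q. {..?L - q})" by auto
      also have "(\<Sum>(q, s)\<in>Sigma {..?L} (\<lambda>q. {..?L - q}). ?t q s) = (\<Sum>q\<le>?L. \<Sum>s\<le>?L - q. ?t q s)"
        by (rule sum.Sigma[symmetric]) auto
      also have "\<dots> = (x \<otimes>\<^bsub>path_algebra\<^esub> (y \<otimes>\<^bsub>path_algebra\<^esub> z)) (i, as)"
        unfolding path_algebra_def
        by (auto simp: sum_distrib_left take_add path_source_append add.commute intro!: sum.cong)
      finally show "(x \<otimes>\<^bsub>path_algebra\<^esub> y \<otimes>\<^bsub>path_algebra\<^esub> z) (i, as) =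
        (x \<otimes>\<^bsub>path_algebra\<^esub> (y \<otimes>\<^bsub>path_algebra\<^esub> z)) (i, as)" .
    qed
  next
    case (4 x)
    show ?case
    proof (rule ext, clarify)
      fix i :: nat and as :: "arrow list"
      have "(\<one>\<^bsub>path_algebra\<^esub> \<otimes>\<^bsub>path_algebra\<^esub> x) (i, as) =
        (\<Sum>m\<le>length as. \<one>\<^bsub>path_algebra\<^esub> (i, take m as) * x (path_source i (take m as), drop m as))"
        by (simp add: path_algebra_def)
      also have "\<dots> = (\<Sum>m\<le>length as. if m = 0 then if i \<in> {1..n} then x (i, as) else 0 else 0)"
        by (rule sum.cong) (auto simp: path_algebra_def)
      also have "\<dots> = x (i, as)"
        using 4 by (auto simp: path_algebra_def paths_def)
      finally show "(\<one>\<^bsub>path_algebra\<^esub> \<otimes>\<^bsub>path_algebra\<^esub> x) (i, as) = x (i, as)" .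
    qed
  next
    case (5 x)
    show ?case
    proof (rule ext, clarify)
      fix i :: nat and as :: "arrow list"
      have "(x \<otimes>\<^bsub>path_algebra\<^esub> \<one>\<^bsub>path_algebra\<^esub>) (i, as) =
        (\<Sum>m\<le>length as. x (i, take m as) * \<one>\<^bsub>path_algebra\<^esub> (path_source i (take m as), drop m as))"
        by (simp add: path_algebra_def)
      also have "\<dots> = (\<Sum>m\<le>length as. if m = length as then if path_source i as \<in> {1..n} then x (i, as) else 0 else 0)"
        by (rule sum.cong) (auto simp: path_algebra_def)
      also have "\<dots> = (if path_source i as \<in> {1..n} then x (i, as) else 0)"
        by (subst sum.delta) auto
      also have "\<dots> = x (i, as)"
      proof (cases "x (i, as) = 0")
        case False
        then have "(i, as) \<in> paths" using 5 by (auto simp: path_algebra_def)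
        then show ?thesis using path_source_in[OF om] by (auto simp: paths_def)
      qed auto
      finally show "(x \<otimes>\<^bsub>path_algebra\<^esub> \<one>\<^bsub>path_algebra\<^esub>) (i, as) = x (i, as)" .
    qed
  qed
next
  fix x y z
  have "((x \<oplus>\<^bsub>path_algebra\<^esub> y) \<otimes>\<^bsub>path_algebra\<^esub> z) (i, as) =
      (x \<otimes>\<^bsub>path_algebra\<^esub> z \<oplus>\<^bsub>path_algebra\<^esub> y \<otimes>\<^bsub>path_algebra\<^esub> z) (i, as)" for i as
    by (simp add: path_algebra_mult path_algebra_add distrib_right sum.distrib)
  then show "(x \<oplus>\<^bsub>path_algebra\<^esub> y) \<otimes>\<^bsub>path_algebra\<^esub> z =
      x \<otimes>\<^bsub>path_algebra\<^esub> z \<oplus>\<^bsub>path_algebra\<^esub> y \<otimes>\<^bsub>path_algebra\<^esub> z"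
    by (intro ext) (metis surj_pair)
  have "(z \<otimes>\<^bsub>path_algebra\<^esub> (x \<oplus>\<^bsub>path_algebra\<^esub> y)) (i, as) =
      (z \<otimes>\<^bsub>path_algebra\<^esub> x \<oplus>\<^bsub>path_algebra\<^esub> z \<otimes>\<^bsub>path_algebra\<^esub> y) (i, as)" for i as
    by (simp add: path_algebra_mult path_algebra_add distrib_left sum.distrib)
  then show "z \<otimes>\<^bsub>path_algebra\<^esub> (x \<oplus>\<^bsub>path_algebra\<^esub> y) =
      z \<otimes>\<^bsub>path_algebra\<^esub> x \<oplus>\<^bsub>path_algebra\<^esub> z \<otimes>\<^bsub>path_algebra\<^esub> y"
    by (intro ext) (metis surj_pair)
qed

lemma path_vector_closed: "p \<in> paths \<Longrightarrow> path_vector p \<in> carrier path_algebra"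
  by (auto simp: path_algebra_def path_vector_def)

definition nilpotency_relations :: "(path \<Rightarrow> complex) set" where
  "nilpotency_relations = {path_vector (i, replicate (c i) (Eps i)) | i. i \<in> {1..n}}"

definition commutation_relations :: "(path \<Rightarrow> complex) set" where
  "commutation_relations =
     {(\<lambda>p. path_vector (i, replicate (f j i) (Eps i) @ [Alpha i j h]) p
          - path_vector (i, [Alpha i j h] @ replicate (f i j) (Eps j)) p)
      | i j h. (i, j) \<in> \<Omega> \<and> 1 \<le> h \<and> h \<le> g i j}"

definition relations_ideal :: "(path \<Rightarrow> complex) set" where
  "relations_ideal = Idl\<^bsub>path_algebra\<^esub> (nilpotency_relations \<union> commutation_relations)"

definition H :: "(path \<Rightarrow> complex) set ring" where
  "H = path_algebra Quot relations_ideal"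

lemma composable_loops: "i \<in> {1..n} \<Longrightarrow> composable i (replicate m (Eps i)) \<and> path_source i (replicate m (Eps i)) = i"
  by (induction m) auto

lemma relations_closed:
  assumes om: "\<Omega> \<subseteq> {1..n} \<times> {1..n}"
  shows "nilpotency_relations \<union> commutation_relations \<subseteq> carrier path_algebra"
proof -
  have diff: "(\<lambda>p. u p - v p) \<in> carrier path_algebra"
    if "u \<in> carrier path_algebra" "v \<in> carrier path_algebra" for u v
  proof -
    have "{p. u p - v p \<noteq> 0} \<subseteq> {p. u p \<noteq> 0} \<union> {p. v p \<noteq> 0}" by auto
    then show ?thesis using that unfolding path_algebra_carrier
      by (meson finite_UnI finite_subset le_sup_iff order_trans)
  qed
  have nil: "(i, replicate m (Eps i)) \<in> paths" if "i \<in> {1..n}" for i m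
    using that composable_loops[of i m] by (auto simp: paths_def arrows_def)
  have com: "(i, replicate m (Eps i) @ [Alpha i j h]) \<in> paths" "(i, [Alpha i j h] @ replicate m (Eps j)) \<in> paths"
    if "(i, j) \<in> \<Omega>" "1 \<le> h" "h \<le> g i j" for i j h m
    using that om composable_loops[of i m] composable_loops[of j m] by (auto simp: paths_def arrows_def composable_append)
  show ?thesis
    unfolding nilpotency_relations_def commutation_relations_def
    using path_vector_closed[OF nil] diff[OF path_vector_closed path_vector_closed, OF com]
    by blast
qed

lemma relations_ideal_ideal:
  assumes "\<Omega> \<subseteq> {1..n} \<times> {1..n}"
  shows "ideal relations_ideal path_algebra"
  unfolding relations_ideal_def
  using ring.genideal_ideal[OF path_algebra_ring relations_closed] assms by blast

lemma H_ring:
  assumes "\<Omega> \<subseteq> {1..n} \<times> {1..n}"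
  shows "ring H"
  unfolding H_def using ideal.quotient_is_ring[OF relations_ideal_ideal[OF assms]] .

definition residue_class :: "(path \<Rightarrow> complex) \<Rightarrow> (path \<Rightarrow> complex) set" where
  "residue_class u = relations_ideal +>\<^bsub>path_algebra\<^esub> u"

text \<open>The structure map \<open>K \<rightarrow> H\<close>.\<close>

definition scalar :: "complex \<Rightarrow> (path \<Rightarrow> complex) set" where
  "scalar z = residue_class (\<lambda>p. z * \<one>\<^bsub>path_algebra\<^esub> p)"

definition idem :: "nat \<Rightarrow> (path \<Rightarrow> complex) set" where
  "idem i = residue_class (path_vector (i, []))"

definition eps :: "nat \<Rightarrow> (path \<Rightarrow> complex) set" where
  "eps i = residue_class (path_vector (i, [Eps i]))"

text \<open>\<open>H\<^sub>i \<cong> K[x]/(x^c\<^sub>i)\<close>, the \<open>K\<close>-subalgebra of \<open>H\<close> generated by \<open>\<epsilon>\<^sub>i\<close>; its unit is the idempotent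
  \<open>e\<^sub>i\<close>, not the unit of \<open>H\<close>.\<close>

inductive_set H_loop :: "nat \<Rightarrow> (path \<Rightarrow> complex) set set" for i :: nat where
  unit: "idem i \<in> H_loop i"
| gen: "eps i \<in> H_loop i"
| add: "a \<in> H_loop i \<Longrightarrow> b \<in> H_loop i \<Longrightarrow> a \<oplus>\<^bsub>H\<^esub> b \<in> H_loop i"
| mult: "a \<in> H_loop i \<Longrightarrow> b \<in> H_loop i \<Longrightarrow> a \<otimes>\<^bsub>H\<^esub> b \<in> H_loop i"
| scale: "a \<in> H_loop i \<Longrightarrow> scalar z \<otimes>\<^bsub>H\<^esub> a \<in> H_loop i"

definition vertex_space :: "((path \<Rightarrow> complex) set, 'v) module \<Rightarrow> nat \<Rightarrow> 'v set" where
  "vertex_space M i = {idem i \<odot>\<^bsub>M\<^esub> x | x. x \<in> carrier M}"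

text \<open>\<open>M\<^sub>i = e\<^sub>i M\<close> is a free \<open>H\<^sub>i\<close>-module with a basis of \<open>r\<close> elements.\<close>

definition free_at :: "((path \<Rightarrow> complex) set, 'v) module \<Rightarrow> nat \<Rightarrow> nat \<Rightarrow> bool" where
  "free_at M i r \<longleftrightarrow>
     (\<exists>b :: nat \<Rightarrow> 'v. (\<forall>q<r. b q \<in> vertex_space M i) \<and>
        (\<forall>x\<in>vertex_space M i. \<exists>!h. h \<in> {..<r} \<rightarrow>\<^sub>E H_loop i \<and>
           x = (\<Oplus>\<^bsub>M\<^esub>q\<in>{..<r}. h q \<odot>\<^bsub>M\<^esub> b q)))"

definition locally_free :: "((path \<Rightarrow> complex) set, 'v) module \<Rightarrow> bool" where
  "locally_free M \<longleftrightarrow> (\<forall>i\<in>{1..n}. \<exists>r. free_at M i r)"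

text \<open>\<open>M\<close> is locally free and \<open>\<r>\<close> is its rank vector.\<close>

definition has_rank_vector ::
    "((path \<Rightarrow> complex) set, 'v) module \<Rightarrow> (nat \<Rightarrow> nat) \<Rightarrow> bool" where
  "has_rank_vector M \<r> \<longleftrightarrow> (\<forall>i\<in>{1..n}. free_at M i (\<r> i))"

text \<open>Finite-dimensional \<open>H\<close>-modules with underlying vector space \<open>\<complex>\<^sup>N\<close>; up to isomorphism these are
  all finite-dimensional \<open>H\<close>-modules.\<close>

definition matrix_module :: "((path \<Rightarrow> complex) set, nat \<Rightarrow> complex) module \<Rightarrow> bool" where
  "matrix_module M \<longleftrightarrow> left_module H M \<and> (\<exists>N. carrier M = coord_space N) \<and>
     \<zero>\<^bsub>M\<^esub> = (\<lambda>_. 0) \<and>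
     (\<forall>v\<in>carrier M. \<forall>w\<in>carrier M. v \<oplus>\<^bsub>M\<^esub> w = (\<lambda>a. v a + w a)) \<and>
     (\<forall>z. \<forall>v\<in>carrier M. scalar z \<odot>\<^bsub>M\<^esub> v = (\<lambda>a. z * v a))"


section \<open>Varieties of flags of locally free submodules\<close>

definition zero_module :: "((path \<Rightarrow> complex) set, nat \<Rightarrow> complex) module" where
  "zero_module =
     \<lparr>carrier = {\<lambda>_. 0}, mult = undefined, one = undefined, zero = (\<lambda>_. 0),
      add = (\<lambda>_ _ _. 0), smult = (\<lambda>_ _ _. 0)\<rparr>"

text \<open>\<open>M\<^sub>\<m>\<close>; the choice is unique up to isomorphism.\<close>

definition rigid_module ::
    "(nat \<Rightarrow> nat) \<Rightarrow> ((path \<Rightarrow> complex) set, nat \<Rightarrow> complex) module" where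
  "rigid_module \<m> =
     (if \<exists>M. matrix_module M \<and> rigid H M \<and> has_rank_vector M \<m>
      then SOME M. matrix_module M \<and> rigid H M \<and> has_rank_vector M \<m>
      else zero_module)"

definition Flf_set ::
    "((path \<Rightarrow> complex) set, nat \<Rightarrow> complex) module \<Rightarrow> nat \<Rightarrow> (nat \<Rightarrow> nat \<Rightarrow> nat) \<Rightarrow>
     (nat \<Rightarrow> (nat \<Rightarrow> complex) set) set" where
  "Flf_set M l \<r> = {U \<in> extensional {0..l}. U 0 = {\<zero>\<^bsub>M\<^esub>} \<and> U l = carrier M \<and>
     (\<forall>j\<in>{0..l}. submodule (U j) H M \<and> locally_free (M\<lparr>carrier := U j\<rparr>)) \<and>
     (\<forall>j\<in>{1..l}. U (j - 1) \<subseteq> U j \<and>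
        has_rank_vector (quotient_module (M\<lparr>carrier := U j\<rparr>) (U (j - 1))) (\<r> j))}"

definition Flf ::
    "((path \<Rightarrow> complex) set, nat \<Rightarrow> complex) module \<Rightarrow> nat \<Rightarrow> (nat \<Rightarrow> nat \<Rightarrow> nat) \<Rightarrow>
     (nat \<Rightarrow> (nat \<Rightarrow> complex) set) topology" where
  "Flf M l \<r> = subtopology (product_topology (\<lambda>_. grassmannian (carrier M)) {0..l}) (Flf_set M l \<r>)"

definition Flf_rigid :: "nat \<Rightarrow> (nat \<Rightarrow> nat \<Rightarrow> nat) \<Rightarrow> (nat \<Rightarrow> (nat \<Rightarrow> complex) set) topology" where
  "Flf_rigid l \<r> = Flf (rigid_module (\<lambda>i. \<Sum>j=1..l. \<r> j i)) l \<r>"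

end

end

(*
  A locally free H(k)-module of rank m is a family of matrices over truncated polynomial rings, and it
  lifts to power series; reducing modulo eps^k and multiplying by the central element
  sum_i eps_i^(k c_i) relate the modules over H(k) and H(k+1). Surjectivity of the adjoint action of
  prod_i GL_(m_i) on representations says that Ext^1(M,M) vanishes; by Nakayama's lemma it does not depend
  on k, and it makes the rigid module unique and compatible with all reductions H(k+1) -> H(k).
  Reduction of flags Flf(k+1) -> Flf(k) is then surjective with affine spaces as fibres: the lifts
  of a flag U are parametrised by linear sections satisfying affine conditions, whose obstruction
  vanishes by rigidity. Local continuous solutions (Cramer's rule) and a partition of unity give
  a global section, and convexity of the fibres shows that the reduction is a homotopy equivalence.
*)

theory Submission
  imports Defs "HOL-Library.Function_Algebras" "Jordan_Normal_Form.Determinant"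
begin

text \<open>Since all operators act on power series, one and the same \<open>A\<close> defines a
  module at every level, and \<open>adsurj k A\<close> for different \<open>k\<close> speaks of the
  same object. The fibres of the reduction are affine spaces that vary with the flag. Instead of
  assembling them into a bundle, lifts are overparametrised by linear sections \<open>h\<close> of
  the truncation: different \<open>h\<close> may give the same flag, but all live in one fixed
  function space, where the admissible ones form a convex set; convexity is all that gluing and the
  final straight-line homotopy need. Partitions of unity want a metric space, so flags are encoded
  by orthogonal projection matrices (\<open>PP\<close>), and the quotient topology of the
  Grassmannians is met only in the last identification. Uniqueness of the rigid module rests on the
  connectedness of the complex line minus finitely many points: on the line joining two rigid
  representations rigidity fails at most at the roots of a nonzero polynomial. Replacing a missing
  rigid module by zero is harmless because its existence does not depend on the level and zero has
  no flag of nonzero rank.\<close>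

abbreviation (input) smult_in ("(_ \<star>_ _)" [70, 1000, 71] 70) where "h \<star>M x \<equiv> h \<odot>\<^bsub>M\<^esub> x"
abbreviation (input) mult_in ("(_ \<ast>_ _)" [70, 1000, 71] 70) where "x \<ast>R y \<equiv> x \<otimes>\<^bsub>R\<^esub> y"
abbreviation (input) add_in ("(_ \<box>_ _)" [65, 1000, 66] 65) where "x \<box>R y \<equiv> x \<oplus>\<^bsub>R\<^esub> y"


section \<open>Determinants and adjugates of matrices indexed by finite sets\<close>

lemma continuous_on_det:
 fixes A :: "'u::topological_space => complex mat"
 assumes A: "!!u. A u : carrier_mat n n"
  and c: "!!i j. i < n ==> j < n ==> continuous_on B (%u. A u $$ (i, j))"
 shows "continuous_on B (%u. det (A u))"
proof -
 have "det (A u) = (\<Sum>p | p permutes {0..<n}. signof p * (\<Prod>i = 0..<n. A u $$ (i, p i)))" for u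
  using det_def'[OF A] .
 moreover have "continuous_on B (%u. (\<Sum>p | p permutes {0..<n}. signof p * (\<Prod>i = 0..<n. A u $$ (i, p i))))"
  by (intro continuous_intros c) (auto simp: permutes_in_image)
 ultimately show ?thesis by simp
qed

text \<open>An arbitrary enumeration transports matrices with numerical indices to matrices indexed
  by any finite set, such as the triples \<open>(i, q, a)\<close> or the coordinates of
  representations used below.\<close>

definition enum_of :: "'x set => nat => 'x" where
 "enum_of J = (SOME e. bij_betw e {0..<card J} J)"

lemma enum_of_bij: "finite J ==> bij_betw (enum_of J) {0..<card J} J"
 unfolding enum_of_def by (rule someI_ex[of "%e. bij_betw e {0..<card J} J"]) (rule ex_bij_betw_nat_finite)

definition jmat :: "'x set => ('x => 'x => 'a) => 'a mat" where
 "jmat J W = mat (card J) (card J) (%(i, j). W (enum_of J i) (enum_of J j))"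

definition jdet :: "'x set => ('x => 'x => complex) => complex" where
 "jdet J W = det (jmat J W)"

definition jadj :: "'x set => ('x => 'x => complex) => 'x => 'x => complex" where
 "jadj J W t s = adj_mat (jmat J W) $$
   (the_inv_into {0..<card J} (enum_of J) t, the_inv_into {0..<card J} (enum_of J) s)"

lemma jmat_carrier [simp]: "jmat J W : carrier_mat (card J) (card J)"
 by (simp add: jmat_def)

lemma jmat_dim [simp]: "dim_row (jmat J W) = card J" "dim_col (jmat J W) = card J"
 by (simp_all add: jmat_def)

lemma jmat_index: "i < card J ==> j < card J ==> jmat J W $$ (i, j) = W (enum_of J i) (enum_of J j)"
 by (simp add: jmat_def)

context
 fixes J :: "'x set"
 assumes fin: "finite J"
begin

lemma jadj_enum: "i < card J ==> j < card J ==>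
  jadj J W (enum_of J i) (enum_of J j) = adj_mat (jmat J W) $$ (i, j)"
 using enum_of_bij[OF fin] by (simp add: jadj_def bij_betw_def the_inv_into_f_f)

lemma enum_cases: assumes "t : J" obtains i where "i < card J" "t = enum_of J i"
proof -
 have "t : enum_of J ` {0..<card J}" using assms enum_of_bij[OF fin] by (simp add: bij_betw_def)
 thus thesis using that by auto
qed

lemma enum_inj: "i < card J ==> j < card J ==> enum_of J i = enum_of J j \<longleftrightarrow> i = j"
 using enum_of_bij[OF fin] by (auto simp: bij_betw_def inj_on_def)

lemma enum_mem: "i < card J ==> enum_of J i : J"
 using enum_of_bij[OF fin] by (auto simp: bij_betw_def)

lemma sum_enum: "(SUM t:J. F t) = (SUM i = 0..<card J. F (enum_of J i))"
 using sum.reindex_bij_betw[OF enum_of_bij[OF fin], of F] by simp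

lemma jadj_right:
 assumes "t : J" "s : J"
 shows "(SUM t':J. W t t' * jadj J W t' s) = (if t = s then jdet J W else 0)"
proof -
 obtain i where i: "i < card J" "t = enum_of J i" using enum_cases[OF assms(1)] .
 obtain j where j: "j < card J" "s = enum_of J j" using enum_cases[OF assms(2)] .
 have "(SUM t':J. W t t' * jadj J W t' s) = (SUM k = 0..<card J. jmat J W $$ (i, k) * adj_mat (jmat J W) $$ (k, j))"
  unfolding sum_enum using i j by (auto intro!: sum.cong simp: jadj_enum jmat_index)
 also have "... = (jmat J W * adj_mat (jmat J W)) $$ (i, j)"
  using adj_mat(1)[OF jmat_carrier, of J W] i j
  by (auto simp: times_mat_def scalar_prod_def intro!: sum.cong)
 also have "... = (if t = s then jdet J W else 0)"
  using adj_mat(2)[OF jmat_carrier, of J W] i j by (simp add: jdet_def enum_inj)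
 finally show ?thesis .
qed

lemma jadj_left:
 assumes "t : J" "s : J"
 shows "(SUM t':J. jadj J W t t' * W t' s) = (if t = s then jdet J W else 0)"
proof -
 obtain i where i: "i < card J" "t = enum_of J i" using enum_cases[OF assms(1)] .
 obtain j where j: "j < card J" "s = enum_of J j" using enum_cases[OF assms(2)] .
 have "(SUM t':J. jadj J W t t' * W t' s) = (SUM k = 0..<card J. adj_mat (jmat J W) $$ (i, k) * jmat J W $$ (k, j))"
  unfolding sum_enum using i j by (auto intro!: sum.cong simp: jadj_enum jmat_index)
 also have "... = (adj_mat (jmat J W) * jmat J W) $$ (i, j)"
  using adj_mat(1)[OF jmat_carrier, of J W] i j
  by (auto simp: times_mat_def scalar_prod_def intro!: sum.cong)
 also have "... = (if t = s then jdet J W else 0)"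
  using adj_mat(3)[OF jmat_carrier, of J W] i j by (simp add: jdet_def enum_inj)
 finally show ?thesis .
qed

lemma jdet_zero:
 assumes "jdet J W = 0"
 shows "EX v. (EX t:J. v t ~= 0) & (ALL t:J. (SUM s:J. W t s * v s) = 0)"
proof -
 obtain v where v: "v : carrier_vec (card J)" "v ~= 0\<^sub>v (card J)" "jmat J W *\<^sub>v v = 0\<^sub>v (card J)"
  using det_0_iff_vec_prod_zero_field[OF jmat_carrier, of J W] assms by (auto simp: jdet_def)
 define w where "w t = v $ the_inv_into {0..<card J} (enum_of J) t" for t
 have w: "w (enum_of J i) = v $ i" if "i < card J" for i
  using that enum_of_bij[OF fin] by (simp add: w_def bij_betw_def the_inv_into_f_f)
 have "EX i<card J. v $ i ~= 0" using v(1,2) by (auto simp: vec_eq_iff)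
 hence "EX t:J. w t ~= 0"
  using w enum_of_bij[OF fin] by (metis atLeastLessThan_iff bij_betwE zero_le)
 moreover have "(SUM s:J. W t s * w s) = 0" if t: "t : J" for t
 proof -
  obtain i where i: "i < card J" "t = enum_of J i" using enum_cases[OF t] .
  have "(SUM s:J. W t s * w s) = (SUM k = 0..<card J. jmat J W $$ (i, k) * v $ k)"
   unfolding sum_enum using i by (auto intro!: sum.cong simp: w jmat_index)
  also have "... = (jmat J W *\<^sub>v v) $ i"
   using i v(1) by (auto simp: mult_mat_vec_def scalar_prod_def jmat_def intro!: sum.cong)
  also have "... = 0" using v(3) i by simp
  finally show ?thesis .
 qed
 ultimately show ?thesis by blast
qed

lemma jdet_one: "jdet J (%t s. if t = s then 1 else 0) = 1"
proof -
 have "jmat J (%t s. if t = s then 1 else 0) = (1\<^sub>m (card J) :: complex mat)"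
  by (rule eq_matI) (auto simp: jmat_def enum_inj)
 thus ?thesis by (simp add: jdet_def)
qed

lemma jdet_cong:
 assumes "!!t s. t : J ==> s : J ==> W t s = W' t s"
 shows "jdet J W = jdet J W'"
proof -
 have "jmat J W = jmat J W'"
  using assms by (intro eq_matI) (auto simp: jmat_def enum_mem)
 thus ?thesis by (simp add: jdet_def)
qed

lemma continuous_jdet:
 fixes W :: "'u::topological_space => 'x => 'x => complex"
 assumes c: "!!t s. t : J ==> s : J ==> continuous_on B (%u. W u t s)"
 shows "continuous_on B (%u. jdet J (W u))"
 unfolding jdet_def
 by (rule continuous_on_det[OF jmat_carrier])
  (use enum_of_bij[OF fin] in \<open>auto simp: jmat_index bij_betw_def intro!: c\<close>)

lemma continuous_jadj:
 fixes W :: "'u::topological_space => 'x => 'x => complex"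
 assumes c: "!!t s. t : J ==> s : J ==> continuous_on B (%u. W u t s)"
  and ts: "t : J" "s : J"
 shows "continuous_on B (%u. jadj J (W u) t s)"
proof -
 obtain i where i: "i < card J" "t = enum_of J i" using enum_cases[OF ts(1)] .
 obtain j where j: "j < card J" "s = enum_of J j" using enum_cases[OF ts(2)] .
 have "continuous_on B (%u. det (mat_delete (jmat J (W u)) j i))"
 proof (rule continuous_on_det)
  show "mat_delete (jmat J (W u)) j i : carrier_mat (card J - 1) (card J - 1)" for u
   using mat_delete_carrier[OF jmat_carrier] .
  fix a b assume ab: "a < card J - 1" "b < card J - 1"
  \<comment> \<open>An entry of a minor is an entry of the full matrix whose index is raised by one
    from the deleted row \<open>j\<close>, respectively column \<open>i\<close>, on.\<close>
  obtain a' b' where ab': "a' < card J" "b' < card J"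
   "!!A. A : carrier_mat (card J) (card J) ==> mat_delete A j i $$ (a, b) = (A::complex mat) $$ (a', b')"
   using ab i j by (intro that[of "if a < j then a else Suc a" "if b < i then b else Suc b"])
    (auto simp: mat_delete_def)
  thus "continuous_on B (%u. mat_delete (jmat J (W u)) j i $$ (a, b))"
   using enum_of_bij[OF fin] by (auto simp: jmat_index bij_betw_def intro!: c)
 qed
 hence "continuous_on B (%u. cofactor (jmat J (W u)) j i)"
  unfolding cofactor_def by (intro continuous_intros)
 moreover have "jadj J (W u) t s = cofactor (jmat J (W u)) j i" for u
  using i j by (simp add: jadj_enum adj_mat_def jmat_def)
 ultimately show ?thesis by simp
qed

text \<open>The determinant over the polynomial ring of the matrix of linear polynomials, evaluated
  at \<open>z\<close>; evaluation is a ring homomorphism and commutes with \<open>det\<close>. It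
  will show that degeneracy along a line of matrices happens at finitely many points only.\<close>

lemma jdet_poly: "EX p. ALL z. jdet J (%t s. W0 t s + z * W1 t s) = poly p z"
proof -
 let ?P = "jmat J (%t s. [:W0 t s, W1 t s:])"
 have "jdet J (%t s. W0 t s + z * W1 t s) = poly (det ?P) z" for z
 proof -
  interpret comm_ring_hom "%p. poly p z" by standard auto
  have "map_mat (%p. poly p z) ?P = jmat J (%t s. W0 t s + z * W1 t s)"
   by (rule eq_matI) (auto simp: jmat_def algebra_simps)
  thus ?thesis using hom_det[of ?P] by (simp add: jdet_def)
 qed
 thus ?thesis by blast
qed

end

section \<open>Linear maps between spaces of complex-valued functions\<close>

lemma sum_fun_apply: "(SUM a:A. F a) t = (SUM a:A. F a t :: 'b::comm_monoid_add)"
 by (induction A rule: infinite_finite_induct) auto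

definition cs :: "complex => ('x => complex) => 'x => complex" where
 "cs z v = (%t. z * v t)"

lemma cs_apply [simp]: "cs z v t = z * v t"
 by (simp add: cs_def)

lemma cs_simps [simp]: "cs 1 v = v" "cs 0 v = 0" "cs z 0 = 0" "cs (-1) v = - v" "cs z (cs w v) = cs (z * w) v"
 by (simp_all add: fun_eq_iff)

lemma cs_add: "cs z (v + w) = cs z v + cs z w" "cs (z + z') v = cs z v + cs z' v"
 and cs_diff: "cs z (v - w) = cs z v - cs z w"
 by (simp_all add: fun_eq_iff algebra_simps)

lemma cs_sum: "cs z (SUM a:A. F a) = (SUM a:A. cs z (F a))"
 by (simp add: fun_eq_iff sum_fun_apply sum_distrib_left)

definition lin :: "(('x => complex) => ('y => complex)) => bool" where
 "lin L \<longleftrightarrow> (ALL v w. L (v + w) = L v + L w) & (ALL z v. L (cs z v) = cs z (L v))"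

lemma linI: "[|!!v w. L (v + w) = L v + L w; !!z v. L (cs z v) = cs z (L v)|] ==> lin L"
 by (simp add: lin_def)

lemma lin_add: "lin L ==> L (v + w) = L v + L w"
 and lin_scale: "lin L ==> L (cs z v) = cs z (L v)"
 by (simp_all add: lin_def)

lemma lin_0: "lin L ==> L 0 = 0"
 using lin_scale[of L 0 0] by simp

lemma lin_minus: "lin L ==> L (- v) = - L v"
 using lin_scale[of L "-1" v] by simp

lemma lin_diff: "lin L ==> L (v - w) = L v - L w"
 using lin_add[of L v "- w"] lin_minus[of L w] by simp

lemma lin_sum: "lin L ==> L (SUM a:A. F a) = (SUM a:A. L (F a))"
 by (induction A rule: infinite_finite_induct) (simp_all add: lin_0[of L] lin_add[of L])

lemma lin_comp: "lin L ==> lin M ==> lin (%v. L (M v))"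
 by (simp add: lin_def)

lemma lin_plus: "lin L ==> lin M' ==> lin (%v. L v + M' v)"
 and lin_minus': "lin L ==> lin M' ==> lin (%v. L v - M' v)"
 and lin_cs: "lin L ==> lin (%v. cs z (L v))"
 and lin_id: "lin (%v. v)"
 by (auto simp: lin_def fun_eq_iff algebra_simps)

lemma lin_sum': "(!!a. a : A ==> lin (L a)) ==> lin (%v. SUM a:A. L a v)"
 by (auto simp: lin_def sum.distrib cs_sum intro!: sum.cong)

definition delta :: "'x => 'x => complex" where
 "delta t = (%s. if s = t then 1 else 0)"

lemma delta_apply: "delta t s = (if s = t then 1 else 0)"
 by (simp add: delta_def)

lemma delta_expand:
 assumes "finite I" "!!t. t \<notin> I ==> v t = 0"
 shows "v = (SUM t:I. cs (v t) (delta t))"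
proof
 fix s
 have "(SUM t:I. cs (v t) (delta t)) s = (SUM t:I. if s = t then v t else 0)"
  unfolding sum_fun_apply by (rule sum.cong) (auto simp: delta_apply)
 also have "... = v s" using assms by simp
 finally show "v s = (SUM t:I. cs (v t) (delta t)) s" by simp
qed

lemma lin_expand:
 assumes "finite I" "!!t. t \<notin> I ==> v t = 0" "lin L"
 shows "L v = (SUM t:I. cs (v t) (L (delta t)))"
proof -
 have "L v = L (SUM t:I. cs (v t) (delta t))" using delta_expand[OF assms(1,2)] by simp
 thus ?thesis by (simp add: lin_sum[OF assms(3)] lin_scale[OF assms(3)])
qed

section \<open>Power series modules, their truncations and basic operators\<close>

type_synonym vec3 = "nat * nat * nat => complex"

lemma vec3_eqI: "(!!i q a. v (i, q, a) = w (i, q, a)) ==> v = (w :: nat * nat * nat => 'a)"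
 by auto

text \<open>The vector with entry 1 at \<open>(i, q, a)\<close> is \<open>\<epsilon>\<^sub>i\<^sup>a b\<^sub>i\<^sub>q\<close>, where \<open>(b\<^sub>i\<^sub>q)\<close>, \<open>q < m i\<close>, is the standard basis
 of a free module over \<open>K[[\<epsilon>\<^sub>i]]\<close>. All operators live on these power series modules and objects over
 \<open>H(k)\<close> are their truncations by \<open>tr k\<close>; the operator \<open>D k\<close> is the multiplication by the central
 element \<open>\<Sum>\<^sub>i \<epsilon>\<^sub>i^(k c\<^sub>i)\<close>. Lifting an object from \<open>H(k)\<close> to \<open>H(k + 1)\<close> thus becomes invisible.\<close>

locale power_series_model =
 fixes n :: nat and c m :: "nat => nat" and Arr :: "(nat * nat * nat) set"
  and p r :: "nat => nat => nat"
 assumes fin_Arr: "finite Arr"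
  and Arr: "(i, j, h) : Arr ==>
   i : {1..n} & j : {1..n} & 0 < p i j & 0 < r i j & (EX e. c i = p i j * e & c j = r i j * e)"
  and c_pos: "i : {1..n} ==> 0 < c i"
begin

text \<open>The full power series module: only the vertex and the basis index are restricted, not
  the exponent \<open>a\<close>. The subspace \<open>V K\<close> below consists of the
  representatives of bounded degree of its quotient by the multiples of \<open>D K\<close>.\<close>

definition Vin :: "vec3 set" where
 "Vin = {v. ALL i q a. v (i, q, a) ~= 0 --> i : {1..n} & q < m i}"

definition I :: "nat => (nat * nat * nat) set" where
 "I K = {(i, q, a). i : {1..n} & q < m i & a < K * c i}"

definition V :: "nat => vec3 set" where
 "V K = {v. ALL t. t \<notin> I K --> v t = 0}"

definition tr :: "nat => vec3 => vec3" where
 "tr K v = (%t. if t : I K then v t else 0)"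

definition es :: "nat => vec3 => vec3" where
 "es i v = (%(i', q, a). if i' = i & q < m i then v (i', q, a) else 0)"

definition Es :: "nat => vec3 => vec3" where
 "Es s v = (%(i, q, a). if a < s then 0 else v (i, q, a - s))"

definition D :: "nat => vec3 => vec3" where
 "D k v = (%(i, q, a). if a < k * c i then 0 else v (i, q, a - k * c i))"

text \<open>Division by the central element, with remainder dropped. It is exact on the elements of
  \<open>Vin\<close> whose truncation at level \<open>k\<close> is zero, see
  \<open>D_Dinv\<close>.\<close>

definition Dinv :: "nat => vec3 => vec3" where
 "Dinv k v = (%(i, q, a). v (i, q, a + k * c i))"

lemma I_mem [simp]: "(i, q, a) : I K \<longleftrightarrow> i : {1..n} & q < m i & a < K * c i"
 by (simp add: I_def)

lemma fin_I [simp]: "finite (I K)"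
proof (rule finite_subset)
 show "I K \<subseteq> (SIGMA i:{1..n}. {..<m i} \<times> {..<K * c i})" by (auto simp: I_def)
qed auto

lemma es_apply: "es i v (i', q, a) = (if i' = i & q < m i then v (i', q, a) else 0)"
 and Es_apply: "Es s v (i', q, a) = (if a < s then 0 else v (i', q, a - s))"
 and D_apply: "D k v (i', q, a) = (if a < k * c i' then 0 else v (i', q, a - k * c i'))"
 and Dinv_apply: "Dinv k v (i', q, a) = v (i', q, a + k * c i')"
 and tr_apply: "tr K v (i', q, a) = (if i' : {1..n} & q < m i' & a < K * c i' then v (i', q, a) else 0)"
 by (simp_all add: es_def Es_def D_def Dinv_def tr_def)

lemmas ops_apply = es_apply Es_apply D_apply Dinv_apply tr_apply

lemma lin_tr: "lin (tr K)" and lin_es: "lin (es i)" and lin_Es: "lin (Es s)" and lin_D: "lin (D k)"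
 and lin_Dinv: "lin (Dinv k)"
 by (auto simp: lin_def ops_apply intro!: vec3_eqI)

lemma tr_add: "tr K (v + w) = tr K v + tr K w"
 and tr_diff: "tr K (v - w) = tr K v - tr K w"
 and tr_zero [simp]: "tr K 0 = 0"
 using lin_add[OF lin_tr] lin_diff[OF lin_tr] lin_0[OF lin_tr] by auto

lemma V_Vin: "v : V K ==> v : Vin"
 by (fastforce simp: V_def Vin_def)

lemma tr_V [simp]: "tr K v : V K"
 by (simp add: V_def tr_def)

lemma tr_Vin [simp]: "tr K v : Vin"
 using V_Vin tr_V .

lemma tr_id: "v : V K ==> tr K v = v"
 by (force simp: V_def tr_def)

lemma V_iff_tr: "v : V K \<longleftrightarrow> tr K v = v"
 using tr_id tr_V by metis

lemma tr_tr: "K <= K' ==> tr K (tr K' v) = tr K v"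
proof (rule vec3_eqI)
 fix i q a assume "K <= K'"
 hence "a < K' * c i" if "a < K * c i" using that by (meson less_le_trans mult_le_mono1)
 thus "tr K (tr K' v) (i, q, a) = tr K v (i, q, a)" by (auto simp: tr_apply)
qed

lemma tr_tr_same [simp]: "tr K (tr K v) = tr K v"
 by (simp add: tr_tr)

lemma tr_tr': "K <= K' ==> tr K' (tr K v) = tr K v"
proof (rule vec3_eqI)
 fix i q a assume "K <= K'"
 hence "a < K' * c i" if "a < K * c i" using that by (meson less_le_trans mult_le_mono1)
 thus "tr K' (tr K v) (i, q, a) = tr K v (i, q, a)" by (auto simp: tr_apply)
qed

lemma tr_eq_mono: "K <= K' ==> tr K' v = tr K' w ==> tr K v = tr K w"
 by (metis tr_tr)

lemma V_mono: "K <= K' ==> v : V K ==> v : V K'"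
 by (metis V_iff_tr tr_tr')

lemma Vin_ops [simp]: "v : Vin ==> es i v : Vin" "v : Vin ==> Es s v : Vin" "v : Vin ==> D k v : Vin"
  "v : Vin ==> Dinv k v : Vin"
 by (auto simp: Vin_def ops_apply split: if_splits)

lemma Vin_sub [simp]: "0 : Vin" "v : Vin ==> w : Vin ==> v + w : Vin" "v : Vin ==> w : Vin ==> v - w : Vin"
  "v : Vin ==> cs z v : Vin"
proof -
 show "v + w : Vin" if "v : Vin" "w : Vin" using that unfolding Vin_def by (simp, metis add_0)
 show "v - w : Vin" if "v : Vin" "w : Vin" using that unfolding Vin_def by (simp, metis diff_0_right)
qed (auto simp: Vin_def)

lemma V_sub [simp]: "0 : V K" "v : V K ==> w : V K ==> v + w : V K" "v : V K ==> w : V K ==> v - w : V K"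
  "v : V K ==> cs z v : V K" "v : V K ==> es i v : V K"
 by (auto simp: V_def es_def)

lemma V_sum: "(!!a. a : A ==> F a : V K) ==> (SUM a:A. F a) : V K"
 by (induction A rule: infinite_finite_induct) auto

lemma delta_V: "t : I K ==> delta t : V K"
 by (auto simp: V_def delta_def)

lemma delta_Vin: "i : {1..n} ==> q < m i ==> delta (i, q, a) : Vin"
 by (auto simp: Vin_def delta_def split: if_splits)

lemma Es_delta: "Es s (delta (i, q, a)) = delta (i, q, a + s)"
 by (rule vec3_eqI) (auto simp: Es_apply delta_apply)

lemma es_delta: "q < m i ==> es i' (delta (i, q, a)) = (if i' = i then delta (i, q, a) else 0)"
 by (rule vec3_eqI) (auto simp: es_apply delta_apply)

lemma V_expand: "v : V K ==> v = (SUM t:I K. cs (v t) (delta t))"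
 by (rule delta_expand) (auto simp: V_def)

lemma V_lin_expand: "v : V K ==> lin L ==> L v = (SUM t:I K. cs (v t) (L (delta t)))"
 by (rule lin_expand) (auto simp: V_def)

lemma Vin_expand: "v : Vin ==> v = (SUM i:{1..n}. es i v)"
proof (rule vec3_eqI)
 fix i' q a assume v: "v : Vin"
 have "(SUM i:{1..n}. es i v) (i', q, a) = (SUM i:{1..n}. if i = i' then if q < m i' then v (i', q, a) else 0 else 0)"
  unfolding sum_fun_apply by (rule sum.cong) (auto simp: es_apply)
 also have "... = v (i', q, a)" using v by (auto simp: Vin_def)
 finally show "v (i', q, a) = (SUM i:{1..n}. es i v) (i', q, a)" by simp
qed

lemma Vin_eqI: "v : Vin ==> w : Vin ==> (!!i. i : {1..n} ==> es i v = es i w) ==> v = w"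
 using Vin_expand[of v] Vin_expand[of w] by (metis (no_types, lifting) sum.cong)

lemma es_es [simp]: "es i (es j v) = (if i = j then es i v else 0)"
 by (rule vec3_eqI) (auto simp: es_apply)

lemma es_commute: "es i (Es s v) = Es s (es i v)" "es i (tr K v) = tr K (es i v)" "es i (D k v) = D k (es i v)"
 by (rule vec3_eqI; auto simp: ops_apply)+

lemma es_D: "es i (D k v) = es i (Es (k * c i) v)"
 by (rule vec3_eqI) (auto simp: ops_apply)

lemma Es_Es: "Es s (Es s' v) = Es (s + s') v" and Es_0 [simp]: "Es 0 v = v"
 by (rule vec3_eqI; auto simp: ops_apply algebra_simps)+

lemma Es_D: "Es s (D k v) = D k (Es s v)"
 by (rule vec3_eqI) (auto simp: ops_apply algebra_simps diff_commute)

lemma D_D: "D k (D k' v) = D (k + k') v" and D_0 [simp]: "D 0 v = v"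
 by (rule vec3_eqI; auto simp: ops_apply algebra_simps)+

lemma tr_D: "tr K (D k v) = D k (tr (K - k) v)"
 by (rule vec3_eqI) (auto simp: ops_apply diff_mult_distrib)

lemma Dinv_D [simp]: "Dinv k (D k v) = v"
 by (rule vec3_eqI) (auto simp: ops_apply)

lemma D_inj: "D k v = D k w ==> v = w"
 by (metis Dinv_D)

lemma D_Dinv: "v : Vin ==> tr K v = 0 ==> D K (Dinv K v) = v"
proof (rule vec3_eqI)
 fix i q a assume v: "v : Vin" "tr K v = 0"
 hence "tr K v (i, q, a) = 0" by simp
 hence "v (i, q, a) = 0" if "a < K * c i"
  using v(1) that by (cases "i : {1..n} & q < m i") (auto simp: tr_apply Vin_def)
 thus "D K (Dinv K v) (i, q, a) = v (i, q, a)" by (auto simp: ops_apply)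
qed

text \<open>Multiplication by \<open>D k\<close> gains \<open>k\<close> levels of precision. All
  corrections from level \<open>k\<close> to level \<open>Suc k\<close> below rely on this.\<close>

lemma tr_D_cong: "tr (K - k) v = tr (K - k) w ==> tr K (D k v) = tr K (D k w)"
 by (simp add: tr_D)

section \<open>Operators compatible with truncation: endomorphisms and representations\<close>

definition dop :: "(vec3 => vec3) => bool" where
 "dop L \<longleftrightarrow> lin L & (ALL v:Vin. L v : Vin) & (ALL k. ALL v:Vin. L (D k v) = D k (L v))"

lemma dopD: assumes "dop L" shows "lin L" "v : Vin ==> L v : Vin" "v : Vin ==> L (D k v) = D k (L v)"
 using assms by (auto simp: dop_def)

text \<open>If the truncation of \<open>v - w\<close> vanishes, then \<open>v - w\<close> is
  \<open>D K\<close> times a series, and an operator commuting with \<open>D K\<close> maps it to a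
  multiple of \<open>D K\<close> again. So these operators descend to every truncation.\<close>

lemma dop_cong:
 assumes L: "dop L" and v: "v : Vin" "w : Vin" "tr K v = tr K w"
 shows "tr K (L v) = tr K (L w)"
proof -
 have d: "v - w : Vin" "tr K (v - w) = 0" using v by (auto simp: tr_diff)
 hence "L (v - w) = D K (L (Dinv K (v - w)))" using dopD(3)[OF L, of "Dinv K (v - w)" K] D_Dinv[OF d] by simp
 hence "tr K (L v - L w) = 0" by (simp add: lin_diff[OF dopD(1)[OF L]] tr_D) (rule vec3_eqI, auto simp: ops_apply)
 thus ?thesis by (simp add: tr_diff)
qed

lemma dop_tr: "dop L ==> v : Vin ==> tr K (L (tr K v)) = tr K (L v)"
 by (rule dop_cong) auto

lemma dop_es: "dop (es i)" and dop_Es: "dop (Es s)" and dop_D: "dop (D k)" and dop_id: "dop (%v. v)"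
 by (auto simp: dop_def lin_es lin_Es lin_D lin_id es_commute Es_D D_D add.commute)

lemma dop_comp: "dop L ==> dop M ==> dop (%v. L (M v))"
 unfolding dop_def using lin_comp[of L M] by auto

lemma dop_diff: "dop L ==> dop M ==> dop (%v. L v - M v)"
 unfolding dop_def using lin_minus'[of L M] by (auto simp: lin_diff[OF lin_D])

text \<open>On \<open>Vin\<close> these are families of square matrices over the power series rings,
  one for each vertex: the Lie algebra of the product of the groups \<open>GL\<close>. The group
  itself appears later as the pairs in \<open>invm\<close>.\<close>

definition gl :: "(vec3 => vec3) set" where
 "gl = {y. lin y & (ALL v:Vin. y v : Vin & (ALL i:{1..n}. y (es i v) = es i (y v)) & y (Es 1 v) = Es 1 (y v))}"

lemma glD:
 assumes "y : gl"
 shows "lin y" "v : Vin ==> y v : Vin" "v : Vin ==> i : {1..n} ==> y (es i v) = es i (y v)"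
  "v : Vin ==> y (Es 1 v) = Es 1 (y v)"
 using assms by (auto simp: gl_def)

lemma gl_Es: assumes "y : gl" "v : Vin" shows "y (Es s v) = Es s (y v)"
proof (induction s)
 case (Suc s)
 have "y (Es (Suc s) v) = y (Es 1 (Es s v))" by (simp add: Es_Es)
 also have "... = Es 1 (Es s (y v))" using Suc glD(4)[OF assms(1), of "Es s v"] assms(2) by simp
 finally show ?case by (simp add: Es_Es)
qed simp

text \<open>Checked vertex by vertex: at \<open>i\<close> the central element acts as the power
  \<open>Es (k * c i)\<close>, with which \<open>y\<close> commutes.\<close>

lemma gl_dop: assumes "y : gl" shows "dop y"
 unfolding dop_def
proof (intro conjI allI ballI)
 fix k v assume v: "v : Vin"
 show "y (D k v) = D k (y v)"
 proof (rule Vin_eqI)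
  fix i assume i: "i : {1..n}"
  have "es i (y (D k v)) = y (es i (D k v))" using glD(3)[OF assms, of "D k v"] v i by simp
  also have "... = y (Es (k * c i) (es i v))" by (simp only: es_D es_commute)
  also have "... = Es (k * c i) (es i (y v))" using gl_Es[OF assms] glD(3)[OF assms] v i by simp
  finally show "es i (y (D k v)) = es i (D k (y v))" by (simp only: es_D es_commute)
 qed (use glD[OF assms] v in auto)
qed (use glD[OF assms] in auto)

lemma gl_id: "(%v. v) : gl" and gl_comp: "y : gl ==> z : gl ==> (%v. y (z v)) : gl"
 and gl_add: "y : gl ==> z : gl ==> (%v. y v + z v) : gl"
 and gl_diff: "y : gl ==> z : gl ==> (%v. y v - z v) : gl"
 and gl_cs: "y : gl ==> (%v. cs a (y v)) : gl"
 and gl_D: "y : gl ==> (%v. D k (y v)) : gl"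
 by (auto simp: gl_def lin_id lin_comp lin_plus lin_minus' lin_cs lin_comp[OF lin_D]
   lin_add[OF lin_es] lin_add[OF lin_Es] lin_diff[OF lin_es] lin_diff[OF lin_Es]
   lin_scale[OF lin_es] lin_scale[OF lin_Es] es_commute Es_D)

lemma gl_sum:
 assumes "!!a. a : A ==> y a : gl"
 shows "(%v. SUM a:A. y a v) : gl"
 using assms
proof (induction A rule: infinite_finite_induct)
 case (insert x F)
 hence eq: "(%v. SUM a:insert x F. y a v) = (%v. y x v + (SUM a:F. y a v))"
  by (subst sum.insert) auto
 show ?case unfolding eq by (rule gl_add) (use insert in auto)
qed (auto simp: gl_def lin_def lin_0[OF lin_es] lin_0[OF lin_Es])

text \<open>An arrow \<open>(i, j, h)\<close> acts from vertex \<open>j\<close> to vertex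
  \<open>i\<close> and satisfies the commutation relation of \<open>H\<close>, where
  \<open>p i j\<close> and \<open>r i j\<close> will be \<open>f j i\<close> and
  \<open>f i j\<close>. The nilpotency relations are absent, so one element of \<open>rep\<close>
  gives a module at every level by truncation.\<close>

definition rep :: "(nat * nat * nat => vec3 => vec3) set" where
 "rep = {A. ALL (i, j, h):Arr. lin (A (i, j, h)) & (ALL v:Vin. A (i, j, h) v : Vin \<and>
   es i (A (i, j, h) v) = A (i, j, h) v & A (i, j, h) (es j v) = A (i, j, h) v \<and>
   A (i, j, h) (Es (r i j) v) = Es (p i j) (A (i, j, h) v))}"

lemma repI:
 assumes "!!i j h. (i, j, h) : Arr ==> lin (A (i, j, h))"
  "!!i j h v. (i, j, h) : Arr ==> v : Vin ==> A (i, j, h) v : Vin"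
  "!!i j h v. (i, j, h) : Arr ==> v : Vin ==> es i (A (i, j, h) v) = A (i, j, h) v"
  "!!i j h v. (i, j, h) : Arr ==> v : Vin ==> A (i, j, h) (es j v) = A (i, j, h) v"
  "!!i j h v. (i, j, h) : Arr ==> v : Vin ==> A (i, j, h) (Es (r i j) v) = Es (p i j) (A (i, j, h) v)"
 shows "A : rep"
 using assms by (auto simp: rep_def)

lemma repD:
 assumes "A : rep" "(i, j, h) : Arr"
 shows "lin (A (i, j, h))" "v : Vin ==> A (i, j, h) v : Vin" "v : Vin ==> es i (A (i, j, h) v) = A (i, j, h) v"
  "v : Vin ==> A (i, j, h) (es j v) = A (i, j, h) v"
  "v : Vin ==> A (i, j, h) (Es (r i j) v) = Es (p i j) (A (i, j, h) v)"
 using assms by (auto simp: rep_def)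

lemma rep_Es:
 assumes "A : rep" "(i, j, h) : Arr" "v : Vin"
 shows "A (i, j, h) (Es (r i j * s) v) = Es (p i j * s) (A (i, j, h) v)"
proof (induction s)
 case (Suc s)
 have "A (i, j, h) (Es (r i j * Suc s) v) = A (i, j, h) (Es (r i j) (Es (r i j * s) v))"
  by (simp add: Es_Es algebra_simps)
 also have "... = Es (p i j) (Es (p i j * s) (A (i, j, h) v))"
  using Suc repD(5)[OF assms(1,2), of "Es (r i j * s) v"] assms(3) by simp
 finally show ?case by (simp add: Es_Es algebra_simps)
qed simp

text \<open>Because \<open>c i = p i j * e\<close> and \<open>c j = r i j * e\<close> with the same
  \<open>e\<close>, using the commutation relation \<open>k * e\<close> times turns
  \<open>Es (k * c j)\<close> at the source into \<open>Es (k * c i)\<close> at the target. This is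
  the centrality of \<open>D k\<close>.\<close>

lemma rep_dop: assumes "A : rep" "a : Arr" shows "dop (A a)"
proof -
 obtain i j h where a: "a = (i, j, h)" by (cases a) auto
 note A = repD[OF assms(1) assms(2)[unfolded a]]
 obtain e where e: "c i = p i j * e" "c j = r i j * e" using Arr assms(2) a by blast
 have "A a (D k v) = D k (A a v)" if v: "v : Vin" for k v
 proof -
  have "A a (D k v) = A a (es j (D k v))" using A(4)[of "D k v"] v a by simp
  also have "... = A a (Es (r i j * (k * e)) (es j v))"
   by (simp only: es_D es_commute) (simp add: e ac_simps)
  also have "... = Es (k * c i) (A a v)"
   using rep_Es[OF assms(1) assms(2)[unfolded a], of "es j v" "k * e"] v A(4)[OF v] a by (simp add: e ac_simps)
  also have "... = Es (k * c i) (es i (A a v))" using A(3)[OF v] a by simp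
  also have "... = D k (es i (A a v))" by (simp only: es_D[symmetric] es_commute[symmetric])
  finally show ?thesis using A(3)[OF v] a by simp
 qed
 thus ?thesis using A a by (auto simp: dop_def)
qed

lemma rep_gl_left: assumes A: "A : rep" and y: "y : gl" shows "(%a v. y (A a v)) : rep"
proof (rule repI)
 fix i j h assume a: "(i, j, h) : Arr"
 hence i: "i : {1..n}" using Arr by blast
 note A' = repD[OF A a]
 show "lin (%v. y (A (i, j, h) v))" by (rule lin_comp[OF glD(1)[OF y] A'(1)])
 fix v assume v: "v : Vin"
 show "y (A (i, j, h) v) : Vin" using A' glD(2)[OF y] v by simp
 show "es i (y (A (i, j, h) v)) = y (A (i, j, h) v)" using glD(3)[OF y A'(2)[OF v] i] A'(3)[OF v] by simp
 show "y (A (i, j, h) (es j v)) = y (A (i, j, h) v)" using A' v by simp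
 show "y (A (i, j, h) (Es (r i j) v)) = Es (p i j) (y (A (i, j, h) v))"
  using A'(5)[OF v] gl_Es[OF y A'(2)[OF v]] by simp
qed

lemma rep_gl_right: assumes A: "A : rep" and y: "y : gl" shows "(%a v. A a (y v)) : rep"
proof (rule repI)
 fix i j h assume a: "(i, j, h) : Arr"
 hence j: "j : {1..n}" using Arr by blast
 note A' = repD[OF A a]
 show "lin (%v. A (i, j, h) (y v))" by (rule lin_comp[OF A'(1) glD(1)[OF y]])
 fix v assume v: "v : Vin"
 note yv = glD(2)[OF y v]
 show "A (i, j, h) (y v) : Vin" using A' yv by simp
 show "es i (A (i, j, h) (y v)) = A (i, j, h) (y v)" using A'(3)[OF yv] by simp
 show "A (i, j, h) (y (es j v)) = A (i, j, h) (y v)" using A'(4)[OF yv] glD(3)[OF y v j] by simp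
 show "A (i, j, h) (y (Es (r i j) v)) = Es (p i j) (A (i, j, h) (y v))"
  using A'(5)[OF yv] gl_Es[OF y v] by simp
qed

lemma rep_add: assumes A: "A : rep" and B: "B : rep" shows "(%a v. A a v + B a v) : rep"
proof (rule repI)
 fix i j h assume a: "(i, j, h) : Arr"
 note A' = repD[OF A a] and B' = repD[OF B a]
 show "lin (%v. A (i, j, h) v + B (i, j, h) v)" by (rule lin_plus[OF A'(1) B'(1)])
qed (use repD[OF A] repD[OF B] in \<open>simp_all add: lin_add[OF lin_es] lin_add[OF lin_Es]\<close>)

lemma rep_cs: assumes A: "A : rep" shows "(%a v. cs z (A a v)) : rep"
proof (rule repI)
 fix i j h assume a: "(i, j, h) : Arr"
 show "lin (%v. cs z (A (i, j, h) v))" by (rule lin_cs[OF repD(1)[OF A a]])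
qed (use repD[OF A] in \<open>simp_all add: lin_scale[OF lin_es] lin_scale[OF lin_Es]\<close>)

lemma rep_diff: assumes A: "A : rep" and B: "B : rep" shows "(%a v. A a v - B a v) : rep"
 using rep_add[OF A rep_cs[OF B, of "-1"]] by simp

lemma rep_0: "(%a v. 0) : rep"
 by (auto intro!: repI simp: lin_def lin_0[OF lin_es] lin_0[OF lin_Es])

lemma rep_sum:
 assumes "!!x. x : S ==> A x : rep"
 shows "(%a v. SUM x:S. A x a v) : rep"
 using assms
proof (induction S rule: infinite_finite_induct)
 case (insert x F)
 hence eq: "(%a v. SUM x:insert x F. A x a v) = (%a v. A x a v + (SUM x:F. A x a v))"
  by (subst sum.insert) auto
 show ?case unfolding eq by (rule rep_add) (use insert in auto)
qed (auto simp: rep_0)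

text \<open>The error terms met below vanish modulo a level and are divided by \<open>D k\<close>.
  That the quotient is again a representation is checked after applying the injective operator
  \<open>D k\<close>.\<close>

lemma rep_Dinv:
 assumes B: "B : rep" and z: "!!a v. a : Arr ==> v : Vin ==> tr k (B a v) = 0"
 shows "(%a v. Dinv k (B a v)) : rep" "!!a v. a : Arr ==> v : Vin ==> D k (Dinv k (B a v)) = B a v"
proof -
 show d: "!!a v. a : Arr ==> v : Vin ==> D k (Dinv k (B a v)) = B a v"
  using z D_Dinv rep_dop[OF B] dopD(2) by blast
 show "(%a v. Dinv k (B a v)) : rep"
 proof (rule repI)
  fix i j h assume a: "(i, j, h) : Arr"
  note B' = repD[OF B a]
  show "lin (%v. Dinv k (B (i, j, h) v))" by (rule lin_comp[OF lin_Dinv B'(1)])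
  fix v assume v: "v : Vin"
  show "Dinv k (B (i, j, h) v) : Vin" using B' v by simp
  show "es i (Dinv k (B (i, j, h) v)) = Dinv k (B (i, j, h) v)"
   by (rule D_inj[of k]) (simp add: es_commute(3)[symmetric] d[OF a v] B'(3)[OF v])
  show "Dinv k (B (i, j, h) (es j v)) = Dinv k (B (i, j, h) v)" using B'(4)[OF v] by simp
  show "Dinv k (B (i, j, h) (Es (r i j) v)) = Es (p i j) (Dinv k (B (i, j, h) v))"
   by (rule D_inj[of k]) (simp add: Es_D[symmetric] d[OF a] v B'(5)[OF v, symmetric])
 qed
qed

section \<open>Endomorphisms and representations with prescribed values\<close>

definition gen :: "(nat => nat => vec3) => vec3 => vec3" where
 "gen x v = (%(i, q', a). if i : {1..n} & q' < m i
   then SUM q<m i. SUM b<=a. v (i, q, b) * x i q (i, q', a - b) else 0)"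

lemma gen_apply: "gen x v (i, q', a) = (if i : {1..n} & q' < m i
   then SUM q<m i. SUM b<=a. v (i, q, b) * x i q (i, q', a - b) else 0)"
 by (simp add: gen_def)

text \<open>The sum over \<open>b\<close> in \<open>gen\<close> is a Cauchy product, so
  \<open>gen x\<close> is multiplication by a matrix of power series whose column \<open>q\<close>
  at vertex \<open>i\<close> is the part of \<open>x i q\<close> at that vertex, see
  \<open>gen_delta\<close>.\<close>

lemma gen_gl: "gen x : gl"
 unfolding gl_def
proof (intro CollectI conjI ballI)
 show "lin (gen x)"
  by (rule linI; rule vec3_eqI) (auto simp: gen_apply sum.distrib distrib_right sum_distrib_left mult.assoc)
 fix v assume v: "v : Vin"
 show "gen x v : Vin" by (auto simp: Vin_def gen_apply split: if_splits)
 show "gen x (es i v) = es i (gen x v)" if "i : {1..n}" for i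
 proof (rule vec3_eqI)
  fix i' q a
  show "gen x (es i v) (i', q, a) = es i (gen x v) (i', q, a)"
   by (cases "i' = i") (auto simp: gen_apply es_apply)
 qed
 show "gen x (Es 1 v) = Es 1 (gen x v)"
 proof (rule vec3_eqI)
  fix i q' a
  have "(SUM b<=a. Es 1 v (i, q, b) * x i q (i, q', a - b)) =
   (if a < 1 then 0 else SUM b<=a - 1. v (i, q, b) * x i q (i, q', a - 1 - b))" for q
   by (cases a) (simp_all add: Es_apply sum.atMost_Suc_shift del: sum.atMost_Suc)
  thus "gen x (Es 1 v) (i, q', a) = Es 1 (gen x v) (i, q', a)"
   by (simp add: gen_apply Es_apply)
 qed
qed

lemma gen_delta:
 assumes "i : {1..n}" "q < m i"
 shows "gen x (delta (i, q, 0)) = es i (x i q)"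
proof (rule vec3_eqI)
 fix i' q' a
 have "(SUM q0<m i. SUM b<=a. delta (i, q, 0) (i, q0, b) * x i q0 (i, q', a - b)) =
   (SUM q0<m i. SUM b<=a. if b = 0 then if q0 = q then x i q (i, q', a) else 0 else 0)"
  by (intro sum.cong) (auto simp: delta_apply)
 also have "... = x i q (i, q', a)" using assms by simp
 finally show "gen x (delta (i, q, 0)) (i', q', a) = es i (x i q) (i', q', a)"
  using assms by (cases "i' = i") (auto simp: gen_apply es_apply delta_apply)
qed

lemma delta_Es0: "delta (i, q, a) = Es a (delta (i, q, 0))"
 by (simp add: Es_delta)

lemma gl_eqI:
 assumes y: "y : gl" "y' : gl"
  and e: "!!i q. i : {1..n} ==> q < m i ==> tr K (y (delta (i, q, 0))) = tr K (y' (delta (i, q, 0)))"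
  and v: "v : Vin"
 shows "tr K (y v) = tr K (y' v)"
proof -
 have d: "tr K (y (delta t)) = tr K (y' (delta t))" if t: "t : I K" for t
 proof -
  obtain i q a where t': "t = (i, q, a)" "i : {1..n}" "q < m i" using t by (cases t) auto
  have "tr K (Es a (y (delta (i, q, 0)))) = tr K (Es a (y' (delta (i, q, 0))))"
   using dop_cong[OF dop_Es glD(2)[OF y(1) delta_Vin] glD(2)[OF y(2) delta_Vin] e] t' by simp
  thus ?thesis using gl_Es[OF y(1) delta_Vin, of i q a 0] gl_Es[OF y(2) delta_Vin, of i q a 0] t'
   by (simp add: Es_delta)
 qed
 have "tr K (y (tr K v)) = tr K (y' (tr K v))"
  using d by (simp add: V_lin_expand[OF tr_V glD(1)[OF y(1)]] V_lin_expand[OF tr_V glD(1)[OF y(2)]]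
   lin_sum[OF lin_tr] lin_scale[OF lin_tr])
 thus ?thesis using dop_tr[OF gl_dop[OF y(1)] v] dop_tr[OF gl_dop[OF y(2)] v] by simp
qed

text \<open>The representation that sends \<open>delta (j, q, b)\<close> with
  \<open>b < r i j\<close> to the part of \<open>x (i, j, h) q b\<close> at vertex \<open>i\<close>,
  see \<open>rgen_delta\<close>. An exponent at \<open>j\<close> is written as
  \<open>b + r i j * s\<close>; the commutation relation turns the factor
  \<open>Es (r i j * s)\<close> into \<open>Es (p i j * s)\<close>, whence the shift by
  \<open>p i j * s\<close> in the value.\<close>

definition rgen :: "(nat * nat * nat => nat => nat => vec3) => nat * nat * nat => vec3 => vec3" where
 "rgen x = (%(i, j, h) v (i', q', a). if i' = i & i : {1..n} & q' < m i
   then SUM q<m j. SUM b<r i j. \<Sum>s | p i j * s <= a. v (j, q, b + r i j * s) * x (i, j, h) q b (i, q', a - p i j * s) else 0)"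

lemma rgen_apply: "rgen x (i, j, h) v (i', q', a) = (if i' = i & i : {1..n} & q' < m i
   then SUM q<m j. SUM b<r i j. \<Sum>s | p i j * s <= a. v (j, q, b + r i j * s) * x (i, j, h) q b (i, q', a - p i j * s) else 0)"
 by (simp add: rgen_def)

lemma rgen_rep: "rgen x : rep"
proof (rule repI)
 fix i j h assume a: "(i, j, h) : Arr"
 have pr: "0 < p i j" "0 < r i j" using Arr[OF a] by auto
 show "lin (rgen x (i, j, h))"
  by (rule linI; rule vec3_eqI) (auto simp: rgen_apply sum.distrib distrib_right sum_distrib_left mult.assoc)
 fix v assume v: "v : Vin"
 show "rgen x (i, j, h) v : Vin" by (auto simp: Vin_def rgen_apply split: if_splits)
 show "es i (rgen x (i, j, h) v) = rgen x (i, j, h) v"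
  by (rule vec3_eqI) (auto simp: rgen_apply es_apply)
 show "rgen x (i, j, h) (es j v) = rgen x (i, j, h) v"
  by (rule vec3_eqI) (auto simp: rgen_apply es_apply)
 show "rgen x (i, j, h) (Es (r i j) v) = Es (p i j) (rgen x (i, j, h) v)"
 proof (rule vec3_eqI)
  fix i' q' a
  have fin: "finite {s. p i j * s <= a}" for a
   by (rule finite_subset[of _ "{..a}"]) (use pr in \<open>auto intro: order_trans[rotated]\<close>)
  \<comment> \<open>The shift by \<open>r i j\<close> at the source is absorbed by lowering the
    index \<open>s\<close> by one; the term for \<open>s = 0\<close> vanishes because
    \<open>b < r i j\<close>.\<close>
  have "(\<Sum>s | p i j * s <= a. Es (r i j) v (j, q, b + r i j * s) * x (i, j, h) q b (i, q', a - p i j * s)) =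
   (if a < p i j then 0 else \<Sum>s | p i j * s <= a - p i j. v (j, q, b + r i j * s) * x (i, j, h) q b (i, q', a - p i j - p i j * s))"
   (is "?L = ?R") if b: "b < r i j" for q b
  proof (cases "a < p i j")
   case True
   have "?L = 0"
   proof (rule sum.neutral, safe)
    fix s assume "p i j * s <= a"
    hence "p i j * s < p i j * 1" using True by linarith
    hence "s = 0" using pr(1) by (metis less_one nat_mult_less_cancel1)
    thus "Es (r i j) v (j, q, b + r i j * s) * x (i, j, h) q b (i, q', a - p i j * s) = 0"
     using b by (simp add: Es_apply)
   qed
   thus ?thesis using True by simp
  next
   case False
   have S: "{s. p i j * s <= a} = insert 0 (Suc ` {s. p i j * s <= a - p i j})"
   proof (rule Set.set_eqI)
    fix s show "s : {s. p i j * s <= a} \<longleftrightarrow> s : insert 0 (Suc ` {s. p i j * s <= a - p i j})"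
     using False by (cases s) auto
   qed
   have "?L = (SUM s:Suc ` {s. p i j * s <= a - p i j}. Es (r i j) v (j, q, b + r i j * s) * x (i, j, h) q b (i, q', a - p i j * s))"
    unfolding S using b fin by (subst sum.insert) (auto simp: Es_apply)
   also have "... = (\<Sum>s | p i j * s <= a - p i j. v (j, q, b + r i j * s) * x (i, j, h) q b (i, q', a - p i j - p i j * s))"
    by (subst sum.reindex) (auto simp: Es_apply o_def intro!: sum.cong)
   finally show ?thesis using False by simp
  qed
  hence "(SUM q<m j. SUM b<r i j. \<Sum>s | p i j * s <= a. Es (r i j) v (j, q, b + r i j * s) * x (i, j, h) q b (i, q', a - p i j * s)) =
   (SUM q<m j. SUM b<r i j. if a < p i j then 0 else \<Sum>s | p i j * s <= a - p i j. v (j, q, b + r i j * s) * x (i, j, h) q b (i, q', a - p i j - p i j * s))"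
   by (intro sum.cong refl) simp
  thus "rgen x (i, j, h) (Es (r i j) v) (i', q', a) = Es (p i j) (rgen x (i, j, h) v) (i', q', a)"
   by (simp add: rgen_apply[of x i j h "Es (r i j) v"] Es_apply[of "p i j"] rgen_apply[of x i j h v])
 qed
qed

lemma rgen_delta:
 assumes a: "(i, j, h) : Arr" and q: "q < m j" and b: "b < r i j"
 shows "rgen x (i, j, h) (delta (j, q, b)) = es i (x (i, j, h) q b)"
proof (rule vec3_eqI)
 fix i' q' a
 have pr: "0 < p i j" "i : {1..n}" using Arr[OF assms(1)] by auto
 have fin: "finite {s. p i j * s <= a}" for a
  by (rule finite_subset[of _ "{..a}"]) (use pr in \<open>auto intro: order_trans[rotated]\<close>)
 have "delta (j, q, b) (j, q0, b0 + r i j * s) * x (i, j, h) q0 b0 (i, q', a - p i j * s) =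
   (if s = 0 then if b0 = b then if q0 = q then x (i, j, h) q b (i, q', a) else 0 else 0 else 0)"
  if "b0 < r i j" for q0 b0 s
  using that b by (cases s) (auto simp: delta_apply)
 hence "(SUM q0<m j. SUM b0<r i j. \<Sum>s | p i j * s <= a. delta (j, q, b) (j, q0, b0 + r i j * s) * x (i, j, h) q0 b0 (i, q', a - p i j * s)) =
   (SUM q0<m j. SUM b0<r i j. \<Sum>s | p i j * s <= a. if s = 0 then if b0 = b then if q0 = q then x (i, j, h) q b (i, q', a) else 0 else 0 else 0)"
  by (intro sum.cong) auto
 also have "... = x (i, j, h) q b (i, q', a)" using q b fin by simp
 finally show "rgen x (i, j, h) (delta (j, q, b)) (i', q', a) = es i (x (i, j, h) q b) (i', q', a)"
  using pr by (auto simp: rgen_apply es_apply)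
qed

text \<open>Division of an exponent by \<open>r i j\<close> with remainder writes every basis vector
  at \<open>j\<close> as a power of \<open>Es (r i j)\<close> applied to one with exponent below
  \<open>r i j\<close>.\<close>

lemma rep_eqI:
 assumes A: "A : rep" "A' : rep" and a: "(i, j, h) : Arr"
  and e: "!!q b. q < m j ==> b < r i j ==> tr K (A (i, j, h) (delta (j, q, b))) = tr K (A' (i, j, h) (delta (j, q, b)))"
  and v: "v : Vin"
 shows "tr K (A (i, j, h) v) = tr K (A' (i, j, h) v)"
proof -
 have j: "j : {1..n}" "0 < r i j" using Arr[OF a] by auto
 have d: "tr K (A (i, j, h) (delta t)) = tr K (A' (i, j, h) (delta t))" if t: "t : I K" for t
 proof -
  obtain j' q b where t': "t = (j', q, b)" "j' : {1..n}" "q < m j'" using t by (cases t) auto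
  note dV = delta_Vin[OF t'(2,3)]
  show ?thesis
  proof (cases "j' = j")
   case False
   have "es j (delta t) = 0" using t' False by (simp add: es_delta)
   thus ?thesis using repD(4)[OF A(1) a dV[of b]] repD(4)[OF A(2) a dV[of b]] t'
    by (simp add: lin_0[OF repD(1)[OF A(1) a]] lin_0[OF repD(1)[OF A(2) a]])
  next
   case True
   let ?s = "b div r i j" and ?b = "b mod r i j"
   have dt: "delta t = Es (r i j * ?s) (delta (j, q, ?b))" using t' True by (simp add: Es_delta)
   have "tr K (Es (p i j * ?s) (A (i, j, h) (delta (j, q, ?b)))) = tr K (Es (p i j * ?s) (A' (i, j, h) (delta (j, q, ?b))))"
    by (rule dop_cong[OF dop_Es repD(2)[OF A(1) a] repD(2)[OF A(2) a]])
     (use e[of q ?b] dV[of ?b] t' True j in auto)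
   thus ?thesis unfolding dt
    using rep_Es[OF A(1) a dV[of ?b]] rep_Es[OF A(2) a dV[of ?b]] True by simp
  qed
 qed
 have "tr K (A (i, j, h) (tr K v)) = tr K (A' (i, j, h) (tr K v))"
  using d by (simp add: V_lin_expand[OF tr_V repD(1)[OF A(1) a]] V_lin_expand[OF tr_V repD(1)[OF A(2) a]]
   lin_sum[OF lin_tr] lin_scale[OF lin_tr])
 thus ?thesis using dop_tr[OF rep_dop[OF A(1) a] v] dop_tr[OF rep_dop[OF A(2) a] v] by simp
qed

end

section \<open>Linear systems with continuous coefficients\<close>

lemma jdet_solve:
 assumes J: "finite J" and t: "t : J" and nz: "jdet J W ~= 0"
 shows "(SUM s:J. W t s * ((SUM s':J. jadj J W s s' * y s') / jdet J W)) = y t"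
proof -
 have "(SUM s:J. W t s * ((SUM s':J. jadj J W s s' * y s') / jdet J W)) =
   (SUM s:J. SUM s':J. W t s * (jadj J W s s' * y s')) / jdet J W"
  by (simp add: sum_distrib_left sum_divide_distrib)
 also have "(SUM s:J. SUM s':J. W t s * (jadj J W s s' * y s')) = (SUM s':J. (SUM s:J. W t s * jadj J W s s') * y s')"
  by (subst sum.swap) (simp add: sum_distrib_right mult.assoc)
 also have "... = (SUM s':J. if t = s' then jdet J W * y s' else 0)"
  using jadj_right[OF J t, of _ W] by (auto intro!: sum.cong)
 also have "... = jdet J W * y t" using t J by simp
 finally show ?thesis using nz by simp
qed

text \<open>The determinant is 1 at \<open>u0\<close>, hence nonzero on a neighbourhood, where
  Cramer's rule gives a continuous solution. At \<open>u0\<close> the matrix is the identity, so the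
  solution there is the right-hand side itself; this normalisation is used to start from the zero
  solution.\<close>

lemma local_linear_solve:
 fixes w :: "'u::topological_space => 'x => 'x => complex"
 assumes J: "finite J" and u0: "u0 : B"
  and w: "!!t s. t : J ==> s : J ==> continuous_on B (%u. w u t s)"
  and w0: "!!t s. t : J ==> s : J ==> w u0 t s = (if t = s then 1 else 0)"
  and y: "!!t. t : J ==> continuous_on B (%u. y u t)"
 obtains W c where "open W" "u0 : W"
  "!!t. t : J ==> continuous_on (W Int B) (%u. c u t)"
  "!!u t. u : W Int B ==> t : J ==> (SUM s:J. w u t s * c u s) = y u t"
  "!!t. t : J ==> c u0 t = y u0 t"
proof -
 have d: "continuous_on B (%u. jdet J (w u))"
  by (rule continuous_jdet[where W = w and B = B, OF J]) (rule w)
 have adj: "continuous_on B (%u. jadj J (w u) t s)" if ts: "t : J" "s : J" for t s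
  by (rule continuous_jadj[where W = w and B = B, OF J _ ts]) (rule w)
 have "jdet J (w u0) = jdet J (%t s. if t = s then 1 else 0)" by (rule jdet_cong[OF J w0])
 hence d0: "jdet J (w u0) = 1" using jdet_one[OF J] by simp
 have "openin (top_of_set B) (B Int (%u. jdet J (w u)) -` (- {0}))"
  by (rule continuous_openin_preimage_gen[OF d]) auto
 then obtain W where W: "open W" "B Int (%u. jdet J (w u)) -` (- {0}) = B Int W"
  unfolding openin_open by blast
 hence nz: "jdet J (w u) ~= 0" if "u : W Int B" for u using that by auto
 have W0: "u0 : W" using W(2) u0 d0 by auto
 define c where "c u t = (SUM s:J. jadj J (w u) t s * y u s) / jdet J (w u)" for u t
 show thesis
 proof (rule that[OF W(1) W0])
  fix t assume t: "t : J"
  show "continuous_on (W Int B) (%u. c u t)"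
   unfolding c_def using nz
   by (intro continuous_intros continuous_on_subset[OF adj]
     continuous_on_subset[OF y] continuous_on_subset[OF d]) (use t in auto)
  have "c u0 t = (SUM s:J. if t = s then c u0 s else 0)" using t J by simp
  also have "... = (SUM s:J. w u0 t s * c u0 s)"
   by (rule sum.cong) (use w0 t in auto)
  also have "... = y u0 t" unfolding c_def by (rule jdet_solve[OF J t]) (simp add: d0)
  finally show "c u0 t = y u0 t" .
 next
  fix u t assume u: "u : W Int B" and t: "t : J"
  show "(SUM s:J. w u t s * c u s) = y u t" unfolding c_def by (rule jdet_solve[OF J t nz[OF u]])
 qed
qed

section \<open>Invertible operators and surjectivity of the adjoint action\<close>

context power_series_model
begin

lemma tr_in: "t : I K ==> tr K v t = v t"
 by (simp add: tr_def)

lemma tr_D_zero: "K <= k ==> tr K (D k v) = 0"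
 by (simp add: tr_D) (rule vec3_eqI, auto simp: ops_apply)

text \<open>Invertibility is demanded modulo level \<open>K\<close> only, and the inverse is kept as
  explicit data, so that it can be lifted to higher levels by a formula and followed
  continuously.\<close>

definition invm :: "nat => (vec3 => vec3) => (vec3 => vec3) => bool" where
 "invm K g h \<longleftrightarrow> g : gl & h : gl & (ALL v:Vin. tr K (g (h v)) = tr K v & tr K (h (g v)) = tr K v)"

lemma invmD: assumes "invm K g h" shows "g : gl" "h : gl" "v : Vin ==> tr K (g (h v)) = tr K v"
  "v : Vin ==> tr K (h (g v)) = tr K v"
 using assms by (auto simp: invm_def)

lemma invm_sym: "invm K g h ==> invm K h g"
 by (auto simp: invm_def)

lemma invm_id: "invm K (%v. v) (%v. v)"
 by (auto simp: invm_def gl_id)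

lemma invm_mono: "K <= K' ==> invm K' g h ==> invm K g h"
 unfolding invm_def by (meson tr_eq_mono)

lemma gl_cong: "g : gl ==> v : Vin ==> w : Vin ==> tr K v = tr K w ==> tr K (g v) = tr K (g w)"
 using dop_cong[OF gl_dop] .

lemma rep_cong: "A : rep ==> a : Arr ==> v : Vin ==> w : Vin ==> tr K v = tr K w ==> tr K (A a v) = tr K (A a w)"
 using dop_cong[OF rep_dop] .

lemma rep_Vin: "A : rep ==> a : Arr ==> v : Vin ==> A a v : Vin"
 using dopD(2)[OF rep_dop] .

lemma rep_lin: "A : rep ==> a : Arr ==> lin (A a)"
 using dopD(1)[OF rep_dop] .

lemma rep_D: "A : rep ==> a : Arr ==> v : Vin ==> A a (D k v) = D k (A a v)"
 using dopD(3)[OF rep_dop] .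

lemma gl_D_commute: "g : gl ==> v : Vin ==> g (D k v) = D k (g v)"
 using dopD(3)[OF gl_dop] .

lemma invm_comp:
 assumes g: "invm K g h" and g': "invm K g' h'"
 shows "invm K (%v. g (g' v)) (%v. h' (h v))"
 unfolding invm_def
proof (intro conjI ballI)
 fix v assume v: "v : Vin"
 have "tr K (g (g' (h' (h v)))) = tr K (g (h v))"
  by (rule gl_cong[OF invmD(1)[OF g]]) (use invmD[OF g] invmD[OF g'] glD(2) v in auto)
 thus "tr K (g (g' (h' (h v)))) = tr K v" using invmD(3)[OF g v] by simp
 have "tr K (h' (h (g (g' v)))) = tr K (h' (g' v))"
  by (rule gl_cong[OF invmD(2)[OF g']]) (use invmD[OF g] invmD[OF g'] glD(2) v in auto)
 thus "tr K (h' (h (g (g' v)))) = tr K v" using invmD(4)[OF g' v] by simp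
qed (use invmD(1,2)[OF g] invmD(1,2)[OF g'] in \<open>auto intro: gl_comp[where y = g] gl_comp[where y = h']\<close>)

text \<open>A Newton step: if the error is \<open>\<nu> = 1 - g h\<close>, the error of the improved
  inverse \<open>2 h - h g h\<close> is the square of \<open>\<nu>\<close>. As \<open>\<nu>\<close>
  is divisible by \<open>D k\<close>, its square is divisible by \<open>D k\<close> twice, which
  vanishes at level \<open>Suc k\<close> because \<open>k\<close> is positive.\<close>

lemma invm_lift_aux:
 assumes g: "g : gl" and h: "h : gl" and k: "0 < k" and v: "v : Vin"
  and e: "!!v. v : Vin ==> tr k (g (h v)) = tr k v"
 shows "tr (Suc k) (cs 2 (g (h v)) - g (h (g (h v)))) = tr (Suc k) v"
proof -
 define \<nu> where "\<nu> v = v - g (h v)" for v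
 have \<nu>: "dop \<nu>" unfolding \<nu>_def
  by (rule dop_diff[OF dop_id gl_dop[OF gl_comp[OF g h]]])
 have n0: "v : Vin ==> tr k (\<nu> v) = 0" for v by (simp add: \<nu>_def tr_diff e)
 have nV: "v : Vin ==> \<nu> v : Vin" for v using dopD(2)[OF \<nu>] .
 have "\<nu> (\<nu> v) = \<nu> (D k (Dinv k (\<nu> v)))" using D_Dinv[OF nV n0] v by simp
 also have "... = D k (\<nu> (Dinv k (\<nu> v)))" using dopD(3)[OF \<nu>] nV v by simp
 finally have "\<nu> (\<nu> v) = D k (\<nu> (Dinv k (\<nu> v)))" .
 moreover have "tr (Suc k) (D k (\<nu> (Dinv k (\<nu> v)))) = 0"
 proof -
  have "tr k (\<nu> (Dinv k (\<nu> v))) = 0" using n0 nV v by simp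
  hence "tr (Suc k - k) (\<nu> (Dinv k (\<nu> v))) = tr (Suc k - k) 0"
   using tr_eq_mono[of "Suc k - k" k _ 0] k by simp
  thus ?thesis by (simp add: tr_D) (rule vec3_eqI, auto simp: ops_apply)
 qed
 ultimately have "tr (Suc k) (\<nu> (\<nu> v)) = 0" by simp
 moreover have "\<nu> (\<nu> v) = v - (cs 2 (g (h v)) - g (h (g (h v))))"
  unfolding \<nu>_def by (simp add: lin_diff[OF glD(1)[OF g]] lin_diff[OF glD(1)[OF h]] fun_eq_iff)
 ultimately show ?thesis by (simp add: tr_diff)
qed

lemma invm_lift:
 assumes g: "invm k g h" and k: "0 < k"
 shows "invm (Suc k) g (%v. cs 2 (h v) - h (g (h v)))"
 unfolding invm_def
proof (intro conjI ballI)
 note g' = invmD[OF g]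
 show "(%v. cs 2 (h v) - h (g (h v))) : gl"
  by (rule gl_diff[OF gl_cs[OF g'(2)] gl_comp[OF g'(2) gl_comp[OF g'(1,2)]]])
 fix v assume v: "v : Vin"
 show "tr (Suc k) (g (cs 2 (h v) - h (g (h v)))) = tr (Suc k) v"
  using invm_lift_aux[OF g'(1,2) k v g'(3)] by (simp add: lin_diff[OF glD(1)[OF g'(1)]] lin_scale[OF glD(1)[OF g'(1)]])
 show "tr (Suc k) (cs 2 (h (g v)) - h (g (h (g v)))) = tr (Suc k) v"
  using invm_lift_aux[OF g'(2,1) k v g'(4)] .
qed (use invmD[OF g] in auto)

text \<open>Surjectivity, modulo level \<open>K\<close>, of the differential of the group action at
  \<open>A\<close>. The cokernel of this differential is the self-extension group of the module
  given by \<open>A\<close>; what is proved about it is that \<open>adsurj\<close> and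
  \<open>rigid\<close> correspond, in \<open>rigid_imp_adsurj\<close> and
  \<open>adsurj_imp_rigid\<close>.\<close>

definition adsurj :: "nat => (nat * nat * nat => vec3 => vec3) => bool" where
 "adsurj K A \<longleftrightarrow> A : rep \<and>
   (ALL B:rep. EX y:gl. ALL a:Arr. ALL v:Vin. tr K (y (A a v) - A a (y v)) = tr K (B a v))"

lemma adsurj_rep: "adsurj K A ==> A : rep"
 by (simp add: adsurj_def)

lemma adsurjE:
 assumes "adsurj K A" "B : rep"
 obtains y where "y : gl" "!!a v. a : Arr ==> v : Vin ==> tr K (y (A a v) - A a (y v)) = tr K (B a v)"
 using assms unfolding adsurj_def by metis

lemma adsurj_mono: "K <= K' ==> adsurj K' A ==> adsurj K A"
 unfolding adsurj_def by (meson tr_eq_mono)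

lemma rep_bracket: "A : rep ==> A' : rep ==> y : gl ==> (%a v. y (A a v) - A' a (y v)) : rep"
 using rep_diff[OF rep_gl_left rep_gl_right] .

text \<open>The Nakayama argument made explicit: a solution modulo level \<open>k\<close> leaves an
  error \<open>R\<close> divisible by \<open>D k\<close>. Solving once more for the quotient and
  subtracting \<open>D k\<close> times that solution removes the error modulo level
  \<open>Suc k\<close>.\<close>

lemma adsurj_Suc:
 assumes A: "adsurj k A" and k: "0 < k"
 shows "adsurj (Suc k) A"
 unfolding adsurj_def
proof (intro conjI ballI)
 show A': "A : rep" using A by (rule adsurj_rep)
 fix B assume B: "B : rep"
 obtain y where y: "y : gl" "!!a v. a : Arr ==> v : Vin ==> tr k (y (A a v) - A a (y v)) = tr k (B a v)"
  using adsurjE[OF A B] by metis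
 define R where "R a v = (y (A a v) - A a (y v)) - B a v" for a v
 have R: "R : rep" unfolding R_def by (rule rep_diff[OF rep_bracket[OF A' A' y(1)] B])
 have R0: "tr k (R a v) = 0" if "a : Arr" "v : Vin" for a v
  using y(2)[OF that] by (simp add: R_def tr_diff)
 note \<rho> = rep_Dinv[OF R R0]
 obtain y' where y': "y' : gl" "!!a v. a : Arr ==> v : Vin ==> tr k (y' (A a v) - A a (y' v)) = tr k (Dinv k (R a v))"
  using adsurjE[OF A \<rho>(1)] by blast
 show "EX y:gl. ALL a:Arr. ALL v:Vin. tr (Suc k) (y (A a v) - A a (y v)) = tr (Suc k) (B a v)"
 proof (intro bexI ballI)
  show "(%v. y v - D k (y' v)) : gl" by (rule gl_diff[OF y(1) gl_D[OF y'(1)]])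
  fix a v assume a: "a : Arr" and v: "v : Vin"
  have "y (A a v) - D k (y' (A a v)) - A a (y v - D k (y' v)) =
    B a v + (D k (Dinv k (R a v)) - D k (y' (A a v) - A a (y' v)))"
   using rep_D[OF A' a glD(2)[OF y'(1) v]] \<rho>(2)[OF _ _ a v]
   by (simp add: R_def lin_diff[OF lin_D] lin_diff[OF rep_lin[OF A' a]])
  moreover have "tr (Suc k) (D k (Dinv k (R a v))) = tr (Suc k) (D k (y' (A a v) - A a (y' v)))"
   by (rule tr_D_cong, rule tr_eq_mono[of _ k]) (use k y'(2)[OF a v] in auto)
  ultimately show "tr (Suc k) (y (A a v) - D k (y' (A a v)) - A a (y v - D k (y' v))) = tr (Suc k) (B a v)"
   by (simp add: tr_add tr_diff)
 qed
qed

lemma adsurj_level: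
 assumes "adsurj k A" "0 < k" shows "adsurj k' A"
proof (cases "k <= k'")
 case True
 thus ?thesis
  by (induction k' rule: dec_induct) (use assms adsurj_Suc in auto)
qed (use assms adsurj_mono[of k' k] in auto)

lemma rep_conj: "A : rep ==> g : gl ==> h : gl ==> (%a v. h (A a (g v))) : rep"
 using rep_gl_left[OF rep_gl_right] .

text \<open>The equation for the conjugated representation and right-hand side \<open>B\<close> is
  the conjugate of the equation for \<open>A\<close> and right-hand side \<open>g B h\<close>; so
  the latter is solved and the solution conjugated back.\<close>

lemma adsurj_conj:
 assumes A: "adsurj K A" and g: "invm K g h"
 shows "adsurj K (%a v. h (A a (g v)))"
 unfolding adsurj_def
proof (intro conjI ballI)
 note A' = adsurj_rep[OF A] and g' = invmD[OF g]
 show "(%a v. h (A a (g v))) : rep" by (rule rep_conj[OF A' g'(1,2)])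
 fix B assume B: "B : rep"
 obtain y where y: "y : gl" "!!a v. a : Arr ==> v : Vin ==> tr K (y (A a v) - A a (y v)) = tr K (g (B a (h v)))"
  using adsurjE[OF A rep_conj[OF B g'(2,1)]] by metis
 show "EX y:gl. ALL a:Arr. ALL v:Vin. tr K (y (h (A a (g v))) - h (A a (g (y v)))) = tr K (B a v)"
 proof (intro bexI[of _ "%v. h (y (g v))"] ballI)
  show "(%v. h (y (g v))) : gl" using gl_comp[OF g'(2) gl_comp[OF y(1) g'(1)]] .
  fix a v assume a: "a : Arr" and v: "v : Vin"
  note [simp] = glD(2)[OF y(1)] glD(2)[OF g'(1)] glD(2)[OF g'(2)] rep_Vin[OF A' a] rep_Vin[OF B a] v
  have "tr K (h (y (g (h (A a (g v)))))) = tr K (h (y (A a (g v))))"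
   by (intro gl_cong[OF g'(2)] gl_cong[OF y(1)] g'(3)) auto
  moreover have "tr K (h (A a (g (h (y (g v)))))) = tr K (h (A a (y (g v))))"
   by (intro gl_cong[OF g'(2)] rep_cong[OF A' a] g'(3)) auto
  moreover have "tr K (h (y (A a (g v)) - A a (y (g v)))) = tr K (h (g (B a (h (g v)))))"
   by (intro gl_cong[OF g'(2)] y(2)[OF a]) auto
  moreover have "tr K (h (g (B a (h (g v))))) = tr K (B a (h (g v)))" by (rule g'(4)) auto
  moreover have "tr K (B a (h (g v))) = tr K (B a v)" by (intro rep_cong[OF B a] g'(4)) auto
  ultimately show "tr K (h (y (g (h (A a (g v))))) - h (A a (g (h (y (g v)))))) = tr K (B a v)"
   by (simp add: lin_diff[OF glD(1)[OF g'(2)]] tr_diff)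
 qed
qed

section \<open>Continuous families of vectors and operators\<close>

definition conton :: "'u::topological_space set => ('u => 'x => complex) => bool" where
 "conton S F \<longleftrightarrow> (ALL t. continuous_on S (%u. F u t))"

lemma contonD: "conton S F ==> continuous_on S (%u. F u t)"
 by (simp add: conton_def)

lemma conton_subset: "conton S F ==> T \<subseteq> S ==> conton T F"
 unfolding conton_def using continuous_on_subset by blast

lemma conton_const: "conton S (%u. v)"
 and conton_add: "conton S F ==> conton S G ==> conton S (%u. F u + G u)"
 and conton_diff: "conton S F ==> conton S G ==> conton S (%u. F u - G u)"
 and conton_cs: "continuous_on S z ==> conton S F ==> conton S (%u. cs (z u) (F u))"
 by (auto simp: conton_def intro!: continuous_intros)

lemma conton_sum: "(!!x. x : X ==> conton S (F x)) ==> conton S (%u. SUM x:X. F x u)"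
 by (auto simp: conton_def sum_fun_apply intro!: continuous_intros)

lemma continuous_on_if_const: "(P ==> continuous_on S f) ==> (\<not> P ==> continuous_on S g) ==>
  continuous_on S (%u. if P then f u else g u)"
 by (cases P) auto

lemma conton_ops: "conton S F ==> conton S (%u. tr K (F u))" "conton S F ==> conton S (%u. es i (F u))"
  "conton S F ==> conton S (%u. Es s (F u))" "conton S F ==> conton S (%u. D k (F u))"
  "conton S F ==> conton S (%u. Dinv k (F u))"
 unfolding conton_def by (auto simp: ops_apply intro!: continuous_on_if_const)

text \<open>Continuity is required for each fixed argument only. For operators in \<open>dop\<close>
  this implies continuity for varying arguments (\<open>conton_apply\<close>), since each
  coefficient of the value depends on finitely many coefficients of the argument.\<close>

definition opcont :: "'u::topological_space set => ('u => vec3 => vec3) => bool" where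
 "opcont S L \<longleftrightarrow> (ALL v:Vin. conton S (%u. L u v))"

lemma opcontD: "opcont S L ==> v : Vin ==> conton S (%u. L u v)"
 by (simp add: opcont_def)

lemma opcont_subset: "opcont S F ==> T \<subseteq> S ==> opcont T F"
 unfolding opcont_def using conton_subset by blast

lemma conton_apply:
 assumes L: "opcont S L" "!!u. u : S ==> dop (L u)" and w: "conton S w" "!!u. u : S ==> w u : Vin"
 shows "conton S (%u. L u (w u))"
 unfolding conton_def
proof
 fix t :: "nat * nat * nat"
 obtain i q a where t: "t = (i, q, a)" by (cases t)
 show "continuous_on S (%u. L u (w u) t)"
 proof (cases "i : {1..n} & q < m i")
  case False
  hence "L u (w u) t = 0" if "u : S" for u
   using dopD(2)[OF L(2)[OF that] w(2)[OF that]] t by (auto simp: Vin_def)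
  thus ?thesis by simp
 next
  case True
  hence "0 < c i" using c_pos by simp
  \<comment> \<open>Any level that contains the exponent \<open>a\<close> at vertex \<open>i\<close>
    would do; \<open>Suc a\<close> does since \<open>c i\<close> is at least 1.\<close>
  hence "a < Suc a * c i" by (cases "c i") auto
  hence tI: "t : I (Suc a)" using True t by simp
  have "L u (w u) t = (SUM s:I (Suc a). w u s * L u (delta s) t)" if u: "u : S" for u
  proof -
   have "L u (w u) t = tr (Suc a) (L u (w u)) t" using tI by (simp add: tr_def)
   also have "... = tr (Suc a) (L u (tr (Suc a) (w u))) t" using dop_tr[OF L(2)[OF u] w(2)[OF u]] by simp
   also have "... = (SUM s:I (Suc a). tr (Suc a) (w u) s * L u (delta s) t)"
    using tI by (simp add: V_lin_expand[OF tr_V dopD(1)[OF L(2)[OF u]]] tr_in sum_fun_apply)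
   also have "... = (SUM s:I (Suc a). w u s * L u (delta s) t)" by (rule sum.cong) (auto simp: tr_def)
   finally show ?thesis .
  qed
  moreover have "continuous_on S (%u. SUM s:I (Suc a). w u s * L u (delta s) t)"
  proof (intro continuous_intros)
   fix s assume "s : I (Suc a)"
   hence "delta s : Vin" by (rule V_Vin[OF delta_V])
   thus "continuous_on S (%u. L u (delta s) t)" by (rule contonD[OF opcontD[OF L(1)]])
  qed (rule contonD[OF w(1)])
  ultimately show ?thesis by (subst continuous_on_cong[OF refl]) auto
 qed
qed

lemma opcont_comp:
 assumes "opcont S L" "!!u. u : S ==> dop (L u)" "opcont S M" "!!u. u : S ==> dop (M u)"
 shows "opcont S (%u v. L u (M u v))"
 unfolding opcont_def
proof
 fix v assume v: "v : Vin"
 show "conton S (%u. L u (M u v))"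
  by (rule conton_apply[OF assms(1,2) opcontD[OF assms(3) v] dopD(2)[OF assms(4) v]])
qed

lemma opcont_const: "opcont S (%u. L)"
 by (simp add: opcont_def conton_const)

lemma opcont_gen: "(!!i q. conton S (%u. x u i q)) ==> opcont S (%u. gen (x u))"
 unfolding opcont_def conton_def by (auto simp: gen_def intro!: continuous_intros continuous_on_if_const)

text \<open>Modulo level \<open>K\<close> the operator is a square matrix indexed by
  \<open>I K\<close>. Its determinant is nonzero near \<open>u0\<close>, and the adjugate inverts it
  continuously. Only the columns of the inverse at exponent 0 are kept and extended by
  \<open>gen\<close>, which puts the inverse into \<open>gl\<close>.\<close>

lemma gl_local_inverse:
 assumes u0: "u0 : S" and g: "!!u. u : S ==> g u : gl" "opcont S g" and g0: "invm K (g u0) h0"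
 obtains W h where "open W" "u0 : W" "!!u. u : W Int S ==> invm K (g u) (h u)" "opcont (W Int S) h"
proof -
 let ?J = "I K"
 define w where "w u t s = g u (delta s) t" for u t s
 have app: "tr K (g u v) t = (SUM s:?J. w u t s * v s)" if u: "u : S" and v: "v : Vin" and t: "t : ?J" for u v t
 proof -
  have "tr K (g u v) t = tr K (g u (tr K v)) t" using dop_tr[OF gl_dop[OF g(1)[OF u]] v] by simp
  also have "... = (SUM s:?J. tr K v s * g u (delta s) t)"
   using t by (simp add: V_lin_expand[OF tr_V glD(1)[OF g(1)[OF u]]] tr_in sum_fun_apply)
  also have "... = (SUM s:?J. w u t s * v s)" by (rule sum.cong) (auto simp: tr_def w_def)
  finally show ?thesis .
 qed
 have wc: "continuous_on S (%u. w u t s)" if "s : ?J" for t s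
  unfolding w_def by (rule contonD[OF opcontD[OF g(2) V_Vin[OF delta_V[OF that]]]])
 have d: "continuous_on S (%u. jdet ?J (w u))"
  by (rule continuous_jdet[where W = w and B = S, OF fin_I]) (rule wc)
 have adj: "continuous_on S (%u. jadj ?J (w u) t s)" if ts: "t : ?J" "s : ?J" for t s
  by (rule continuous_jadj[where W = w and B = S, OF fin_I _ ts]) (rule wc)
 \<comment> \<open>A nonzero kernel vector of the matrix would be annihilated modulo level
   \<open>K\<close> by \<open>g u0\<close>, hence by \<open>h0\<close> after \<open>g u0\<close>,
   which is the identity there.\<close>
 have d0: "jdet ?J (w u0) ~= 0"
 proof
  assume "jdet ?J (w u0) = 0"
  then obtain v t where v: "t : ?J" "v t ~= 0" "!!t. t : ?J ==> (SUM s:?J. w u0 t s * v s) = 0"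
   using jdet_zero[OF fin_I] by metis
  have "tr K (g u0 (tr K v)) = 0"
  proof
   fix t show "tr K (g u0 (tr K v)) t = 0 t"
   proof (cases "t : ?J")
    case True
    hence "tr K (g u0 (tr K v)) t = (SUM s:?J. w u0 t s * tr K v s)" using app[OF u0] by simp
    also have "... = (SUM s:?J. w u0 t s * v s)" by (rule sum.cong) (auto simp: tr_def)
    finally show ?thesis using v(3)[OF True] by simp
   qed (simp add: tr_def)
  qed
  hence "tr K (h0 (g u0 (tr K v))) = tr K (h0 0)"
   by (intro gl_cong[OF invmD(2)[OF g0]]) (use glD(2)[OF g(1)[OF u0]] in auto)
  hence "tr K v = 0" using invmD(4)[OF g0, of "tr K v"] lin_0[OF glD(1)[OF invmD(2)[OF g0]]] by simp
  hence "tr K v t = 0" by simp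
  thus False using v(1,2) by (simp add: tr_def)
 qed
 have "openin (top_of_set S) (S Int (%u. jdet ?J (w u)) -` (- {0}))"
  by (rule continuous_openin_preimage_gen[OF d]) auto
 then obtain W where W: "open W" "S Int (%u. jdet ?J (w u)) -` (- {0}) = S Int W"
  unfolding openin_open by blast
 hence nz: "jdet ?J (w u) ~= 0" if "u : W Int S" for u using that by auto
 have W0: "u0 : W" using W(2) u0 d0 by auto
 \<comment> \<open>The column of the inverse matrix at \<open>delta (i, q, 0)\<close>. For a valid
   pair \<open>i\<close>, \<open>q\<close> this index is missing from \<open>I K\<close> only if
   \<open>K = 0\<close>, where every truncation vanishes.\<close>
 define x where "x u i q = (%t. if t : ?J then if (i, q, 0) : ?J then jadj ?J (w u) t (i, q, 0) / jdet ?J (w u) else 0 else 0)" for u i q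
 have xV: "x u i q : V K" for u i q by (auto simp: x_def V_def)
 have xc: "conton (W Int S) (%u. x u i q)" for i q
  unfolding conton_def
 proof
  fix t show "continuous_on (W Int S) (%u. x u i q t)"
  proof (cases "t : ?J & (i, q, 0) : ?J")
   case True
   have "continuous_on (W Int S) (%u. jadj ?J (w u) t (i, q, 0) / jdet ?J (w u))"
    by (intro continuous_on_divide ballI nz continuous_on_subset[OF adj] continuous_on_subset[OF d])
     (use True in auto)
   thus ?thesis using True by (simp add: x_def del: I_mem)
  next
   case False
   hence "x u i q t = 0" for u by (auto simp: x_def)
   thus ?thesis by simp
  qed
 qed
 define h where "h u = gen (x u)" for u
 have right: "tr K (g u (h u v)) = tr K v" if u: "u : W Int S" and v: "v : Vin" for u v
 proof -
  have gu: "g u : gl" and uS: "u : S" using g u by auto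
  have b: "tr K (g u (h u (delta (i, q, 0)))) = tr K (delta (i, q, 0))" if iq: "i : {1..n}" "q < m i" for i q
  proof (cases "(i, q, 0) : ?J")
   case True
   have "tr K (g u (x u i q)) = tr K (delta (i, q, 0))"
   proof
    fix t show "tr K (g u (x u i q)) t = tr K (delta (i, q, 0)) t"
    proof (cases "t : ?J")
     case t: True
     have "tr K (g u (x u i q)) t = (SUM s:?J. w u t s * x u i q s)" using app[OF uS V_Vin[OF xV] t] .
     also have "... = (SUM s:?J. w u t s * jadj ?J (w u) s (i, q, 0)) / jdet ?J (w u)"
      unfolding sum_divide_distrib by (rule sum.cong) (use True in \<open>auto simp: x_def simp del: I_mem\<close>)
     also have "... = delta (i, q, 0) t"
      using jadj_right[OF fin_I t True, of "w u"] nz[OF u] by (simp add: delta_apply)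
     finally show ?thesis using t by (simp add: tr_def)
    qed (simp add: tr_def)
   qed
   hence "tr K (es i (g u (x u i q))) = tr K (delta (i, q, 0))"
    using iq by (simp only: es_commute[symmetric]) (simp add: es_commute es_delta)
   thus ?thesis using glD(3)[OF gu V_Vin[OF xV] iq(1)] gen_delta[OF iq] by (simp add: h_def)
  next
   case False
   hence "K = 0" using iq c_pos[of i] by auto
   thus ?thesis by (auto simp: tr_def I_def fun_eq_iff)
  qed
  show ?thesis
   unfolding h_def by (rule gl_eqI[OF gl_comp[OF gu gen_gl[of "x u"]] gl_id _ v]) (use b in \<open>simp add: h_def\<close>)
 qed
 \<comment> \<open>The left adjugate identity yields injectivity, which turns the right inverse just
   found into a two-sided one.\<close>
 have inj: "tr K v = tr K v'" if u: "u : W Int S" and v: "v : Vin" "v' : Vin" and e: "tr K (g u v) = tr K (g u v')" for u v v'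
 proof -
  have uS: "u : S" using u by simp
  have "tr K v s = tr K v' s" if s: "s : ?J" for s
  proof -
   have "jdet ?J (w u) * (v s - v' s) = (SUM s':?J. if s = s' then jdet ?J (w u) * (v s' - v' s') else 0)" using s by simp
   also have "... = (SUM s':?J. (SUM t:?J. jadj ?J (w u) s t * w u t s') * (v s' - v' s'))"
    using jadj_left[OF fin_I s] by (intro sum.cong) auto
   also have "... = (SUM t:?J. jadj ?J (w u) s t * ((SUM s':?J. w u t s' * v s') - (SUM s':?J. w u t s' * v' s')))"
    unfolding sum_subtractf[symmetric] sum_distrib_left sum_distrib_right
    by (subst sum.swap) (simp add: algebra_simps)
   also have "... = 0" using app[OF uS v(1)] app[OF uS v(2)] e by simp
   finally show ?thesis using nz[OF u] s by (simp add: tr_def)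
  qed
  thus ?thesis by (auto simp: tr_def fun_eq_iff)
 qed
 show thesis
 proof (rule that[OF W(1) W0])
  show "opcont (W Int S) h" unfolding h_def by (rule opcont_gen[OF xc])
  fix u assume u: "u : W Int S"
  have gu: "g u : gl" using g u by auto
  have hu: "h u : gl" by (simp add: h_def gen_gl)
  have "tr K (h u (g u v)) = tr K v" if v: "v : Vin" for v
   by (rule inj[OF u _ v right[OF u]]) (use glD(2)[OF gu] glD(2)[OF hu] v in auto)
  thus "invm K (g u) (h u)" using right[OF u] gu hu by (simp add: invm_def)
 qed
qed


section \<open>Coordinates of representations and commutator equations\<close>

definition Xi :: "nat => ((nat * nat * nat) \<times> nat * nat \<times> (nat * nat * nat)) set" where
 "Xi K = {((i, j, h), q, b, t). (i, j, h) : Arr & q < m j & b < r i j & t : I K & fst t = i}"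

text \<open>The coordinates of a representation modulo \<open>\<epsilon>\<^sup>K\<close>: a map with \<open>\<alpha>(\<epsilon>\<^sub>j^r v) = \<epsilon>\<^sub>i^p \<alpha>(v)\<close> is free on the values at
 \<open>\<epsilon>\<^sub>j\<^sup>b b\<^sub>j\<^sub>q\<close> for \<open>b < r\<close>.\<close>

fun co :: "(nat * nat * nat => vec3 => vec3) => (nat * nat * nat) \<times> nat * nat \<times> (nat * nat * nat) => complex" where
 "co A ((i, j, h), q, b, t) = A (i, j, h) (delta (j, q, b)) t"

text \<open>The basis dual to the coordinates \<open>co\<close>, see \<open>co_bas\<close>.\<close>

fun bas :: "(nat * nat * nat) \<times> nat * nat \<times> (nat * nat * nat) => nat * nat * nat => vec3 => vec3" where
 "bas (a0, q0, b0, t0) = rgen (%a q b. if a = a0 & q = q0 & b = b0 then delta t0 else 0)"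

lemma xi_cases: obtains i j h q b t where "\<xi> = ((i, j, h), q, b, t)"
 by (metis prod.collapse)

lemma fin_Xi: "finite (Xi K)"
proof (rule finite_subset)
 show "Xi K \<subseteq> (SIGMA a:Arr. {..<m (fst (snd a))} \<times> {..<r (fst a) (fst (snd a))} \<times> I K)"
  by (auto simp: Xi_def)
qed (auto simp: fin_Arr)

lemma bas_rep: "bas \<xi> : rep"
 by (cases \<xi>) (simp add: rgen_rep)

lemma co_bas:
 assumes "\<xi> : Xi K" "\<xi>' : Xi K"
 shows "co (bas \<xi>') \<xi> = (if \<xi> = \<xi>' then 1 else 0)"
proof -
 obtain i j h q b t where x: "\<xi> = ((i, j, h), q, b, t)" by (metis prod.collapse)
 obtain a' q' b' t' where x': "\<xi>' = (a', q', b', t')" by (metis prod.collapse)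
 have a: "(i, j, h) : Arr" "q < m j" "b < r i j" "t : I K" "fst t = i" using assms(1) x by (auto simp: Xi_def)
 obtain q1 a1 where t: "t = (i, q1, a1)" "q1 < m i" using a(4,5) by (cases t) auto
 show ?thesis
  unfolding x x' using a t by (auto simp: rgen_delta es_apply delta_apply)
qed

lemma co_eq:
 assumes A: "A : rep" and B: "B : rep" and e: "!!\<xi>. \<xi> : Xi K ==> co A \<xi> = co B \<xi>"
  and a: "a : Arr" and v: "v : Vin"
 shows "tr K (A a v) = tr K (B a v)"
proof -
 obtain i j h where ijh: "a = (i, j, h)" by (cases a)
 have aA: "(i, j, h) : Arr" using a ijh by simp
 have j: "j : {1..n}" using Arr[OF aA] by simp
 have "tr K (A (i, j, h) (delta (j, q, b))) = tr K (B (i, j, h) (delta (j, q, b)))" if q: "q < m j" "b < r i j" for q b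
 proof
  fix t
  have z: "F (i, j, h) (delta (j, q, b)) t = 0" if "F : rep" "fst t ~= i" for F
  proof -
   have "es i (F (i, j, h) (delta (j, q, b))) t = 0" using that(2) by (cases t) (auto simp: es_apply)
   thus ?thesis using repD(3)[OF that(1) aA delta_Vin[OF j q(1)]] by simp
  qed
  show "tr K (A (i, j, h) (delta (j, q, b))) t = tr K (B (i, j, h) (delta (j, q, b))) t"
  proof (cases "t : I K & fst t = i")
   case True
   hence "((i, j, h), q, b, t) : Xi K" using q aA by (auto simp: Xi_def)
   from e[OF this] show ?thesis using True by (simp add: tr_in)
  next
   case False
   thus ?thesis using z[OF A] z[OF B] by (auto simp: tr_def)
  qed
 qed
 thus ?thesis unfolding ijh by (rule rep_eqI[OF A B aA _ v])
qed

lemma co_cong: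
 assumes "!!a v. a : Arr ==> v : Vin ==> tr K (A a v) = tr K (B a v)" and x: "\<xi> : Xi K"
 shows "co A \<xi> = co B \<xi>"
proof -
 obtain i j h q b t where x': "\<xi> = ((i, j, h), q, b, t)" by (metis prod.collapse)
 have a: "(i, j, h) : Arr" "q < m j" "b < r i j" "t : I K" "fst t = i" using x x' by (auto simp: Xi_def)
 have "tr K (A (i, j, h) (delta (j, q, b))) t = tr K (B (i, j, h) (delta (j, q, b))) t"
  using assms(1)[OF a(1) delta_Vin] Arr[OF a(1)] a by auto
 thus ?thesis using a x' by (simp add: tr_in)
qed

lemma co_continuous:
 assumes "!!a. a : Arr ==> opcont S (%u. A u a)" "\<xi> : Xi K"
 shows "continuous_on S (%u. co (A u) \<xi>)"
proof -
 obtain i j h q b t where x': "\<xi> = ((i, j, h), q, b, t)" by (metis prod.collapse)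
 have a: "(i, j, h) : Arr" "q < m j" using assms x' by (auto simp: Xi_def)
 thus ?thesis unfolding x' co.simps
  using contonD[OF opcontD[OF assms(1)[OF a(1)] delta_Vin[of j q b]]] Arr[OF a(1)] a(2) by simp
qed

lemma co_sum: "co (%a v. SUM x:X. cs (z x) (F x a v)) \<xi> = (SUM x:X. z x * co (F x) \<xi>)"
 by (cases \<xi> rule: xi_cases) (simp add: sum_fun_apply)

definition comb :: "'x set => ('x => vec3 => vec3) => ('x => complex) => vec3 => vec3" where
 "comb X Y \<gamma> v = (SUM x:X. cs (\<gamma> x) (Y x v))"

lemma comb_gl: "(!!x. x : X ==> Y x : gl) ==> comb X Y \<gamma> : gl"
 unfolding comb_def by (intro gl_sum gl_cs)

lemma comb_bracket:
 assumes "a : Arr" "A' : rep"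
 shows "comb X Y \<gamma> (A a v) - A' a (comb X Y \<gamma> v) = (SUM x:X. cs (\<gamma> x) (Y x (A a v) - A' a (Y x v)))"
 unfolding comb_def
 by (simp add: lin_sum[OF rep_lin[OF assms(2,1)]] lin_scale[OF rep_lin[OF assms(2,1)]] cs_diff sum_subtractf)

lemma co_arr_cong: "(!!a. a : Arr ==> A a = B a) ==> \<xi> : Xi K ==> co A \<xi> = co B \<xi>"
 by (cases \<xi> rule: xi_cases) (auto simp: Xi_def)

text \<open>The commutator is linear in its operator argument, so for combinations of fixed
  operators \<open>Y \<xi>'\<close> the equation becomes a linear system in the coordinates
  \<open>co\<close>. It is square because the operators and the coordinates are indexed by the same
  set \<open>Xi K\<close>.\<close>

lemma bracket_solves:
 assumes A: "A : rep" and A': "A' : rep" and R: "R : rep" and Y: "!!\<xi>. \<xi> : Xi K ==> Y \<xi> : gl"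
  and e: "!!\<xi>. \<xi> : Xi K ==> (\<Sum>\<xi>'\<in>Xi K. co (%a v. Y \<xi>' (A a v) - A' a (Y \<xi>' v)) \<xi> * \<gamma> \<xi>') = co R \<xi>"
  and a: "a : Arr" and v: "v : Vin"
 shows "tr K (comb (Xi K) Y \<gamma> (A a v) - A' a (comb (Xi K) Y \<gamma> v)) = tr K (R a v)"
proof (rule co_eq[OF rep_bracket[OF A A' comb_gl[OF Y]] R _ a v])
 fix \<xi> assume x: "\<xi> : Xi K"
 have "co (%a v. comb (Xi K) Y \<gamma> (A a v) - A' a (comb (Xi K) Y \<gamma> v)) \<xi> =
   co (%a v. \<Sum>\<xi>'\<in>Xi K. cs (\<gamma> \<xi>') (Y \<xi>' (A a v) - A' a (Y \<xi>' v))) \<xi>"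
  by (rule co_arr_cong[OF _ x], rule ext) (rule comb_bracket[OF _ A'])
 also have "... = co R \<xi>" unfolding co_sum using e[OF x] by (simp add: mult.commute)
 finally show "co (%a v. comb (Xi K) Y \<gamma> (A a v) - A' a (comb (Xi K) Y \<gamma> v)) \<xi> = co R \<xi>" .
qed

text \<open>The operators \<open>Y \<xi>\<close> are preimages of the basis representations
  \<open>bas \<xi>\<close> under the commutator with \<open>A\<close>; with respect to them the
  square system has the identity matrix.\<close>

lemma adsurj_basis:
 assumes "adsurj K A"
 shows "EX Y. (\<forall>\<xi>. Y \<xi> : gl) \<and>
  (\<forall>\<xi>\<in>Xi K. \<forall>\<xi>'\<in>Xi K. co (%a v. Y \<xi>' (A a v) - A a (Y \<xi>' v)) \<xi> = (if \<xi> = \<xi>' then 1 else 0))"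
proof -
 have "\<forall>\<xi>. EX y:gl. ALL a:Arr. ALL v:Vin. tr K (y (A a v) - A a (y v)) = tr K (bas \<xi> a v)"
  using assms bas_rep by (simp add: adsurj_def)
 then obtain Y where Y: "!!\<xi>. Y \<xi> : gl"
  "!!\<xi> a v. a : Arr ==> v : Vin ==> tr K (Y \<xi> (A a v) - A a (Y \<xi> v)) = tr K (bas \<xi> a v)"
  by metis
 have "co (%a v. Y \<xi>' (A a v) - A a (Y \<xi>' v)) \<xi> = (if \<xi> = \<xi>' then 1 else 0)"
  if "\<xi> : Xi K" "\<xi>' : Xi K" for \<xi> \<xi>'
  using co_cong[where A = "%a v. Y \<xi>' (A a v) - A a (Y \<xi>' v)", OF Y(2) that(1)] co_bas[OF that] by simp
 with Y(1) show ?thesis by (intro exI[of _ Y]) simp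
qed

text \<open>The preimages \<open>Y\<close> are chosen once, at \<open>u0\<close>, and only their
  coefficients vary with \<open>u\<close>. Thus the system is the identity at \<open>u0\<close> and
  solvable continuously nearby. The last conclusion lets solutions start at zero where the
  right-hand side vanishes, as \<open>adsurj_unique\<close> requires.\<close>

lemma local_bracket_solve:
 fixes A A' R :: "'u::topological_space => nat * nat * nat => vec3 => vec3"
 assumes u0: "u0 : S"
  and A: "!!u. u : S ==> A u : rep" "!!a. a : Arr ==> opcont S (%u. A u a)"
  and A': "!!u. u : S ==> A' u : rep" "!!a. a : Arr ==> opcont S (%u. A' u a)"
  and R: "!!u. u : S ==> R u : rep" "!!a. a : Arr ==> opcont S (%u. R u a)"
  and A0: "adsurj K (A u0)" "A' u0 = A u0"
 obtains W y where "open W" "u0 : W" "opcont (W Int S) y" "!!u. u : W Int S ==> y u : gl"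
  "!!u a v. u : W Int S ==> a : Arr ==> v : Vin ==> tr K (y u (A u a v) - A' u a (y u v)) = tr K (R u a v)"
  "(!!a v. a : Arr ==> v : Vin ==> R u0 a v = 0) ==> y u0 = (%v. 0)"
proof -
 obtain Y where Y0: "\<forall>\<xi>. Y \<xi> : gl" "\<forall>\<xi>\<in>Xi K. \<forall>\<xi>'\<in>Xi K.
   co (%a v. Y \<xi>' (A u0 a v) - A u0 a (Y \<xi>' v)) \<xi> = (if \<xi> = \<xi>' then 1 else 0)"
  using adsurj_basis[OF A0(1)] by (elim exE conjE)
 note Y = Y0(1)[rule_format] Y0(2)[rule_format]
 define w where "w u \<xi> \<xi>' = co (%a v. Y \<xi>' (A u a v) - A' u a (Y \<xi>' v)) \<xi>" for u \<xi> \<xi>'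
 have br: "opcont S (%u v. Y \<xi> (A u a v) - A' u a (Y \<xi> v))" if a: "a : Arr" for a \<xi>
 proof -
  have "opcont S (%u v. Y \<xi> (A u a v))"
   by (rule opcont_comp[OF opcont_const _ A(2)[OF a]]) (use gl_dop[OF Y(1)] rep_dop[OF A(1) a] in auto)
  moreover have "opcont S (%u v. A' u a (Y \<xi> v))"
   by (rule opcont_comp[OF A'(2)[OF a] _ opcont_const]) (use gl_dop[OF Y(1)] rep_dop[OF A'(1) a] in auto)
  ultimately show ?thesis by (simp add: opcont_def conton_diff)
 qed
 obtain W \<gamma> where W: "open W" "u0 : W"
  and \<gamma>: "!!\<xi>. \<xi> : Xi K ==> continuous_on (W Int S) (%u. \<gamma> u \<xi>)"
   "!!u \<xi>. u : W Int S ==> \<xi> : Xi K ==> (\<Sum>\<xi>'\<in>Xi K. w u \<xi> \<xi>' * \<gamma> u \<xi>') = co (R u) \<xi>"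
   "!!\<xi>. \<xi> : Xi K ==> \<gamma> u0 \<xi> = co (R u0) \<xi>"
 proof (rule local_linear_solve[OF fin_Xi u0, where w = w and y = "%u. co (R u)"])
  show "continuous_on S (%u. w u \<xi> \<xi>')" if "\<xi> : Xi K" for \<xi> \<xi>'
   unfolding w_def by (rule co_continuous[OF br that])
  show "w u0 \<xi> \<xi>' = (if \<xi> = \<xi>' then 1 else 0)" if "\<xi> : Xi K" "\<xi>' : Xi K" for \<xi> \<xi>'
   unfolding w_def A0(2) by (rule Y(2)[OF that])
  show "continuous_on S (%u. co (R u) \<xi>)" if "\<xi> : Xi K" for \<xi>
   by (rule co_continuous[OF R(2) that])
 qed blast
 define y where "y u = comb (Xi K) Y (\<gamma> u)" for u
 show thesis
 proof (rule that[OF W, of y])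
  show "opcont (W Int S) y"
   unfolding y_def comb_def opcont_def by (intro ballI conton_sum conton_cs \<gamma>(1) conton_const)
  show "y u : gl" for u unfolding y_def by (rule comb_gl[OF Y(1)])
  show "tr K (y u (A u a v) - A' u a (y u v)) = tr K (R u a v)"
   if u: "u : W Int S" and "a : Arr" "v : Vin" for u a v
   unfolding y_def
   by (rule bracket_solves[OF A(1) A'(1) R(1) Y(1) _ that(2,3)]) (use u \<gamma>(2)[OF u] in \<open>auto simp: w_def\<close>)
  show "y u0 = (%v. 0)" if z: "!!a v. a : Arr ==> v : Vin ==> R u0 a v = 0"
  proof -
   have "\<gamma> u0 \<xi> = 0" if x: "\<xi> : Xi K" for \<xi>
    using \<gamma>(3)[OF x] co_cong[OF _ x, of "R u0" "%a v. 0"] z by (cases \<xi> rule: xi_cases) auto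
   thus ?thesis unfolding y_def comb_def by (intro ext) (auto simp: sum_fun_apply)
  qed
 qed
qed

definition isom :: "nat => (nat * nat * nat => vec3 => vec3) => (nat * nat * nat => vec3 => vec3) => bool" where
 "isom K A B \<longleftrightarrow> (EX g h. invm K g h & (ALL a:Arr. ALL v:Vin. tr K (g (A a v)) = tr K (B a (g v))))"

lemma isom_sym:
 assumes A: "A : rep" and B: "B : rep" and i: "isom K A B" shows "isom K B A"
proof -
 obtain g h where g: "invm K g h" "!!a v. a : Arr ==> v : Vin ==> tr K (g (A a v)) = tr K (B a (g v))"
  using i unfolding isom_def by blast
 note g' = invmD[OF g(1)]
 have "tr K (h (B a v)) = tr K (A a (h v))" if a: "a : Arr" and v: "v : Vin" for a v
 proof -
  note [simp] = glD(2)[OF g'(1)] glD(2)[OF g'(2)] rep_Vin[OF A a] rep_Vin[OF B a] v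
  have "tr K (h (B a v)) = tr K (h (B a (g (h v))))"
   by (intro gl_cong[OF g'(2)] rep_cong[OF B a] g'(3)[symmetric]) auto
  also have "... = tr K (h (g (A a (h v))))" by (intro gl_cong[OF g'(2)] g(2)[OF a, symmetric]) auto
  also have "... = tr K (A a (h v))" by (rule g'(4)) auto
  finally show ?thesis .
 qed
 thus ?thesis unfolding isom_def using invm_sym[OF g(1)] by blast
qed

lemma isom_trans:
 assumes A: "A : rep" and B: "B : rep" and C: "C : rep" and i: "isom K A B" "isom K B C" shows "isom K A C"
proof -
 obtain g h where g: "invm K g h" "!!a v. a : Arr ==> v : Vin ==> tr K (g (A a v)) = tr K (B a (g v))"
  using i(1) unfolding isom_def by blast
 obtain g1 h1 where g1: "invm K g1 h1" "!!a v. a : Arr ==> v : Vin ==> tr K (g1 (B a v)) = tr K (C a (g1 v))"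
  using i(2) unfolding isom_def by blast
 have "tr K (g1 (g (A a v))) = tr K (C a (g1 (g v)))" if a: "a : Arr" and v: "v : Vin" for a v
 proof -
  note [simp] = glD(2)[OF invmD(1)[OF g(1)]] rep_Vin[OF A a] rep_Vin[OF B a] v
  have "tr K (g1 (g (A a v))) = tr K (g1 (B a (g v)))" by (intro gl_cong[OF invmD(1)[OF g1(1)]] g(2)[OF a]) auto
  thus ?thesis using g1(2)[OF a, of "g v"] by simp
 qed
 thus ?thesis unfolding isom_def using invm_comp[OF g1(1) g(1)] by blast
qed

text \<open>On the complex line through \<open>A\<close> and \<open>B\<close> rigidity fails at
  finitely many points at most. The remaining points form a connected set on which the isomorphism
  class is locally constant.\<close>

theorem adsurj_unique:
 assumes A: "adsurj K A" and B: "adsurj K B"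
 shows "isom K A B"
proof -
 note A' = adsurj_rep[OF A] and B' = adsurj_rep[OF B]
 define L where "L z = (%a v. A a v + cs z (B a v - A a v))" for z
 have L: "L z : rep" for z unfolding L_def by (intro rep_add A' rep_cs rep_diff B')
 have L0: "L 0 = A" and L1: "L 1 = B" by (simp_all add: L_def fun_eq_iff)
 have Lc: "opcont S (%z. L z a)" for S a
  unfolding L_def opcont_def by (intro ballI conton_add conton_const conton_cs continuous_intros)
 define T where "T = {z. adsurj K (L z)}"
 obtain Y where Y0: "\<forall>\<xi>. Y \<xi> : gl" "\<forall>\<xi>\<in>Xi K. \<forall>\<xi>'\<in>Xi K.
   co (%a v. Y \<xi>' (A a v) - A a (Y \<xi>' v)) \<xi> = (if \<xi> = \<xi>' then 1 else 0)"
  using adsurj_basis[OF A] by (elim exE conjE)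
 note Y = Y0(1)[rule_format] Y0(2)[rule_format]
 define w where "w z \<xi> \<xi>' = co (%a v. Y \<xi>' (L z a v) - L z a (Y \<xi>' v)) \<xi>" for z \<xi> \<xi>'
 define w1 where "w1 \<xi> \<xi>' = co (%a v. Y \<xi>' (B a v - A a v) - (B a (Y \<xi>' v) - A a (Y \<xi>' v))) \<xi>" for \<xi> \<xi>'
 have w: "w z \<xi> \<xi>' = w 0 \<xi> \<xi>' + z * w1 \<xi> \<xi>'" for z \<xi> \<xi>'
  unfolding w_def w1_def
  by (cases \<xi> rule: xi_cases)
   (simp add: L_def lin_add[OF glD(1)[OF Y(1)]] lin_diff[OF glD(1)[OF Y(1)]] lin_scale[OF glD(1)[OF Y(1)]] algebra_simps)
 \<comment> \<open>Solvability within the span of the operators \<open>Y\<close> chosen at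
   \<open>A\<close> is guaranteed wherever one determinant is nonzero. This determinant is a
   polynomial in \<open>z\<close> with value 1 at \<open>z = 0\<close>.\<close>
 obtain P where P: "!!z. jdet (Xi K) (%\<xi> \<xi>'. w 0 \<xi> \<xi>' + z * w1 \<xi> \<xi>') = poly P z"
  using jdet_poly[OF fin_Xi, of K "w 0" w1] by blast
 have "jdet (Xi K) (w 0) = jdet (Xi K) (%\<xi> \<xi>'. if \<xi> = \<xi>' then 1 else 0)"
  by (rule jdet_cong[OF fin_Xi]) (simp add: w_def L0 Y(2))
 hence "poly P 0 = 1" using P[of 0] jdet_one[OF fin_Xi, of K] by simp
 hence "P ~= 0" by auto
 have solv: "adsurj K (L z)" if z: "poly P z ~= 0" for z
  unfolding adsurj_def
 proof (intro conjI ballI L)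
  fix R assume R: "R : rep"
  have nz: "jdet (Xi K) (w z) ~= 0"
  proof -
   have "w z = (%\<xi> \<xi>'. w 0 \<xi> \<xi>' + z * w1 \<xi> \<xi>')" by (intro ext) (rule w)
   thus ?thesis using P[of z] z by simp
  qed
  define \<gamma> where "\<gamma> \<xi> = (\<Sum>\<eta>\<in>Xi K. jadj (Xi K) (w z) \<xi> \<eta> * co R \<eta>) / jdet (Xi K) (w z)" for \<xi>
  have "(\<Sum>\<xi>'\<in>Xi K. w z \<xi> \<xi>' * \<gamma> \<xi>') = co R \<xi>" if x: "\<xi> : Xi K" for \<xi>
   unfolding \<gamma>_def by (rule jdet_solve[OF fin_Xi x nz])
  hence sol: "tr K (comb (Xi K) Y \<gamma> (L z a v) - L z a (comb (Xi K) Y \<gamma> v)) = tr K (R a v)"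
   if "a : Arr" "v : Vin" for a v
   by (intro bracket_solves[OF L L R Y(1) _ that]) (simp add: w_def)
  show "EX y:gl. ALL a:Arr. ALL v:Vin. tr K (y (L z a v) - L z a (y v)) = tr K (R a v)"
   by (intro bexI[of _ "comb (Xi K) Y \<gamma>"] ballI sol comb_gl[OF Y(1)])
 qed
 have "finite (- T)"
  by (rule finite_subset[OF _ poly_roots_finite[OF \<open>P ~= 0\<close>]]) (use solv in \<open>auto simp: T_def\<close>)
 hence "connected (- (- T))"
  by (intro path_connected_imp_connected path_connected_complement_countable)
   (auto intro: countable_finite)
 hence conn: "connected T" by simp
 have "isom K (L 0) (L 1)"
 proof (rule connected_equivalence_relation[OF conn, where R = "%z z'. isom K (L z) (L z')"])
  show "0 : T" "1 : T" using A B by (simp_all add: T_def L0 L1)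
  show "isom K (L z') (L z)" if "isom K (L z) (L z')" for z z' using isom_sym[OF L L that] .
  show "isom K (L z) (L z'')" if "isom K (L z) (L z')" "isom K (L z') (L z'')" for z z' z''
   using isom_trans[OF L L L that] .
  fix z0 assume z0: "z0 : T"
  obtain W y where W: "open W" "z0 : W" "opcont (W Int UNIV) y" "!!u. u : W Int UNIV ==> y u : gl"
   "!!u a v. u : W Int UNIV ==> a : Arr ==> v : Vin ==>
     tr K (y u (L z0 a v) - L u a (y u v)) = tr K (L z0 a v - L u a v)"
   "(!!a v. a : Arr ==> v : Vin ==> L z0 a v - L z0 a v = 0) ==> y z0 = (%v. 0)"
  proof (rule local_bracket_solve[where S = UNIV and A = "%_. L z0" and A' = L and R = "%u a v. L z0 a v - L u a v" and K = K and ?u0.0 = z0])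
   show "adsurj K (L z0)" using z0 by (simp add: T_def)
   show "opcont UNIV (%u v. L z0 a v - L u a v)" for a
    using Lc[of UNIV a] by (auto simp: opcont_def intro!: conton_diff conton_const)
  qed (use L Lc rep_diff opcont_const in auto)
  \<comment> \<open>Rearranged, the equation for \<open>y\<close> says that \<open>1 - y u\<close>
    intertwines \<open>L z0\<close> with \<open>L u\<close> modulo level \<open>K\<close>. At
    \<open>z0\<close> it is the identity, hence it is invertible nearby.\<close>
  define g where "g u v = v - y u v" for u v
  have gg: "g u : gl" if "u : W" for u unfolding g_def using gl_diff[OF gl_id W(4)] that by simp
  have gc: "opcont W g"
   using W(3) by (auto simp: opcont_def g_def intro!: conton_diff conton_const)
  have "y z0 = (%v. 0)" by (rule W(6)) simp
  hence "g z0 = (%v. v)" by (intro ext) (simp add: g_def)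
  hence g0: "invm K (g z0) (%v. v)" using invm_id by simp
  obtain W' h where W': "open W'" "z0 : W'" "!!u. u : W' Int W ==> invm K (g u) (h u)"
   "opcont (W' Int W) h"
  proof (rule gl_local_inverse[OF W(2) _ gc g0])
   show "g u : gl" if "u : W" for u using gg[OF that] .
  qed (rule that)
  have "isom K (L z0) (L u)" if u: "u : W' Int W" for u
   unfolding isom_def
  proof (intro exI conjI ballI)
   show "invm K (g u) (h u)" using W'(3)[OF u] .
   fix a v assume a: "a : Arr" and v: "v : Vin"
   show "tr K (g u (L z0 a v)) = tr K (L u a (g u v))"
    using W(5)[of u a v] u a v by (simp add: g_def lin_diff[OF rep_lin[OF L a]] tr_diff algebra_simps)
  qed
  thus "EX X. openin (top_of_set T) X & z0 : X & (ALL x:X. isom K (L z0) (L x))"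
   using W' W(1,2) z0 by (intro exI[of _ "T Int (W' Int W)"]) auto
 qed
 thus ?thesis by (simp add: L0 L1)
qed

end

section \<open>Flags as translates of a standard flag\<close>

locale flag_model = power_series_model +
 fixes l :: nat and \<rho> :: "nat => nat => nat"
 assumes m_sum: "i : {1..n} ==> m i = (SUM j = 1..l. \<rho> j i)"
begin

definition lev :: "nat => nat => nat" where
 "lev j i = (SUM j' = 1..j. \<rho> j' i)"

lemma lev_0 [simp]: "lev 0 i = 0"
 by (simp add: lev_def)

lemma lev_Suc: "lev (Suc j) i = lev j i + \<rho> (Suc j) i"
 by (simp add: lev_def)

lemma lev_l: "i : {1..n} ==> lev l i = m i"
 by (simp add: lev_def m_sum)

lemma lev_mono: "j <= j' ==> lev j i <= lev j' i"
 unfolding lev_def by (rule sum_mono2) auto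

text \<open>The projection onto step \<open>j\<close> of the standard flag, whose part at vertex
  \<open>i\<close> is free on the first \<open>lev j i\<close> basis vectors.\<close>

definition Qp :: "nat => vec3 => vec3" where
 "Qp j v = (%(i, q, a). if q < lev j i then v (i, q, a) else 0)"

lemma Qp_apply: "Qp j v (i, q, a) = (if q < lev j i then v (i, q, a) else 0)"
 by (simp add: Qp_def)

lemma Qp_gl: "Qp j : gl"
 unfolding gl_def
proof (intro CollectI conjI ballI)
 show "lin (Qp j)" by (rule linI; rule vec3_eqI) (auto simp: Qp_apply)
 fix v assume "v : Vin"
 thus "Qp j v : Vin" by (auto simp: Vin_def Qp_apply split: if_splits)
 show "Qp j (es i v) = es i (Qp j v)" for i by (rule vec3_eqI) (auto simp: ops_apply Qp_apply)
 show "Qp j (Es 1 v) = Es 1 (Qp j v)" by (rule vec3_eqI) (auto simp: ops_apply Qp_apply)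
qed

lemma Qp_tr: "Qp j (tr K v) = tr K (Qp j v)" and Qp_D: "Qp j (D k v) = D k (Qp j v)"
 by (rule vec3_eqI; auto simp: ops_apply Qp_apply)+

lemma Qp_Qp: "Qp j (Qp j' v) = Qp (min j j') v"
proof (rule vec3_eqI)
 fix i q a show "Qp j (Qp j' v) (i, q, a) = Qp (min j j') v (i, q, a)"
  using lev_mono[of j j' i] lev_mono[of j' j i] by (cases "j <= j'") (auto simp: Qp_apply min_def)
qed

lemma Qp_0 [simp]: "Qp 0 v = 0"
 by (rule vec3_eqI) (simp add: Qp_apply)

lemma Qp_l: "v : Vin ==> Qp l v = v"
proof (rule vec3_eqI)
 fix i q a assume v: "v : Vin"
 show "Qp l v (i, q, a) = v (i, q, a)"
 proof (cases "v (i, q, a) = 0")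
  case False
  hence "i : {1..n}" "q < m i" using v unfolding Vin_def by blast+
  thus ?thesis using lev_l[of i] by (simp add: Qp_apply)
 qed (simp add: Qp_apply)
qed

definition F :: "nat => nat => vec3 set" where
 "F K j = {v \<in> V K. Qp j v = v}"

definition FI :: "nat => nat => (nat * nat * nat) set" where
 "FI K j = {(i, q, a). (i, q, a) : I K & q < lev j i}"

lemma F_V: "v : F K j ==> v : V K" and F_Vin: "v : F K j ==> v : Vin"
 by (auto simp: F_def V_Vin)

lemma F_sub: "0 : F K j" "v : F K j ==> w : F K j ==> v + w : F K j" "v : F K j ==> cs z v : F K j"
 using glD(1)[OF Qp_gl] by (auto simp: F_def lin_add[of "Qp j"] lin_scale[of "Qp j"] lin_0[of "Qp j"])

lemma F_0: "F K 0 = {0}"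
 by (auto simp: F_def)

lemma F_l: "F K l = V K"
 by (auto simp: F_def V_Vin Qp_l)

lemma F_mono: "j <= j' ==> v : F K j ==> v : F K j'"
 unfolding F_def using Qp_Qp[of j' j v] by auto

lemma F_tr: "v : Vin ==> Qp j v = v ==> tr K v : F K j"
 by (simp add: F_def Qp_tr)

lemma F_Qp: "v : F K j ==> Qp j v = v"
 by (simp add: F_def)

lemma F_delta: "t : FI K j ==> delta t : F K j"
 by (cases t) (auto simp: F_def FI_def delta_V Qp_apply delta_apply intro!: vec3_eqI)

lemma F_support: "v : F K j ==> t \<notin> FI K j ==> v t = 0"
proof -
 assume v: "v : F K j" and t: "t \<notin> FI K j"
 obtain i q a where t': "t = (i, q, a)" by (cases t)
 show "v t = 0"
 proof (cases "t : I K")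
  case True
  hence "Qp j v t = 0" using t t' by (simp add: FI_def Qp_apply)
  thus ?thesis using F_Qp[OF v] by simp
 next
  case False
  thus ?thesis using F_V[OF v] unfolding V_def by blast
 qed
qed

lemma fin_FI: "finite (FI K j)"
 by (rule finite_subset[OF _ fin_I[of K]]) (auto simp: FI_def simp del: I_mem)

definition fl :: "nat => (vec3 => vec3) => nat => vec3 set" where
 "fl K g j = (%v. tr K (g v)) ` F K j"

text \<open>Freeness of all subquotients with the ranks \<open>\<rho> j\<close> is encoded by the
  existence of an invertible \<open>g\<close> that carries the standard flag to \<open>U\<close>;
  what remains is stability under the arrows. The agreement with the flags of locally free
  submodules is shown in \<open>Flf_set_image\<close> and \<open>Flf_set_preimage\<close>.\<close>

definition Z :: "nat => (nat * nat * nat => vec3 => vec3) => (nat => vec3 set) set" where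
 "Z K A = {U \<in> extensional {0..l}. (EX g h. invm K g h & (ALL j<=l. U j = fl K g j)) \<and>
   (ALL j<=l. ALL a:Arr. ALL x:U j. tr K (A a x) : U j)}"

definition Ops :: "(nat * nat * nat => vec3 => vec3) => (vec3 => vec3) set" where
 "Ops A = es ` {1..n} \<union> {Es 1} \<union> A ` Arr"

lemma Ops_dop: "A : rep ==> T : Ops A ==> dop T"
 by (auto simp: Ops_def dop_es dop_Es rep_dop)

lemma Z_flag:
 assumes "U : Z K A"
 obtains g h where "invm K g h" "!!j. j <= l ==> U j = fl K g j"
 using assms unfolding Z_def by blast

lemma Z_stable: "U : Z K A ==> j <= l ==> a : Arr ==> x : U j ==> tr K (A a x) : U j"
 unfolding Z_def by blast

lemma Z_ext: "U : Z K A ==> U : extensional {0..l}"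
 unfolding Z_def by blast

lemma fl_V: "x : fl K g j ==> x : V K"
 by (auto simp: fl_def)

lemma fl_sub:
 assumes g: "lin g"
 shows "0 : fl K g j" "x : fl K g j ==> y : fl K g j ==> x + y : fl K g j" "x : fl K g j ==> cs z x : fl K g j"
proof -
 have "0 = tr K (g 0)" by (simp add: lin_0[OF g])
 thus "0 : fl K g j" unfolding fl_def using F_sub(1) by (rule image_eqI)
 show "x + y : fl K g j" if xy: "x : fl K g j" "y : fl K g j"
 proof -
  obtain v w where v: "v : F K j" "x = tr K (g v)" and w: "w : F K j" "y = tr K (g w)"
   using xy unfolding fl_def by blast
  hence "x + y = tr K (g (v + w))" by (simp add: lin_add[OF g] tr_add)
  thus ?thesis unfolding fl_def using F_sub(2)[OF v(1) w(1)] by (rule image_eqI)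
 qed
 show "cs z x : fl K g j" if x: "x : fl K g j"
 proof -
  obtain v where v: "v : F K j" "x = tr K (g v)" using x by (auto simp: fl_def)
  hence "cs z x = tr K (g (cs z v))" by (simp add: lin_scale[OF g] lin_scale[OF lin_tr])
  thus ?thesis unfolding fl_def using F_sub(3)[OF v(1)] by (rule image_eqI)
 qed
qed

lemma Z_sub:
 assumes U: "U : Z K A" and j: "j <= l"
 shows "0 : U j" "x : U j ==> y : U j ==> x + y : U j" "x : U j ==> cs z x : U j"
  "x : U j ==> y : U j ==> x - y : U j" "x : U j ==> x : V K"
proof -
 obtain g h where g: "invm K g h" "U j = fl K g j" using Z_flag[OF U] j by metis
 note s = fl_sub[OF glD(1)[OF invmD(1)[OF g(1)]], where K = K and j = j]
 show "0 : U j" using s(1) g(2) by simp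
 show a: "x + y : U j" if "x : U j" "y : U j" for x y using s(2) that g(2) by simp
 show c: "cs z x : U j" if "x : U j" for z x using s(3) that g(2) by simp
 show "x - y : U j" if "x : U j" "y : U j" using a[OF that(1) c[OF that(2), of "-1"]] by simp
 show "x : V K" if "x : U j" using that g(2) fl_V by blast
qed

lemma fl_stable_gl:
 assumes g: "g : gl" and T: "T : gl" and c: "!!v. v : Vin ==> T (g v) = g (T v)" "!!v. Qp j (T v) = T (Qp j v)"
  and x: "x : fl K g j"
 shows "tr K (T x) : fl K g j"
proof -
 obtain v where v: "v : F K j" "x = tr K (g v)" using x by (auto simp: fl_def)
 note vV = F_Vin[OF v(1)]
 have "tr K (T x) = tr K (T (g v))" using dop_tr[OF gl_dop[OF T] glD(2)[OF g vV]] v(2) by simp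
 also have "... = tr K (g (tr K (T v)))" using c(1)[OF vV] dop_tr[OF gl_dop[OF g] glD(2)[OF T vV]] by simp
 finally show ?thesis unfolding fl_def
  using F_tr[OF glD(2)[OF T vV], of j K] c(2)[of v] F_Qp[OF v(1)] by auto
qed

lemma Es_gl: "Es s : gl"
 by (simp add: gl_def lin_Es es_commute Es_Es add.commute)

lemma es_gl: "es i : gl"
 by (auto simp: gl_def lin_es es_commute)

lemma Ops_stable:
 assumes U: "U : Z K A" and T: "T : Ops A" and j: "j <= l" and x: "x : U j"
 shows "tr K (T x) : U j"
proof -
 obtain g h where g: "invm K g h" "U j = fl K g j" using Z_flag[OF U] j by metis
 note g' = invmD(1)[OF g(1)]
 consider i where "i : {1..n}" "T = es i" | "T = Es 1" | a where "a : Arr" "T = A a"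
  using T unfolding Ops_def by blast
 thus ?thesis
 proof cases
  case (1 i)
  show ?thesis unfolding g(2) 1(2)
  proof (rule fl_stable_gl[OF g' es_gl _ _ x[unfolded g(2)]])
   show "es i (g v) = g (es i v)" if "v : Vin" for v using glD(3)[OF g' that 1(1)] by simp
   show "Qp j (es i v) = es i (Qp j v)" for v by (rule vec3_eqI) (auto simp: ops_apply Qp_apply)
  qed
 next
  case 2
  show ?thesis unfolding g(2) 2
  proof (rule fl_stable_gl[OF g' Es_gl _ _ x[unfolded g(2)]])
   show "Es 1 (g v) = g (Es 1 v)" if "v : Vin" for v using glD(4)[OF g' that] by simp
   show "Qp j (Es 1 v) = Es 1 (Qp j v)" for v by (rule vec3_eqI) (auto simp: ops_apply Qp_apply)
  qed
 next
  case 3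
  thus ?thesis using Z_stable[OF U j _ x] by simp
 qed
qed

lemma fl_tr: assumes g: "g : gl" and "k <= K" shows "tr k ` fl K g j = fl k g j"
proof (intro equalityI subsetI)
 fix x assume "x : tr k ` fl K g j"
 then obtain v where v: "v : F K j" "x = tr k (g v)" using assms by (auto simp: fl_def tr_tr)
 hence "x = tr k (g (tr k v))" using dop_tr[OF gl_dop[OF g] F_Vin[OF v(1)]] by simp
 thus "x : fl k g j" unfolding fl_def using F_tr[OF F_Vin[OF v(1)] F_Qp[OF v(1)]] by (rule image_eqI)
next
 fix x assume "x : fl k g j"
 then obtain v where v: "v : F k j" "x = tr k (g v)" by (auto simp: fl_def)
 hence "v : F K j" using V_mono[OF assms(2)] by (auto simp: F_def)
 moreover have "x = tr k (tr K (g v))" using v assms by (simp add: tr_tr)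
 ultimately show "x : tr k ` fl K g j" unfolding fl_def by blast
qed

section \<open>Reduction of flags and their lifts through linear sections\<close>

definition kap :: "nat => vec3 => vec3" where
 "kap k y = tr (Suc k) (D k y)"

definition rest :: "nat => (nat => vec3 set) => nat => vec3 set" where
 "rest k U = (\<lambda>j\<in>{0..l}. tr k ` U j)"

text \<open>A lift of \<open>U\<close> contains preimages \<open>h x\<close> of the elements of
  \<open>U j\<close>, and by \<open>purity\<close> its elements with zero reduction are exactly the
  \<open>kap k y\<close> with \<open>y\<close> in \<open>U j\<close>. So a lift is determined by any
  section with values in it.\<close>

definition Phi :: "nat => (nat => vec3 set) => (vec3 => vec3) => nat => vec3 set" where
 "Phi k U h = (\<lambda>j\<in>{0..l}. {h x + kap k y | x y. x : U j & y : U j})"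

definition sect :: "nat => (vec3 => vec3) set" where
 "sect k = {h. lin h & (ALL v:V k. h v : V (Suc k) & tr k (h v) = v)}"

text \<open>\<open>Sel k A U\<close> is the affine space of linear sections \<open>h\<close> for which \<open>Phi k U h\<close> is a submodule flag
 lifting \<open>U\<close>; \<open>Sel' k U'\<close> consists of the sections yielding the given lift \<open>U'\<close>.\<close>

definition Sel :: "nat => (nat * nat * nat => vec3 => vec3) => (nat => vec3 set) => (vec3 => vec3) set" where
 "Sel k A U = {h \<in> sect k. ALL T:Ops A. ALL j<=l. ALL x:U j.
   tr (Suc k) (T (h x)) - h (tr k (T x)) : kap k ` U j}"

definition Sel' :: "nat => (nat => vec3 set) => (vec3 => vec3) set" where
 "Sel' k U = {h \<in> sect k. ALL j<=l. ALL x:U j. h (tr k x) : U j}"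

lemma lin_kap: "lin (kap k)"
 unfolding kap_def by (rule lin_comp[OF lin_tr lin_D])

lemma sectD:
 assumes "h : sect k" shows "lin h" "v : V k ==> h v : V (Suc k)" "v : V k ==> tr k (h v) = v"
 using assms by (auto simp: sect_def)

lemma tr_kap [simp]: "tr k (kap k y) = 0"
 by (simp add: kap_def tr_tr tr_D_zero)

lemma kap_V [simp]: "kap k y : V (Suc k)"
 by (simp add: kap_def)

lemma kap_cong: "0 < k ==> tr k v = tr k w ==> kap k v = kap k w"
 unfolding kap_def by (rule tr_D_cong, rule tr_eq_mono[of _ k]) auto

lemma rest_Z:
 assumes A: "A : rep" and U: "U : Z (Suc k) A"
 shows "rest k U : Z k A"
proof -
 obtain g h where g: "invm (Suc k) g h" "!!j. j <= l ==> U j = fl (Suc k) g j" using Z_flag[OF U] by metis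
 have "rest k U j = fl k g j" if "j <= l" for j
  using fl_tr[OF invmD(1)[OF g(1)], of k "Suc k" j] g(2)[OF that] that by (simp add: rest_def)
 moreover have "tr k (A a x) : rest k U j" if j: "j <= l" and a: "a : Arr" and x: "x : rest k U j" for j a x
 proof -
  obtain y where y: "y : U j" "x = tr k y" using x j by (auto simp: rest_def)
  have yV: "y : Vin" using Z_sub(5)[OF U j y(1)] V_Vin by blast
  have "tr k (A a x) = tr k (tr (Suc k) (A a y))"
   using dop_tr[OF rep_dop[OF A a] yV] y(2) by (simp add: tr_tr)
  thus ?thesis using Z_stable[OF U j a y(1)] j by (simp add: rest_def)
 qed
 moreover have "invm k g h" using invm_mono[OF _ g(1), of k] by simp
 moreover have "rest k U : extensional {0..l}" by (simp add: rest_def)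
 ultimately show ?thesis unfolding Z_def by blast
qed

text \<open>In the standard flag an element divisible by \<open>D k\<close> is \<open>D k\<close>
  times an element of the same step, because \<open>Qp\<close> commutes with the injective
  \<open>D k\<close>. The invertible \<open>g\<close> carries this property to
  \<open>U\<close>.\<close>

lemma purity:
 assumes k: "0 < k" and U: "U : Z (Suc k) A" and j: "j <= l" and x: "x : U j" "tr k x = 0"
 shows "x : kap k ` rest k U j"
proof -
 obtain g h where g: "invm (Suc k) g h" "U j = fl (Suc k) g j" using Z_flag[OF U] j by metis
 note g' = invmD[OF g(1)] and gk = invmD[OF invm_mono[OF _ g(1), of k, simplified]]
 obtain w where w: "w : F (Suc k) j" "x = tr (Suc k) (g w)" using x(1) g(2) by (auto simp: fl_def)
 have wV: "w : Vin" using F_Vin[OF w(1)] .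
 have "tr k (g w) = tr k (g 0)" using x(2) w(2) by (simp add: tr_tr lin_0[OF glD(1)[OF g'(1)]])
 hence "tr k (h (g w)) = tr k (h (g 0))" using gl_cong[OF g'(2)] glD(2)[OF g'(1)] wV by simp
 hence w0: "tr k w = 0" using gk(4)[OF wV] gk(4)[of 0] by simp
 define w1 where "w1 = Dinv k w"
 have w1: "D k w1 = w" "w1 : Vin" using D_Dinv[OF wV w0] wV by (simp_all add: w1_def)
 have "Qp j w1 = w1" by (rule D_inj[of k]) (simp add: Qp_D[symmetric] w1 F_Qp[OF w(1)])
 hence F1: "tr (Suc k) w1 : F (Suc k) j" using F_tr w1(2) by blast
 have "g w = D k (g w1)" using gl_D_commute[OF g'(1) w1(2), of k] by (simp only: w1(1))
 hence "x = tr (Suc k) (D k (g w1))" using w(2) by simp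
 also have "... = kap k (tr k (g (tr (Suc k) w1)))"
 proof -
  have "tr k (g w1) = tr k (g (tr (Suc k) w1))" using gl_cong[OF g'(1) w1(2), of "tr (Suc k) w1" k] by (simp add: tr_tr)
  thus ?thesis using kap_cong[OF k, of "g w1" "tr k (g (tr (Suc k) w1))"] by (simp add: kap_def)
 qed
 finally have "x = kap k (tr k (tr (Suc k) (g (tr (Suc k) w1))))" by (simp add: tr_tr)
 moreover have "tr k (tr (Suc k) (g (tr (Suc k) w1))) : rest k U j"
  using F1 g(2) j by (auto simp: rest_def fl_def)
 ultimately show ?thesis by (rule image_eqI)
qed

text \<open>If \<open>h\<close> takes values in \<open>U\<close>, both terms of the defect lie in
  \<open>U j\<close> and have the same reduction, so \<open>purity\<close> places their difference
  in the image of \<open>kap k\<close>. For the second claim, \<open>x\<close> and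
  \<open>h (tr k x)\<close> are compared in the same way.\<close>

lemma Sel'_Sel:
 assumes A: "A : rep" and k: "0 < k" and U: "U : Z (Suc k) A" and h: "h : Sel' k U"
 shows "h : Sel k A (rest k U)" "Phi k (rest k U) h = U"
proof -
 have hs: "h : sect k" and hU: "!!j x. j <= l ==> x : U j ==> h (tr k x) : U j" using h by (auto simp: Sel'_def)
 note h' = sectD[OF hs]
 show "h : Sel k A (rest k U)"
  unfolding Sel_def
 proof (intro CollectI conjI hs ballI allI impI)
  fix T j x assume T: "T : Ops A" and j: "j <= l" and x: "x : rest k U j"
  note Td = Ops_dop[OF A T]
  obtain x' where x': "x' : U j" "x = tr k x'" using x j by (auto simp: rest_def)
  have xV: "x : V k" using x'(2) by simp
  have hx: "h x : U j" using hU[OF j x'(1)] x'(2) by simp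
  have hxV: "h x : Vin" using V_Vin[OF h'(2)[OF xV]] .
  have 1: "tr (Suc k) (T (h x)) : U j" using Ops_stable[OF U T j hx] .
  have e: "tr k (T (h x)) = tr k (T x)"
   using dop_cong[OF Td hxV V_Vin[OF xV], of k] h'(3)[OF xV] xV by (simp add: tr_id)
  hence "tr k (T x) = tr k (tr (Suc k) (T (h x)))" by (simp add: tr_tr)
  hence 2: "h (tr k (T x)) : U j" using hU[OF j 1] by simp
  show "tr (Suc k) (T (h x)) - h (tr k (T x)) : kap k ` rest k U j"
  proof (rule purity[OF k U j Z_sub(4)[OF U j 1 2]])
   show "tr k (tr (Suc k) (T (h x)) - h (tr k (T x))) = 0"
    unfolding tr_diff using e h'(3)[OF tr_V] by (simp add: tr_tr)
  qed
 qed
 show "Phi k (rest k U) h = U"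
 proof (rule extensionalityI[of _ "{0..l}"])
  fix j assume "j : {0..l}"
  hence j: "j <= l" by simp
  have kp: "kap k y : U j" if y: "y : rest k U j" for y
  proof -
   obtain y' where y': "y' : U j" "y = tr k y'" using y j by (auto simp: rest_def)
   obtain g h where g: "invm (Suc k) g h" "U j = fl (Suc k) g j" using Z_flag[OF U] j by metis
   note g' = invmD(1)[OF g(1)]
   obtain w where w: "w : F (Suc k) j" "y' = tr (Suc k) (g w)" using y' g(2) by (auto simp: fl_def)
   have wV: "w : Vin" using F_Vin[OF w(1)] .
   have "kap k y = tr (Suc k) (D k (g w))" using y' w(2) kap_cong[OF k, of y "g w"] by (simp add: tr_tr kap_def)
   also have "... = tr (Suc k) (g (tr (Suc k) (D k w)))"
    using gl_D_commute[OF g' wV] dop_tr[OF gl_dop[OF g'], of "D k w"] wV by simp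
   finally show ?thesis unfolding g(2) fl_def
    using F_tr[of "D k w" j "Suc k"] wV F_Qp[OF w(1)] by (simp add: Qp_D)
  qed
  show "Phi k (rest k U) h j = U j"
  proof (intro equalityI subsetI)
   fix x assume "x : Phi k (rest k U) h j"
   then obtain x1 y where x1: "x1 : rest k U j" "y : rest k U j" "x = h x1 + kap k y" using j by (auto simp: Phi_def)
   hence "h x1 : U j" using hU[OF j] j by (auto simp: rest_def)
   thus "x : U j" using Z_sub(2)[OF U j] kp x1 by simp
  next
   fix x assume x: "x : U j"
   have xr: "tr k x : rest k U j" using x j by (simp add: rest_def)
   have "x - h (tr k x) : kap k ` rest k U j"
   proof (rule purity[OF k U j Z_sub(4)[OF U j x hU[OF j x]]])
    show "tr k (x - h (tr k x)) = 0" unfolding tr_diff using h'(3)[OF tr_V] by simp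
   qed
   then obtain y where "y : rest k U j" "x - h (tr k x) = kap k y" by blast
   hence "x = h (tr k x) + kap k y" by (simp add: algebra_simps)
   thus "x : Phi k (rest k U) h j" using \<open>y : _\<close> xr j by (auto simp: Phi_def)
  qed
 qed (simp_all add: Phi_def Z_ext[OF U])
qed

text \<open>The frame of the lifted flag: the section moves the truncated images of the basis
  vectors under \<open>g\<close> to the next level, and \<open>gen\<close> extends them compatibly
  with \<open>Es\<close>.\<close>

definition lift_gl :: "nat => (vec3 => vec3) => (vec3 => vec3) => vec3 => vec3" where
 "lift_gl k g h = gen (%i q. h (tr k (g (delta (i, q, 0)))))"

text \<open>The operator \<open>lift_gl k g h\<close> agrees with \<open>g\<close> modulo level
  \<open>k\<close>, so a Newton step makes it invertible modulo level \<open>Suc k\<close>. The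
  condition in \<open>Sel\<close> makes \<open>Phi k U h\<close> stable under the generators in
  \<open>Ops A\<close>; stability under the idempotents and \<open>Es 1\<close> is what allows to
  identify it with the translate of the standard flag.\<close>

lemma Phi_Z:
 assumes A: "A : rep" and k: "0 < k" and U: "U : Z k A" and h: "h : Sel k A U"
  and g: "invm k g g1" "!!j. j <= l ==> U j = fl k g j"
 shows "EX g'. invm (Suc k) (lift_gl k g h) g'" "j <= l ==> Phi k U h j = fl (Suc k) (lift_gl k g h) j"
  "Phi k U h : Z (Suc k) A" "rest k (Phi k U h) = U"
proof -
 have hs: "h : sect k" and hT: "!!T j x. T : Ops A ==> j <= l ==> x : U j ==>
   tr (Suc k) (T (h x)) - h (tr k (T x)) : kap k ` U j" using h by (auto simp: Sel_def)
 note h' = sectD[OF hs] and g' = invmD[OF g(1)]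
 let ?G = "lift_gl k g h"
 have GG: "?G : gl" by (simp add: lift_gl_def gen_gl)
 have eqk: "tr k (?G v) = tr k (g v)" if v: "v : Vin" for v
 proof (rule gl_eqI[OF GG g'(1) _ v])
  fix i q assume iq: "i : {1..n}" "q < m i"
  have "tr k (?G (delta (i, q, 0))) = es i (tr k (h (tr k (g (delta (i, q, 0))))))"
   using gen_delta[OF iq] by (simp add: lift_gl_def es_commute)
  also have "... = tr k (es i (g (delta (i, q, 0))))" by (simp add: h'(3) es_commute)
  also have "... = tr k (g (delta (i, q, 0)))"
   using glD(3)[OF g'(1) delta_Vin[OF iq, of 0] iq(1)] by (simp add: es_delta iq)
  finally show "tr k (?G (delta (i, q, 0))) = tr k (g (delta (i, q, 0)))" .
 qed
 have invk: "invm k ?G g1"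
  unfolding invm_def
 proof (intro conjI ballI GG g'(2))
  fix v assume v: "v : Vin"
  show "tr k (?G (g1 v)) = tr k v" using eqk[OF glD(2)[OF g'(2) v]] g'(3)[OF v] by simp
  have "tr k (g1 (?G v)) = tr k (g1 (g v))"
   by (rule gl_cong[OF g'(2) glD(2)[OF GG v] glD(2)[OF g'(1) v] eqk[OF v]])
  thus "tr k (g1 (?G v)) = tr k v" using g'(4)[OF v] by simp
 qed
 note inv = invm_lift[OF invk k]
 thus "EX g'. invm (Suc k) ?G g'" by blast
 have Uj: "j <= l ==> U j = fl k ?G j" for j
 proof -
  assume j: "j <= l"
  have "fl k g j = fl k ?G j" unfolding fl_def using eqk F_Vin by (intro image_cong) auto
  thus ?thesis using g(2)[OF j] by simp
 qed
 let ?P = "Phi k U h"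
 have Pj: "?P j = {h x + kap k y | x y. x : U j & y : U j}" if "j <= l" for j using that by (simp add: Phi_def)
 have P_add: "x + y : ?P j" if j: "j <= l" and xy: "x : ?P j" "y : ?P j" for x y j
 proof -
  obtain x1 x2 y1 y2 where x: "x = h x1 + kap k x2" "y = h y1 + kap k y2" "x1 : U j" "x2 : U j" "y1 : U j" "y2 : U j"
   using xy Pj[OF j] by auto
  hence "x + y = h (x1 + y1) + kap k (x2 + y2)" by (simp add: lin_add[OF h'(1)] lin_add[OF lin_kap])
  thus ?thesis using x Z_sub(2)[OF U j] Pj[OF j] by blast
 qed
 have P_cs: "cs z x : ?P j" if j: "j <= l" and x: "x : ?P j" for x z j
 proof -
  obtain x1 x2 where x: "x = h x1 + kap k x2" "x1 : U j" "x2 : U j" using x Pj[OF j] by auto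
  hence "cs z x = h (cs z x1) + kap k (cs z x2)" by (simp add: lin_scale[OF h'(1)] lin_scale[OF lin_kap] cs_add)
  thus ?thesis using x Z_sub(3)[OF U j] Pj[OF j] by blast
 qed
 have P_0: "0 : ?P j" if j: "j <= l" for j
 proof -
  have "0 = h 0 + kap k 0" by (simp add: lin_0[OF h'(1)] lin_0[OF lin_kap])
  thus ?thesis using Z_sub(1)[OF U j] Pj[OF j] by blast
 qed
 have P_sum: "(SUM x:X. f x) : ?P j" if "j <= l" "!!x. x : X ==> f x : ?P j" for X :: "(nat * nat * nat) set" and f j
  using that(2) by (induction X rule: infinite_finite_induct) (auto intro: P_0 P_add that(1))
 have P_V: "x : V (Suc k)" if j: "j <= l" and x: "x : ?P j" for x j
  using x Pj[OF j] h'(2) Z_sub(5)[OF U j] by auto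
 have kap_P: "kap k y : ?P j" if j: "j <= l" and y: "y : U j" for y j
 proof -
  have "kap k y = h 0 + kap k y" by (simp add: lin_0[OF h'(1)])
  thus ?thesis using y Z_sub(1)[OF U j] Pj[OF j] by blast
 qed
 \<comment> \<open>On the part \<open>h x1\<close> the defect allowed in \<open>Sel\<close> is again
   of the form \<open>kap k y\<close>; on the part \<open>kap k x2\<close> the operator commutes
   with \<open>D k\<close>.\<close>
 have P_stab: "tr (Suc k) (T x) : ?P j" if T: "T : Ops A" and j: "j <= l" and x: "x : ?P j" for T x j
 proof -
  note Td = Ops_dop[OF A T]
  obtain x1 x2 where x1: "x = h x1 + kap k x2" "x1 : U j" "x2 : U j" using x Pj[OF j] by auto
  have x2V: "x2 : Vin" using V_Vin[OF Z_sub(5)[OF U j x1(3)]] .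
  have a: "tr (Suc k) (T (h x1)) : ?P j"
  proof -
   obtain y where y: "y : U j" "tr (Suc k) (T (h x1)) - h (tr k (T x1)) = kap k y" using hT[OF T j x1(2)] by blast
   hence "tr (Suc k) (T (h x1)) = h (tr k (T x1)) + kap k y" by (simp add: algebra_simps)
   thus ?thesis using y(1) Ops_stable[OF U T j x1(2)] Pj[OF j] by blast
  qed
  have "tr (Suc k) (T (kap k x2)) = tr (Suc k) (D k (T x2))"
   using dop_tr[OF Td, of "D k x2" "Suc k"] dopD(3)[OF Td x2V] x2V by (simp add: kap_def)
  also have "... = kap k (tr k (T x2))" using kap_cong[OF k, of "T x2" "tr k (T x2)"] by (simp add: kap_def)
  finally have b: "tr (Suc k) (T (kap k x2)) : ?P j" using kap_P[OF j Ops_stable[OF U T j x1(3)]] by simp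
  show ?thesis using P_add[OF j a b] x1(1) by (simp add: lin_add[OF dopD(1)[OF Td]] tr_add)
 qed
 have es_O: "i : {1..n} ==> es i : Ops A" and Es_O: "Es 1 : Ops A" for i by (auto simp: Ops_def)
 show PF: "?P j = fl (Suc k) ?G j" if j: "j <= l" for j
 proof (intro equalityI subsetI)
  \<comment> \<open>The exponent 0 is settled by the section and the idempotent at \<open>i\<close>,
    higher exponents by repeated application of \<open>Es 1\<close>.\<close>
  have dP: "tr (Suc k) (?G (delta t)) : ?P j" if t: "t : FI (Suc k) j" for t
  proof -
   obtain i q a where t': "t = (i, q, a)" "i : {1..n}" "q < m i" "q < lev j i" using t by (cases t) (auto simp: FI_def)
   let ?d = "delta (i, q, 0)"
   have "tr k (g ?d) : U j"
   proof -
    have "tr k ?d : F k j" by (rule F_tr[OF delta_Vin[OF t'(2,3)]], rule vec3_eqI) (use t' in \<open>auto simp: Qp_apply delta_apply\<close>)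
    hence "tr k (g (tr k ?d)) : U j" using g(2)[OF j] by (auto simp: fl_def)
    thus ?thesis using dop_tr[OF gl_dop[OF g'(1)] delta_Vin[OF t'(2,3)]] by simp
   qed
   hence "h (tr k (g ?d)) : ?P j" using Pj[OF j] Z_sub(1)[OF U j] lin_0[OF lin_kap] by force
   hence "tr (Suc k) (es i (h (tr k (g ?d)))) : ?P j" using P_stab[OF es_O[OF t'(2)] j] by blast
   hence s0: "tr (Suc k) (?G ?d) : ?P j" using gen_delta[OF t'(2,3)] by (simp add: lift_gl_def)
   have "tr (Suc k) (?G (delta (i, q, a))) : ?P j" for a
   proof (induction a)
    case (Suc a)
    have dV: "delta (i, q, a) : Vin" using delta_Vin[OF t'(2,3)] .
    have "tr (Suc k) (?G (delta (i, q, Suc a))) = tr (Suc k) (?G (Es 1 (delta (i, q, a))))" by (simp add: Es_delta)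
    also have "... = tr (Suc k) (Es 1 (?G (delta (i, q, a))))" using glD(4)[OF GG dV] by simp
    also have "... = tr (Suc k) (Es 1 (tr (Suc k) (?G (delta (i, q, a)))))" using dop_tr[OF dop_Es glD(2)[OF GG dV]] by simp
    finally show ?case using P_stab[OF Es_O j Suc] by simp
   qed (rule s0)
   thus ?thesis using t' by simp
  qed
  show "x : ?P j" if x: "x : fl (Suc k) ?G j" for x
  proof -
   obtain v where v: "v : F (Suc k) j" "x = tr (Suc k) (?G v)" using x by (auto simp: fl_def)
   have "x = (SUM t:FI (Suc k) j. cs (v t) (tr (Suc k) (?G (delta t))))"
    using lin_expand[OF fin_FI F_support[OF v(1)] lin_comp[OF lin_tr glD(1)[OF GG]]] v(2) by simp
   thus ?thesis using P_sum[OF j] P_cs[OF j dP] by simp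
  qed
  \<comment> \<open>For the other inclusion \<open>x\<close> is compared with an element
    \<open>?x\<close> of the translate that has the same reduction. Both lie in \<open>Phi\<close>,
    so they differ by some \<open>kap k y\<close> with \<open>y\<close> in \<open>U j\<close>, which
    belongs to the translate as well.\<close>
  fix x assume x: "x : ?P j"
  then obtain x1 x2 where x1: "x = h x1 + kap k x2" "x1 : U j" "x2 : U j" using Pj[OF j] by auto
  have x1V: "x1 : V k" using Z_sub(5)[OF U j x1(2)] .
  obtain w where w: "w : F k j" "x1 = tr k (?G w)" using x1(2) Uj[OF j] by (auto simp: fl_def)
  have wS: "w : F (Suc k) j" using w(1) V_mono[of k "Suc k"] by (auto simp: F_def)
  have sub: "fl (Suc k) ?G j \<subseteq> ?P j" using \<open>!!x. x : fl (Suc k) ?G j ==> x : ?P j\<close> by blast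
  let ?x = "tr (Suc k) (?G w)"
  have xf: "?x : fl (Suc k) ?G j" using wS by (auto simp: fl_def)
  obtain z1 z2 where z: "?x = h z1 + kap k z2" "z1 : U j" "z2 : U j" using xf sub Pj[OF j] by blast
  have "tr k ?x = z1" using z h'(3) Z_sub(5)[OF U j z(2)] by (simp add: tr_add)
  hence z1: "z1 = x1" using w(2) by (simp add: tr_tr)
  have "x = ?x + kap k (x2 - z2)" using x1(1) z(1) z1 by (simp add: lin_diff[OF lin_kap])
  moreover have "kap k (x2 - z2) : fl (Suc k) ?G j"
  proof -
   obtain w' where w': "w' : F k j" "x2 - z2 = tr k (?G w')" using Z_sub(4)[OF U j x1(3) z(3)] Uj[OF j] by (auto simp: fl_def)
   have w'V: "w' : Vin" using F_Vin[OF w'(1)] .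
   have "kap k (x2 - z2) = tr (Suc k) (D k (?G w'))" using w'(2) kap_cong[OF k, of "tr k (?G w')" "?G w'"] by (simp add: kap_def)
   also have "... = tr (Suc k) (?G (tr (Suc k) (D k w')))"
    using gl_D_commute[OF GG w'V] dop_tr[OF gl_dop[OF GG], of "D k w'"] w'V by simp
   finally show ?thesis unfolding fl_def
    using F_tr[of "D k w'" j "Suc k"] w'V F_Qp[OF w'(1)] by (simp add: Qp_D)
  qed
  ultimately show "x : fl (Suc k) ?G j" using fl_sub(2)[OF glD(1)[OF GG] xf] by simp
 qed
 have ext: "?P : extensional {0..l}" by (simp add: Phi_def)
 show "?P : Z (Suc k) A"
  unfolding Z_def
 proof (intro CollectI conjI ext allI impI ballI)
  show "EX g h'. invm (Suc k) g h' & (ALL j<=l. ?P j = fl (Suc k) g j)" using inv PF by blast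
  show "tr (Suc k) (A a x) : ?P j" if "j <= l" "a : Arr" "x : ?P j" for j a x
   by (rule P_stab[OF _ that(1,3)]) (use that in \<open>auto simp: Ops_def\<close>)
 qed
 show "rest k ?P = U"
 proof (rule extensionalityI[of _ "{0..l}"])
  fix j assume "j : {0..l}"
  hence j: "j <= l" by simp
  show "rest k ?P j = U j"
   using fl_tr[OF GG, of k "Suc k" j] PF[OF j] Uj[OF j] j by (simp add: rest_def)
 qed (simp_all add: rest_def Z_ext[OF U])
qed

end

section \<open>Global continuous selections\<close>

lemma continuous_on_local:
 fixes f :: "'a::t2_space => 'b::topological_space"
 assumes "!!x. x : B ==> EX A. open A & x : A & continuous_on (A Int B) f"
 shows "continuous_on B f"
 unfolding continuous_on_eq_continuous_within
proof
 fix x assume x: "x : B"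
 obtain A where A: "open A" "x : A" "continuous_on (A Int B) f" using assms[OF x] by blast
 have "continuous (at x within (A Int B)) f"
  using A x by (simp add: continuous_on_eq_continuous_within)
 moreover have "at x within (A Int B) = at x within B"
  by (rule at_within_nhd[OF A(2,1)]) auto
 ultimately show "continuous (at x within B) f" by simp
qed

text \<open>A convex-valued map with local continuous selections has a global one, by a partition of unity.
 The patches are shrunk to closed balls because a local selection may be unbounded near the boundary
 of its domain.\<close>

lemma continuous_selection:
 fixes B :: "'u::{metric_space, second_countable_topology} set" and S :: "'u => ('a => 'b => complex) set"
 assumes loc: "!!u0. u0 : B ==> EX W s. open W & u0 : W & (ALL u:W Int B. s u : S u) \<and>
   (ALL a:X. ALL t. continuous_on (W Int B) (%u. s u a t))"
  and conv: "!!u (Y :: 'u set set) w h. [|u : B; finite Y; !!y. y : Y ==> h y : S u; (SUM y:Y. w y) = (1::real)|] ==>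
   (%a t. SUM y:Y. of_real (w y) * h y a t) : S u"
 shows "EX s. (ALL u:B. s u : S u) & (ALL a:X. ALL t. continuous_on B (%u. s u a t))"
proof -
 obtain W \<sigma> where W: "!!u0. u0 : B ==> open (W u0) & u0 : W u0"
  and \<sigma>: "!!u0 u. u0 : B ==> u : W u0 Int B ==> \<sigma> u0 u : S u"
  and \<sigma>c: "!!u0 a t. u0 : B ==> a : X ==> continuous_on (W u0 Int B) (%u. \<sigma> u0 u a t)"
 proof -
  have "ALL u0. EX Ws. u0 : B --> open (fst Ws) & u0 : fst Ws & (ALL u:fst Ws Int B. snd Ws u : S u) \<and>
   (ALL a:X. ALL t. continuous_on (fst Ws Int B) (%u. snd Ws u a t))"
  proof
   fix u0 show "EX Ws. u0 : B --> open (fst Ws) & u0 : fst Ws & (ALL u:fst Ws Int B. snd Ws u : S u) \<and>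
    (ALL a:X. ALL t. continuous_on (fst Ws Int B) (%u. snd Ws u a t))"
   proof (cases "u0 : B")
    case True
    from loc[OF this] obtain V s where "open V & u0 : V & (ALL u:V Int B. s u : S u) \<and>
      (ALL a:X. ALL t. continuous_on (V Int B) (%u. s u a t))" by (elim exE)
    thus ?thesis by (intro exI[of _ "(V, s)"]) simp
   qed simp
  qed
  then obtain Ws where Ws: "ALL u0. u0 : B --> open (fst (Ws u0)) & u0 : fst (Ws u0) & (ALL u:fst (Ws u0) Int B. snd (Ws u0) u : S u) \<and>
   (ALL a:X. ALL t. continuous_on (fst (Ws u0) Int B) (%u. snd (Ws u0) u a t))"
   by (rule choice[THEN exE])
  show thesis by (rule that[of "%u. fst (Ws u)" "%u. snd (Ws u)"]) (use Ws in auto)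
 qed
 have "\<exists>e>0. cball u e \<subseteq> W u" if "u : B" for u using W[OF that] open_contains_cball by blast
 then obtain e where e: "!!u. u : B ==> 0 < e u & cball u (e u) \<subseteq> W u" by metis
 have "B \<subseteq> \<Union> ((%u. ball u (e u)) ` B)" using e by force
 then obtain \<C> where C: "B \<subseteq> \<Union>\<C>" "!!U. U : \<C> ==> open U & (EX T:(%u. ball u (e u)) ` B. U \<subseteq> T)"
  "!!x. x : B ==> EX V. open V & x : V & finite {U. U : \<C> & (U Int V ~= {})}"
  by (rule paracompact[where S = B]) (auto simp: Bex_def)
 obtain F where F: "!!U. U : \<C> ==> continuous_on B (F U) & (ALL x:B. 0 <= F U x)"
   "!!x U. [|U : \<C>; x : B; x \<notin> U|] ==> F U x = (0::real)"
   "!!x. x : B ==> supp_sum (%W. F W x) \<C> = 1"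
   "!!x. x : B ==> EX V. open V & x : V & finite {U \<in> \<C>. EX x:V. F U x ~= 0}"
 proof (rule subordinate_partition_of_unity[OF C(1)])
  show "open T" if "T : \<C>" for T using C(2)[OF that] by simp
  show "EX V. open V & x : V & finite {U \<in> \<C>. U Int V ~= {}}" if "x : B" for x using C(3)[OF that] by simp
 qed (rule that)
 have "ALL U:\<C>. EX u. u : B & U \<subseteq> ball u (e u)" using C(2) by blast
 then obtain z where z: "!!U. U : \<C> ==> z U : B & U \<subseteq> ball (z U) (e (z U))" by metis
 have clU: "closure U \<subseteq> W (z U)" if "U : \<C>" for U
 proof -
  have "closure U \<subseteq> cball (z U) (e (z U))" by (rule closure_minimal) (use z[OF that] in auto)
  thus ?thesis using e z[OF that] by blast
 qed
 define G where "G U u a t = of_real (F U u) * \<sigma> (z U) u a t" for U u a t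
 \<comment> \<open>At a point of the domain \<open>W (z U)\<close> both factors are continuous. Any
   other point has the complement of the closure of \<open>U\<close> as a neighbourhood, where the
   weight and hence the product are zero.\<close>
 have Gc: "continuous_on B (%u. G U u a t)" if U: "U : \<C>" and a: "a : X" for U a t
 proof (rule continuous_on_local)
  fix x assume x: "x : B"
  show "EX A. open A & x : A & continuous_on (A Int B) (%u. G U u a t)"
  proof (cases "x : W (z U)")
   case True
   have "continuous_on (W (z U) Int B) (F U)"
    by (rule continuous_on_subset[OF conjunct1[OF F(1)[OF U]]]) simp
   moreover have "continuous_on (W (z U) Int B) (%u. \<sigma> (z U) u a t)"
    using \<sigma>c[OF _ a] z[OF U] by simp
   ultimately have "continuous_on (W (z U) Int B) (%u. G U u a t)"
    unfolding G_def by (rule continuous_on_mult[OF continuous_on_of_real])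
   thus ?thesis using True W[of "z U"] z[OF U] by (intro exI[of _ "W (z U)"]) simp
  next
   case False
   hence "x : - closure U" using clU[OF U] by blast
   moreover have "continuous_on ((- closure U) Int B) (%u. G U u a t) \<longleftrightarrow> continuous_on ((- closure U) Int B) (%u. 0 :: complex)"
    by (rule continuous_on_cong) (use F(2)[OF U] closure_subset[of U] in \<open>auto simp: G_def\<close>)
   ultimately show ?thesis by (intro exI[of _ "- closure U"]) auto
  qed
 qed
 define s where "s u a t = (SUM U:{U \<in> \<C>. F U u ~= 0}. G U u a t)" for u a t
 have fin: "finite {U \<in> \<C>. F U u ~= 0}" if u: "u : B" for u
 proof -
  obtain V where "u : V" "finite {U \<in> \<C>. EX x:V. F U x ~= 0}" using F(4)[OF u] by blast
  thus ?thesis by (elim rev_finite_subset) auto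
 qed
 have "s u : S u" if u: "u : B" for u
 proof -
  have "(%a t. SUM U:{U \<in> \<C>. F U u ~= 0}. of_real (F U u) * \<sigma> (z U) u a t) : S u"
  proof (rule conv[OF u fin[OF u]])
   fix U assume "U : {U \<in> \<C>. F U u ~= 0}"
   hence U: "U : \<C>" "u : U" using F(2) u by auto
   hence "u : W (z U)" using clU closure_subset by blast
   thus "\<sigma> (z U) u : S u" using \<sigma> z[OF U(1)] u by blast
  next
   show "(SUM U:{U \<in> \<C>. F U u ~= 0}. F U u) = 1"
    using F(3)[OF u] by (simp add: supp_sum_def support_on_def)
  qed
  moreover have "s u = (%a t. SUM U:{U \<in> \<C>. F U u ~= 0}. of_real (F U u) * \<sigma> (z U) u a t)"
   by (intro ext) (simp add: s_def G_def)
  ultimately show ?thesis by simp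
 qed
 moreover have "continuous_on B (%u. s u a t)" if a: "a : X" for a t
 proof (rule continuous_on_local)
  fix x assume x: "x : B"
  obtain V where V: "open V" "x : V" "finite {U \<in> \<C>. EX x:V. F U x ~= 0}" using F(4)[OF x] by blast
  let ?T = "{U \<in> \<C>. EX x:V. F U x ~= 0}"
  have "continuous_on (V Int B) (%u. SUM U:?T. G U u a t)"
   by (intro continuous_on_sum continuous_on_subset[OF Gc[OF _ a]]) auto
  \<comment> \<open>The finite index set in \<open>s\<close> varies with \<open>u\<close>; on the
    neighbourhood \<open>V\<close> it is enlarged to a fixed finite one by adding zero
    terms.\<close>
  moreover have "s u a t = (SUM U:?T. G U u a t)" if u: "u : V Int B" for u
   unfolding s_def using u V(3) by (intro sum.mono_neutral_left) (auto simp: G_def)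
  ultimately have "continuous_on (V Int B) (%u. s u a t)" by (subst continuous_on_cong[OF refl]) auto
  thus "EX A. open A & x : A & continuous_on (A Int B) (%u. s u a t)"
   using V by (intro exI[of _ V]) simp
 qed
 ultimately show ?thesis by (intro exI[of _ s]) blast
qed

section \<open>Convexity of the sets of sections; unobstructedness\<close>

context flag_model
begin

lemma sect_comb:
 assumes h: "!!x. x : X ==> h x : sect k" and w: "(SUM x:X. w x) = 1"
 shows "(%v. SUM x:X. cs (w x) (h x v)) : sect k"
 unfolding sect_def
proof (intro CollectI conjI ballI)
 show "lin (%v. SUM x:X. cs (w x) (h x v))" by (intro lin_sum' lin_cs) (rule sectD(1)[OF h])
 fix v assume v: "v : V k"
 show "(SUM x:X. cs (w x) (h x v)) : V (Suc k)" by (intro V_sum V_sub sectD(2)[OF h v])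
 have "tr k (SUM x:X. cs (w x) (h x v)) = (SUM x:X. cs (w x) v)"
  unfolding lin_sum[OF lin_tr] lin_scale[OF lin_tr] by (rule sum.cong) (auto simp: sectD(3)[OF h v])
 also have "... = v" using w by (simp add: fun_eq_iff sum_fun_apply sum_distrib_right[symmetric])
 finally show "tr k (SUM x:X. cs (w x) (h x v)) = v" .
qed

lemma Z_sum: "U : Z K A ==> j <= l ==> (!!x. x : X ==> f x : U j) ==> (SUM x:X. f x) : U j"
 by (induction X rule: infinite_finite_induct) (auto intro: Z_sub)

text \<open>The defect in the definition of \<open>Sel\<close> is linear in \<open>h\<close> and is
  required to lie in a subspace. The weights must sum to 1 only to keep the combination a section of
  the truncation.\<close>

lemma Sel_comb:
 assumes A: "A : rep" and U: "U : Z k A"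
  and h: "!!x. x : X ==> h x : Sel k A U" and w: "(SUM x:X. w x) = 1"
 shows "(%v. SUM x:X. cs (w x) (h x v)) : Sel k A U"
 unfolding Sel_def
proof (intro CollectI conjI ballI allI impI)
 have hs: "x : X ==> h x : sect k" for x using h by (auto simp: Sel_def)
 thus "(%v. SUM x:X. cs (w x) (h x v)) : sect k" by (rule sect_comb[OF _ w])
 fix T j v assume T: "T : Ops A" and j: "j <= l" and v: "v : U j"
 note lT = dopD(1)[OF Ops_dop[OF A T]]
 have "ALL x:X. EX y:U j. tr (Suc k) (T (h x v)) - h x (tr k (T v)) = kap k y"
  using h T j v unfolding Sel_def by blast
 then obtain y where y: "!!x. x : X ==> y x : U j" "!!x. x : X ==> tr (Suc k) (T (h x v)) - h x (tr k (T v)) = kap k (y x)"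
  by metis
 have "tr (Suc k) (T (SUM x:X. cs (w x) (h x v))) - (SUM x:X. cs (w x) (h x (tr k (T v)))) =
   (SUM x:X. cs (w x) (tr (Suc k) (T (h x v)) - h x (tr k (T v))))"
  unfolding lin_sum[OF lT] lin_scale[OF lT] lin_sum[OF lin_tr] lin_scale[OF lin_tr] cs_diff sum_subtractf ..
 also have "... = kap k (SUM x:X. cs (w x) (y x))"
  unfolding lin_sum[OF lin_kap] lin_scale[OF lin_kap] using y(2) by (auto intro!: sum.cong)
 also have "... : kap k ` U j" by (intro imageI Z_sum[OF U j] Z_sub(3)[OF U j] y(1))
 finally show "tr (Suc k) (T (SUM x:X. cs (w x) (h x v))) - (SUM x:X. cs (w x) (h x (tr k (T v)))) : kap k ` U j" .
qed

lemma Sel'_comb: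
 assumes U: "U : Z (Suc k) A"
  and h: "!!x. x : X ==> h x : Sel' k U" and w: "(SUM x:X. w x) = 1"
 shows "(%v. SUM x:X. cs (w x) (h x v)) : Sel' k U"
 unfolding Sel'_def
proof (intro CollectI conjI ballI allI impI)
 have hs: "x : X ==> h x : sect k" for x using h by (auto simp: Sel'_def)
 thus "(%v. SUM x:X. cs (w x) (h x v)) : sect k" by (rule sect_comb[OF _ w])
 fix j v assume j: "j <= l" and v: "v : U j"
 show "(SUM x:X. cs (w x) (h x (tr k v))) : U j"
  by (intro Z_sum[OF U j] Z_sub(3)[OF U j]) (use h j v in \<open>auto simp: Sel'_def\<close>)
qed

lemma opcont_gen_valid:
 assumes "!!i q. i : {1..n} ==> q < m i ==> conton S (%u. x u i q)"
 shows "opcont S (%u. gen (x u))"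
 unfolding opcont_def conton_def
proof (intro ballI allI)
 fix v and t :: "nat * nat * nat"
 obtain i q a where t: "t = (i, q, a)" by (cases t)
 show "continuous_on S (%u. gen (x u) v t)"
 proof (cases "i : {1..n} & q < m i")
  case True
  have "continuous_on S (%u. SUM q'<m i. SUM b<=a. v (i, q', b) * x u i q' (i, q, a - b))"
   by (intro continuous_on_sum continuous_on_mult continuous_on_const contonD[OF assms]) (use True in auto)
  thus ?thesis using True t by (simp add: gen_apply)
 next
  case False
  hence "gen (x u) v t = 0" for u using t by (auto simp: gen_apply)
  thus ?thesis by simp
 qed
qed

lemma conton_lin_apply:
 assumes h: "opcont S h" "!!u. u : S ==> lin (h u)" and w: "conton S w" "!!u. u : S ==> w u : V k"
 shows "conton S (%u. h u (w u))"
 unfolding conton_def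
proof
 fix t
 have "continuous_on S (%u. SUM s:I k. w u s * h u (delta s) t)"
  by (intro continuous_on_sum continuous_on_mult contonD[OF w(1)] contonD[OF opcontD[OF h(1)]] V_Vin[OF delta_V])
 moreover have "h u (w u) t = (SUM s:I k. w u s * h u (delta s) t)" if u: "u : S" for u
  using V_lin_expand[OF w(2)[OF u] h(2)[OF u]] by (simp add: sum_fun_apply)
 ultimately show "continuous_on S (%u. h u (w u) t)" by (subst continuous_on_cong[OF refl]) auto
qed

lemma opcont_lift_gl:
 assumes g: "opcont S g" and h: "opcont S h" "!!u. u : S ==> h u : sect k"
 shows "opcont S (%u. lift_gl k (g u) (h u))"
 unfolding lift_gl_def
proof (rule opcont_gen_valid)
 fix i q assume iq: "i : {1..n}" "q < m i"
 show "conton S (%u. h u (tr k (g u (delta (i, q, 0)))))"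
  by (rule conton_lin_apply[OF h(1) sectD(1)[OF h(2)] conton_ops(1)[OF opcontD[OF g delta_Vin[OF iq]]] tr_V])
qed

text \<open>A frame \<open>g\<close> of \<open>U\<close> yields a section with values in
  \<open>U\<close>: pull back by the inverse, truncate, and push forward again. The standard flag is
  preserved by truncation, hence so is \<open>U\<close> by the result.\<close>

lemma Sel'_conj:
 assumes g: "invm (Suc k) g g'" and U: "!!j. j <= l ==> U j = fl (Suc k) g j"
 shows "(%v. tr (Suc k) (g (tr k (g' v)))) : Sel' k U"
 unfolding Sel'_def sect_def
proof (intro CollectI conjI ballI allI impI)
 note gg = invmD[OF g] and gk = invmD[OF invm_mono[OF _ g, of k, simplified]]
 show "lin (%v. tr (Suc k) (g (tr k (g' v))))"
  by (rule lin_comp[OF lin_tr lin_comp[OF glD(1)[OF gg(1)] lin_comp[OF lin_tr glD(1)[OF gg(2)]]]])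
 show "tr (Suc k) (g (tr k (g' v))) : V (Suc k)" for v by simp
 show "tr k (tr (Suc k) (g (tr k (g' v)))) = v" if v: "v : V k" for v
  using dop_tr[OF gl_dop[OF gg(1)] glD(2)[OF gg(2) V_Vin[OF v]]] gk(3)[OF V_Vin[OF v]] tr_id[OF v] by (simp add: tr_tr)
 fix j x assume j: "j <= l" and x: "x : U j"
 obtain w where w: "w : F (Suc k) j" "x = tr (Suc k) (g w)" using x U[OF j] by (auto simp: fl_def)
 have wV: "w : Vin" using F_Vin[OF w(1)] .
 have "tr k (g' (tr k x)) = tr k (g' (g w))"
  using dop_cong[OF gl_dop[OF gg(2)], of "tr k x" "g w" k] glD(2)[OF gg(1) wV] w(2) by (simp add: tr_tr)
 hence e: "tr k (g' (tr k x)) = tr k w" using gk(4)[OF wV] by simp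
 have "tr k w : F (Suc k) j" using w(1) V_mono[OF _ tr_V, of k "Suc k" w] by (auto simp: F_def Qp_tr)
 thus "tr (Suc k) (g (tr k (g' (tr k x)))) : U j" unfolding e U[OF j] fl_def by blast
qed

lemma opcont_Sel'_conj:
 assumes g: "opcont S g" "!!u. u : S ==> g u : gl" and g': "opcont S g'"
 shows "opcont S (%u v. tr (Suc k) (g u (tr k (g' u v))))"
 unfolding opcont_def
proof
 fix v assume v: "v : Vin"
 show "conton S (%u. tr (Suc k) (g u (tr k (g' u v))))"
  by (rule conton_ops(1)[OF conton_apply[OF g(1) gl_dop[OF g(2)] conton_ops(1)[OF opcontD[OF g' v]]]]) auto
qed

text \<open>The part of a representation that does not respect the standard flag.\<close>

definition Npart :: "(nat * nat * nat => vec3 => vec3) => nat * nat * nat => vec3 => vec3" where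
 "Npart A a v = (SUM j = 1..l. A a (Qp j v - Qp (j - 1) v) - Qp j (A a (Qp j v - Qp (j - 1) v)))"

lemma Qp_diff_gl: "(%v. Qp j v - Qp j' v) : gl"
 by (rule gl_diff[OF Qp_gl Qp_gl])

lemma Npart_rep: assumes A: "A : rep" shows "Npart A : rep"
proof -
 have "(%a v. SUM j:{1..l}. A a (Qp j v - Qp (j - 1) v) - Qp j (A a (Qp j v - Qp (j - 1) v))) : rep"
  by (intro rep_sum rep_diff rep_gl_right[OF A Qp_diff_gl] rep_gl_left[OF rep_gl_right[OF A Qp_diff_gl] Qp_gl])
 thus ?thesis unfolding Npart_def[abs_def] .
qed

lemma Qp_telescope: assumes "v : Vin" shows "(SUM j = 1..l. Qp j v - Qp (j - 1) v) = v"
proof -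
 have "(SUM j = 1..l. Qp j v - Qp (j - 1) v) = Qp l v - Qp 0 v"
  by (induction l) (simp_all add: algebra_simps)
 thus ?thesis using Qp_l[OF assms] by simp
qed

text \<open>Splitting \<open>v\<close> into its components \<open>Qp j v - Qp (j - 1) v\<close>,
  subtraction of \<open>Npart\<close> leaves the images of the components projected back to their
  own step. Components beyond the step of \<open>v\<close> are zero.\<close>

lemma Npart_complement:
 assumes A: "A : rep" and a: "a : Arr" and v: "v : Vin" "Qp j v = v" and j: "j <= l"
 shows "Qp j (A a v - Npart A a v) = A a v - Npart A a v"
proof -
 let ?P = "%j v. Qp j v - Qp (j - 1) v"
 note lA = rep_lin[OF A a]
 have "A a v = (SUM j = 1..l. A a (?P j v))"
  using Qp_telescope[OF v(1)] lin_sum[OF lA, of "%j. ?P j v" "{1..l}"] by simp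
 hence "A a v - Npart A a v = (SUM j = 1..l. Qp j (A a (?P j v)))"
  unfolding Npart_def sum_subtractf by simp
 moreover have "Qp j (SUM j' = 1..l. Qp j' (A a (?P j' v))) = (SUM j' = 1..l. Qp j' (A a (?P j' v)))"
  unfolding lin_sum[OF glD(1)[OF Qp_gl]]
 proof (rule sum.cong[OF refl])
  fix j' assume "j' : {1..l}"
  show "Qp j (Qp j' (A a (?P j' v))) = Qp j' (A a (?P j' v))"
  proof (cases "j' <= j")
   case False
   hence "?P j' v = 0" using v(2) Qp_Qp[of j' j v] Qp_Qp[of "j' - 1" j v] by (simp add: min_absorb2)
   thus ?thesis by (simp add: lin_0[OF lA] lin_0[OF glD(1)[OF Qp_gl]])
  qed (simp add: Qp_Qp min_absorb2)
 qed
 ultimately show ?thesis by simp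
qed

lemma conton_Npart:
 assumes "opcont S (%u. A u a)" "!!u. u : S ==> dop (A u a)"
 shows "opcont S (%u. Npart (A u) a)"
 unfolding opcont_def Npart_def
proof (intro ballI conton_sum conton_diff)
 fix v j assume v: "v : Vin"
 note PV = glD(2)[OF Qp_diff_gl v]
 show c: "conton S (%u. A u a (Qp j v - Qp (j - 1) v))" by (rule opcontD[OF assms(1) PV])
 show "conton S (%u. Qp j (A u a (Qp j v - Qp (j - 1) v)))"
  by (rule conton_apply[OF opcont_const gl_dop[OF Qp_gl] c dopD(2)[OF assms(2) PV]])
qed

text \<open>Unobstructedness: a flag of submodules \<open>g F\<close> over \<open>H(k)\<close> lifts to \<open>g (1 + \<epsilon>\<^sup>k y) F\<close> over \<open>H(k + 1)\<close>
 iff the commutator \<open>[y, g\<^sup>-\<^sup>1 A g]\<close> cancels the part of \<open>g\<^sup>-\<^sup>1 A g\<close> violating the standard flag, and all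
 commutator equations are solvable by rigidity.\<close>

lemma local_lift:
 assumes k: "0 < k" and A: "adsurj k A" and u0: "u0 : S"
  and g: "opcont S g" "opcont S g'" "!!u. u : S ==> invm k (g u) (g' u)"
  and st: "!!u j a x. u : S ==> j <= l ==> a : Arr ==> x : fl k (g u) j ==> tr k (A a x) : fl k (g u) j"
 obtains W G G' where "open W" "u0 : W" "opcont (W Int S) G" "opcont (W Int S) G'"
  "!!u. u : W Int S ==> invm (Suc k) (G u) (G' u)"
  "!!u v. u : W Int S ==> v : Vin ==> tr k (G u v) = tr k (g u v)"
  "!!u j a x. u : W Int S ==> j <= l ==> a : Arr ==> x : fl (Suc k) (G u) j ==> tr (Suc k) (A a x) : fl (Suc k) (G u) j"
proof -
 note Ar = adsurj_rep[OF A]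
 have A1: "adsurj (Suc k) A" using adsurj_level[OF A k] .
 \<comment> \<open>The Newton step of \<open>invm_lift\<close>, which makes \<open>f u\<close> an
   inverse of \<open>g u\<close> at the next level and is visibly continuous in
   \<open>u\<close>.\<close>
 define f where "f u v = cs 2 (g' u v) - g' u (g u (g' u v))" for u v
 have ggl: "g u : gl" "g' u : gl" if "u : S" for u using invmD(1,2)[OF g(3)[OF that]] .
 have inv: "invm (Suc k) (g u) (f u)" if u: "u : S" for u
  unfolding f_def[abs_def] by (rule invm_lift[OF g(3)[OF u] k])
 have fgl: "f u : gl" if "u : S" for u using invmD(2)[OF inv[OF that]] .
 have gd: "dop (g u)" "dop (g' u)" "dop (f u)" if "u : S" for u using gl_dop ggl fgl that by auto
 have fc: "opcont S f"
 proof -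
  have "opcont S (%u v. g' u (g u (g' u v)))"
   by (rule opcont_comp[OF g(2) _ opcont_comp[OF g(1) _ g(2)]]) (use gd dop_comp in auto)
  thus ?thesis using g(2) unfolding opcont_def f_def by (intro ballI conton_diff conton_cs) auto
 qed
 \<comment> \<open>In the coordinates of the frame the given flag becomes the standard one, and
   \<open>Af u\<close> is the representation seen there.\<close>
 define Af where "Af u = (%a v. f u (A a (g u v)))" for u
 have Afr: "Af u : rep" if "u : S" for u unfolding Af_def using rep_conj[OF Ar ggl(1)[OF that] fgl[OF that]] .
 have Afc: "opcont S (%u. Af u a)" if a: "a : Arr" for a
  unfolding Af_def
  by (rule opcont_comp[OF fc _ opcont_comp[OF opcont_const _ g(1)]]) (use gd rep_dop[OF Ar a] dop_comp in auto)
 have AfF: "tr k (Qp j (Af u a w)) = tr k (Af u a w)"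
  if u: "u : S" and a: "a : Arr" and j: "j <= l" and w: "w : Vin" "Qp j w = w" for u a j w
 proof -
  note ik = invm_mono[OF _ inv[OF u], of k, simplified]
  note [simp] = glD(2)[OF ggl(1)[OF u]] glD(2)[OF fgl[OF u]] rep_Vin[OF Ar a] w(1)
  have "tr k w : F k j" using F_tr[OF w] .
  hence "tr k (g u (tr k w)) : fl k (g u) j" by (auto simp: fl_def)
  hence "tr k (A a (tr k (g u (tr k w)))) : fl k (g u) j" by (rule st[OF u j a])
  then obtain w' where w': "w' : F k j" "tr k (A a (tr k (g u (tr k w)))) = tr k (g u w')" by (auto simp: fl_def)
  have "tr k (A a (tr k (g u (tr k w)))) = tr k (A a (g u w))"
   by (rule rep_cong[OF Ar a]) (use dop_tr[OF gd(1)[OF u] w(1)] in auto)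
  hence "tr k (A a (g u w)) = tr k (g u w')" using w'(2) by simp
  hence "tr k (f u (A a (g u w))) = tr k (f u (g u w'))"
   by (intro gl_cong[OF fgl[OF u]]) (use F_Vin[OF w'(1)] in auto)
  hence "tr k (Af u a w) = w'" using invmD(4)[OF ik F_Vin[OF w'(1)]] F_V[OF w'(1)] by (simp add: Af_def tr_id)
  thus ?thesis using F_Qp[OF w'(1)] by (simp add: Qp_tr[symmetric])
 qed
 \<comment> \<open>Stability at level \<open>k\<close> means that the part violating the standard
   flag vanishes modulo level \<open>k\<close>. Divided by \<open>D k\<close> it is the obstruction
   \<open>R\<close> to stability at the next level.\<close>
 have N0: "tr k (Npart (Af u) a v) = 0" if u: "u : S" and a: "a : Arr" and v: "v : Vin" for u a v
  unfolding Npart_def lin_sum[OF lin_tr] tr_diff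
 proof (rule sum.neutral, intro ballI)
  fix j assume j: "j : {1..l}"
  have "Qp j (Qp j v - Qp (j - 1) v) = Qp j v - Qp (j - 1) v"
   by (simp add: lin_diff[OF glD(1)[OF Qp_gl]] Qp_Qp min_absorb2)
  from AfF[OF u a _ glD(2)[OF Qp_diff_gl v] this] j
  show "tr k (Af u a (Qp j v - Qp (j - 1) v)) - tr k (Qp j (Af u a (Qp j v - Qp (j - 1) v))) = 0" by simp
 qed
 define R where "R u = (%a v. Dinv k (Npart (Af u) a v))" for u
 have Rr: "R u : rep" "!!a v. a : Arr ==> v : Vin ==> D k (R u a v) = Npart (Af u) a v" if u: "u : S" for u
  unfolding R_def using rep_Dinv[OF Npart_rep[OF Afr[OF u]] N0[OF u]] by auto
 have Rc: "opcont S (%u. R u a)" if a: "a : Arr" for a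
  unfolding opcont_def R_def
 proof (intro ballI conton_ops(5))
  fix v assume v: "v : Vin"
  show "conton S (%u. Npart (Af u) a v)"
   by (rule opcontD[OF conton_Npart[where A = Af and a = a, OF Afc[OF a]] v]) (rule rep_dop[OF Afr a])
 qed
 have ads0: "adsurj (Suc k) (Af u0)" unfolding Af_def by (rule adsurj_conj[OF A1 inv[OF u0]])
 \<comment> \<open>Rigidity enters: the obstruction is a commutator with \<open>Af u\<close>, solved
   continuously in \<open>u\<close>. The hypothesis on \<open>A\<close> passes to
   \<open>Af u0\<close> by conjugation.\<close>
 obtain W y where W: "open W" "u0 : W" "opcont (W Int S) y" "!!u. u : W Int S ==> y u : gl"
  "!!u a v. u : W Int S ==> a : Arr ==> v : Vin ==> tr (Suc k) (y u (Af u a v) - Af u a (y u v)) = tr (Suc k) (R u a v)"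
  by (rule local_bracket_solve[where A = Af and A' = Af and R = R and S = S, OF u0 _ _ _ _ _ _ ads0 refl])
   ((erule Afr | erule Afc | erule Rr(1) | erule Rc)+, rule that)
 \<comment> \<open>At level \<open>Suc k\<close> the operators \<open>1 + D k y\<close> and
   \<open>1 - D k y\<close> are mutually inverse, because applying \<open>D k\<close> twice gives
   zero there for positive \<open>k\<close>.\<close>
 define e where "e u v = v + D k (y u v)" for u v
 define e' where "e' u v = v - D k (y u v)" for u v
 have DD0: "tr (Suc k) (D k (D k v)) = 0" for v
  using k by (simp add: D_D tr_D_zero)
 have egl: "e u : gl" "e' u : gl" if "u : W Int S" for u
  unfolding e_def[abs_def] e'_def[abs_def] using gl_add[OF gl_id gl_D[OF W(4)[OF that]]] gl_diff[OF gl_id gl_D[OF W(4)[OF that]]] by auto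
 have einv: "invm (Suc k) (e u) (e' u)" if u: "u : W Int S" for u
  unfolding invm_def
 proof (intro conjI egl[OF u] ballI)
  fix v assume v: "v : Vin"
  note ly = glD(1)[OF W(4)[OF u]] and yV = glD(2)[OF W(4)[OF u]]
  have "e u (e' u v) = v - D k (D k (y u (y u v)))" "e' u (e u v) = v - D k (D k (y u (y u v)))"
   unfolding e_def e'_def
   by (simp_all add: lin_diff[OF ly] lin_add[OF ly] lin_diff[OF lin_D] lin_add[OF lin_D] gl_D_commute[OF W(4)[OF u] yV[OF v]])
  thus "tr (Suc k) (e u (e' u v)) = tr (Suc k) v" "tr (Suc k) (e' u (e u v)) = tr (Suc k) v"
   by (simp_all only: tr_diff DD0 diff_0_right)
 qed
 have ec: "opcont (W Int S) e" "opcont (W Int S) e'"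
  unfolding opcont_def e_def e'_def using W(3)
  by (auto intro!: conton_add conton_diff conton_const conton_ops(4) dest: opcontD)
 define G where "G u v = g u (e u v)" for u v
 define G' where "G' u v = e' u (f u v)" for u v
 have Ginv: "invm (Suc k) (G u) (G' u)" if u: "u : W Int S" for u
  unfolding G_def[abs_def] G'_def[abs_def] by (rule invm_comp[OF inv einv[OF u]]) (use u in auto)
 have sub: "W Int S \<subseteq> S" by auto
 show thesis
 proof (rule that[OF W(1,2), of G G'])
  show "opcont (W Int S) G" unfolding G_def[abs_def]
   by (rule opcont_comp[OF opcont_subset[OF g(1) sub] _ ec(1)]) (use gd gl_dop[OF egl(1)] in auto)
  show "opcont (W Int S) G'" unfolding G'_def[abs_def]
   by (rule opcont_comp[OF ec(2) _ opcont_subset[OF fc sub]]) (use gd gl_dop[OF egl(2)] in auto)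
  show "invm (Suc k) (G u) (G' u)" if "u : W Int S" for u using Ginv[OF that] .
  show "tr k (G u v) = tr k (g u v)" if u: "u : W Int S" and v: "v : Vin" for u v
  proof -
   have "tr k (e u v) = tr k v" by (simp add: e_def tr_add tr_D_zero)
   thus ?thesis unfolding G_def using u v by (intro gl_cong[OF ggl(1)] glD(2)[OF egl(1)]) auto
  qed
  fix u j a x assume u: "u : W Int S" and j: "j <= l" and a: "a : Arr" and x: "x : fl (Suc k) (G u) j"
  have uS: "u : S" using u by simp
  note G' = invmD[OF Ginv[OF u]]
  obtain w where w: "w : F (Suc k) j" "x = tr (Suc k) (G u w)" using x by (auto simp: fl_def)
  have wV: "w : Vin" using F_Vin[OF w(1)] .
  note [simp] = glD(2)[OF G'(1)] glD(2)[OF G'(2)] rep_Vin[OF Ar a] wV glD(2)[OF W(4)[OF u]] rep_Vin[OF Afr[OF uS] a]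
  let ?B = "A a (G u w)"
  have x1: "tr (Suc k) (A a x) = tr (Suc k) (G u (tr (Suc k) (G' u ?B)))"
  proof -
   have "tr (Suc k) (A a x) = tr (Suc k) ?B" using dop_tr[OF rep_dop[OF Ar a], of "G u w"] w(2) by simp
   also have "... = tr (Suc k) (G u (G' u ?B))" using G'(3)[of ?B] by simp
   also have "... = tr (Suc k) (G u (tr (Suc k) (G' u ?B)))" using dop_tr[OF gl_dop[OF G'(1)], of "G' u ?B"] by simp
   finally show ?thesis .
  qed
  \<comment> \<open>Conjugation by \<open>1 + D k y\<close> changes \<open>Af u\<close> by minus
    \<open>D k\<close> times the commutator, up to a term in which \<open>D k\<close> is applied
    twice. By the choice of \<open>y\<close> this subtracts exactly \<open>Npart\<close>.\<close>
  have "G' u ?B = e' u (Af u a (e u w))" by (simp add: G'_def G_def Af_def)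
  also have "... = Af u a w - D k (y u (Af u a w) - Af u a (y u w)) - D k (D k (y u (Af u a (y u w))))"
   using rep_D[OF Afr[OF uS] a, of "y u w"] gl_D_commute[OF W(4)[OF u], of "Af u a (y u w)"]
   unfolding e_def e'_def
   by (simp add: lin_add[OF rep_lin[OF Afr[OF uS] a]] lin_add[OF lin_D] lin_diff[OF lin_D] lin_add[OF glD(1)[OF W(4)[OF u]]])
  finally have "tr (Suc k) (G' u ?B) = tr (Suc k) (Af u a w) - tr (Suc k) (D k (y u (Af u a w) - Af u a (y u w)))"
   by (simp only: tr_diff DD0 diff_0_right)
  also have "tr (Suc k) (D k (y u (Af u a w) - Af u a (y u w))) = tr (Suc k) (D k (R u a w))"
   by (rule tr_D_cong, rule tr_eq_mono[of _ "Suc k"]) (use W(5)[OF u a wV] in auto)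
  finally have "tr (Suc k) (G' u ?B) = tr (Suc k) (Af u a w - Npart (Af u) a w)"
   unfolding tr_diff Rr(2)[OF uS a wV] .
  moreover have "tr (Suc k) (Af u a w - Npart (Af u) a w) : F (Suc k) j"
  proof (rule F_tr)
   show "Af u a w - Npart (Af u) a w : Vin" using rep_Vin[OF Npart_rep[OF Afr[OF uS]] a wV] by simp
   show "Qp j (Af u a w - Npart (Af u) a w) = Af u a w - Npart (Af u) a w"
    by (rule Npart_complement[OF Afr[OF uS] a wV F_Qp[OF w(1)] j])
  qed
  ultimately show "tr (Suc k) (A a x) : fl (Suc k) (G u) j"
   unfolding x1 fl_def by auto
 qed
qed

end

section \<open>Orthogonal projections as coordinates of flags\<close>

lemma continuous_on_fun3:
 fixes f :: "'u::topological_space => 'a => 'b => 'c => complex"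
 assumes "!!j s t. continuous_on S (%u. f u j s t)"
 shows "continuous_on S f"
 by (intro continuous_on_coordinatewise_then_product assms)

lemma continuous_on_fun3D:
 fixes f :: "'u::topological_space => 'a => 'b => 'c => complex"
 assumes "continuous_on S f"
 shows "continuous_on S (%u. f u j s t)"
 by (rule continuous_on_product_then_coordinatewise[OF continuous_on_product_then_coordinatewise[OF
    continuous_on_product_then_coordinatewise[OF assms]]])

text \<open>Injectivity makes the determinant nonzero, and Cramer's rule writes down the preimage.
  The finite set \<open>J\<close> singles out the coordinates that may be nonzero, so the statement
  concerns a finite-dimensional subspace.\<close>

lemma lin_inj_surj:
 fixes L :: "('x => complex) => 'x => complex"
 assumes J: "finite J" and L: "lin L"
  and J_L: "!!v. (!!t. t \<notin> J ==> v t = 0) ==> (!!t. t \<notin> J ==> L v t = 0)"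
  and inj: "!!v. (!!t. t \<notin> J ==> v t = 0) ==> L v = 0 ==> v = 0"
  and y: "!!t. t \<notin> J ==> y t = 0"
 obtains v where "!!t. t \<notin> J ==> v t = 0" "L v = y"
proof -
 define w where "w t s = L (delta s) t" for t s
 have app: "L v t = (SUM s:J. w t s * v s)" if "!!t. t \<notin> J ==> v t = 0" for v t
  using lin_expand[OF J that L] by (simp add: sum_fun_apply w_def mult.commute)
 have nz: "jdet J w ~= 0"
 proof
  assume "jdet J w = 0"
  then obtain v t where v: "t : J" "v t ~= 0" "!!t. t : J ==> (SUM s:J. w t s * v s) = 0"
   using jdet_zero[OF J] by metis
  define v' where "v' t = (if t : J then v t else 0)" for t
  have v'J: "!!t. t \<notin> J ==> v' t = 0" by (simp add: v'_def)
  have "L v' = 0"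
  proof
   fix t show "L v' t = 0 t"
   proof (cases "t : J")
    case True
    thus ?thesis using app[where v = v', OF v'J] v(3)[OF True] by (simp add: v'_def)
   qed (use J_L[where v = v', OF v'J] in simp)
  qed
  hence "v' = 0" using inj[where v = v', OF v'J] by simp
  hence "v' t = 0" by simp
  thus False using v(1,2) by (simp add: v'_def)
 qed
 define v where "v t = (if t : J then (SUM s':J. jadj J w t s' * y s') / jdet J w else 0)" for t
 have vJ: "!!t. t \<notin> J ==> v t = 0" by (simp add: v_def)
 have "L v = y"
 proof
  fix t show "L v t = y t"
  proof (cases "t : J")
   case True
   have "L v t = (SUM s:J. w t s * ((SUM s':J. jadj J w s s' * y s') / jdet J w))"
    by (subst app[where v = v, OF vJ], assumption, rule sum.cong) (auto simp: v_def)
   thus ?thesis using jdet_solve[OF J True nz, of y] by simp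
  qed (use J_L[where v = v, OF vJ] y in simp)
 qed
 with vJ show thesis by (rule that)
qed

context flag_model
begin

definition ip :: "nat => vec3 => vec3 => complex" where
 "ip K v w = (SUM t:I K. v t * cnj (w t))"

lemma ip_simps: "ip K (v + v') w = ip K v w + ip K v' w" "ip K (v - v') w = ip K v w - ip K v' w"
  "ip K (cs z v) w = z * ip K v w" "ip K v (cs z w) = cnj z * ip K v w" "ip K v (w + w') = ip K v w + ip K v w'"
  "ip K v (w - w') = ip K v w - ip K v w'"
 by (simp_all add: ip_def algebra_simps sum.distrib sum_subtractf sum_distrib_left)

lemma ip_zero: "ip K 0 w = 0" "ip K v 0 = 0"
 by (simp_all add: ip_def)

lemma ip_sum: "ip K (SUM x:X. f x) w = (SUM x:X. ip K (f x) w)" "ip K v (SUM x:X. f x) = (SUM x:X. ip K v (f x))"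
 by (induction X rule: infinite_finite_induct) (simp_all add: ip_simps ip_zero)

lemma ip_self: assumes "ip K v v = 0" "v : V K" shows "v = 0"
proof -
 have "(SUM t:I K. complex_of_real ((cmod (v t))\<^sup>2)) = 0"
  using assms(1) by (simp add: ip_def complex_norm_square[symmetric] del: of_real_power)
 hence "(SUM t:I K. (cmod (v t))\<^sup>2) = 0" unfolding of_real_sum[symmetric] of_real_eq_0_iff .
 hence "ALL t:I K. (cmod (v t))\<^sup>2 = 0" by (subst (asm) sum_nonneg_eq_0_iff) auto
 hence "v t = 0" for t
  using assms(2) unfolding V_def by (cases "t : I K") (auto simp del: I_mem split_paired_All)
 thus ?thesis by (simp add: fun_eq_iff)
qed

definition PJ :: "nat => vec3 set => vec3 => vec3" where
 "PJ K W v = (THE w. w : W & (ALL x:W. ip K (v - w) x = 0))"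

lemma PJ_eq:
 assumes W: "W \<subseteq> V K" "!!x y. x : W ==> y : W ==> x - y : W"
  and w: "w : W" "!!x. x : W ==> ip K (v - w) x = 0"
 shows "PJ K W v = w"
 unfolding PJ_def
proof (rule the_equality)
 show "w : W & (ALL x:W. ip K (v - w) x = 0)" using w by blast
 fix w' assume w': "w' : W & (ALL x:W. ip K (v - w') x = 0)"
 have d: "w' - w : W" using W(2) w w' by blast
 have "ip K (w' - w) (w' - w) = ip K (v - w) (w' - w) - ip K (v - w') (w' - w)"
  by (simp add: ip_simps)
 also have "... = 0" using w(2)[OF d] w' d by simp
 finally have "w' - w = 0" using ip_self d W(1) by blast
 thus "w' = w" by simp
qed

definition lspan :: "'f set => ('f => vec3) => vec3 set" where
 "lspan J b = {(SUM a:J. cs (z a) (b a)) | z. True}"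

definition indep :: "'f set => ('f => vec3) => bool" where
 "indep J b \<longleftrightarrow> (ALL z. (SUM a:J. cs (z a) (b a)) = 0 --> (ALL a:J. z a = 0))"

lemma lspan_diff: assumes "x : lspan J b" "y : lspan J b" shows "x - y : lspan J b"
proof -
 obtain z z' where "x = (SUM a:J. cs (z a) (b a))" "y = (SUM a:J. cs (z' a) (b a))" using assms unfolding lspan_def by blast
 hence "x - y = (SUM a:J. cs (z a - z' a) (b a))"
  by (simp add: sum_subtractf[symmetric]) (auto simp: fun_eq_iff sum_fun_apply algebra_simps intro!: sum.cong)
 thus ?thesis unfolding lspan_def by (intro CollectI exI[of _ "%a. z a - z' a"]) simp
qed

lemma lspan_V: "(!!a. a : J ==> b a : V K) ==> lspan J b \<subseteq> V K"
 unfolding lspan_def by (auto intro!: V_sum V_sub)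

definition gram :: "nat => ('f => vec3) => 'f => 'f => complex" where
 "gram K b a a' = ip K (b a') (b a)"

text \<open>A kernel vector of the Gram matrix gives a combination of the \<open>b a\<close> that is
  orthogonal to all of them, hence to itself, hence zero.\<close>

lemma gram_nonzero:
 assumes J: "finite J" and b: "!!a. a : J ==> b a : V K" "indep J b"
 shows "jdet J (gram K b) ~= 0"
proof
 assume "jdet J (gram K b) = 0"
 then obtain z a0 where z: "a0 : J" "z a0 ~= 0" "!!a. a : J ==> (SUM a':J. gram K b a a' * z a') = 0"
  using jdet_zero[OF J] by metis
 let ?x = "SUM a:J. cs (z a) (b a)"
 have "ip K ?x (b a) = 0" if "a : J" for a
  using z(3)[OF that] by (simp add: ip_sum ip_simps gram_def mult.commute)
 hence "ip K ?x ?x = 0" by (simp add: ip_sum(2) ip_simps)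
 moreover have "?x : V K" by (intro V_sum V_sub b(1))
 ultimately have "?x = 0" by (rule ip_self)
 thus False using b(2) z(1,2) unfolding indep_def by blast
qed

definition gcoef :: "nat => 'f set => ('f => vec3) => vec3 => 'f => complex" where
 "gcoef K J b v a = (SUM a':J. jadj J (gram K b) a a' * ip K v (b a')) / jdet J (gram K b)"

text \<open>The coefficients \<open>gcoef\<close> solve the normal equations by Cramer's rule. In
  this form the projection visibly depends continuously on the basis, as used in
  \<open>PJ_continuous\<close>.\<close>

lemma PJ_span:
 assumes J: "finite J" and b: "!!a. a : J ==> b a : V K" "indep J b"
 shows "PJ K (lspan J b) v = (SUM a:J. cs (gcoef K J b v a) (b a))"
proof (rule PJ_eq[OF lspan_V[OF b(1)]])
 let ?w = "SUM a:J. cs (gcoef K J b v a) (b a)"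
 show "?w : lspan J b" unfolding lspan_def by blast
 have o: "ip K (v - ?w) (b a) = 0" if a: "a : J" for a
 proof -
  have "ip K ?w (b a) = (SUM a':J. gram K b a a' * gcoef K J b v a')"
   by (simp add: ip_sum ip_simps gram_def mult.commute)
  also have "... = ip K v (b a)"
   unfolding gcoef_def by (rule jdet_solve[OF J a gram_nonzero[OF J b], where y = "%a. ip K v (b a)"])
  finally show ?thesis by (simp add: ip_simps)
 qed
 fix x assume "x : lspan J b"
 thus "ip K (v - ?w) x = 0" using o by (auto simp: lspan_def ip_sum(2) ip_simps)
qed (use lspan_diff in auto)

lemma PJ_continuous:
 fixes b :: "'u::topological_space => 'f => vec3"
 assumes J: "finite J" and b: "!!u a. u : S ==> a : J ==> b u a : V K" "!!u. u : S ==> indep J (b u)"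
  and bc: "!!a. a : J ==> conton S (%u. b u a)"
 shows "conton S (%u. PJ K (lspan J (b u)) v)"
 unfolding conton_def
proof
 fix t
 have ipc: "continuous_on S (%u. ip K v (b u a))" if "a : J" for a v
  unfolding ip_def by (intro continuous_on_sum continuous_on_mult continuous_on_const continuous_on_cnj contonD[OF bc[OF that]])
 have gc: "continuous_on S (%u. gram K (b u) a a')" if "a : J" "a' : J" for a a'
  unfolding gram_def ip_def
  by (intro continuous_on_sum continuous_on_mult continuous_on_cnj contonD[OF bc[OF that(1)]] contonD[OF bc[OF that(2)]])
 have nz: "jdet J (gram K (b u)) ~= 0" if "u : S" for u
  by (rule gram_nonzero[OF J b(1)[OF that] b(2)[OF that]])
 have adj: "continuous_on S (%u. jadj J (gram K (b u)) a a')" if a: "a : J" "a' : J" for a a'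
  by (rule continuous_jadj[where W = "%u. gram K (b u)" and B = S, OF J _ a]) (rule gc)
 have det: "continuous_on S (%u. jdet J (gram K (b u)))"
  by (rule continuous_jdet[where W = "%u. gram K (b u)" and B = S, OF J]) (rule gc)
 have co: "continuous_on S (%u. gcoef K J (b u) v a)" if a: "a : J" for a
  unfolding gcoef_def
  by (intro continuous_on_divide continuous_on_sum continuous_on_mult det ballI nz adj[OF a] ipc)
 have "continuous_on S (%u. SUM a:J. gcoef K J (b u) v a * b u a t)"
  by (intro continuous_on_sum continuous_on_mult co contonD[OF bc])
 moreover have "PJ K (lspan J (b u)) v t = (SUM a:J. gcoef K J (b u) v a * b u a t)" if u: "u : S" for u
  using PJ_span[OF J b(1)[OF u] b(2)[OF u]] by (simp add: sum_fun_apply)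
 ultimately show "continuous_on S (%u. PJ K (lspan J (b u)) v t)" by (subst continuous_on_cong[OF refl]) auto
qed

definition fb :: "nat => (vec3 => vec3) => nat * nat * nat => vec3" where
 "fb K g t = tr K (g (delta t))"

lemma fb_V [simp]: "fb K g t : V K"
 by (simp add: fb_def)

lemma fb_sum: "lin g ==> (SUM t:J. cs (z t) (fb K g t)) = tr K (g (SUM t:J. cs (z t) (delta t)))"
 unfolding fb_def by (simp add: lin_sum[of g] lin_scale[of g] lin_sum[OF lin_tr] lin_scale[OF lin_tr])

lemma delta_sum_apply: "finite J ==> t : J ==> (SUM t:J. cs (z t) (delta t)) t = z t"
proof -
 assume J: "finite J" "t : J"
 have "(SUM t:J. cs (z t) (delta t)) t = (SUM s:J. if t = s then z s else 0)"
  unfolding sum_fun_apply by (rule sum.cong) (auto simp: delta_apply)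
 thus ?thesis using J by simp
qed

lemma F_sum_delta: "(SUM t:FI K j. cs (z t) (delta t)) : F K j"
proof -
 have "(SUM t:X. cs (z t) (delta t)) : F K j" if "X \<subseteq> FI K j" for X
  using that by (induction X rule: infinite_finite_induct) (auto intro: F_sub F_delta)
 thus ?thesis by simp
qed

lemma fb_indep: assumes g: "invm K g h" shows "indep (FI K j) (fb K g)"
 unfolding indep_def
proof (intro allI impI ballI)
 fix z t assume e: "(SUM t:FI K j. cs (z t) (fb K g t)) = 0" and t: "t : FI K j"
 note g' = invmD[OF g]
 let ?v = "SUM t:FI K j. cs (z t) (delta t)"
 have v: "?v : F K j" by (rule F_sum_delta)
 have "tr K (g ?v) = tr K 0" using e fb_sum[OF glD(1)[OF g'(1)]] by simp
 hence "tr K (h (g ?v)) = tr K (h 0)" by (intro gl_cong[OF g'(2)] glD(2)[OF g'(1)] F_Vin[OF v]) auto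
 hence "tr K ?v = 0" using g'(4)[OF F_Vin[OF v]] lin_0[OF glD(1)[OF g'(2)]] by simp
 hence "?v = 0" using tr_id[OF F_V[OF v]] by simp
 hence "?v t = 0" by simp
 thus "z t = 0" using delta_sum_apply[OF fin_FI t, of z] by simp
qed

lemma fl_span: assumes g: "lin g" shows "fl K g j = lspan (FI K j) (fb K g)"
proof (intro equalityI subsetI)
 fix x assume "x : fl K g j"
 then obtain v where v: "v : F K j" "x = tr K (g v)" by (auto simp: fl_def)
 have "v = (SUM t:FI K j. cs (v t) (delta t))" by (rule delta_expand[OF fin_FI F_support[OF v(1)]])
 hence "x = (SUM t:FI K j. cs (v t) (fb K g t))" using v(2) fb_sum[OF g] by simp
 thus "x : lspan (FI K j) (fb K g)" unfolding lspan_def by blast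
next
 fix x assume "x : lspan (FI K j) (fb K g)"
 then obtain z where "x = (SUM t:FI K j. cs (z t) (fb K g t))" unfolding lspan_def by blast
 hence "x = tr K (g (SUM t:FI K j. cs (z t) (delta t)))" using fb_sum[OF g] by simp
 thus "x : fl K g j" unfolding fl_def using F_sum_delta by (rule image_eqI)
qed

text \<open>A flag is encoded by the matrices of the orthogonal projections onto its members.\<close>

definition pr :: "nat => (nat => vec3 set) => nat => nat * nat * nat => vec3" where
 "pr K U = (%j s. if j <= l then PJ K (U j) (delta s) else 0)"

definition appl :: "nat => (nat => nat * nat * nat => vec3) => nat => vec3 => vec3" where
 "appl K P j x = (SUM s:I K. cs (x s) (P j s))"

text \<open>Inverse to \<open>pr\<close> on flags, see \<open>un_pr\<close>: a subspace is recovered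
  as the space of fixed vectors of its projection.\<close>

definition un :: "nat => (nat => nat * nat * nat => vec3) => nat => vec3 set" where
 "un K P = (\<lambda>j\<in>{0..l}. {x \<in> V K. appl K P j x = x})"

lemma PJ_fl_in: assumes g: "invm K g h" shows "PJ K (fl K g j) v : fl K g j" "x : fl K g j ==> ip K (v - PJ K (fl K g j) v) x = 0"
proof -
 note s = fl_span[OF glD(1)[OF invmD(1)[OF g]]]
 note b = fb_indep[OF g, of j]
 let ?w = "SUM a:FI K j. cs (gcoef K (FI K j) (fb K g) v a) (fb K g a)"
 have e: "PJ K (fl K g j) v = ?w" unfolding s by (rule PJ_span[OF fin_FI _ b]) simp
 have ws: "?w : lspan (FI K j) (fb K g)" unfolding lspan_def by blast
 thus "PJ K (fl K g j) v : fl K g j" using e s by simp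
 have o: "ip K (v - ?w) (fb K g a) = 0" if a: "a : FI K j" for a
 proof -
  have "ip K ?w (fb K g a) = (SUM a':FI K j. gram K (fb K g) a a' * gcoef K (FI K j) (fb K g) v a')"
   by (simp add: ip_sum ip_simps gram_def mult.commute)
  also have "... = ip K v (fb K g a)"
   unfolding gcoef_def
   by (rule jdet_solve[OF fin_FI a gram_nonzero[OF fin_FI fb_V b], where y = "%a. ip K v (fb K g a)"])
  finally show ?thesis by (simp add: ip_simps)
 qed
 show "ip K (v - PJ K (fl K g j) v) x = 0" if x: "x : fl K g j"
 proof -
  obtain z where z: "x = (SUM a:FI K j. cs (z a) (fb K g a))" using x unfolding s lspan_def by blast
  show ?thesis unfolding e z ip_sum(2) ip_simps(4) by (rule sum.neutral) (simp add: o)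
 qed
qed

lemma PJ_Z:
 assumes U: "U : Z K A" and j: "j <= l"
 shows "PJ K (U j) v : U j" "x : U j ==> ip K (v - PJ K (U j) v) x = 0"
proof -
 obtain g h where g: "invm K g h" "U j = fl K g j" using Z_flag[OF U] j by metis
 show "PJ K (U j) v : U j" "x : U j ==> ip K (v - PJ K (U j) v) x = 0"
  unfolding g(2) using PJ_fl_in[OF g(1)] by auto
qed

lemma PJ_Z_eq:
 assumes U: "U : Z K A" and j: "j <= l" and w: "w : U j" "!!x. x : U j ==> ip K (v - w) x = 0"
 shows "PJ K (U j) v = w"
 by (rule PJ_eq[OF _ Z_sub(4)[OF U j] w]) (use Z_sub(5)[OF U j] in auto)

lemma appl_pr:
 assumes U: "U : Z K A" and j: "j <= l" and x: "x : V K"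
 shows "appl K (pr K U) j x = PJ K (U j) x"
proof (rule sym, rule PJ_Z_eq[OF U j])
 have e: "appl K (pr K U) j x = (SUM s:I K. cs (x s) (PJ K (U j) (delta s)))" using j by (simp add: appl_def pr_def)
 show "appl K (pr K U) j x : U j"
  unfolding e by (intro Z_sum[OF U j] Z_sub(3)[OF U j] PJ_Z(1)[OF U j])
 fix y assume y: "y : U j"
 have "x - appl K (pr K U) j x = (SUM s:I K. cs (x s) (delta s - PJ K (U j) (delta s)))"
  unfolding e cs_diff sum_subtractf V_expand[OF x, symmetric] ..
 thus "ip K (x - appl K (pr K U) j x) y = 0" by (simp add: ip_sum ip_simps(3) PJ_Z(2)[OF U j y])
qed

lemma un_pr: assumes U: "U : Z K A" shows "un K (pr K U) = U"
proof (rule extensionalityI[of _ "{0..l}"])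
 fix j assume "j : {0..l}"
 hence j: "j <= l" by simp
 show "un K (pr K U) j = U j"
 proof (intro equalityI subsetI)
  fix x assume "x : un K (pr K U) j"
  hence "x : V K" "PJ K (U j) x = x" using j appl_pr[OF U j] by (auto simp: un_def)
  thus "x : U j" using PJ_Z(1)[OF U j, of x] by simp
 next
  fix x assume x: "x : U j"
  have "PJ K (U j) x = x" by (rule PJ_Z_eq[OF U j x]) (simp add: ip_def)
  thus "x : un K (pr K U) j" using j appl_pr[OF U j] Z_sub(5)[OF U j x] by (simp add: un_def)
 qed
qed (simp_all add: un_def Z_ext[OF U])

text \<open>The space in which the homotopy takes place. Its points are complex-valued functions on
  countable index sets, so it is metrizable and second countable, as
  \<open>continuous_selection\<close> demands.\<close>

definition PP :: "nat => (nat * nat * nat => vec3 => vec3) => (nat => nat * nat * nat => vec3) set" where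
 "PP K A = pr K ` Z K A"

lemma un_Z: "u : PP K A ==> un K u : Z K A" and pr_un: "u : PP K A ==> pr K (un K u) = u"
 by (auto simp: PP_def un_pr)

lemma pr_continuous:
 fixes g :: "'u::topological_space => vec3 => vec3"
 assumes g: "opcont S g" "!!u. u : S ==> invm K (g u) (g' u)"
  and U: "!!u j. u : S ==> j <= l ==> U u j = fl K (g u) j"
 shows "continuous_on S (%u. pr K (U u))"
proof (rule continuous_on_fun3)
 fix j s t
 show "continuous_on S (%u. pr K (U u) j s t)"
 proof (cases "j <= l")
  case True
  have "conton S (%u. PJ K (lspan (FI K j) (fb K (g u))) (delta s))"
  proof (rule PJ_continuous[OF fin_FI])
   show "indep (FI K j) (fb K (g u))" if "u : S" for u by (rule fb_indep[OF g(2)[OF that]])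
   fix a assume "a : FI K j"
   hence "delta a : Vin" by (rule F_Vin[OF F_delta])
   thus "conton S (%u. fb K (g u) a)" unfolding fb_def by (intro conton_ops(1) opcontD[OF g(1)])
  qed simp
  hence "continuous_on S (%u. PJ K (lspan (FI K j) (fb K (g u))) (delta s) t)" by (rule contonD)
  moreover have "pr K (U u) j s t = PJ K (lspan (FI K j) (fb K (g u))) (delta s) t" if u: "u : S" for u
   using True U[OF u True] fl_span[OF glD(1)[OF invmD(1)[OF g(2)[OF u]]]] by (simp add: pr_def)
  ultimately show ?thesis by (subst continuous_on_cong[OF refl]) auto
 qed (simp add: pr_def)
qed

lemma Z_mono: "U : Z K A ==> j <= j' ==> j' <= l ==> x : U j ==> x : U j'"
proof -
 assume U: "U : Z K A" and j: "j <= j'" "j' <= l" and x: "x : U j"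
 obtain g h where g: "invm K g h" "!!j. j <= l ==> U j = fl K g j" using Z_flag[OF U] by metis
 thus "x : U j'" using x j F_mono[OF j(1)] by (auto simp: fl_def)
qed

lemma Z_Es: assumes U: "U : Z K A" and j: "j <= l" and x: "x : U j" shows "tr K (Es a x) : U j"
proof (induction a)
 case 0
 show ?case using x tr_id[OF Z_sub(5)[OF U j x]] by simp
next
 case (Suc a)
 have xV: "x : Vin" using V_Vin[OF Z_sub(5)[OF U j x]] .
 have "tr K (Es (Suc a) x) = tr K (Es 1 (tr K (Es a x)))" using dop_tr[OF dop_Es, of "Es a x" K 1] xV by (simp add: Es_Es)
 thus ?case using Ops_stable[OF U _ j Suc, of "Es 1"] by (simp add: Ops_def)
qed

lemma Z_es: assumes U: "U : Z K A" and j: "j <= l" and x: "x : U j" and i: "i : {1..n}" shows "tr K (es i x) : U j"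
 using Ops_stable[OF U _ j x, of "es i"] i by (auto simp: Ops_def)

text \<open>The frame at \<open>u\<close> is obtained by projecting the basis vectors of a frame at
  \<open>u0\<close> into the flag of \<open>u\<close>. At \<open>u0\<close> this changes nothing, so
  the result stays invertible nearby, and a dimension argument shows that it spans each
  step.\<close>

lemma local_frame:
 assumes u0: "u0 : PP K A"
 obtains W g g' where "open W" "u0 : W" "opcont (W Int PP K A) g" "opcont (W Int PP K A) g'"
  "!!u. u : W Int PP K A ==> invm K (g u) (g' u)"
  "!!u j. u : W Int PP K A ==> j <= l ==> un K u j = fl K (g u) j"
proof -
 let ?S = "PP K A"
 note U0 = un_Z[OF u0]
 obtain g0 h0 where g0: "invm K g0 h0" "!!j. j <= l ==> un K u0 j = fl K g0 j" using Z_flag[OF U0] by metis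
 note g0' = invmD[OF g0(1)]
 \<comment> \<open>The first step of the standard flag that contains basis vector \<open>q\<close>
   at vertex \<open>i\<close>; the vector is projected into the corresponding step of the varying
   flag.\<close>
 define lv where "lv i q = (LEAST j. q < lev j i)" for i q
 have lv: "q < lev (lv i q) i" "lv i q <= l" if "i : {1..n}" "q < m i" for i q
 proof -
  have "q < lev l i" using lev_l that by simp
  thus "q < lev (lv i q) i" "lv i q <= l" unfolding lv_def by (auto intro: LeastI Least_le)
 qed
 define x0 where "x0 i q = tr K (g0 (delta (i, q, 0)))" for i q
 define x where "x u i q = appl K u (lv i q) (x0 i q)" for u i q
 define g where "g u = gen (x u)" for u
 have ggl: "g u : gl" for u by (simp add: g_def gen_gl)
 have gc: "opcont ?S g"
  unfolding g_def
 proof (rule opcont_gen_valid)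
  fix i q
  have "continuous_on ?S (%u. SUM s:I K. x0 i q s * u (lv i q) s t)" for t
   by (intro continuous_on_sum continuous_on_mult continuous_on_const continuous_on_fun3D[OF continuous_on_id])
  thus "conton ?S (%u. x u i q)" by (simp add: conton_def x_def appl_def sum_fun_apply)
 qed
 have x0F: "x0 i q : un K u0 (lv i q)" if iq: "i : {1..n}" "q < m i" for i q
 proof -
  have "tr K (delta (i, q, 0)) : F K (lv i q)"
   by (rule F_tr[OF delta_Vin[OF iq]], rule vec3_eqI) (use lv[OF iq] in \<open>auto simp: Qp_apply delta_apply\<close>)
  hence "tr K (g0 (tr K (delta (i, q, 0)))) : fl K g0 (lv i q)" by (auto simp: fl_def)
  thus ?thesis using g0(2)[OF lv(2)[OF iq]] dop_tr[OF gl_dop[OF g0'(1)] delta_Vin[OF iq]] by (simp add: x0_def)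
 qed
 have e0: "tr K (g u0 v) = tr K (g0 v)" if v: "v : Vin" for v
 proof (rule gl_eqI[OF ggl g0'(1) _ v])
  fix i q assume iq: "i : {1..n}" "q < m i"
  have "x u0 i q = x0 i q" using x0F[OF iq] lv(2)[OF iq] by (simp add: un_def x_def)
  hence "g u0 (delta (i, q, 0)) = es i (tr K (g0 (delta (i, q, 0))))" using gen_delta[OF iq] by (simp add: g_def x0_def)
  also have "... = tr K (g0 (es i (delta (i, q, 0))))" using glD(3)[OF g0'(1) delta_Vin[OF iq] iq(1)] by (simp add: es_commute)
  finally show "tr K (g u0 (delta (i, q, 0))) = tr K (g0 (delta (i, q, 0)))" using iq by (simp add: es_delta)
 qed
 have inv0: "invm K (g u0) h0"
  unfolding invm_def
 proof (intro conjI ballI ggl g0'(2))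
  fix v assume v: "v : Vin"
  show "tr K (g u0 (h0 v)) = tr K v" using e0[OF glD(2)[OF g0'(2) v]] g0'(3)[OF v] by simp
  have "tr K (h0 (g u0 v)) = tr K (h0 (g0 v))"
   by (rule gl_cong[OF g0'(2) glD(2)[OF ggl v] glD(2)[OF g0'(1) v] e0[OF v]])
  thus "tr K (h0 (g u0 v)) = tr K v" using g0'(4)[OF v] by simp
 qed
 obtain W g' where W: "open W" "u0 : W" "!!u. u : W Int ?S ==> invm K (g u) (g' u)" "opcont (W Int ?S) g'"
  by (rule gl_local_inverse[where S = "PP K A" and g = g and K = K and ?u0.0 = u0 and ?h0.0 = h0])
   (rule u0, rule ggl, rule gc, rule inv0, rule that)
 show thesis
 proof (rule that[OF W(1,2) opcont_subset[OF gc] W(4,3)])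
  fix u j assume u: "u : W Int ?S" and j: "j <= l"
  hence uS: "u : ?S" by simp
  note U = un_Z[OF uS] and gu = invmD[OF W(3)[OF u]]
  obtain g1 h1 where g1: "invm K g1 h1" "un K u j = fl K g1 j" using Z_flag[OF U] j by metis
  note g1' = invmD[OF g1(1)]
  have dP: "tr K (g u (delta t)) : un K u j" if t: "t : FI K j" for t
  proof -
   obtain i q a where t': "t = (i, q, a)" "i : {1..n}" "q < m i" "q < lev j i" using t by (cases t) (auto simp: FI_def)
   have lj: "lv i q <= j" unfolding lv_def using t'(4) by (rule Least_le)
   have "x u i q : un K u (lv i q)"
    using appl_pr[OF U lv(2)[OF t'(2,3)], of "x0 i q"] PJ_Z(1)[OF U lv(2)[OF t'(2,3)]] pr_un[OF uS]
    by (simp add: x_def x0_def)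
   hence "x u i q : un K u j" by (rule Z_mono[OF U lj j])
   hence "tr K (Es a (tr K (es i (x u i q)))) : un K u j" by (intro Z_Es[OF U j] Z_es[OF U j _ t'(2)])
   moreover have "g u (delta t) = Es a (es i (x u i q))"
    using gl_Es[OF ggl delta_Vin[OF t'(2,3), of 0], of u a] gen_delta[OF t'(2,3)] t'(1) by (simp add: Es_delta g_def)
   moreover have "es i (x u i q) : Vin"
    using V_Vin[OF Z_sub(5)[OF U j \<open>x u i q : un K u j\<close>]] by simp
   ultimately show ?thesis using dop_tr[OF dop_Es, of "es i (x u i q)" K a] by simp
  qed
  have sub: "fl K (g u) j \<subseteq> un K u j"
  proof
   fix y assume "y : fl K (g u) j"
   then obtain z where "y = (SUM t:FI K j. cs (z t) (fb K (g u) t))"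
    unfolding fl_span[OF glD(1)[OF ggl]] lspan_def by blast
   thus "y : un K u j" using dP by (auto simp: fb_def intro!: Z_sum[OF U j] Z_sub(3)[OF U j])
  qed
  \<comment> \<open>The inclusion just shown is compared with some frame \<open>g1\<close> of the
    same flag: in its coordinates \<open>g u\<close> becomes an injective endomorphism of the
    standard step, hence a surjective one.\<close>
  define L where "L v = tr K (h1 (g u v))" for v
  have linL: "lin L" unfolding L_def[abs_def]
   by (rule lin_comp[OF lin_tr lin_comp[OF glD(1)[OF g1'(2)] glD(1)[OF ggl]]])
  have FI_F: "v : F K j" if "!!t. t \<notin> FI K j ==> v t = 0" for v
   using delta_expand[OF fin_FI that] F_sum_delta[of v K j] by simp
  have LF: "L v : F K j" if v: "v : F K j" for v
  proof -
   have "tr K (g u v) : fl K g1 j" using sub v g1(2) by (auto simp: fl_def)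
   then obtain w where w: "w : F K j" "tr K (g u v) = tr K (g1 w)" by (auto simp: fl_def)
   have "tr K (h1 (g u v)) = tr K (h1 (g1 w))"
    by (rule gl_cong[OF g1'(2) glD(2)[OF ggl F_Vin[OF v]] glD(2)[OF g1'(1) F_Vin[OF w(1)]] w(2)])
   thus ?thesis using g1'(4)[OF F_Vin[OF w(1)]] tr_id[OF F_V[OF w(1)]] w(1) by (simp add: L_def)
  qed
  have Lg: "tr K (g1 (L v)) = tr K (g u v)" if v: "v : Vin" for v
   using dop_tr[OF gl_dop[OF g1'(1)], of "h1 (g u v)" K] g1'(3)[OF glD(2)[OF ggl v], of u] glD(2)[OF g1'(2)] glD(2)[OF ggl v]
   by (simp add: L_def)
  have "un K u j \<subseteq> fl K (g u) j"
  proof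
   fix y assume "y : un K u j"
   then obtain w where w: "w : F K j" "y = tr K (g1 w)" using g1(2) by (auto simp: fl_def)
   obtain v where v: "!!t. t \<notin> FI K j ==> v t = 0" "L v = w"
   proof (rule lin_inj_surj[where J = "FI K j" and L = L and y = w, OF fin_FI linL])
    show "L v t = 0" if "!!t. t \<notin> FI K j ==> v t = 0" "t \<notin> FI K j" for v t
     by (rule F_support[OF LF[OF FI_F[OF that(1)]] that(2)])
    show "v = 0" if vJ: "!!t. t \<notin> FI K j ==> v t = 0" and "L v = 0" for v
    proof -
     have vF: "v : F K j" by (rule FI_F[OF vJ])
     note vV = F_Vin[OF vF]
     have "tr K (g u v) = tr K (g u 0)"
      using Lg[OF vV] \<open>L v = 0\<close> by (simp add: lin_0[OF glD(1)[OF g1'(1)]] lin_0[OF glD(1)[OF ggl]])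
     hence "tr K (g' u (g u v)) = tr K (g' u (g u 0))"
      by (intro gl_cong[OF gu(2)] glD(2)[OF ggl]) (use vV in auto)
     thus "v = 0" using gu(4)[OF vV] gu(4)[of 0] tr_id[OF F_V[OF vF]] by simp
    qed
    show "w t = 0" if "t \<notin> FI K j" for t by (rule F_support[OF w(1) that])
   qed (rule that)
   have vF: "v : F K j" by (rule FI_F[OF v(1)])
   have "y = tr K (g u v)" using w(2) v(2) Lg[OF F_Vin[OF vF]] by simp
   thus "y : fl K (g u) j" unfolding fl_def using vF by (rule image_eqI)
  qed
  with sub show "un K u j = fl K (g u) j" by blast
 qed auto
qed


section \<open>Homotopy equivalence between consecutive levels\<close>

lemma Phi_continuous:
 fixes f :: "'w::t2_space => nat => nat * nat * nat => vec3"
 assumes A: "A : rep" and k: "0 < k"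
  and f: "continuous_on S f" "!!w. w : S ==> f w : PP k A"
  and h: "opcont S h" "!!w. w : S ==> h w : Sel k A (un k (f w))"
 shows "continuous_on S (%w. pr (Suc k) (Phi k (un k (f w)) (h w)))"
proof (rule continuous_on_local)
 fix w0 assume w0: "w0 : S"
 obtain W g g' where W: "open W" "f w0 : W" "opcont (W Int PP k A) g" "opcont (W Int PP k A) g'"
  "!!u. u : W Int PP k A ==> invm k (g u) (g' u)"
  "!!u j. u : W Int PP k A ==> j <= l ==> un k u j = fl k (g u) j"
  by (rule local_frame[OF f(2)[OF w0]]) (rule that)
 obtain X where X: "open X" "X Int S = f -` W Int S"
  using f(1) W(1) unfolding continuous_on_open_invariant by blast
 have fW: "f w : W Int PP k A" if "w : X Int S" for w using that X(2) f(2) by auto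
 have gc: "opcont (X Int S) (%w. g (f w))"
  unfolding opcont_def conton_def
 proof (intro ballI allI)
  fix v t assume v: "v : Vin"
  have "continuous_on (X Int S) f" by (rule continuous_on_subset[OF f(1)]) simp
  thus "continuous_on (X Int S) (%w. g (f w) v t)"
   by (rule continuous_on_compose2[OF contonD[OF opcontD[OF W(3) v]]]) (use fW in auto)
 qed
 have hc: "opcont (X Int S) h" by (rule opcont_subset[OF h(1)]) simp
 have hs: "h w : sect k" if "w : X Int S" for w using h(2)[of w] that by (simp add: Sel_def)
 let ?G = "%w. lift_gl k (g (f w)) (h w)"
 \<comment> \<open>Any pointwise choice of inverses will do: \<open>pr_continuous\<close> asks for
   continuity of the frame itself, which \<open>opcont_lift_gl\<close> supplies.\<close>
 define G' where "G' w = (SOME g'. invm (Suc k) (?G w) g')" for w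
 have "continuous_on (X Int S) (%w. pr (Suc k) (Phi k (un k (f w)) (h w)))"
 proof (rule pr_continuous[where g = ?G and g' = G'])
  show "opcont (X Int S) ?G" by (rule opcont_lift_gl[OF gc hc hs])
  fix w assume w: "w : X Int S"
  hence wS: "w : S" by simp
  note P = Phi_Z[OF A k un_Z[OF f(2)[OF wS]] h(2)[OF wS] W(5)[OF fW[OF w]] W(6)[OF fW[OF w]]]
  show "invm (Suc k) (?G w) (G' w)" unfolding G'_def using P(1) by (rule someI_ex)
  show "Phi k (un k (f w)) (h w) j = fl (Suc k) (?G w) j" if "j <= l" for j
   using P(2)[OF _ that] that by simp
 qed
 moreover have "w0 : X" using X(2) W(2) w0 by auto
 ultimately show "EX X. open X & w0 : X & continuous_on (X Int S) (%w. pr (Suc k) (Phi k (un k (f w)) (h w)))"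
  using X(1) by (intro exI[of _ X]) simp
qed

lemma rest_continuous:
 assumes A: "A : rep"
 shows "continuous_on (PP (Suc k) A) (%u. pr k (rest k (un (Suc k) u)))"
proof (rule continuous_on_local)
 fix u0 assume u0: "u0 : PP (Suc k) A"
 obtain W g g' where W: "open W" "u0 : W" "opcont (W Int PP (Suc k) A) g" "opcont (W Int PP (Suc k) A) g'"
  "!!u. u : W Int PP (Suc k) A ==> invm (Suc k) (g u) (g' u)"
  "!!u j. u : W Int PP (Suc k) A ==> j <= l ==> un (Suc k) u j = fl (Suc k) (g u) j"
  by (rule local_frame[OF u0]) (rule that)
 have "continuous_on (W Int PP (Suc k) A) (%u. pr k (rest k (un (Suc k) u)))"
 proof (rule pr_continuous[OF W(3)])
  fix u assume u: "u : W Int PP (Suc k) A"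
  show "invm k (g u) (g' u)" using invm_mono[OF _ W(5)[OF u]] by simp
  show "rest k (un (Suc k) u) j = fl k (g u) j" if "j <= l" for j
   using W(6)[OF u that] fl_tr[OF invmD(1)[OF W(5)[OF u]], of k "Suc k" j] that by (simp add: rest_def)
 qed
 thus "EX X. open X & u0 : X & continuous_on (X Int PP (Suc k) A) (%u. pr k (rest k (un (Suc k) u)))"
  using W(1,2) by (intro exI[of _ W]) simp
qed

lemma of_real_comb:
 "(%a t. SUM y:Y. of_real (w y) * h y a t) = (%v. SUM y:Y. cs (of_real (w y)) (h y v))"
 by (intro ext) (simp add: sum_fun_apply)

text \<open>This is the place where the homotopy equivalence depends on rigidity. Near each flag
  \<open>local_lift\<close> gives a continuous frame of some lift, \<open>Sel'_conj\<close> turns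
  the frame into an admissible section, and convexity glues these sections.\<close>

lemma Sel_selection:
 assumes k: "0 < k" and A: "adsurj k A"
 obtains s where "!!u. u : PP k A ==> s u : Sel k A (un k u)" "opcont (PP k A) s"
proof -
 note Ar = adsurj_rep[OF A]
 let ?S = "%u. Sel k A (un k u)"
 have "EX s. (ALL u:PP k A. s u : ?S u) & (ALL a:Vin. ALL t. continuous_on (PP k A) (%u. s u a t))"
 proof (rule continuous_selection)
  fix u0 assume u0: "u0 : PP k A"
  obtain W g g' where W: "open W" "u0 : W" "opcont (W Int PP k A) g" "opcont (W Int PP k A) g'"
   "!!u. u : W Int PP k A ==> invm k (g u) (g' u)"
   "!!u j. u : W Int PP k A ==> j <= l ==> un k u j = fl k (g u) j"
   by (rule local_frame[OF u0]) (rule that)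
  have st: "tr k (A a x) : fl k (g u) j"
   if "u : W Int PP k A" "j <= l" "a : Arr" "x : fl k (g u) j" for u j a x
   using Z_stable[OF un_Z that(2,3), of u k A x] W(6)[OF that(1,2)] that by simp
  have u0W: "u0 : W Int PP k A" using u0 W(2) by simp
  obtain X G G' where X: "open X" "u0 : X" "opcont (X Int (W Int PP k A)) G" "opcont (X Int (W Int PP k A)) G'"
   "!!u. u : X Int (W Int PP k A) ==> invm (Suc k) (G u) (G' u)"
   "!!u v. u : X Int (W Int PP k A) ==> v : Vin ==> tr k (G u v) = tr k (g u v)"
   "!!u j a x. u : X Int (W Int PP k A) ==> j <= l ==> a : Arr ==> x : fl (Suc k) (G u) j ==> tr (Suc k) (A a x) : fl (Suc k) (G u) j"
   by (rule local_lift[OF k A u0W W(3,4)]) ((erule W(5) | (rule st, assumption+))+, rule that)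
  show "EX W s. open W & u0 : W & (ALL u:W Int PP k A. s u : ?S u) \<and>
    (ALL a:Vin. ALL t. continuous_on (W Int PP k A) (%u. s u a t))"
  proof (intro exI conjI ballI allI)
   show "open (X Int W)" "u0 : X Int W" using X(1,2) W(1,2) by auto
   let ?h = "%u v. tr (Suc k) (G u (tr k (G' u v)))"
   have eq: "X Int W Int PP k A = X Int (W Int PP k A)" by auto
   show "continuous_on (X Int W Int PP k A) (%u. ?h u v t)" if v: "v : Vin" for v t
    unfolding eq
    by (rule contonD[OF opcontD[OF opcont_Sel'_conj[OF X(3) invmD(1)[OF X(5)] X(4)] v]])
   fix u assume "u : X Int W Int PP k A"
   hence u: "u : X Int (W Int PP k A)" "u : W Int PP k A" "u : PP k A" by auto
   let ?U = "\<lambda>j\<in>{0..l}. fl (Suc k) (G u) j"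
   have UZ: "?U : Z (Suc k) A"
    unfolding Z_def
   proof (intro CollectI conjI allI impI ballI)
    show "EX g h. invm (Suc k) g h & (ALL j<=l. ?U j = fl (Suc k) g j)"
     by (rule exI[of _ "G u"], rule exI[of _ "G' u"]) (use X(5)[OF u(1)] in simp)
    show "tr (Suc k) (A a x) : ?U j" if "j <= l" "a : Arr" "x : ?U j" for j a x
     using X(7)[OF u(1) that(1,2), of x] that by simp
   qed simp
   have "rest k ?U = un k u"
   proof (rule extensionalityI[of _ "{0..l}"])
    fix j assume "j : {0..l}"
    hence j: "j <= l" by simp
    have "rest k ?U j = fl k (G u) j" using fl_tr[OF invmD(1)[OF X(5)[OF u(1)]], of k "Suc k" j] j by (simp add: rest_def)
    also have "... = fl k (g u) j" unfolding fl_def by (rule image_cong[OF refl]) (rule X(6)[OF u(1) F_Vin])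
    finally show "rest k ?U j = un k u j" using W(6)[OF u(2) j] by simp
   qed (simp_all add: rest_def Z_ext[OF un_Z[OF u(3)]])
   moreover have "?h u : Sel' k ?U" by (rule Sel'_conj[OF X(5)[OF u(1)]]) simp
   ultimately show "?h u : ?S u" using Sel'_Sel(1)[OF Ar k UZ, of "?h u"] by simp
  qed
 next
  fix u and Y :: "(nat => nat * nat * nat => vec3) set set" and w :: "_ => real" and h
  assume u: "u : PP k A" and h: "!!y. y : Y ==> h y : ?S u" and w: "(SUM y:Y. w y) = 1"
  show "(%a t. SUM y:Y. of_real (w y) * h y a t) : ?S u"
   unfolding of_real_comb
   by (rule Sel_comb[OF Ar un_Z[OF u] h]) (use w in \<open>simp_all add: of_real_sum[symmetric] del: of_real_sum\<close>)
 qed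
 then obtain s where "ALL u:PP k A. s u : ?S u" "ALL a:Vin. ALL t. continuous_on (PP k A) (%u. s u a t)"
  by (elim exE conjE)
 thus thesis by (intro that[of s]) (auto simp: opcont_def conton_def)
qed

text \<open>Here the lift is the given flag itself, so its local frames provide the sections
  directly.\<close>

lemma Sel'_selection:
 assumes A: "A : rep"
 obtains s where "!!u. u : PP (Suc k) A ==> s u : Sel' k (un (Suc k) u)" "opcont (PP (Suc k) A) s"
proof -
 let ?S = "%u. Sel' k (un (Suc k) u)"
 let ?P = "PP (Suc k) A"
 have "EX s. (ALL u:?P. s u : ?S u) & (ALL a:Vin. ALL t. continuous_on ?P (%u. s u a t))"
 proof (rule continuous_selection)
  fix u0 assume u0: "u0 : ?P"
  obtain W g g' where W: "open W" "u0 : W" "opcont (W Int ?P) g" "opcont (W Int ?P) g'"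
   "!!u. u : W Int ?P ==> invm (Suc k) (g u) (g' u)"
   "!!u j. u : W Int ?P ==> j <= l ==> un (Suc k) u j = fl (Suc k) (g u) j"
   by (rule local_frame[OF u0]) (rule that)
  show "EX W s. open W & u0 : W & (ALL u:W Int ?P. s u : ?S u) \<and>
    (ALL a:Vin. ALL t. continuous_on (W Int ?P) (%u. s u a t))"
  proof (intro exI conjI ballI allI)
   show "open W" "u0 : W" using W by auto
   let ?h = "%u v. tr (Suc k) (g u (tr k (g' u v)))"
   show "continuous_on (W Int ?P) (%u. ?h u v t)" if v: "v : Vin" for v t
    by (rule contonD[OF opcontD[OF opcont_Sel'_conj[OF W(3) invmD(1)[OF W(5)] W(4)] v]])
   show "?h u : ?S u" if u: "u : W Int ?P" for u
    by (rule Sel'_conj[OF W(5)[OF u] W(6)[OF u]])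
  qed
 next
  fix u and Y :: "(nat => nat * nat * nat => vec3) set set" and w :: "_ => real" and h
  assume u: "u : ?P" and h: "!!y. y : Y ==> h y : ?S u" and w: "(SUM y:Y. w y) = 1"
  show "(%a t. SUM y:Y. of_real (w y) * h y a t) : ?S u"
   unfolding of_real_comb
   by (rule Sel'_comb[OF un_Z[OF u] h]) (use w in \<open>simp_all add: of_real_sum[symmetric] del: of_real_sum\<close>)
 qed
 then obtain s where "ALL u:?P. s u : ?S u" "ALL a:Vin. ALL t. continuous_on ?P (%u. s u a t)"
  by (elim exE conjE)
 thus thesis by (intro that[of s]) (auto simp: opcont_def conton_def)
qed

lemma Sel_convex2:
 assumes A: "A : rep" and U: "U : Z k A" and h: "h : Sel k A U" "h' : Sel k A U"
 shows "(%v. cs (1 - z) (h v) + cs z (h' v)) : Sel k A U"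
proof -
 have "(%v. SUM x:{True, False}. cs (if x then 1 - z else z) ((if x then h else h') v)) : Sel k A U"
  by (rule Sel_comb[OF A U]) (use h in auto)
 thus ?thesis by simp
qed

text \<open>\<open>f\<close> reduces a flag and \<open>g\<close> lifts it by a global section, so
  \<open>f\<close> after \<open>g\<close> is the identity. A flag \<open>u\<close> at the upper
  level is itself the lift of \<open>f u\<close> along the section \<open>s' u\<close>, and the
  straight path from \<open>s (f u)\<close> to \<open>s' u\<close> inside \<open>Sel\<close> deforms
  \<open>g (f u)\<close> into \<open>u\<close>.\<close>

theorem PP_homotopy_equivalent:
 assumes k: "0 < k" and A: "adsurj k A"
 shows "top_of_set (PP (Suc k) A) homotopy_equivalent_space top_of_set (PP k A)"
proof -
 note Ar = adsurj_rep[OF A]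
 let ?P = "PP (Suc k) A" and ?Q = "PP k A"
 obtain s where s: "!!u. u : ?Q ==> s u : Sel k A (un k u)" "opcont ?Q s"
  by (rule Sel_selection[OF k A]) (rule that)
 obtain s' where s': "!!u. u : ?P ==> s' u : Sel' k (un (Suc k) u)" "opcont ?P s'"
  by (rule Sel'_selection[OF Ar]) (rule that)
 define f where "f u = pr k (rest k (un (Suc k) u))" for u
 define g where "g u = pr (Suc k) (Phi k (un k u) (s u))" for u
 have fQ: "f u : ?Q" and unf: "un k (f u) = rest k (un (Suc k) u)" if u: "u : ?P" for u
  using rest_Z[OF Ar un_Z[OF u]] un_pr[OF rest_Z[OF Ar un_Z[OF u]]] by (auto simp: f_def PP_def)
 have fc: "continuous_on ?P f" unfolding f_def by (rule rest_continuous[OF Ar])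
 have gP: "g u : ?P" and fg: "f (g u) = u" if u: "u : ?Q" for u
 proof -
  obtain g0 h0 where g0: "invm k g0 h0" "!!j. j <= l ==> un k u j = fl k g0 j" using Z_flag[OF un_Z[OF u]] by metis
  note P = Phi_Z[OF Ar k un_Z[OF u] s(1)[OF u] g0]
  have PZ: "Phi k (un k u) (s u) : Z (Suc k) A" "rest k (Phi k (un k u) (s u)) = un k u" using P(3,4) by auto
  show "g u : ?P" using PZ(1) by (auto simp: g_def PP_def)
  show "f (g u) = u" using PZ un_pr[OF PZ(1)] pr_un[OF u] by (simp add: f_def g_def)
 qed
 have gc: "continuous_on ?Q g"
  unfolding g_def by (rule Phi_continuous[OF Ar k continuous_on_id _ s(2,1)])
 \<comment> \<open>At time 0 the section chosen over the reduction, at time 1 the one that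
   reproduces the flag.\<close>
 define hh where "hh w v = cs (1 - of_real (fst w)) (s (f (snd w)) v) + cs (of_real (fst w)) (s' (snd w) v)" for w :: "real \<times> (nat => nat * nat * nat => vec3)" and v
 define H where "H w = pr (Suc k) (Phi k (un k (f (snd w))) (hh w))" for w
 let ?T = "{0..1::real} \<times> ?P"
 have s'S: "s' u : Sel k A (un k (f u))" "Phi k (un k (f u)) (s' u) = un (Suc k) u" if u: "u : ?P" for u
  using Sel'_Sel[OF Ar k un_Z[OF u] s'(1)[OF u]] unf[OF u] by auto
 have hS: "hh w : Sel k A (un k (f (snd w)))" if w: "w : ?T" for w
 proof -
  have u: "snd w : ?P" using w by auto
  show ?thesis unfolding hh_def[abs_def]
   by (rule Sel_convex2[OF Ar un_Z[OF fQ[OF u]] s(1)[OF fQ[OF u]] s'S(1)[OF u]])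
 qed
 have fsc: "continuous_on ?T (%w. f (snd w))"
  by (rule continuous_on_compose2[OF fc continuous_on_snd[OF continuous_on_id]]) auto
 have hc: "opcont ?T hh"
  unfolding opcont_def conton_def
 proof (intro ballI allI)
  fix v t assume v: "v : Vin"
  have "continuous_on ?T (%w. s (f (snd w)) v t)"
   by (rule continuous_on_compose2[OF contonD[OF opcontD[OF s(2) v]] fsc]) (use fQ in auto)
  moreover have "continuous_on ?T (%w. s' (snd w) v t)"
   by (rule continuous_on_compose2[OF contonD[OF opcontD[OF s'(2) v]] continuous_on_snd[OF continuous_on_id]]) auto
  ultimately have "continuous_on ?T (%w. (1 - of_real (fst w)) * s (f (snd w)) v t + of_real (fst w) * s' (snd w) v t)"
   by (intro continuous_on_add continuous_on_mult continuous_on_diff continuous_on_const continuous_on_of_real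
     continuous_on_fst[OF continuous_on_id])
  thus "continuous_on ?T (%w. hh w v t)" by (simp add: hh_def)
 qed
 have Hc: "continuous_on ?T H"
  unfolding H_def by (rule Phi_continuous[OF Ar k fsc _ hc hS]) (use fQ in auto)
 have HP: "H w : ?P" if w: "w : ?T" for w
 proof -
  have u: "snd w : ?P" using w by auto
  obtain g0 h0 where g0: "invm k g0 h0" "!!j. j <= l ==> un k (f (snd w)) j = fl k g0 j"
   using Z_flag[OF un_Z[OF fQ[OF u]]] by metis
  have "Phi k (un k (f (snd w))) (hh w) : Z (Suc k) A"
   using Phi_Z(3)[OF Ar k un_Z[OF fQ[OF u]] hS[OF w] g0] by simp
  thus ?thesis by (auto simp: H_def PP_def)
 qed
 have hh01: "hh (0, u) = s (f u)" "hh (1, u) = s' u" for u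
  by (rule ext, simp add: hh_def)+
 have "homotopic_with_canon (%h. True) ?P ?P (g \<circ> f) id"
 proof (subst homotopic_with, simp, intro exI conjI)
  show "continuous_map (prod_topology (top_of_set {0..1}) (top_of_set ?P)) (top_of_set ?P) H"
   using Hc HP by (simp add: subtopology_Times[symmetric] image_subset_iff continuous_map_in_subtopology flip: subtopology_Times)
  show "ALL x:topspace (top_of_set ?P). H (0, x) = (g \<circ> f) x" by (simp add: H_def hh01 g_def)
  show "ALL x:topspace (top_of_set ?P). H (1, x) = id x"
   using s'S(2) pr_un by (simp add: H_def hh01)
 qed simp
 moreover have "homotopic_with_canon (%h. True) ?Q ?Q (f \<circ> g) id"
  by (rule homotopic_with_equal) (use fg gP fQ gc fc in \<open>auto intro!: continuous_on_compose2[OF fc gc]\<close>)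
 ultimately show ?thesis
  unfolding homotopy_equivalent_space_def
  using fc gc fQ gP by (intro exI[of _ f] exI[of _ g]) auto
qed

end

section \<open>The algebra H in terms of generators\<close>

locale gls_pos = gls +
 assumes om: "\<Omega> \<subseteq> {1..n} \<times> {1..n}" and c_pos: "i : {1..n} ==> 0 < c i"
begin

abbreviation "PA \<equiv> path_algebra"

sublocale PA: ring path_algebra
 by (rule path_algebra_ring[OF om])

sublocale HR: ring H
 by (rule H_ring[OF om])

definition pv :: "complex => path => path => complex" where
 "pv z p = (%q. z * path_vector p q)"

lemma pv_apply: "pv z p q = (if q = p then z else 0)"
 by (simp add: pv_def path_vector_def)

lemma pv_1: "pv 1 p = path_vector p"
 by (simp add: pv_def)

lemma PA_zero: "\<zero>\<^bsub>PA\<^esub> = (%_. 0)"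
 by (simp add: path_algebra_def)

lemma PA_plus: "u \<box>PA v = u + v"
 by (simp add: fun_eq_iff path_algebra_add)

lemma PA_cs_closed: "u : carrier PA ==> cs z u : carrier PA"
 by (auto simp: path_algebra_carrier intro: finite_subset)

lemma PA_minus: assumes "u : carrier PA" "v : carrier PA" shows "u \<ominus>\<^bsub>PA\<^esub> v = u - v"
proof -
 have m: "cs (-1) v : carrier PA" using PA_cs_closed[OF assms(2)] .
 have "\<ominus>\<^bsub>PA\<^esub> v = cs (-1) v"
  by (rule PA.minus_equality[OF _ assms(2) m]) (simp add: PA_plus PA_zero fun_eq_iff)
 thus ?thesis by (simp add: PA.minus_eq PA_plus)
qed

lemma pv_closed: "p : paths ==> pv z p : carrier PA"
 using PA_cs_closed[OF path_vector_closed, of p z] by (simp add: pv_def cs_def)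

lemma PA_induct:
 assumes u: "u : carrier PA" and 0: "P 0" and pv: "!!z p. p : paths ==> P (pv z p)"
  and add: "!!u v. u : carrier PA ==> v : carrier PA ==> P u ==> P v ==> P (u + v)"
 shows "P u"
proof -
 have "finite S ==> S \<subseteq> paths ==> (%p. if p : S then u p else 0) : carrier PA & P (%p. if p : S then u p else 0)" for S
 proof (induction S rule: finite_induct)
  case empty
  thus ?case using 0 PA.zero_closed by (simp add: zero_fun_def PA_zero)
 next
  case (insert p S)
  have e: "(%q. if q : insert p S then u q else 0) = pv (u p) p + (%q. if q : S then u q else 0)"
   using insert.hyps by (auto simp: fun_eq_iff pv_apply)
  have p: "pv (u p) p : carrier PA" using pv_closed insert.prems by simp
  show ?case unfolding e
   using insert add[OF p, of "%q. if q : S then u q else 0"] pv[of p] PA.add.m_closed[OF p, of "%q. if q : S then u q else 0"]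
   by (simp add: PA_plus)
 qed
 moreover have "(%p. if p : {p. u p ~= 0} then u p else 0) = u" by (auto simp: fun_eq_iff)
 ultimately show ?thesis using u unfolding path_algebra_carrier by metis
qed

text \<open>Among the cuts of a path in the convolution formula, only the one after
  \<open>length as\<close> arrows can contribute.\<close>

lemma pv_mult:
 "pv z (i, as) \<ast>PA pv w (j, bs) = (if path_source i as = j then pv (z * w) (i, as @ bs) else 0)"
proof (rule ext, clarify)
 fix i' cs
 have "(pv z (i, as) \<ast>PA pv w (j, bs)) (i', cs) =
   (SUM k<=length cs. if k = length as then if i' = i & cs = as @ bs & path_source i as = j then z * w else 0 else 0)"
  unfolding path_algebra_mult
 proof (rule sum.cong[OF refl])
  fix k assume k: "k : {..length cs}"
  show "pv z (i, as) (i', take k cs) * pv w (j, bs) (path_source i' (take k cs), drop k cs) =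
   (if k = length as then if i' = i & cs = as @ bs & path_source i as = j then z * w else 0 else 0)"
  proof (cases "take k cs = as & i' = i & drop k cs = bs & path_source i as = j")
   case True
   have "length (take k cs) = k" using k by simp
   hence "cs = as @ bs" "k = length as" using append_take_drop_id[of k cs] True by auto
   thus ?thesis using True by (simp add: pv_apply)
  next
   case False
   hence "\<not> (k = length as & i' = i & cs = as @ bs & path_source i as = j)" by auto
   moreover have "pv z (i, as) (i', take k cs) * pv w (j, bs) (path_source i' (take k cs), drop k cs) = 0"
   proof (rule ccontr)
    assume "pv z (i, as) (i', take k cs) * pv w (j, bs) (path_source i' (take k cs), drop k cs) ~= 0"
    hence "(i', take k cs) = (i, as)" "(path_source i' (take k cs), drop k cs) = (j, bs)"
     unfolding pv_apply by (metis mult_not_zero)+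
    thus False using False by auto
   qed
   ultimately show ?thesis by auto
  qed
 qed
 also have "... = (if path_source i as = j then pv (z * w) (i, as @ bs) else 0) (i', cs)"
  by (auto simp: pv_apply)
 finally show "(pv z (i, as) \<ast>PA pv w (j, bs)) (i', cs) = (if path_source i as = j then pv (z * w) (i, as @ bs) else 0) (i', cs)" .
qed

abbreviation "rc \<equiv> residue_class"

lemma rc_hom: "rc : Ring.ring_hom PA H"
 using ideal.rcos_ring_hom[OF relations_ideal_ideal[OF om]]
 unfolding H_def residue_class_def[abs_def] .

lemmas rc_closed = ring_hom_closed[OF rc_hom] and rc_mult = ring_hom_mult[OF rc_hom]
 and rc_one = ring_hom_one[OF rc_hom]

lemma rc_add: "u : carrier PA ==> v : carrier PA ==> rc (u + v) = rc u \<box>H rc v"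
 using ring_hom_add[OF rc_hom] by (simp add: PA_plus)

lemma rc_zero: "rc 0 = \<zero>\<^bsub>H\<^esub>"
 using ring_hom_zero[OF rc_hom PA.ring_axioms HR.ring_axioms] by (simp add: PA_zero zero_fun_def)

lemma rc_cases: assumes "h : carrier H" obtains u where "u : carrier PA" "h = rc u"
 using assms by (auto simp: H_def FactRing_def A_RCOSETS_def' residue_class_def)

lemma rc_eq: "u : carrier PA ==> v : carrier PA ==> rc u = rc v \<longleftrightarrow> u - v : relations_ideal"
 using PA.quotient_eq_iff_same_a_r_cos[OF relations_ideal_ideal[OF om]]
 by (simp add: residue_class_def PA_minus)

lemma rc_rel: "u : relations_ideal ==> rc u = \<zero>\<^bsub>H\<^esub>"
proof -
 assume u: "u : relations_ideal"
 hence "u : carrier PA" using ideal.Icarr[OF relations_ideal_ideal[OF om]] by blast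
 moreover have "0 : carrier PA" using PA.zero_closed by (simp add: PA_zero zero_fun_def)
 ultimately have "rc u = rc 0" using rc_eq[of u 0] u by simp
 thus ?thesis by (simp add: rc_zero)
qed

definition arr :: "arrow => (path => complex) set" where
 "arr a = rc (path_vector (arrow_target a, [a]))"

lemma arrow_ends: "a : arrows ==> arrow_target a : {1..n} & arrow_source a : {1..n}"
 using om by (auto simp: arrows_def)

lemma nil_path: "i : {1..n} ==> (i, []) : paths"
 and arr_path: "a : arrows ==> (arrow_target a, [a]) : paths"
 using arrow_ends by (auto simp: paths_def)

lemma Eps_arrow: "i : {1..n} ==> Eps i : arrows"
 and Alpha_arrow: "(i, j) : \<Omega> ==> 1 <= h ==> h <= g i j ==> Alpha i j h : arrows"
 by (auto simp: arrows_def)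

lemma eps_arr: "eps i = arr (Eps i)"
 by (simp add: eps_def arr_def)

lemma one_PA: "\<one>\<^bsub>PA\<^esub> = (%(i, as). if i : {1..n} & as = [] then 1 else 0)"
 by (simp add: path_algebra_def)

lemma scalar_rc: "scalar z = rc (cs z \<one>\<^bsub>PA\<^esub>)"
 by (simp add: scalar_def cs_def)

lemma scalar_closed [simp]: "scalar z : carrier H"
 unfolding scalar_rc by (intro rc_closed PA_cs_closed PA.one_closed)

lemma idem_closed [simp]: "i : {1..n} ==> idem i : carrier H"
 and arr_closed [simp]: "a : arrows ==> arr a : carrier H"
 unfolding idem_def arr_def by (intro rc_closed path_vector_closed nil_path arr_path; simp)+

lemma cs_one_mult: "u : carrier PA ==> cs z \<one>\<^bsub>PA\<^esub> \<ast>PA u = cs z u"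
 and mult_cs_one: "u : carrier PA ==> u \<ast>PA cs z \<one>\<^bsub>PA\<^esub> = cs z u"
proof -
 assume u: "u : carrier PA"
 have "(cs z \<one>\<^bsub>PA\<^esub> \<ast>PA u) (i, as) = z * (\<one>\<^bsub>PA\<^esub> \<ast>PA u) (i, as)" for i as
  unfolding path_algebra_mult by (simp add: sum_distrib_left mult.assoc)
 thus "cs z \<one>\<^bsub>PA\<^esub> \<ast>PA u = cs z u" using u by (simp add: fun_eq_iff)
 have "(u \<ast>PA cs z \<one>\<^bsub>PA\<^esub>) (i, as) = z * (u \<ast>PA \<one>\<^bsub>PA\<^esub>) (i, as)" for i as
  unfolding path_algebra_mult by (simp add: sum_distrib_left mult.left_commute)
 thus "u \<ast>PA cs z \<one>\<^bsub>PA\<^esub> = cs z u" using u by (simp add: fun_eq_iff)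
qed

lemma rc_cs: "u : carrier PA ==> rc (cs z u) = scalar z \<ast>H rc u"
 using rc_mult[of "cs z \<one>\<^bsub>PA\<^esub>" u] PA_cs_closed[OF PA.one_closed] cs_one_mult by (simp add: scalar_rc)

lemma scalar_central: "h : carrier H ==> h \<ast>H scalar z = scalar z \<ast>H h"
proof -
 assume "h : carrier H"
 then obtain u where u: "u : carrier PA" "h = rc u" by (rule rc_cases)
 hence "h \<ast>H scalar z = rc (u \<ast>PA cs z \<one>\<^bsub>PA\<^esub>)" using rc_mult PA_cs_closed[OF PA.one_closed] by (simp add: scalar_rc)
 thus ?thesis using rc_cs[OF u(1)] u mult_cs_one by simp
qed

lemma scalar_mult: "scalar z \<ast>H scalar w = scalar (z * w)"
 using rc_cs[OF PA_cs_closed[OF PA.one_closed, of w], of z] by (simp add: scalar_rc)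

lemma scalar_add: "scalar z \<box>H scalar w = scalar (z + w)"
 using rc_add[OF PA_cs_closed PA_cs_closed, OF PA.one_closed PA.one_closed, of z w] by (simp add: scalar_rc cs_add)

lemma scalar_1: "scalar 1 = \<one>\<^bsub>H\<^esub>" and scalar_0: "scalar 0 = \<zero>\<^bsub>H\<^esub>"
 using rc_one rc_zero by (simp_all add: scalar_rc)

text \<open>The class of a path is the product of the classes of its arrows followed by an
  idempotent, and every element is a combination of such classes.\<close>

lemma H_induct:
 assumes h: "h : carrier H" and sc: "!!z. P (scalar z)" and id: "!!i. i : {1..n} ==> P (idem i)"
  and ar: "!!a. a : arrows ==> P (arr a)"
  and add: "!!x y. x : carrier H ==> y : carrier H ==> P x ==> P y ==> P (x \<box>H y)"
  and mult: "!!x y. x : carrier H ==> y : carrier H ==> P x ==> P y ==> P (x \<ast>H y)"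
 shows "P h"
proof -
 obtain u where u: "u : carrier PA" "h = rc u" using h by (rule rc_cases)
 have pth: "(i, as) : paths ==> P (rc (path_vector (i, as)))" for i as
 proof (induction as arbitrary: i)
  case Nil
  thus ?case using id[of i] by (simp add: paths_def idem_def)
 next
  case (Cons a as)
  have a: "a : arrows" "arrow_target a = i" "(arrow_source a, as) : paths"
   using Cons.prems arrow_ends by (auto simp: paths_def)
  have "pv 1 (i, [a]) \<ast>PA pv 1 (arrow_source a, as) = pv 1 (i, a # as)" by (simp add: pv_mult)
  hence "rc (path_vector (i, a # as)) = arr a \<ast>H rc (path_vector (arrow_source a, as))"
   using rc_mult[OF path_vector_closed path_vector_closed, OF arr_path[OF a(1)] a(3)] a by (simp add: pv_1 arr_def)
  thus ?case using mult[OF arr_closed[OF a(1)] rc_closed[OF path_vector_closed[OF a(3)]] ar[OF a(1)] Cons.IH[OF a(3)]] by simp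
 qed
 have "P (rc u)"
  using u(1)
 proof (rule PA_induct)
  show "P (rc 0)" using sc[of 0] by (simp add: rc_zero scalar_0)
  fix z p assume p: "p : paths"
  have "rc (pv z p) = scalar z \<ast>H rc (path_vector p)"
   using rc_cs[OF path_vector_closed[OF p], of z] by (simp add: pv_def cs_def)
  thus "P (rc (pv z p))"
   using mult[OF scalar_closed rc_closed[OF path_vector_closed[OF p]] sc] pth p by (cases p) simp
 next
  fix u v assume uv: "u : carrier PA" "v : carrier PA" "P (rc u)" "P (rc v)"
  thus "P (rc (u + v))" using add[OF rc_closed rc_closed] rc_add by simp
 qed
 thus ?thesis using u by simp
qed

definition epsp :: "nat => nat => (path => complex) set" where
 "epsp i a = rc (path_vector (i, replicate a (Eps i)))"

lemma loop_path: "i : {1..n} ==> (i, replicate a (Eps i)) : paths"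
 using composable_loops[of i a] Eps_arrow by (auto simp: paths_def)

lemma epsp_closed [simp]: "i : {1..n} ==> epsp i a : carrier H"
 unfolding epsp_def by (intro rc_closed path_vector_closed loop_path)

lemma epsp_0: "epsp i 0 = idem i" and epsp_1: "epsp i (Suc 0) = eps i"
 by (simp_all add: epsp_def idem_def eps_def)

lemma epsp_mult: "i : {1..n} ==> epsp i a \<ast>H epsp i b = epsp i (a + b)"
proof -
 assume i: "i : {1..n}"
 have "pv 1 (i, replicate a (Eps i)) \<ast>PA pv 1 (i, replicate b (Eps i)) = pv 1 (i, replicate (a + b) (Eps i))"
  using composable_loops[OF i, of a] by (simp add: pv_mult replicate_add)
 thus ?thesis
  using rc_mult[OF path_vector_closed path_vector_closed, OF loop_path loop_path, OF i i, of a b] by (simp add: pv_1 epsp_def)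
qed

lemma epsp_nil: "i : {1..n} ==> c i <= a ==> epsp i a = \<zero>\<^bsub>H\<^esub>"
proof -
 assume i: "i : {1..n}" and a: "c i <= a"
 have "path_vector (i, replicate (c i) (Eps i)) : relations_ideal"
  unfolding relations_ideal_def
  using PA.genideal_self[OF relations_closed[OF om]] i by (auto simp: nilpotency_relations_def)
 hence "epsp i (c i) = \<zero>\<^bsub>H\<^esub>" using rc_rel by (simp add: epsp_def)
 hence "epsp i (c i) \<ast>H epsp i (a - c i) = \<zero>\<^bsub>H\<^esub>" using i by simp
 thus ?thesis using epsp_mult[OF i] a by simp
qed

lemma idem_idem: "i : {1..n} ==> j : {1..n} ==> idem i \<ast>H idem j = (if i = j then idem i else \<zero>\<^bsub>H\<^esub>)"
proof -
 assume i: "i : {1..n}" and j: "j : {1..n}"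
 have "pv 1 (i, []) \<ast>PA pv 1 (j, []) = (if i = j then pv 1 (i, []) else 0)" by (simp add: pv_mult)
 thus ?thesis
  using rc_mult[OF path_vector_closed path_vector_closed, OF nil_path nil_path, OF i j] rc_zero by (auto simp: pv_1 idem_def)
qed

lemma idem_arr: "a : arrows ==> i : {1..n} ==> idem i \<ast>H arr a = (if i = arrow_target a then arr a else \<zero>\<^bsub>H\<^esub>)"
 and arr_idem: "a : arrows ==> i : {1..n} ==> arr a \<ast>H idem i = (if i = arrow_source a then arr a else \<zero>\<^bsub>H\<^esub>)"
proof -
 assume a: "a : arrows" and i: "i : {1..n}"
 have "pv 1 (i, []) \<ast>PA pv 1 (arrow_target a, [a]) = (if i = arrow_target a then pv 1 (arrow_target a, [a]) else 0)" by (simp add: pv_mult)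
 thus "idem i \<ast>H arr a = (if i = arrow_target a then arr a else \<zero>\<^bsub>H\<^esub>)"
  using rc_mult[OF path_vector_closed path_vector_closed, OF nil_path arr_path, OF i a] rc_zero by (auto simp: pv_1 idem_def arr_def)
 have "pv 1 (arrow_target a, [a]) \<ast>PA pv 1 (i, []) = (if i = arrow_source a then pv 1 (arrow_target a, [a]) else 0)" by (auto simp: pv_mult)
 thus "arr a \<ast>H idem i = (if i = arrow_source a then arr a else \<zero>\<^bsub>H\<^esub>)"
  using rc_mult[OF path_vector_closed path_vector_closed, OF arr_path nil_path, OF a i] rc_zero by (auto simp: pv_1 idem_def arr_def)
qed

lemma commutation:
 assumes a: "(i, j) : \<Omega>" "1 <= h" "h <= g i j"
 shows "epsp i (f j i) \<ast>H arr (Alpha i j h) = arr (Alpha i j h) \<ast>H epsp j (f i j)"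
proof -
 have ij: "i : {1..n}" "j : {1..n}" using a om by auto
 note A = Alpha_arrow[OF a]
 let ?l = "path_vector (i, replicate (f j i) (Eps i) @ [Alpha i j h])" and ?r = "path_vector (i, [Alpha i j h] @ replicate (f i j) (Eps j))"
 have lc: "?l : carrier PA" "?r : carrier PA"
  using A ij composable_loops[OF ij(1)] composable_loops[OF ij(2)] Eps_arrow
  by (auto intro!: path_vector_closed simp: paths_def composable_append)
 have "?l - ?r : relations_ideal"
 proof -
  have "(%p. ?l p - ?r p) : commutation_relations" unfolding commutation_relations_def using a by blast
  thus ?thesis unfolding relations_ideal_def
   using PA.genideal_self[OF relations_closed[OF om]] by (auto simp: fun_diff_def)
 qed
 hence e: "rc ?l = rc ?r" using rc_eq[OF lc] by simp
 have "pv 1 (i, replicate (f j i) (Eps i)) \<ast>PA pv 1 (i, [Alpha i j h]) = pv 1 (i, replicate (f j i) (Eps i) @ [Alpha i j h])"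
  using composable_loops[OF ij(1)] by (simp add: pv_mult)
 hence 1: "epsp i (f j i) \<ast>H arr (Alpha i j h) = rc ?l"
  using rc_mult[OF path_vector_closed path_vector_closed, OF loop_path arr_path, OF ij(1) A, of "f j i"] by (simp add: pv_1 epsp_def arr_def)
 have "pv 1 (i, [Alpha i j h]) \<ast>PA pv 1 (j, replicate (f i j) (Eps j)) = pv 1 (i, [Alpha i j h] @ replicate (f i j) (Eps j))"
  by (simp add: pv_mult)
 hence 2: "arr (Alpha i j h) \<ast>H epsp j (f i j) = rc ?r"
  using rc_mult[OF path_vector_closed path_vector_closed, OF arr_path loop_path, OF A ij(2), of "f i j"] by (simp add: pv_1 epsp_def arr_def)
 show ?thesis using 1 2 e by simp
qed

lemma one_idem: "\<one>\<^bsub>H\<^esub> = (\<Oplus>\<^bsub>H\<^esub>i\<in>{1..n}. idem i)"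
proof -
 have "X \<subseteq> {1..n} ==> finite X ==> (SUM i:X. path_vector (i, [])) : carrier PA \<and>
   rc (SUM i:X. path_vector (i, [])) = (\<Oplus>\<^bsub>H\<^esub>i\<in>X. idem i)" for X
 proof (induction X rule: infinite_finite_induct)
  case empty
  thus ?case using rc_zero PA.zero_closed by (simp add: PA_zero zero_fun_def)
 next
  case (insert i X)
  hence i: "path_vector (i, []) : carrier PA" using path_vector_closed nil_path by auto
  have "i : {1..n}" "idem : X \<rightarrow> carrier H" using insert by auto
  moreover have "(SUM i:insert i X. path_vector (i, [])) = path_vector (i, []) + (SUM i:X. path_vector (i, []))"
   by (rule sum.insert[OF insert.hyps])
  moreover have IH: "(SUM i:X. path_vector (i, [])) : carrier PA" "rc (SUM i:X. path_vector (i, [])) = (\<Oplus>\<^bsub>H\<^esub>i\<in>X. idem i)"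
   using insert by auto
  ultimately show ?case
   using rc_add[OF i IH(1)] PA.add.m_closed[OF i IH(1)] insert.hyps
   by (simp only: HR.finsum_insert[of X i idem] idem_def[symmetric] idem_closed PA_plus IH(2)) simp
 qed simp
 from this[of "{1..n}"] have "rc (SUM i:{1..n}. path_vector (i, [])) = (\<Oplus>\<^bsub>H\<^esub>i\<in>{1..n}. idem i)" by simp
 moreover have "(SUM i:{1..n}. path_vector (i, [])) = \<one>\<^bsub>PA\<^esub>"
 proof (rule ext, clarify)
  fix i' as
  have "(SUM i:{1..n}. path_vector (i, [])) (i', as) = (SUM i:{1..n}. if i = i' then if as = [] then 1 else 0 else 0)"
   unfolding sum_fun_apply by (rule sum.cong) (auto simp: path_vector_def)
  thus "(SUM i:{1..n}. path_vector (i, [])) (i', as) = \<one>\<^bsub>PA\<^esub> (i', as)" by (simp add: one_PA)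
 qed
 ultimately show ?thesis using rc_one by simp
qed

end

section \<open>Modules from idempotents and arrow maps satisfying the relations\<close>

locale gls_rep = gls_pos +
 fixes N :: nat and e :: "nat => (nat => complex) => nat => complex"
  and T :: "arrow => (nat => complex) => nat => complex"
 assumes e_lin: "i : {1..n} ==> lin (e i)" and T_lin: "a : arrows ==> lin (T a)"
  and e_closed: "i : {1..n} ==> v : coord_space N ==> e i v : coord_space N"
  and T_closed: "a : arrows ==> v : coord_space N ==> T a v : coord_space N"
  and e_e: "i : {1..n} ==> j : {1..n} ==> v : coord_space N ==> e i (e j v) = (if i = j then e i v else 0)"
  and e_sum: "v : coord_space N ==> (SUM i:{1..n}. e i v) = v"
  and T_source: "a : arrows ==> v : coord_space N ==> T a (e (arrow_source a) v) = T a v"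
  and T_target: "a : arrows ==> v : coord_space N ==> e (arrow_target a) (T a v) = T a v"
  and nilp: "i : {1..n} ==> v : coord_space N ==> (T (Eps i) ^^ c i) (e i v) = 0"
  and comm: "(i, j) : \<Omega> ==> 1 <= h ==> h <= g i j ==> v : coord_space N ==>
   (T (Eps i) ^^ f j i) (T (Alpha i j h) v) = T (Alpha i j h) ((T (Eps j) ^^ f i j) (e j v))"
begin

lemma coord_sub: "0 : coord_space N" "v : coord_space N ==> w : coord_space N ==> v + w : coord_space N"
  "v : coord_space N ==> cs z v : coord_space N"
 by (auto simp: coord_space_def)

primrec pact :: "nat => arrow list => (nat => complex) => nat => complex" where
 "pact i [] = e i"
| "pact i (a # as) = (%v. T a (pact (arrow_source a) as v))"

lemma pact_props:
 assumes "(i, as) : paths"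
 shows "lin (pact i as) & (ALL v:coord_space N. pact i as v : coord_space N & e i (pact i as v) = pact i as v \<and>
   pact i as (e (path_source i as) v) = pact i as v)"
 using assms
proof (induction as arbitrary: i)
 case Nil
 thus ?case using e_lin e_closed e_e by (auto simp: paths_def)
next
 case (Cons a as)
 have a: "a : arrows" "arrow_target a = i" "(arrow_source a, as) : paths"
  using Cons.prems arrow_ends by (auto simp: paths_def)
 show ?case using Cons.IH[OF a(3)] T_lin[OF a(1)] T_closed[OF a(1)] T_target[OF a(1)] a(2)
  lin_comp[OF T_lin[OF a(1)], of "pact (arrow_source a) as"] by auto
qed

lemma pact_append:
 assumes "(i, as @ bs) : paths" "v : coord_space N"
 shows "pact i (as @ bs) v = pact i as (pact (path_source i as) bs v)"
 using assms
proof (induction as arbitrary: i)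
 case Nil
 thus ?case using pact_props[of i bs] by simp
next
 case (Cons a as)
 have "(arrow_source a, as @ bs) : paths" using Cons.prems arrow_ends[of a] by (auto simp: paths_def)
 thus ?case using Cons.IH Cons.prems by simp
qed

definition uact :: "(path => complex) => (nat => complex) => nat => complex" where
 "uact u v = (\<Sum>q | u q ~= 0. cs (u q) (pact (fst q) (snd q) v))"

lemma uact_superset: "finite S ==> {q. u q ~= 0} \<subseteq> S ==> uact u v = (SUM q:S. cs (u q) (pact (fst q) (snd q) v))"
 unfolding uact_def by (rule sum.mono_neutral_left) auto

lemma uact_add:
 assumes "u : carrier PA" "w : carrier PA" shows "uact (u + w) v = uact u v + uact w v"
proof -
 let ?S = "{q. u q ~= 0} \<union> {q. w q ~= 0}"
 have S: "finite ?S" using assms by (auto simp: path_algebra_carrier)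
 have "{q. (u + w) q ~= 0} \<subseteq> ?S" by auto
 thus ?thesis
  using uact_superset[OF S, of "u + w"] uact_superset[OF S, of u] uact_superset[OF S, of w]
  by (simp add: cs_add sum.distrib)
qed

lemma uact_0: "uact 0 v = 0" by (simp add: uact_def)

lemma uact_pv: "uact (pv z p) v = cs z (pact (fst p) (snd p) v)"
proof -
 have "{q. pv z p q ~= 0} \<subseteq> {p}" by (auto simp: pv_apply split: if_splits)
 thus ?thesis using uact_superset[of "{p}" "pv z p" v] by (simp add: pv_apply)
qed

lemma uact_lin:
 assumes "u : carrier PA" shows "lin (uact u)"
proof -
 have "lin (%v. \<Sum>q | u q ~= 0. cs (u q) (pact (fst q) (snd q) v))"
  by (rule lin_sum', rule lin_cs) (use assms pact_props in \<open>force simp: path_algebra_carrier\<close>)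
 thus ?thesis by (simp add: uact_def[abs_def])
qed

lemma coord_sum: "(!!x. x : X ==> F x : coord_space N) ==> (SUM x:X. F x) : coord_space N"
 by (induction X rule: infinite_finite_induct) (auto intro: coord_sub)

lemma uact_closed:
 assumes "u : carrier PA" "v : coord_space N" shows "uact u v : coord_space N"
 unfolding uact_def
proof (rule coord_sum, rule coord_sub(3))
 fix q assume "q : {q. u q ~= 0}"
 hence "q : paths" using assms(1) unfolding path_algebra_carrier by blast
 thus "pact (fst q) (snd q) v : coord_space N" using pact_props[of "fst q" "snd q"] assms(2) by simp
qed

text \<open>If the paths do not meet, their product is zero, and so is the composite of their
  actions since two different idempotents meet in the middle.\<close>

lemma uact_mult_pv:
 assumes p: "p : paths" "q : paths" and v: "v : coord_space N"
 shows "uact (pv z p \<ast>PA pv w q) v = uact (pv z p) (uact (pv w q) v)"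
proof -
 obtain i as j bs where pq: "p = (i, as)" "q = (j, bs)" by (cases p, cases q)
 note P = pact_props[OF p(1)[unfolded pq]] and Q = pact_props[OF p(2)[unfolded pq]]
 have s: "path_source i as : {1..n}" using path_source_in[OF om] p(1) pq by (auto simp: paths_def)
 have j: "j : {1..n}" using p(2) pq by (auto simp: paths_def)
 show ?thesis
 proof (cases "path_source i as = j")
  case True
  have "(i, as @ bs) : paths" using p pq True by (auto simp: paths_def composable_append)
  thus ?thesis using True P v
   by (simp add: pq pv_mult uact_pv pact_append lin_scale[of "pact i as"])
 next
  case False
  let ?x = "pact j bs v"
  have x: "?x : coord_space N" "e j ?x = ?x" using Q v by auto
  have "pact i as ?x = pact i as (e (path_source i as) (e j ?x))" using P x by simp
  also have "... = pact i as 0" using e_e[OF s j x(1)] False by simp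
  also have "... = 0" using lin_0[of "pact i as"] P by simp
  finally show ?thesis using False P
   by (simp add: pq pv_mult uact_pv uact_0 lin_scale[of "pact i as"])
 qed
qed

lemma uact_mult:
 assumes u: "u : carrier PA" and w: "w : carrier PA" and v: "v : coord_space N"
 shows "uact (u \<ast>PA w) v = uact u (uact w v)"
proof -
 have 0: "(0 :: path => complex) = \<zero>\<^bsub>PA\<^esub>" by (simp add: PA_zero zero_fun_def)
 have pvu: "uact (pv z p \<ast>PA w) v = uact (pv z p) (uact w v)" if p: "p : paths" for z p
  using w
 proof (rule PA_induct)
  show "uact (pv z p \<ast>PA 0) v = uact (pv z p) (uact 0 v)"
   using pv_closed[OF p] by (simp add: 0 uact_0[unfolded 0] lin_0[OF uact_lin, unfolded 0])
  show "uact (pv z p \<ast>PA pv z' q) v = uact (pv z p) (uact (pv z' q) v)" if "q : paths" for z' q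
   by (rule uact_mult_pv[OF p that v])
  fix x y assume xy: "x : carrier PA" "y : carrier PA" "uact (pv z p \<ast>PA x) v = uact (pv z p) (uact x v)"
   "uact (pv z p \<ast>PA y) v = uact (pv z p) (uact y v)"
  have "pv z p \<ast>PA (x + y) = (pv z p \<ast>PA x) + (pv z p \<ast>PA y)"
   using PA.r_distr[OF xy(1,2) pv_closed[OF p, of z]] by (simp add: PA_plus)
  thus "uact (pv z p \<ast>PA (x + y)) v = uact (pv z p) (uact (x + y) v)"
   using xy pv_closed[OF p, of z] PA.m_closed by (simp add: uact_add lin_add[OF uact_lin])
 qed
 show ?thesis
  using u
 proof (rule PA_induct)
  show "uact (0 \<ast>PA w) v = uact 0 (uact w v)" using w by (simp add: 0) (simp add: 0[symmetric] uact_0)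
  show "uact (pv z p \<ast>PA w) v = uact (pv z p) (uact w v)" if "p : paths" for z p by (rule pvu[OF that])
  fix x y assume xy: "x : carrier PA" "y : carrier PA" "uact (x \<ast>PA w) v = uact x (uact w v)"
   "uact (y \<ast>PA w) v = uact y (uact w v)"
  have "(x + y) \<ast>PA w = (x \<ast>PA w) + (y \<ast>PA w)"
   using PA.l_distr[OF xy(1,2) w] by (simp add: PA_plus)
  thus "uact ((x + y) \<ast>PA w) v = uact (x + y) (uact w v)"
   using xy w PA.m_closed by (simp add: uact_add)
 qed
qed

lemma pact_loops: "v : coord_space N ==> i : {1..n} ==> pact i (replicate a (Eps i)) v = (T (Eps i) ^^ a) (e i v)"
 by (induction a) auto

text \<open>The annihilator in the path algebra. It is an ideal containing the defining relations,
  hence the whole \<open>relations_ideal\<close>, so the action descends to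
  \<open>H\<close>.\<close>

definition ker :: "(path => complex) set" where
 "ker = {u \<in> carrier PA. ALL v:coord_space N. uact u v = 0}"

lemma uact_minus: assumes "u : carrier PA" "w : carrier PA" shows "uact (u - w) v = uact u v - uact w v"
proof -
 have "u - w : carrier PA" using PA.minus_closed[OF assms] PA_minus[OF assms] by simp
 hence "uact (u - w + w) v = uact (u - w) v + uact w v" using uact_add assms(2) by blast
 thus ?thesis by simp
qed

lemma ker_ideal: "ideal ker PA"
proof (rule idealI[OF PA.ring_axioms])
 show "subgroup ker (add_monoid PA)"
 proof (rule PA.add.subgroupI)
  show "ker \<subseteq> carrier PA" by (auto simp: ker_def)
  have "0 : ker" using PA.zero_closed by (simp add: ker_def uact_0 PA_zero zero_fun_def[symmetric])
  thus "ker ~= {}" by blast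
  fix x y assume x: "x : ker" and y: "y : ker"
  show "x \<box>PA y : ker" using x y PA.add.m_closed by (auto simp: ker_def PA_plus uact_add)
  have x': "x : carrier PA" using x by (simp add: ker_def)
  have "\<ominus>\<^bsub>PA\<^esub> x = \<zero>\<^bsub>PA\<^esub> - x" using PA_minus[OF PA.zero_closed x'] x' by (simp add: PA.minus_eq)
  thus "\<ominus>\<^bsub>PA\<^esub> x : ker" using x PA.a_inv_closed[OF x'] uact_minus[OF PA.zero_closed x'] uact_0
   by (simp add: ker_def PA_zero zero_fun_def[symmetric])
 qed
 fix a x assume a: "a : ker" and x: "x : carrier PA"
 hence a': "a : carrier PA" by (simp add: ker_def)
 show "x \<ast>PA a : ker" "a \<ast>PA x : ker"
  using a x a' uact_mult[OF x a'] uact_mult[OF a' x] uact_closed lin_0[OF uact_lin[OF x]] by (auto simp: ker_def)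
qed

lemma relations_ker: "relations_ideal \<subseteq> ker"
 unfolding relations_ideal_def
proof (rule PA.genideal_minimal[OF ker_ideal], rule Un_least)
 show "nilpotency_relations \<subseteq> ker"
 proof
  fix u assume "u : nilpotency_relations"
  then obtain i where i: "i : {1..n}" "u = pv 1 (i, replicate (c i) (Eps i))" by (auto simp: nilpotency_relations_def pv_1)
  thus "u : ker" using pv_closed[OF loop_path[OF i(1)]] nilp[OF i(1)]
   by (auto simp: ker_def uact_pv pact_loops)
 qed
 show "commutation_relations \<subseteq> ker"
 proof
  fix u assume "u : commutation_relations"
  then obtain i j h where a: "(i, j) : \<Omega>" "1 <= h" "h <= g i j" and
   u: "u = (%q. path_vector (i, replicate (f j i) (Eps i) @ [Alpha i j h]) q
     - path_vector (i, [Alpha i j h] @ replicate (f i j) (Eps j)) q)"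
   unfolding commutation_relations_def by blast
  have ij: "i : {1..n}" "j : {1..n}" using a om by auto
  note A = Alpha_arrow[OF a]
  let ?l = "(i, replicate (f j i) (Eps i) @ [Alpha i j h])" and ?r = "(i, [Alpha i j h] @ replicate (f i j) (Eps j))"
  have lr: "?l : paths" "?r : paths"
   using A ij composable_loops[OF ij(1)] composable_loops[OF ij(2)] Eps_arrow by (auto simp: paths_def composable_append)
  have u': "u = pv 1 ?l - pv 1 ?r" unfolding u by (simp add: pv_1 fun_eq_iff)
  have "uact u v = 0" if v: "v : coord_space N" for v
  proof -
   have "pact i (replicate (f j i) (Eps i) @ [Alpha i j h]) v = (T (Eps i) ^^ f j i) (T (Alpha i j h) v)"
    using pact_append[OF lr(1) v] composable_loops[OF ij(1)] pact_loops[OF T_closed[OF A v] ij(1)] T_source[OF A v] T_target[OF A v] by simp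
   moreover have "pact i ([Alpha i j h] @ replicate (f i j) (Eps j)) v = T (Alpha i j h) ((T (Eps j) ^^ f i j) (e j v))"
    using pact_loops[OF v ij(2)] by simp
   ultimately show ?thesis
    unfolding u' uact_minus[OF pv_closed[OF lr(1)] pv_closed[OF lr(2)]] using comm[OF a v] by (simp add: uact_pv)
  qed
  moreover have "u : carrier PA" using PA.minus_closed[OF pv_closed pv_closed, OF lr] PA_minus[OF pv_closed pv_closed, OF lr] u' by simp
  ultimately show "u : ker" by (simp add: ker_def)
 qed
qed

text \<open>A residue class acts through an arbitrarily chosen representative; independence of the
  choice is \<open>Mod_smult\<close>.\<close>

definition RMod :: "((path => complex) set, nat => complex) module" where
 "RMod = \<lparr>carrier = coord_space N, mult = undefined, one = undefined, zero = (%_. 0),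
   add = (%v w a. v a + w a), smult = (%X. uact (SOME u. u : carrier PA & rc u = X))\<rparr>"

lemma Mod_smult: assumes u: "u : carrier PA" and v: "v : coord_space N" shows "rc u \<star>RMod v = uact u v"
proof -
 define w where "w = (SOME w. w : carrier PA & rc w = rc u)"
 have w: "w : carrier PA & rc w = rc u" unfolding w_def by (rule someI[of _ u]) (use u in simp)
 hence "w - u : ker" using rc_eq[of w u] u relations_ker by blast
 hence "uact w v - uact u v = 0" using uact_minus w u v by (simp add: ker_def)
 thus ?thesis by (simp add: RMod_def w_def)
qed

lemma Mod_simps: "carrier RMod = coord_space N" "\<zero>\<^bsub>RMod\<^esub> = 0" "v \<box>RMod w = v + w"
 by (simp_all add: RMod_def fun_eq_iff)

lemma Mod_scalar: assumes v: "v : coord_space N" shows "scalar z \<star>RMod v = cs z v"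
proof -
 have inj: "inj_on (%i. (i, [] :: arrow list)) {1..n}" by (auto simp: inj_on_def)
 have sub: "{q. cs z \<one>\<^bsub>PA\<^esub> q ~= 0} \<subseteq> (%i. (i, [])) ` {1..n}" by (auto simp: one_PA split: if_splits)
 have "uact (cs z \<one>\<^bsub>PA\<^esub>) v = (SUM q:(%i. (i, [])) ` {1..n}. cs (cs z \<one>\<^bsub>PA\<^esub> q) (pact (fst q) (snd q) v))"
  by (rule uact_superset[OF _ sub]) simp
 also have "... = (SUM i:{1..n}. cs z (e i v))"
  unfolding sum.reindex[OF inj] by (rule sum.cong) (auto simp: one_PA)
 also have "... = cs z v" using e_sum[OF v] by (simp add: cs_sum[symmetric])
 finally show ?thesis
  unfolding scalar_rc using Mod_smult[OF PA_cs_closed[OF PA.one_closed] v] by simp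
qed

lemma Mod_module: "left_module H RMod"
proof (intro left_module.intro left_module_axioms.intro HR.ring_axioms)
 show "abelian_group RMod"
 proof (rule abelian_groupI, goal_cases)
  case (6 x)
  thus ?case by (intro bexI[of _ "cs (-1) x"]) (auto simp: Mod_simps coord_space_def)
 qed (auto simp: Mod_simps coord_sub algebra_simps)
next
 fix x y v w assume "x : carrier H" "y : carrier H" and v: "v : carrier RMod"
 then obtain u u' where u: "u : carrier PA" "x = rc u" "u' : carrier PA" "y = rc u'" by (metis rc_cases)
 have v': "v : coord_space N" using v by (simp add: Mod_simps)
 show "x \<star>RMod v : carrier RMod" using u v' by (simp add: Mod_smult uact_closed Mod_simps)
 show "(x \<box>H y) \<star>RMod v = x \<star>RMod v \<box>RMod y \<star>RMod v"
  using u v' rc_add[OF u(1,3)] PA.add.m_closed[OF u(1,3)] Mod_smult[of "u + u'" v] uact_add[OF u(1,3)]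
  by (simp add: Mod_smult Mod_simps PA_plus)
 show "(x \<ast>H y) \<star>RMod v = x \<star>RMod (y \<star>RMod v)"
  using u v' rc_mult[OF u(1,3)] PA.m_closed[OF u(1,3)] Mod_smult[of "u \<ast>PA u'" v] uact_mult[OF u(1,3) v'] uact_closed
  by (simp add: Mod_smult)
next
 fix x v w assume "x : carrier H" and v: "v : carrier RMod" "w : carrier RMod"
 then obtain u where u: "u : carrier PA" "x = rc u" by (metis rc_cases)
 show "x \<star>RMod (v \<box>RMod w) = x \<star>RMod v \<box>RMod x \<star>RMod w"
  using u v by (simp add: Mod_smult Mod_simps coord_sub lin_add[OF uact_lin])
next
 fix v assume v: "v : carrier RMod"
 hence v': "v : coord_space N" by (simp add: Mod_simps)
 show "\<one>\<^bsub>H\<^esub> \<star>RMod v = v" using Mod_scalar[OF v', of 1] by (simp add: scalar_1)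
qed

lemma Mod_matrix: "matrix_module RMod"
 unfolding matrix_module_def
 using Mod_module Mod_scalar by (auto simp: Mod_simps zero_fun_def plus_fun_def cs_def)

lemma Mod_idem: "i : {1..n} ==> v : coord_space N ==> idem i \<star>RMod v = e i v"
 using Mod_smult[OF pv_closed[OF nil_path], of i v 1] by (simp add: pv_1 idem_def[symmetric]) (simp add: pv_1[symmetric] uact_pv)

lemma Mod_arr: "a : arrows ==> v : coord_space N ==> arr a \<star>RMod v = T a v"
 using Mod_smult[OF pv_closed[OF arr_path], of a v 1] T_source[of a v]
 by (simp add: pv_1 arr_def[symmetric]) (simp add: pv_1[symmetric] uact_pv)

end

section \<open>Freeness over the loop algebras in coordinates\<close>

lemma (in left_module) smult_zero_left: "x : carrier M ==> \<zero>\<^bsub>R\<^esub> \<star>M x = \<zero>\<^bsub>M\<^esub>"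
proof -
 assume x: "x : carrier M"
 have "\<zero>\<^bsub>R\<^esub> \<star>M x \<box>M \<zero>\<^bsub>R\<^esub> \<star>M x = \<zero>\<^bsub>R\<^esub> \<star>M x"
  using smult_l_distr[of "\<zero>\<^bsub>R\<^esub>" "\<zero>\<^bsub>R\<^esub>" x] x by simp
 thus ?thesis using smult_closed[of "\<zero>\<^bsub>R\<^esub>" x] x by (simp add: M.add.l_cancel_one)
qed

lemma bij_betw_ex1_iff:
 assumes "bij_betw f A B" shows "(EX! y. y : B & P y) \<longleftrightarrow> (EX! x. x : A & P (f x))"
proof -
 have B: "B = f ` A" and inj: "inj_on f A" using assms by (auto simp: bij_betw_def)
 show ?thesis
 proof
  assume "EX! y. y : B & P y"
  then obtain y where y: "y : B" "P y" "!!y'. y' : B ==> P y' ==> y' = y" by blast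
  then obtain x where x: "x : A" "y = f x" using B by blast
  show "EX! x. x : A & P (f x)"
  proof (rule ex1I[of _ x])
   fix x' assume x': "x' : A & P (f x')"
   hence "f x' = y" using y(3) B by blast
   thus "x' = x" using inj_onD[OF inj] x x' by blast
  qed (use x y in blast)
 next
  assume "EX! x. x : A & P (f x)"
  then obtain x where x: "x : A" "P (f x)" "!!x'. x' : A ==> P (f x') ==> x' = x" by blast
  show "EX! y. y : B & P y"
  proof (rule ex1I[of _ "f x"])
   fix y assume "y : B & P y"
   then obtain x' where "x' : A" "y = f x'" "P y" using B by blast
   thus "y = f x" using x(3) by blast
  qed (use x B in blast)
 qed
qed

context gls_pos
begin

text \<open>Modules whose elements are vectors in \<open>\<complex>\<^sup>N\<close> with the usual vector space structure.\<close>

definition pwm :: "((path => complex) set, nat => complex) module => bool" where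
 "pwm M \<longleftrightarrow> left_module H M & \<zero>\<^bsub>M\<^esub> = 0 & (ALL v:carrier M. ALL w:carrier M. v \<box>M w = v + w) \<and>
   (ALL z. ALL v:carrier M. scalar z \<star>M v = cs z v)"

lemma matrix_pwm: "matrix_module M ==> pwm M"
 by (auto simp: matrix_module_def pwm_def zero_fun_def plus_fun_def cs_def)

context
 fixes M :: "((path => complex) set, nat => complex) module"
 assumes M: "pwm M"
begin

lemma pwm_module: "left_module H M" using M by (simp add: pwm_def)

lemma pwm_plus: "v : carrier M ==> w : carrier M ==> v \<box>M w = v + w" using M by (simp add: pwm_def)

lemma pwm_group: "abelian_group M" using pwm_module by (simp add: left_module_def)

lemma pwm_closed:
 "0 : carrier M" "v : carrier M ==> w : carrier M ==> v + w : carrier M" "v : carrier M ==> cs z v : carrier M"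
 "h : carrier H ==> v : carrier M ==> h \<star>M v : carrier M"
proof -
 interpret abelian_group M by (rule pwm_group)
 show "0 : carrier M" using zero_closed M unfolding pwm_def by metis
 show "v : carrier M ==> w : carrier M ==> v + w : carrier M" using a_closed pwm_plus by metis
 show c: "h : carrier H ==> v : carrier M ==> h \<star>M v : carrier M" for h v using left_module.smult_closed[OF pwm_module] .
 show "v : carrier M ==> cs z v : carrier M" using c[OF scalar_closed] M by (metis pwm_def)
qed

lemma pwm_sum:
 fixes f :: "'x => nat => complex"
 shows "(!!x. x : X ==> f x : carrier M) ==> (SUM x:X. f x) : carrier M"
 by (induction X rule: infinite_finite_induct) (auto intro: pwm_closed)

lemma pwm_scalar: "v : carrier M ==> scalar z \<star>M v = cs z v" using M by (simp add: pwm_def)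

lemma act_add: "h : carrier H ==> v : carrier M ==> w : carrier M ==> h \<star>M (v + w) = h \<star>M v + h \<star>M w"
 using left_module.smult_r_distr[OF pwm_module, of h v w] pwm_plus pwm_closed(4) by simp

lemma act_mult: "x : carrier H ==> y : carrier H ==> v : carrier M ==> (x \<ast>H y) \<star>M v = x \<star>M (y \<star>M v)"
 using left_module.smult_assoc[OF pwm_module] .

lemma act_plus: "x : carrier H ==> y : carrier H ==> v : carrier M ==> (x \<box>H y) \<star>M v = x \<star>M v + y \<star>M v"
 using left_module.smult_l_distr[OF pwm_module] pwm_plus pwm_closed(4) by simp

lemma act_zero: "v : carrier M ==> \<zero>\<^bsub>H\<^esub> \<star>M v = 0"
 using left_module.smult_zero_left[OF pwm_module] M by (simp add: pwm_def)

lemma act_cs: "h : carrier H ==> v : carrier M ==> h \<star>M cs z v = cs z (h \<star>M v)"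
proof -
 assume h: "h : carrier H" and v: "v : carrier M"
 have "h \<star>M cs z v = (h \<ast>H scalar z) \<star>M v" using act_mult[OF h scalar_closed v] pwm_scalar[OF v] by simp
 also have "... = scalar z \<star>M (h \<star>M v)" using scalar_central[OF h] act_mult[OF scalar_closed h v] by simp
 finally show ?thesis using pwm_scalar[OF pwm_closed(4)[OF h v]] by simp
qed

lemma act_0: "h : carrier H ==> h \<star>M 0 = 0"
 using act_cs[OF _ pwm_closed(1), of h 0] by simp

lemma act_idem_sum: assumes v: "v : carrier M" shows "(SUM i:{1..n}. idem i \<star>M v) = v"
proof -
 have "X \<subseteq> {1..n} ==> (\<Oplus>\<^bsub>H\<^esub>i\<in>X. idem i) \<star>M v = (SUM i:X. idem i \<star>M v)" if "finite X" for X
  using that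
 proof (induction X rule: finite_induct)
  case (insert i X)
  have "i : {1..n}" "idem : X \<rightarrow> carrier H" using insert.prems by auto
  thus ?case
   using insert HR.finsum_insert[of X i idem] act_plus[OF _ HR.finsum_closed v, of "idem i" idem X] by simp
 qed (simp add: act_zero[OF v])
 from this[of "{1..n}"] have "\<one>\<^bsub>H\<^esub> \<star>M v = (SUM i:{1..n}. idem i \<star>M v)" using one_idem by simp
 thus ?thesis using left_module.smult_one[OF pwm_module v] by simp
qed

lemma act_epsp_Suc: "i : {1..n} ==> v : carrier M ==> epsp i (Suc a) \<star>M v = arr (Eps i) \<star>M (epsp i a \<star>M v)"
 using act_mult[of "epsp i (Suc 0)" "epsp i a" v] epsp_mult[of i "Suc 0" a] by (simp add: epsp_1 eps_arr Eps_arrow)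

lemma vertex_space_iff: "i : {1..n} ==> v : vertex_space M i \<longleftrightarrow> v : carrier M & idem i \<star>M v = v"
proof -
 assume i: "i : {1..n}"
 have "idem i \<star>M (idem i \<star>M x) = idem i \<star>M x" if "x : carrier M" for x
  using act_mult[of "idem i" "idem i" x] idem_idem[OF i i] i that by simp
 thus ?thesis using pwm_closed(4)[OF idem_closed[OF i]] by (auto simp: vertex_space_def) metis
qed

lemma submodule_iff:
 "submodule U H M \<longleftrightarrow> U \<subseteq> carrier M & 0 : U & (ALL v:U. ALL w:U. v + w : U) & (ALL h:carrier H. ALL v:U. h \<star>M v : U)"
proof
 assume "submodule U H M"
 then interpret submodule U H M .
 have U: "U \<subseteq> carrier M" using subset by simp
 have zero: "\<zero>\<^bsub>M\<^esub> = 0" using M by (simp add: pwm_def)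
 note U
 moreover have "v + w : U" if "v : U" "w : U" for v w using m_closed[OF that] pwm_plus[OF subsetD[OF U that(1)] subsetD[OF U that(2)]] by simp
 ultimately show "U \<subseteq> carrier M & 0 : U & (ALL v:U. ALL w:U. v + w : U) & (ALL h:carrier H. ALL v:U. h \<star>M v : U)"
  using one_closed smult_closed zero by simp
next
 assume U: "U \<subseteq> carrier M & 0 : U & (ALL v:U. ALL w:U. v + w : U) & (ALL h:carrier H. ALL v:U. h \<star>M v : U)"
 interpret abelian_group M by (rule pwm_group)
 have neg: "\<ominus>\<^bsub>M\<^esub> v = cs (-1) v" if v: "v : carrier M" for v
 proof (rule minus_equality[OF _ v pwm_closed(3)[OF v]])
  have "cs (-1) v + v = 0" by (simp add: fun_eq_iff)
  thus "cs (-1) v \<box>M v = \<zero>\<^bsub>M\<^esub>" using pwm_plus[OF pwm_closed(3)[OF v] v] M unfolding pwm_def by metis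
 qed
 show "submodule U H M"
 proof (unfold submodule_def submodule_axioms_def, intro conjI allI impI)
  show "subgroup U (add_monoid M)"
  proof (rule add.subgroupI)
   show "U ~= {}" using U by blast
   fix a assume a: "a : U"
   have "scalar (-1) \<star>M a : U" using U a scalar_closed by blast
   moreover have "a : carrier M" using a U by blast
   ultimately show "\<ominus>\<^bsub>M\<^esub> a : U" using neg pwm_scalar by simp
   fix b assume b: "b : U"
   show "a \<box>M b : U" using U a b pwm_plus[OF subsetD[of U "carrier M" a] subsetD[of U "carrier M" b]] by metis
  qed (use U in auto)
 qed (use U in auto)
qed

lemma pwm_sub:
 assumes U: "submodule U H M" shows "pwm (M\<lparr>carrier := U\<rparr>)"
proof -
 note U' = U[unfolded submodule_iff]
 have cs: "cs z v : U" if "v : U" for z v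
 proof -
  have "scalar z \<star>M v : U" using U' that scalar_closed by blast
  moreover have "v : carrier M" using that U' by blast
  ultimately show ?thesis using pwm_scalar by simp
 qed
 have pl: "v \<box>M w = v + w" if "v : U" "w : U" for v w using pwm_plus U' that by auto
 have z: "\<zero>\<^bsub>M\<^esub> = 0" using M by (simp add: pwm_def)
 have "abelian_group (M\<lparr>carrier := U\<rparr>)"
 proof (rule abelian_groupI, goal_cases)
  case (6 x)
  thus ?case using pl cs[of x "-1"] by (intro bexI[of _ "cs (-1) x"]) (auto simp: z)
 qed (use U' pl in \<open>auto simp: z algebra_simps\<close>)
 hence "left_module H (M\<lparr>carrier := U\<rparr>)"
  using U' act_plus act_add act_mult left_module.smult_one[OF pwm_module] pl
  by (intro left_module.intro left_module_axioms.intro HR.ring_axioms) (auto simp: subset_iff)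
 thus ?thesis using pl pwm_scalar U' z by (auto simp: pwm_def)
qed

end

definition hl :: "nat => (nat => complex) => (path => complex) set" where
 "hl i z = (\<Oplus>\<^bsub>H\<^esub>a\<in>{..<c i}. scalar (z a) \<ast>H epsp i a)"

lemma hl_closed [simp]: "i : {1..n} ==> hl i z : carrier H"
 unfolding hl_def by (intro HR.finsum_closed) auto

lemma act_finsum:
 fixes f :: "'x => (path => complex) set"
 assumes M: "pwm M" and v: "v : carrier M" and f: "!!a. a : X ==> f a : carrier H"
 shows "(\<Oplus>\<^bsub>H\<^esub>a\<in>X. f a) \<star>M v = (SUM a:X. f a \<star>M v)"
 using f
proof (induction X rule: infinite_finite_induct)
 case (insert a X)
 hence "f : X \<rightarrow> carrier H" by auto
 thus ?case using insert HR.finsum_insert[of X a f] act_plus[OF M _ HR.finsum_closed v, of "f a" f X] by simp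
qed (simp_all add: act_zero[OF M v])

lemma hl_act:
 assumes M: "pwm M" and v: "v : carrier M" and i: "i : {1..n}"
 shows "hl i z \<star>M v = (SUM a<c i. cs (z a) (epsp i a \<star>M v))"
 unfolding hl_def using i v
 by (simp add: act_finsum[OF M v] act_mult[OF M] pwm_scalar[OF M] pwm_closed(4)[OF M])

lemma H_loop_closed: assumes i: "i : {1..n}" shows "x : H_loop i ==> x : carrier H"
 by (induction rule: H_loop.induct) (use i Eps_arrow in \<open>auto simp: eps_arr\<close>)

lemma H_loop_sum:
 fixes f :: "'x => (path => complex) set"
 assumes i: "i : {1..n}" and f: "!!a. a : X ==> f a : H_loop i"
 shows "(\<Oplus>\<^bsub>H\<^esub>a\<in>X. f a) : H_loop i"
proof -
 have 0: "\<zero>\<^bsub>H\<^esub> : H_loop i" using H_loop.scale[OF H_loop.unit[of i], where z = 0] i by (simp add: scalar_0)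
 show ?thesis using f
 proof (induction X rule: infinite_finite_induct)
  case (insert a X)
  hence "f : X \<rightarrow> carrier H" "f a : carrier H" using H_loop_closed[OF i] by auto
  thus ?case using insert HR.finsum_insert[of X a f] by (simp add: H_loop.add)
 qed (simp_all add: 0)
qed

text \<open>The combinations of the powers below \<open>c i\<close> contain the generators and are
  closed under multiplication because all higher powers vanish by \<open>epsp_nil\<close>.\<close>

lemma H_loop_eq: assumes i: "i : {1..n}" shows "H_loop i = range (hl i)"
proof (intro equalityI subsetI)
 have ep: "epsp i a : H_loop i" for a
 proof (induction a)
  case (Suc a)
  thus ?case using H_loop.mult[OF H_loop.gen[of i] Suc] epsp_mult[OF i, of "Suc 0" a] by (simp add: epsp_1)
 qed (simp add: epsp_0 H_loop.unit)
 fix x assume "x : range (hl i)"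
 thus "x : H_loop i" unfolding hl_def by (auto intro!: H_loop_sum[OF i] H_loop.scale ep)
next
 let ?L = "range (hl i)"
 have hadd: "hl i z \<box>H hl i w = hl i (z + w)" for z w
  unfolding hl_def using i
  by (simp add: HR.finsum_addf[symmetric] Pi_def HR.l_distr[symmetric] scalar_add)
 have hsc: "scalar y \<ast>H hl i z = hl i (cs y z)" for y z
  unfolding hl_def using i
  by (simp add: HR.finsum_rdistr Pi_def HR.m_assoc[symmetric] scalar_mult)
 have eL: "epsp i a : ?L" for a
 proof (cases "a < c i")
  case True
  have "hl i (delta a) = (\<Oplus>\<^bsub>H\<^esub>b\<in>{..<c i}. if a = b then epsp i b else \<zero>\<^bsub>H\<^esub>)"
   unfolding hl_def using i
   by (intro HR.finsum_cong') (auto simp: delta_apply scalar_0 scalar_1)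
  also have "... = epsp i a" using HR.finsum_singleton[of a "{..<c i}" "epsp i"] True i by simp
  finally show ?thesis by (metis rangeI)
 next
  case False
  have "hl i 0 = \<zero>\<^bsub>H\<^esub>" unfolding hl_def using i
   by (intro HR.add.finprod_one_eqI) (simp add: scalar_0)
  thus ?thesis using epsp_nil[OF i, of a] False by (metis linorder_not_less rangeI)
 qed
 have addL: "x \<box>H y : ?L" if "x : ?L" "y : ?L" for x y using that hadd by auto
 have scL: "scalar z \<ast>H x : ?L" if "x : ?L" for x z using that hsc by auto
 have 0: "\<zero>\<^bsub>H\<^esub> : ?L" using scL[OF eL, of 0 0] i by (simp add: scalar_0)
 have sumL: "(\<Oplus>\<^bsub>H\<^esub>a\<in>X. f a) : ?L" if "!!a. a : X ==> f a : ?L" "finite X" for f and X :: "nat set"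
  using that(2,1)
 proof (induction X rule: finite_induct)
  case (insert a X)
  have Lc: "?L \<subseteq> carrier H" using i by auto
  have "f : X \<rightarrow> carrier H" "f a : carrier H" using insert.prems Lc by blast+
  thus ?case using insert HR.finsum_insert[of X a f] addL by simp
 qed (simp add: 0)
 have epm: "epsp i a \<ast>H hl i z : ?L" for a z
 proof -
  have "epsp i a \<ast>H hl i z = (\<Oplus>\<^bsub>H\<^esub>b\<in>{..<c i}. epsp i a \<ast>H (scalar (z b) \<ast>H epsp i b))"
   unfolding hl_def using i by (simp add: HR.finsum_rdistr Pi_def)
  also have "... = (\<Oplus>\<^bsub>H\<^esub>b\<in>{..<c i}. scalar (z b) \<ast>H epsp i (a + b))"
  proof (rule HR.finsum_cong')
   fix b assume "b : {..<c i}"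
   have "epsp i a \<ast>H (scalar (z b) \<ast>H epsp i b) = (scalar (z b) \<ast>H epsp i a) \<ast>H epsp i b"
    using i scalar_central[of "epsp i a" "z b"] HR.m_assoc[of "epsp i a" "scalar (z b)" "epsp i b"] by simp
   thus "epsp i a \<ast>H (scalar (z b) \<ast>H epsp i b) = scalar (z b) \<ast>H epsp i (a + b)"
    using i HR.m_assoc[of "scalar (z b)" "epsp i a" "epsp i b"] epsp_mult[OF i] by simp
  qed (use i in auto)
  finally show ?thesis using sumL[OF scL[OF eL]] by simp
 qed
 have multL: "x \<ast>H y : ?L" if xy: "x : ?L" "y : ?L" for x y
 proof -
  obtain z w where z: "x = hl i z" "y = hl i w" using xy by auto
  have "x \<ast>H y = (\<Oplus>\<^bsub>H\<^esub>a\<in>{..<c i}. (scalar (z a) \<ast>H epsp i a) \<ast>H y)"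
   unfolding z(1) hl_def[of i z] using i z by (simp add: HR.finsum_ldistr Pi_def)
  also have "... = (\<Oplus>\<^bsub>H\<^esub>a\<in>{..<c i}. scalar (z a) \<ast>H (epsp i a \<ast>H y))"
   using i z by (intro HR.finsum_cong') (auto simp: HR.m_assoc)
  finally show ?thesis using sumL[OF scL[OF epm]] z by simp
 qed
 fix x assume "x : H_loop i"
 thus "x : ?L"
 proof (induction rule: H_loop.induct)
  case unit
  show ?case using eL[of 0] by (simp only: epsp_0)
 next
  case gen
  show ?case using eL[of "Suc 0"] by (simp only: epsp_1)
 next
  case (add a b)
  show ?case by (rule addL[OF add(3,4)])
 next
  case (mult a b)
  show ?case by (rule multL[OF mult(3,4)])
 next
  case (scale a z)
  show ?case by (rule scL[OF scale(2)])
 qed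
qed

text \<open>Linear independence of the powers of \<open>\<epsilon>\<^sub>i\<close> in \<open>H\<close> is seen in the module \<open>K[x]/(x^c\<^sub>i)\<close> at the vertex \<open>i\<close>.\<close>

lemma hl_inj:
 assumes i: "i : {1..n}" and eq: "hl i z = hl i z'" and a: "a < c i"
 shows "z a = z' a"
proof -
 define e :: "nat => (nat => complex) => nat => complex" where "e j = (if j = i then (%v. v) else (%v. 0))" for j
 \<comment> \<open>Multiplication by the variable on truncated polynomials; its powers below
   \<open>c i\<close> move \<open>delta 0\<close> to distinct basis vectors, so coefficients can be
   read off.\<close>
 define sh where "sh v = (%b. if b = 0 \<or> c i <= b then 0 else v (b - 1))" for v :: "nat => complex"
 define T :: "arrow => (nat => complex) => nat => complex" where "T x = (if x = Eps i then sh else (%v. 0))" for x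
 have lsh: "lin sh" by (rule linI) (auto simp: sh_def fun_eq_iff)
 have l0: "lin (%v. 0)" by (rule linI) auto
 have shp: "(sh ^^ b) v = (%x. if x < b \<or> c i <= x then 0 else v (x - b))" if "v : coord_space (c i)" for b v
  using that by (induction b) (auto simp: sh_def fun_eq_iff coord_space_def)
 interpret R: gls_rep n C c \<Omega> "c i" e T
 proof (unfold_locales, goal_cases)
  case (1 j) thus ?case by (simp add: e_def lin_id l0)
 next
  case (2 x) thus ?case by (simp add: T_def lsh l0)
 next
  case (9 j v)
  show ?case
  proof (cases "j = i")
   case True
   thus ?thesis using shp[OF 9(2), of "c i"] by (auto simp: e_def T_def fun_eq_iff)
  next
   case False
   have "((%v :: nat => complex. 0) ^^ c j) (0 :: nat => complex) = (0 :: nat => complex)"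
    by (cases "c j") (simp_all only: funpow.simps id_apply o_apply)
   thus ?thesis using False by (simp add: e_def T_def)
  qed
 next
  case (10 k j h v)
  have "(T (Eps k) ^^ b) 0 = 0" for b by (induction b) (auto simp: T_def sh_def fun_eq_iff)
  thus ?case by (simp add: T_def)
 next
  case (6 v)
  thus ?case using i by (simp add: e_def if_distrib[where f = "%f. f v"] sum.delta cong: if_cong)
 qed (auto simp: e_def T_def sh_def coord_space_def fun_eq_iff split: if_splits)
 note M = matrix_pwm[OF R.Mod_matrix]
 have ep: "epsp i b \<odot>\<^bsub>R.RMod\<^esub> v = (sh ^^ b) v" if v: "v : coord_space (c i)" for b v
 proof (induction b)
  case 0
  have "e i v = v" by (simp add: e_def)
  thus ?case using R.Mod_idem[OF i v] by (simp add: epsp_0)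
 next
  case (Suc b)
  have "(sh ^^ b) v : coord_space (c i)" using shp[OF v] by (simp add: coord_space_def)
  moreover have "T (Eps i) = sh" by (simp add: T_def)
  ultimately show ?case using act_epsp_Suc[OF M i, of v b] Suc v R.Mod_arr[OF Eps_arrow[OF i]]
   by (simp add: R.Mod_simps)
 qed
 have d: "delta 0 : coord_space (c i)" using c_pos[OF i] by (auto simp: coord_space_def delta_apply)
 have "(hl i w \<odot>\<^bsub>R.RMod\<^esub> delta 0) a = w a" for w
 proof -
  have "(hl i w \<odot>\<^bsub>R.RMod\<^esub> delta 0) a = (SUM b<c i. w b * (sh ^^ b) (delta 0) a)"
   using hl_act[OF M _ i, of "delta 0" w] d ep[OF d] by (simp add: R.Mod_simps sum_fun_apply)
  also have "... = (SUM b<c i. if b = a then w a else 0)"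
   by (rule sum.cong) (use a in \<open>auto simp: shp[OF d] delta_apply\<close>)
  finally show ?thesis using a by simp
 qed
 from this[of z] this[of z'] show ?thesis unfolding eq by simp
qed

text \<open>Coefficient arrays are required to vanish outside the relevant range, which puts them in
  bijection with tuples from the loop algebra.\<close>

definition Zs :: "nat => nat => (nat => nat => complex) set" where
 "Zs i s = {z. ALL q a. \<not> (q < s & a < c i) --> z q a = 0}"

definition hlin :: "((path => complex) set, nat => complex) module => nat => nat => (nat => nat => complex) =>
  (nat => nat => complex) => nat => complex" where
 "hlin M i s z x = (SUM q<s. SUM a<c i. cs (z q a) (epsp i a \<star>M x q))"

text \<open>Freeness of rank \<open>s\<close> at vertex \<open>i\<close> of the quotient by
  \<open>W\<close>, phrased without cosets: basis representatives and expansions are taken in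
  \<open>M\<close>, and equality is understood modulo \<open>W\<close>. With \<open>W = {0}\<close>
  it covers \<open>M\<close> itself, so submodules and quotients are treated alike.\<close>

definition fchar :: "((path => complex) set, nat => complex) module => nat => nat => (nat => complex) set => bool" where
 "fchar M i s W \<longleftrightarrow> (EX x. (ALL q<s. x q : vertex_space M i) \<and>
   (ALL w:vertex_space M i. EX! z. z : Zs i s & w - hlin M i s z x : W))"

text \<open>The map \<open>cl\<close> stands for the quotient map. By \<open>H_loop_eq\<close> and
  \<open>hl_inj\<close>, tuples from the loop algebra correspond to complex arrays in
  \<open>Zs\<close>, which matches the two statements of unique existence.\<close>

lemma free_at_fchar:
 assumes M: "pwm M" and i: "i : {1..n}" and Q: "abelian_group Q"
  and cl: "cl ` carrier M = carrier Q" "!!v w. v : carrier M ==> w : carrier M ==> cl (v + w) = cl v \<box>Q cl w"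
   "!!h v. h : carrier H ==> v : carrier M ==> cl (h \<star>M v) = h \<star>Q cl v"
   "!!v w. v : carrier M ==> w : carrier M ==> cl v = cl w \<longleftrightarrow> v - w : W"
 shows "free_at Q i s \<longleftrightarrow> fchar M i s W"
proof -
 interpret Q: abelian_group Q by (rule Q)
 have cl0: "cl 0 = \<zero>\<^bsub>Q\<^esub>"
 proof -
  have "cl 0 : carrier Q" using cl(1) pwm_closed(1)[OF M] by blast
  thus ?thesis using cl(2)[OF pwm_closed(1)[OF M] pwm_closed(1)[OF M]] by (simp add: Q.add.r_cancel_one')
 qed
 have vs: "vertex_space Q i = cl ` vertex_space M i"
 proof -
  have "vertex_space Q i = {idem i \<star>Q cl v | v. v : carrier M}" unfolding vertex_space_def cl(1)[symmetric] by blast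
  also have "... = cl ` vertex_space M i" unfolding vertex_space_def using cl(3)[OF idem_closed[OF i]] by (fastforce simp: image_iff)
  finally show ?thesis .
 qed
 have vc: "v : carrier M" if "v : vertex_space M i" for v using that vertex_space_iff[OF M i] by simp
 have clsum: "cl (SUM q<t. f q) = (\<Oplus>\<^bsub>Q\<^esub>q\<in>{..<t}. cl (f q))" if f: "!!q. q < t ==> f q : carrier M" for t :: nat and f
  using f
 proof (induction t)
  case (Suc t)
  have "cl ` carrier M \<subseteq> carrier Q" using cl(1) by simp
  hence "(%q. cl (f q)) : {..<t} \<rightarrow> carrier Q" "cl (f t) : carrier Q" using Suc.prems by auto
  note c = this
  have fc: "(SUM q<t. f q) : carrier M" "f t : carrier M" using pwm_sum[OF M, of "{..<t}" f] Suc.prems by auto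
  have IH: "cl (SUM q<t. f q) = (\<Oplus>\<^bsub>Q\<^esub>q\<in>{..<t}. cl (f q))" using Suc by simp
  have "cl (SUM q<Suc t. f q) = cl (f t) \<box>Q (\<Oplus>\<^bsub>Q\<^esub>q\<in>{..<t}. cl (f q))"
   unfolding sum.lessThan_Suc cl(2)[OF fc] IH using c by (intro Q.a_comm Q.finsum_closed)
  also have "... = (\<Oplus>\<^bsub>Q\<^esub>q\<in>insert t {..<t}. cl (f q))" using c by (intro Q.finsum_insert[symmetric]) auto
  finally show ?case unfolding lessThan_Suc .
 qed (simp add: cl0)
 have hlq: "hlin M i s z x = (SUM q<s. hl i (z q) \<star>M x q)" if x: "ALL q<s. x q : carrier M" for z x
  unfolding hlin_def by (rule sum.cong) (use x hl_act[OF M _ i] in auto)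
 have hc: "hlin M i s z x : carrier M" if x: "ALL q<s. x q : carrier M" for z x
  unfolding hlq[OF x] by (rule pwm_sum[OF M]) (use x pwm_closed(4)[OF M] i in auto)
 have clh: "cl (hlin M i s z x) = (\<Oplus>\<^bsub>Q\<^esub>q\<in>{..<s}. hl i (z q) \<star>Q cl (x q))" if x: "ALL q<s. x q : carrier M" for z x
 proof -
  have "cl (hlin M i s z x) = (\<Oplus>\<^bsub>Q\<^esub>q\<in>{..<s}. cl (hl i (z q) \<star>M x q))"
   unfolding hlq[OF x] by (rule clsum) (use x pwm_closed(4)[OF M] i in auto)
  also have "... = (\<Oplus>\<^bsub>Q\<^esub>q\<in>{..<s}. hl i (z q) \<star>Q cl (x q))"
  proof (rule Q.finsum_cong')
   show "(%q. hl i (z q) \<star>Q cl (x q)) : {..<s} \<rightarrow> carrier Q"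
    using x i cl(1) pwm_closed(4)[OF M] cl(3)[symmetric] by (auto simp: Pi_def)
  qed (use x i cl(3) in auto)
  finally show ?thesis .
 qed
 have key: "(EX! h. h : {..<s} \<rightarrow>\<^sub>E H_loop i & cl w = (\<Oplus>\<^bsub>Q\<^esub>q\<in>{..<s}. h q \<star>Q b q)) \<longleftrightarrow>
   (EX! z. z : Zs i s & w - hlin M i s z x : W)"
  if w: "w : vertex_space M i" and x: "ALL q<s. x q : vertex_space M i" and b: "!!q. q < s ==> b q = cl (x q)" for w x b
 proof -
  have xc: "ALL q<s. x q : carrier M" using x vc by blast
  define hz where "hz z = (\<lambda>q\<in>{..<s}. hl i (z q))" for z
  have bij: "bij_betw hz (Zs i s) ({..<s} \<rightarrow>\<^sub>E H_loop i)"
   unfolding bij_betw_def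
  proof (intro conjI inj_onI equalityI subsetI)
   fix z z' assume z: "z : Zs i s" "z' : Zs i s" "hz z = hz z'"
   have "z q a = z' q a" for q a
   proof (cases "q < s & a < c i")
    case True
    hence "hl i (z q) = hl i (z' q)" using fun_cong[OF z(3), of q] by (simp add: hz_def)
    thus ?thesis using hl_inj[OF i] True by blast
   next
    case False
    thus ?thesis using z(1,2) unfolding Zs_def by (metis (mono_tags, lifting) mem_Collect_eq)
   qed
   thus "z = z'" by (intro ext)
  next
   fix h assume "h : hz ` Zs i s"
   thus "h : {..<s} \<rightarrow>\<^sub>E H_loop i" using H_loop_eq[OF i] by (auto simp: hz_def)
  next
   fix h assume h: "h : {..<s} \<rightarrow>\<^sub>E H_loop i"
   hence "ALL q<s. EX y. h q = hl i y" unfolding H_loop_eq[OF i] PiE_def Pi_def image_iff by auto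
   then obtain y where y: "!!q. q < s ==> h q = hl i (y q)" by metis
   define z where "z q a = (if q < s & a < c i then y q a else 0)" for q a
   have "hl i (z q) = h q" if "q < s" for q
    unfolding y[OF that] hl_def using i that by (intro HR.finsum_cong') (auto simp: z_def)
   hence "h = hz z" using h by (auto simp: hz_def fun_eq_iff PiE_def extensional_def)
   moreover have "z : Zs i s" by (simp add: Zs_def z_def)
   ultimately show "h : hz ` Zs i s" by blast
  qed
  have e: "(cl w = (\<Oplus>\<^bsub>Q\<^esub>q\<in>{..<s}. hz z q \<star>Q b q)) \<longleftrightarrow> w - hlin M i s z x : W" for z
  proof -
   have "(\<Oplus>\<^bsub>Q\<^esub>q\<in>{..<s}. hz z q \<star>Q b q) = (\<Oplus>\<^bsub>Q\<^esub>q\<in>{..<s}. hl i (z q) \<star>Q cl (x q))"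
   proof (rule Q.finsum_cong')
    show "(%q. hl i (z q) \<star>Q cl (x q)) : {..<s} \<rightarrow> carrier Q"
     using xc i cl(1) pwm_closed(4)[OF M] cl(3)[symmetric] by (auto simp: Pi_def)
   qed (use b in \<open>auto simp: hz_def\<close>)
   thus ?thesis using cl(4)[OF vc[OF w] hc[OF xc, of z]] unfolding clh[OF xc, of z] by (simp only:)
  qed
  show ?thesis
   unfolding bij_betw_ex1_iff[OF bij, of "%h. cl w = (\<Oplus>\<^bsub>Q\<^esub>q\<in>{..<s}. h q \<star>Q b q)"] e ..
 qed
 show ?thesis
 proof
  assume "free_at Q i s"
  then obtain b where b: "(ALL q<s. b q : vertex_space Q i) & (ALL y:vertex_space Q i.
    EX! h. h : {..<s} \<rightarrow>\<^sub>E H_loop i & y = (\<Oplus>\<^bsub>Q\<^esub>q\<in>{..<s}. h q \<star>Q b q))"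
   unfolding free_at_def by (rule exE)
  define x where "x q = (SOME y. y : vertex_space M i & b q = cl y)" for q
  have x: "x q : vertex_space M i & b q = cl (x q)" if "q < s" for q
  proof -
   have "EX y. y : vertex_space M i & b q = cl y" using b that unfolding vs by (simp add: image_iff Bex_def)
   thus ?thesis unfolding x_def by (rule someI_ex)
  qed
  have xv: "ALL q<s. x q : vertex_space M i" using x by simp
  show "fchar M i s W"
   unfolding fchar_def
  proof (rule exI[of _ x], intro conjI ballI xv)
   fix w assume w: "w : vertex_space M i"
   hence "cl w : vertex_space Q i" unfolding vs by (rule imageI)
   with b have "EX! h. h : {..<s} \<rightarrow>\<^sub>E H_loop i & cl w = (\<Oplus>\<^bsub>Q\<^esub>q\<in>{..<s}. h q \<star>Q b q)" by (simp only: Ball_def)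
   thus "EX! z. z : Zs i s & w - hlin M i s z x : W"
    by (rule iffD1[OF key[of w x b, OF w xv], rotated]) (use x in simp)
  qed
 next
  assume "fchar M i s W"
  then obtain x where x: "(ALL q<s. x q : vertex_space M i) \<and>
   (ALL w:vertex_space M i. EX! z. z : Zs i s & w - hlin M i s z x : W)" unfolding fchar_def by (rule exE)
  show "free_at Q i s"
   unfolding free_at_def
  proof (rule exI[of _ "%q. cl (x q)"], intro conjI ballI)
   fix y assume "y : vertex_space Q i"
   then obtain w where w: "w : vertex_space M i" and y: "y = cl w" unfolding vs by (elim imageE) (rule that)
   have "EX! z. z : Zs i s & w - hlin M i s z x : W" using x w by (simp only: Ball_def)
   thus "EX! h. h : {..<s} \<rightarrow>\<^sub>E H_loop i & y = (\<Oplus>\<^bsub>Q\<^esub>q\<in>{..<s}. h q \<star>Q cl (x q))"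
    unfolding y by (rule iffD2[OF key[of w x "%q. cl (x q)", OF w conjunct1[OF x] refl]])
  qed (use conjunct1[OF x] vs in simp)
 qed
qed

lemma free_at_pwm: assumes "pwm M" "i : {1..n}" shows "free_at M i s \<longleftrightarrow> fchar M i s {0}"
 by (rule free_at_fchar[OF assms pwm_group[OF assms(1)], where cl = "%v. v"]) (use pwm_plus[OF assms(1)] in auto)

lemma free_at_quotient:
 assumes M: "pwm M" and i: "i : {1..n}" and W: "submodule W H M"
 shows "free_at (quotient_module M W) i s \<longleftrightarrow> fchar M i s W"
proof -
 note W' = W[unfolded submodule_iff[OF M]]
 have Wd: "v - w : W" if "v : W" "w : W" for v w
 proof -
  have "scalar (-1) \<star>M w : W" using W' that scalar_closed by blast
  moreover have "scalar (-1) \<star>M w = - w" using pwm_scalar[OF M] W' that by auto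
  ultimately have "v + (- w) : W" using W' that by metis
  thus ?thesis by simp
 qed
 let ?Q = "quotient_module M W"
 define cl where "cl v = {u + v | u. u : W}" for v
 have cl_rc: "W +>\<^bsub>M\<^esub> v = cl v" if v: "v : carrier M" for v
 proof -
  have "W +>\<^bsub>M\<^esub> v = (\<Union>u\<in>W. {u + v})"
   unfolding a_r_coset_def' by (rule SUP_cong[OF refl]) (simp only: pwm_plus[OF M subsetD[OF conjunct1[OF W']] v])
  also have "... = cl v" unfolding cl_def by blast
  finally show ?thesis .
 qed
 have sa: "set_add M X Y = {x + y | x y. x : X & y : Y}" if "X \<subseteq> carrier M" "Y \<subseteq> carrier M" for X Y
 proof -
  have "set_add M X Y = (\<Union>x\<in>X. \<Union>y\<in>Y. {x + y})"
   unfolding set_add_def' by (intro SUP_cong refl) (simp only: pwm_plus[OF M subsetD[OF that(1)] subsetD[OF that(2)]])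
  also have "... = {x + y | x y. x : X & y : Y}" by blast
  finally show ?thesis .
 qed
 have clsub: "cl v \<subseteq> carrier M" if "v : carrier M" for v unfolding cl_def using pwm_closed(2)[OF M subsetD[OF conjunct1[OF W']] that] by blast
 have car: "carrier ?Q = cl ` carrier M"
  using cl_rc by (auto simp: quotient_module_def A_RCOSETS_def' image_iff)
 have add: "cl (v + w) = cl v \<box>?Q cl w" if vw: "v : carrier M" "w : carrier M" for v w
 proof -
  have "cl v \<box>?Q cl w = {x + y | x y. x : cl v & y : cl w}"
   using sa[OF clsub clsub, OF vw] by (simp add: quotient_module_def)
  also have "... = cl (v + w)"
  proof (intro equalityI subsetI)
   fix x assume "x : {x + y | x y. x : cl v & y : cl w}"
   then obtain u u' where u: "u : W" "u' : W" "x = (u + v) + (u' + w)" by (auto simp: cl_def)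
   have "x = (u + u') + (v + w)" unfolding u(3) by (simp add: ac_simps)
   thus "x : cl (v + w)" using W' u unfolding cl_def by blast
  next
   fix x assume "x : cl (v + w)"
   then obtain u where u: "u : W" "x = u + (v + w)" by (auto simp: cl_def)
   have "x = (u + v) + (0 + w)" unfolding u(2) by (simp add: ac_simps)
   thus "x : {x + y | x y. x : cl v & y : cl w}" using u(1) W' unfolding cl_def by blast
  qed
  finally show ?thesis by simp
 qed
 have cleq: "cl v = cl w \<longleftrightarrow> v - w : W" if "v : carrier M" "w : carrier M" for v w
 proof
  assume e: "cl v = cl w"
  have "0 + v : cl v" using W' unfolding cl_def by blast
  hence "v : cl w" using e by (simp only: add_0)
  then obtain u where "u : W" "v = u + w" unfolding cl_def by blast
  thus "v - w : W" by simp
 next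
  assume d: "v - w : W"
  show "cl v = cl w"
  proof (intro equalityI subsetI)
   fix x assume "x : cl v"
   then obtain u where u: "u : W" "x = u + v" by (auto simp: cl_def)
   hence "x = (u + (v - w)) + w" by simp
   thus "x : cl w" using W' u(1) d unfolding cl_def by blast
  next
   fix x assume "x : cl w"
   then obtain u where u: "u : W" "x = u + w" by (auto simp: cl_def)
   hence "x = (u - (v - w)) + v" by simp
   thus "x : cl v" using Wd[OF u(1) d] unfolding cl_def by blast
  qed
 qed
 have act: "cl (h \<star>M v) = h \<star>?Q cl v" if h: "h : carrier H" and v: "v : carrier M" for h v
 proof -
  have sub: "(%x. h \<star>M x) ` cl v \<subseteq> carrier M" using clsub[OF v] pwm_closed(4)[OF M h] by auto
  have "h \<star>?Q cl v = {x + y | x y. x : W & y : (%x. h \<star>M x) ` cl v}"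
   using sa[OF _ sub, of W] W' by (simp add: quotient_module_def)
  also have "... = cl (h \<star>M v)"
  proof (intro equalityI subsetI)
   fix x assume "x : {x + y | x y. x : W & y : (%x. h \<star>M x) ` cl v}"
   then obtain u u' where u: "u : W" "u' : W" "x = u + h \<star>M (u' + v)" by (auto simp: cl_def)
   have "x = (u + h \<star>M u') + h \<star>M v" using u act_add[OF M h _ v, of u'] W' by (auto simp: ac_simps)
   moreover have "u + h \<star>M u' : W" using W' u h by blast
   ultimately show "x : cl (h \<star>M v)" unfolding cl_def by blast
  next
   fix x assume "x : cl (h \<star>M v)"
   then obtain u where u: "u : W" "x = u + h \<star>M v" by (auto simp: cl_def)
   have "0 + v : cl v" using W' unfolding cl_def by blast
   hence "v : cl v" by (simp only: add_0)
   thus "x : {x + y | x y. x : W & y : (%x. h \<star>M x) ` cl v}" using u by blast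
  qed
  finally show ?thesis by simp
 qed
 have z: "\<zero>\<^bsub>?Q\<^esub> = cl 0" by (auto simp: quotient_module_def cl_def)
 have "abelian_group ?Q"
 proof (rule abelian_groupI, goal_cases)
  case (6 x)
  then obtain v where v: "v : carrier M" "x = cl v" using car by auto
  note m = pwm_closed(3)[OF M v(1), of "-1"]
  show ?case using add[OF m v(1)] v m car z by (intro bexI[of _ "cl (cs (-1) v)"]) auto
 qed (use car pwm_closed[OF M] in \<open>auto simp: z add[symmetric] ac_simps\<close>)
 from free_at_fchar[OF M i this car[symmetric] add act cleq] show ?thesis .
qed

end

section \<open>Linear maps into abstract H-modules\<close>

context gls_pos
begin

text \<open>The middle term of an extension carries an abstract addition and scalar action, not the
  pointwise one; linearity into it has to be expressed through the module operations.\<close>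

definition elin :: "((path => complex) set, 'v) module => (('x => complex) => 'v) => bool" where
 "elin E L \<longleftrightarrow> (ALL v. L v : carrier E) & (ALL v w. L (v + w) = L v \<box>E L w) \<and>
   (ALL z v. L (cs z v) = scalar z \<star>E L v)"

lemma elinD:
 assumes "elin E L"
 shows "L v : carrier E" "L (v + w) = L v \<box>E L w" "L (cs z v) = scalar z \<star>E L v"
 using assms unfolding elin_def by blast+

lemma elinI:
 "[|!!v. L v : carrier E; !!v w. L (v + w) = L v \<box>E L w; !!z v. L (cs z v) = scalar z \<star>E L v|] ==> elin E L"
 unfolding elin_def by blast

lemma elin_pwm:
 assumes M: "pwm M" shows "elin M L \<longleftrightarrow> lin L & (ALL v. L v : carrier M)"
proof
 assume L: "elin M L"
 have "lin L"
 proof (rule linI)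
  show "L (v + w) = L v + L w" for v w
   unfolding elinD(2)[OF L] by (rule pwm_plus[OF M elinD(1)[OF L] elinD(1)[OF L]])
  show "L (cs z v) = cs z (L v)" for z v
   unfolding elinD(3)[OF L] by (rule pwm_scalar[OF M elinD(1)[OF L]])
 qed
 thus "lin L & (ALL v. L v : carrier M)" using elinD(1)[OF L] by simp
next
 assume L: "lin L & (ALL v. L v : carrier M)"
 hence c: "L v : carrier M" for v by simp
 show "elin M L"
 proof (rule elinI[OF c])
  show "L (v + w) = L v \<box>M L w" for v w
   unfolding pwm_plus[OF M c c] by (rule lin_add[OF conjunct1[OF L]])
  show "L (cs z v) = scalar z \<star>M L v" for z v
   unfolding pwm_scalar[OF M c] by (rule lin_scale[OF conjunct1[OF L]])
 qed
qed

context
 fixes E :: "((path => complex) set, 'v) module"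
 assumes E: "left_module H E"
begin

interpretation E: left_module H E by (rule E)

lemma smult_zero_right: assumes h: "h : carrier H" shows "h \<star>E \<zero>\<^bsub>E\<^esub> = \<zero>\<^bsub>E\<^esub>"
proof -
 have z: "\<zero>\<^bsub>H\<^esub> \<star>E \<zero>\<^bsub>E\<^esub> = \<zero>\<^bsub>E\<^esub>" by (rule E.smult_zero_left) simp
 have "h \<star>E (\<zero>\<^bsub>H\<^esub> \<star>E \<zero>\<^bsub>E\<^esub>) = (h \<ast>H \<zero>\<^bsub>H\<^esub>) \<star>E \<zero>\<^bsub>E\<^esub>"
  using E.smult_assoc[of h "\<zero>\<^bsub>H\<^esub>" "\<zero>\<^bsub>E\<^esub>"] h by simp
 thus ?thesis unfolding HR.r_null[OF h] z .
qed

lemma scalar_act: "x : carrier E ==> h : carrier H ==> h \<star>E (scalar z \<star>E x) = scalar z \<star>E (h \<star>E x)"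
 using E.smult_assoc[of h "scalar z" x] E.smult_assoc[of "scalar z" h x] scalar_central[of h z] by simp

lemma scalar_smult_mult: "x : carrier E ==> scalar z \<star>E (scalar w \<star>E x) = scalar (z * w) \<star>E x"
 using E.smult_assoc[of "scalar z" "scalar w" x] scalar_mult by simp

lemma scalar_smult_minus: "x : carrier E ==> x \<box>E scalar (-1) \<star>E x = \<zero>\<^bsub>E\<^esub>"
 using E.smult_l_distr[of "scalar 1" "scalar (-1)" x] scalar_add[of 1 "-1"] E.smult_zero_left[of x]
  E.smult_one[of x] by (simp add: scalar_1 scalar_0)

lemma elin_0: assumes L: "elin E L" shows "L 0 = \<zero>\<^bsub>E\<^esub>"
 using elinD(3)[OF L, of 0 0] E.smult_zero_left[OF elinD(1)[OF L, of 0]] by (simp add: scalar_0)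

lemma elin_act:
 assumes h: "h : carrier H" and L: "elin E L" shows "elin E (%v. h \<star>E L v)"
proof (rule elinI)
 show "h \<star>E L v : carrier E" for v by (rule E.smult_closed[OF h elinD(1)[OF L]])
 show "h \<star>E L (v + w) = h \<star>E L v \<box>E h \<star>E L w" for v w
  unfolding elinD(2)[OF L] by (rule E.smult_r_distr[OF h elinD(1)[OF L] elinD(1)[OF L]])
 show "h \<star>E L (cs z v) = scalar z \<star>E (h \<star>E L v)" for z v
  unfolding elinD(3)[OF L] by (rule scalar_act[OF elinD(1)[OF L] h])
qed

lemma elin_comp: assumes "lin T" "elin E L" shows "elin E (%v. L (T v))"
 by (rule elinI) (simp_all only: lin_add[OF assms(1)] lin_scale[OF assms(1)] elinD[OF assms(2)])

lemma elin_plus: assumes L: "elin E L" "elin E L'" shows "elin E (%v. L v \<box>E L' v)"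
proof (rule elinI)
 note c = elinD(1)[OF L(1)] elinD(1)[OF L(2)]
 show "L v \<box>E L' v : carrier E" for v by (rule E.a_closed[OF c])
 show "L (v + w) \<box>E L' (v + w) = L v \<box>E L' v \<box>E (L w \<box>E L' w)" for v w
  unfolding elinD(2)[OF L(1)] elinD(2)[OF L(2)]
  using c[of v] c[of w] by (simp add: E.add.m_ac)
 show "L (cs z v) \<box>E L' (cs z v) = scalar z \<star>E (L v \<box>E L' v)" for z v
  unfolding elinD(3)[OF L(1)] elinD(3)[OF L(2)] by (rule E.smult_r_distr[OF scalar_closed c, symmetric])
qed

lemma elin_zero: "elin E (%v. \<zero>\<^bsub>E\<^esub>)"
 by (rule elinI) (simp_all add: smult_zero_right)

lemma elin_eqI:
 assumes L: "elin E L" "elin E L'" and J: "finite J" and e: "!!t. t : J ==> L (delta t) = L' (delta t)"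
  and v: "!!t. t \<notin> J ==> v t = 0"
 shows "L v = L' v"
proof -
 have "X \<subseteq> J ==> L (SUM t:X. cs (v t) (delta t)) = L' (SUM t:X. cs (v t) (delta t))" if "finite X" for X
  using that
 proof (induction X rule: finite_induct)
  case empty
  show ?case unfolding sum.empty elin_0[OF L(1)] elin_0[OF L(2)] ..
 next
  case (insert t X)
  have IH: "L (SUM t:X. cs (v t) (delta t)) = L' (SUM t:X. cs (v t) (delta t))" using insert.IH insert.prems by blast
  have "L (delta t) = L' (delta t)" using e insert by simp
  thus ?case
   unfolding sum.insert[OF insert.hyps] elinD(2)[OF L(1)] elinD(2)[OF L(2)] elinD(3)[OF L(1)] elinD(3)[OF L(2)] IH by simp
 qed
 note s = this[OF J subset_refl]
 have e: "v = (SUM t:J. cs (v t) (delta t))" by (rule delta_expand[OF J v])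
 have "L v = L (SUM t:J. cs (v t) (delta t))" by (rule arg_cong[OF e])
 also note s
 also have "L' (SUM t:J. cs (v t) (delta t)) = L' v" by (rule arg_cong[OF e[symmetric]])
 finally show ?thesis .
qed

lemma elin_exists:
 assumes J: "finite J" and t: "!!j. j : J ==> t j : carrier E"
 shows "\<exists>\<tau>. elin E \<tau> & (ALL j:J. \<tau> (delta j) = t j)"
 using assms
proof (induction J rule: finite_induct)
 case empty
 show ?case using elin_zero by (intro exI[of _ "%v. \<zero>\<^bsub>E\<^esub>"]) simp
next
 case (insert j J)
 then obtain \<tau> where \<tau>: "elin E \<tau>" "ALL i:J. \<tau> (delta i) = t i" by auto
 have tj: "t j : carrier E" using insert by simp
 have lin1: "lin (%v. v - cs (v j) (delta j))"
  by (rule linI) (simp_all add: fun_eq_iff algebra_simps)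
 have e1: "elin E (%v. \<tau> (v - cs (v j) (delta j)))" by (rule elin_comp[OF lin1 \<tau>(1)])
 have e2: "elin E (%v. scalar (v j) \<star>E t j)"
 proof (rule elinI)
  show "scalar (v j) \<star>E t j : carrier E" for v by (rule E.smult_closed[OF scalar_closed tj])
  show "scalar ((v + w) j) \<star>E t j = scalar (v j) \<star>E t j \<box>E scalar (w j) \<star>E t j" for v w
   unfolding plus_fun_apply scalar_add[symmetric] by (rule E.smult_l_distr[OF scalar_closed scalar_closed tj])
  show "scalar (cs z v j) \<star>E t j = scalar z \<star>E (scalar (v j) \<star>E t j)" for z v
   unfolding cs_apply by (rule scalar_smult_mult[OF tj, symmetric])
 qed
 show ?case
 proof (intro exI[of _ "%v. \<tau> (v - cs (v j) (delta j)) \<box>E scalar (v j) \<star>E t j"] conjI ballI)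
  show "elin E (%v. \<tau> (v - cs (v j) (delta j)) \<box>E scalar (v j) \<star>E t j)" by (rule elin_plus[OF e1 e2])
  fix i assume i: "i : insert j J"
  show "\<tau> (delta i - cs (delta i j) (delta j)) \<box>E scalar (delta i j) \<star>E t j = t i"
  proof (cases "i = j")
   case True
   have "delta j - cs (delta j j) (delta j) = (0 :: 'a => complex)" by (simp add: delta_apply fun_eq_iff)
   thus ?thesis using True elin_0[OF \<tau>(1)] E.smult_one[OF tj] tj by (simp add: delta_apply scalar_1)
  next
   case False
   have "delta i - cs (delta i j) (delta j) = delta i" using False by (simp add: delta_apply fun_eq_iff)
   thus ?thesis using False \<tau>(2) i insert.prems[of i] E.smult_zero_left[OF tj] by (simp add: delta_apply scalar_0)
  qed
 qed
qed

lemma epsp_Suc_smult: "i : {1..n} ==> x : carrier E ==> epsp i (Suc a) \<star>E x = arr (Eps i) \<star>E (epsp i a \<star>E x)"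
 using E.smult_assoc[of "epsp i (Suc 0)" "epsp i a" x] epsp_mult[of i "Suc 0" a] by (simp add: epsp_1 eps_arr Eps_arrow)

lemma idem_epsp_smult:
 assumes i: "i : {1..n}" and j: "j : {1..n}" and x: "x : carrier E"
 shows "idem j \<star>E (epsp i a \<star>E x) = (if j = i then epsp i a \<star>E x else \<zero>\<^bsub>E\<^esub>)"
proof -
 have y: "epsp i a \<star>E x : carrier E" by (rule E.smult_closed[OF epsp_closed[OF i] x])
 have e: "epsp i a \<star>E x = idem i \<star>E (epsp i a \<star>E x)"
  using E.smult_assoc[of "epsp i 0" "epsp i a" x] epsp_mult[OF i, of 0 a] i x by (simp add: epsp_0)
 have "idem j \<star>E (epsp i a \<star>E x) = (idem j \<ast>H idem i) \<star>E (epsp i a \<star>E x)"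
  using E.smult_assoc[OF idem_closed[OF j] idem_closed[OF i] y] e by simp
 also have "... = (if j = i then epsp i a \<star>E x else \<zero>\<^bsub>E\<^esub>)"
  unfolding idem_idem[OF j i] using e E.smult_zero_left[OF y] by auto
 finally show ?thesis .
qed

lemma arr_source_smult:
 assumes a: "a : arrows" and x: "x : carrier E"
 shows "arr a \<star>E (idem (arrow_source a) \<star>E x) = arr a \<star>E x"
  "idem (arrow_target a) \<star>E (arr a \<star>E x) = arr a \<star>E x"
proof -
 have s: "arrow_source a : {1..n}" "arrow_target a : {1..n}" using arrow_ends[OF a] by auto
 show "arr a \<star>E (idem (arrow_source a) \<star>E x) = arr a \<star>E x"
  unfolding E.smult_assoc[OF arr_closed[OF a] idem_closed[OF s(1)] x, symmetric] arr_idem[OF a s(1)] by simp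
 show "idem (arrow_target a) \<star>E (arr a \<star>E x) = arr a \<star>E x"
  unfolding E.smult_assoc[OF idem_closed[OF s(2)] arr_closed[OF a] x, symmetric] idem_arr[OF a s(2)] by simp
qed

lemma commutation_smult:
 assumes a: "(i, j) : \<Omega>" "1 <= h" "h <= g i j" and x: "x : carrier E"
 shows "arr (Alpha i j h) \<star>E (epsp j (f i j) \<star>E x) = epsp i (f j i) \<star>E (arr (Alpha i j h) \<star>E x)"
proof -
 have ij: "i : {1..n}" "j : {1..n}" using om a by auto
 show ?thesis
  unfolding E.smult_assoc[OF arr_closed[OF Alpha_arrow[OF a]] epsp_closed[OF ij(2)] x, symmetric]
   E.smult_assoc[OF epsp_closed[OF ij(1)] arr_closed[OF Alpha_arrow[OF a]] x, symmetric] commutation[OF a] ..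
qed

end

text \<open>By \<open>H_induct\<close> it is enough to check compatibility with scalars, idempotents
  and arrows.\<close>

lemma hom_by_generators:
 assumes M: "left_module H M" and E: "left_module H E"
  and L: "!!x. x : carrier M ==> L x : carrier E"
   "!!x y. x : carrier M ==> y : carrier M ==> L (x \<box>M y) = L x \<box>E L y"
   "!!z x. x : carrier M ==> L (scalar z \<star>M x) = scalar z \<star>E L x"
   "!!i x. i : {1..n} ==> x : carrier M ==> L (idem i \<star>M x) = idem i \<star>E L x"
   "!!a x. a : arrows ==> x : carrier M ==> L (arr a \<star>M x) = arr a \<star>E L x"
 shows "L : lmod_hom H M E"
proof -
 interpret M: left_module H M by (rule M)
 interpret E: left_module H E by (rule E)
 have "ALL x:carrier M. L (h \<star>M x) = h \<star>E L x" if h: "h : carrier H" for h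
 proof (rule H_induct[OF h], goal_cases)
  case (1 z) show ?case using L(3) by blast
 next
  case (2 i) thus ?case using L(4) by blast
 next
  case (3 a) thus ?case using L(5) by blast
 next
  case (4 x y)
  show ?case
  proof
   fix u assume u: "u : carrier M"
   have "L ((x \<box>H y) \<star>M u) = L (x \<star>M u) \<box>E L (y \<star>M u)"
    unfolding M.smult_l_distr[OF 4(1,2) u] by (rule L(2)[OF M.smult_closed[OF 4(1) u] M.smult_closed[OF 4(2) u]])
   also have "... = x \<star>E L u \<box>E y \<star>E L u" using 4(3,4) u by simp
   finally show "L ((x \<box>H y) \<star>M u) = (x \<box>H y) \<star>E L u"
    unfolding E.smult_l_distr[OF 4(1,2) L(1)[OF u]] .
  qed
 next
  case (5 x y)
  show ?case
  proof
   fix u assume u: "u : carrier M"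
   have "L ((x \<ast>H y) \<star>M u) = x \<star>E L (y \<star>M u)"
    unfolding M.smult_assoc[OF 5(1,2) u] using 5(3) M.smult_closed[OF 5(2) u] by simp
   also have "... = x \<star>E (y \<star>E L u)" using 5(4) u by simp
   finally show "L ((x \<ast>H y) \<star>M u) = (x \<ast>H y) \<star>E L u"
    unfolding E.smult_assoc[OF 5(1,2) L(1)[OF u]] .
  qed
 qed
 thus ?thesis using L(1,2) unfolding lmod_hom_def hom_def by auto
qed

end

section \<open>Comparison of modules with the power series model\<close>

locale gls_model = P?: power_series_model n c m Arr p r + G?: gls_pos n C "%i. k * c i" \<Omega>
 for n :: nat and c m :: "nat => nat" and Arr p r and C k \<Omega> +
 assumes k_pos: "0 < k" and Arr_eq: "Arr = {(i, j, h). (i, j) : \<Omega> & 1 <= h & h <= g i j}"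
  and p_eq: "p i j = f j i" and r_eq: "r i j = f i j"
begin

lemma Arr_D:
 assumes "(i, j, h) : Arr" shows "i : {1..n}" "j : {1..n}" "(i, j) : \<Omega>" "1 <= h" "h <= g i j" "Alpha i j h : arrows"
  "0 < p i j" "0 < r i j"
 using assms Arr[OF assms] Alpha_arrow[of i j h] unfolding Arr_eq by auto

lemma lin_V_eqI:
 assumes "lin L" "lin L'" "!!t. t : I k ==> L (delta t) = L' (delta t)" "v : V k"
 shows "L v = L' v"
 unfolding V_lin_expand[OF assms(4,1)] V_lin_expand[OF assms(4,2)]
 by (rule sum.cong) (simp_all add: assms(3))

lemma tr_Es_tr: "v : Vin ==> tr K (Es s (tr K v)) = tr K (Es s v)"
 by (rule dop_tr[OF dop_Es])

lemma Es_iterate: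
 assumes u: "!!v. v : V k ==> u v : V k" "!!v. v : V k ==> u (tr k (Es s v)) = tr k (Es s' (u v))" and v: "v : V k"
 shows "u (tr k (Es (s * x) v)) = tr k (Es (s' * x) (u v))"
proof (induction x)
 case 0
 show ?case using v u(1)[OF v] by (simp add: tr_id)
next
 case (Suc x)
 have vi: "v : Vin" "u v : Vin" using V_Vin v u(1) by auto
 have "tr k (Es (s * Suc x) v) = tr k (Es s (tr k (Es (s * x) v)))"
  using tr_Es_tr[of "Es (s * x) v" k s] vi by (simp add: Es_Es)
 hence "u (tr k (Es (s * Suc x) v)) = tr k (Es s' (tr k (Es (s' * x) (u v))))"
  using u(2)[of "tr k (Es (s * x) v)"] Suc by simp
 also have "... = tr k (Es (s' * Suc x) (u v))"
  using tr_Es_tr[of "Es (s' * x) (u v)" k s'] vi by (simp add: Es_Es)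
 finally show ?case .
qed

text \<open>An endomorphism of the truncated module is determined by its values on the vectors
  \<open>delta (i, q, 0)\<close>, and \<open>gen\<close> extends these values to power series. The
  analogue for arrows is \<open>rep_lift\<close>, with \<open>rgen\<close> in place of
  \<open>gen\<close>.\<close>

lemma gl_lift:
 assumes u: "lin u" "!!v. v : V k ==> u v : V k" "!!v i. v : V k ==> i : {1..n} ==> u (es i v) = es i (u v)"
  "!!v. v : V k ==> u (tr k (Es 1 v)) = tr k (Es 1 (u v))"
 shows "EX y:gl. ALL v:Vin. tr k (y v) = u (tr k v)"
proof (intro bexI ballI)
 let ?y = "gen (%i q. u (delta (i, q, 0)))"
 show y: "?y : gl" by (rule gen_gl)
 have V: "tr k (?y v) = u v" if v: "v : V k" for v
 proof (rule lin_V_eqI[OF _ u(1) _ v])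
  show "lin (%v. tr k (?y v))" by (rule lin_comp[OF lin_tr glD(1)[OF y]])
  fix t assume t: "t : I k"
  obtain i q a where ta: "t = (i, q, a)" by (cases t)
  have i: "i : {1..n}" "q < m i" "a < k * c i" using t ta by auto
  have "0 < k * c i" using i(3) by (rule le_less_trans[OF le0])
  hence d0: "delta (i, q, 0) : V k" using delta_V[of "(i, q, 0)" k] i by simp
  have dE: "delta (i, q, a) = Es a (delta (i, q, 0))" by (rule delta_Es0)
  have "?y (delta (i, q, a)) = Es a (es i (u (delta (i, q, 0))))"
   unfolding dE gl_Es[OF y V_Vin[OF d0]] gen_delta[OF i(1,2)] ..
  also have "es i (u (delta (i, q, 0))) = u (delta (i, q, 0))"
   unfolding u(3)[OF d0 i(1), symmetric] es_delta[OF i(2)] by simp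
  finally have "tr k (?y (delta (i, q, a))) = u (tr k (Es (1 * a) (delta (i, q, 0))))"
   using Es_iterate[where u = u and s = 1 and s' = 1, OF u(2,4) d0, of a] by simp
  thus "tr k (?y (delta t)) = u (delta t)"
   unfolding ta using tr_id[OF delta_V[OF t]] ta dE by simp
 qed
 fix v assume v: "v : Vin"
 have "tr k (?y v) = tr k (?y (tr k v))" by (rule gl_cong[OF y v]) simp_all
 thus "tr k (?y v) = u (tr k v)" using V[OF tr_V] by simp
qed

lemma rep_lift:
 assumes lin: "!!i j h. (i, j, h) : Arr ==> lin (b (i, j, h))"
  and b: "!!i j h v. (i, j, h) : Arr ==> v : V k ==> b (i, j, h) v : V k"
  "!!i j h v. (i, j, h) : Arr ==> v : V k ==> es i (b (i, j, h) v) = b (i, j, h) v"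
  "!!i j h v. (i, j, h) : Arr ==> v : V k ==> b (i, j, h) (es j v) = b (i, j, h) v"
  "!!i j h v. (i, j, h) : Arr ==> v : V k ==> b (i, j, h) (tr k (Es (r i j) v)) = tr k (Es (p i j) (b (i, j, h) v))"
 shows "EX B:rep. ALL a:Arr. ALL v:V k. tr k (B a v) = b a v"
proof (intro bexI ballI)
 let ?B = "rgen (%a q s. b a (delta (fst (snd a), q, s)))"
 show B: "?B : rep" by (rule rgen_rep)
 fix a v assume a0: "a : Arr" and v: "v : V k"
 obtain i j h where ah: "a = (i, j, h)" by (cases a)
 note a = a0[unfolded ah]
 show "tr k (?B a v) = b a v"
  unfolding ah
 proof (rule lin_V_eqI[OF _ lin[OF a] _ v])
  show "lin (%v. tr k (?B (i, j, h) v))" by (rule lin_comp[OF lin_tr repD(1)[OF B a]])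
  fix t assume t: "t : I k"
  obtain i' q s where ts: "t = (i', q, s)" by (cases t)
  have i: "i' : {1..n}" "q < m i'" "s < k * c i'" using t ts by auto
  note dV = delta_V[OF t]
  show "tr k (?B (i, j, h) (delta t)) = b (i, j, h) (delta t)"
  proof (cases "i' = j")
   case False
   hence z: "es j (delta t) = 0" unfolding ts es_delta[OF i(2)] by simp
   have "?B (i, j, h) (delta t) = 0" using repD(4)[OF B a V_Vin[OF dV]] z lin_0[OF repD(1)[OF B a]] by simp
   moreover have "b (i, j, h) (delta t) = 0" using b(3)[OF a dV] z lin_0[OF lin[OF a]] by simp
   ultimately show ?thesis by simp
  next
   case True
   define x y where "x = s div r i j" and "y = s mod r i j"
   have y: "y < r i j" "s = y + r i j * x" using Arr_D(8)[OF a] by (simp_all add: x_def y_def)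
   have d0: "delta (j, q, y) : V k" using delta_V[of "(j, q, y)" k] i y(2) True by simp
   have dE: "delta t = Es (r i j * x) (delta (j, q, y))" unfolding ts Es_delta y(2) True ..
   have bd: "b (i, j, h) (delta t) = tr k (Es (p i j * x) (b (i, j, h) (delta (j, q, y))))"
    using Es_iterate[where u = "b (i, j, h)", OF b(1)[OF a] b(4)[OF a] d0, of x] tr_id[OF dV] unfolding dE by simp
   have "?B (i, j, h) (delta t) = Es (p i j * x) (es i (b (i, j, h) (delta (j, q, y))))"
    unfolding dE rep_Es[OF B a V_Vin[OF d0]] using rgen_delta[OF a _ y(1), of q] i True by simp
   thus ?thesis unfolding bd b(2)[OF a d0] by simp
  qed
 qed
qed

text \<open>Homomorphisms from the truncated model over the subalgebra generated by the idempotents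
  and the loops; the arrows between different vertices are disregarded.\<close>

definition hloc :: "((path => complex) set, 'v) module => (vec3 => 'v) => bool" where
 "hloc E \<tau> \<longleftrightarrow> elin E \<tau> & (ALL v:V k. ALL i:{1..n}. idem i \<star>E \<tau> v = \<tau> (es i v) \<and>
   arr (Eps i) \<star>E \<tau> v = \<tau> (tr k (Es 1 (es i v))))"

lemma hlocD:
 assumes "hloc E \<tau>"
 shows "elin E \<tau>" "v : V k ==> i : {1..n} ==> idem i \<star>E \<tau> v = \<tau> (es i v)"
  "v : V k ==> i : {1..n} ==> arr (Eps i) \<star>E \<tau> v = \<tau> (tr k (Es 1 (es i v)))"
 using assms unfolding hloc_def by blast+

lemma hloc_epsp:
 assumes E: "left_module H E" and \<tau>: "hloc E \<tau>" and v: "v : V k" and i: "i : {1..n}"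
 shows "epsp i s \<star>E \<tau> v = \<tau> (tr k (Es s (es i v)))"
proof (induction s)
 case 0
 show ?case using hlocD(2)[OF \<tau> v i] tr_id[of "es i v" k] v by (simp add: epsp_0)
next
 case (Suc s)
 let ?w = "Es s (es i v)"
 have w: "?w : Vin" using V_Vin[OF v] by simp
 have e: "es i (tr k ?w) = tr k ?w" unfolding es_commute by simp
 have "epsp i (Suc s) \<star>E \<tau> v = \<tau> (tr k (Es 1 (es i (tr k ?w))))"
  unfolding epsp_Suc_smult[OF E i elinD(1)[OF hlocD(1)[OF \<tau>]]] Suc by (rule hlocD(3)[OF \<tau> tr_V i])
 thus ?case unfolding e tr_Es_tr[OF w] Es_Es by simp
qed

text \<open>Over the loops the model is free on the vectors \<open>delta (i, q, 0)\<close>, so their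
  images may be prescribed up to the idempotent at \<open>i\<close>. When the exponent reaches
  \<open>k * c i\<close>, truncation on one side matches nilpotency on the other.\<close>

lemma hloc_exists:
 assumes E: "left_module H E" and t: "!!i q. i : {1..n} ==> q < m i ==> t i q : carrier E"
 shows "\<exists>\<tau>. hloc E \<tau> & (ALL (i, q, a):I k. \<tau> (delta (i, q, a)) = epsp i a \<star>E t i q)"
proof -
 interpret E: left_module H E by (rule E)
 have "\<exists>\<tau>. elin E \<tau> & (ALL x:I k. \<tau> (delta x) = (case x of (i, q, a) => epsp i a \<star>E t i q))"
  by (rule elin_exists[OF E fin_I]) (use t in \<open>auto intro!: E.smult_closed\<close>)
 then obtain \<tau> where \<tau>: "elin E \<tau>"
  and d: "!!x. x : I k ==> \<tau> (delta x) = (case x of (i, q, a) => epsp i a \<star>E t i q)" by blast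
 have "idem j \<star>E \<tau> v = \<tau> (es j v)" if v: "v : V k" and j: "j : {1..n}" for v j
 proof (rule elin_eqI[OF E elin_act[OF E idem_closed[OF j] \<tau>] elin_comp[OF E lin_es \<tau>] fin_I])
  show "x \<notin> I k ==> v x = 0" for x using v unfolding V_def by blast
  fix x assume x: "x : I k"
  obtain i q a where xa: "x = (i, q, a)" by (cases x)
  have i: "i : {1..n}" "q < m i" using x xa by auto
  show "idem j \<star>E \<tau> (delta x) = \<tau> (es j (delta x))"
   using d[OF x] idem_epsp_smult[OF E i(1) j t[OF i], of a] es_delta[OF i(2), of j a] elin_0[OF E \<tau>] unfolding xa by auto
 qed
 moreover have "arr (Eps j) \<star>E \<tau> v = \<tau> (tr k (Es 1 (es j v)))" if v: "v : V k" and j: "j : {1..n}" for v j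
 proof (rule elin_eqI[OF E elin_act[OF E arr_closed[OF Eps_arrow[OF j]] \<tau>]
    elin_comp[OF E lin_comp[OF lin_tr lin_comp[OF lin_Es lin_es]] \<tau>] fin_I])
  show "x \<notin> I k ==> v x = 0" for x using v unfolding V_def by blast
  fix x assume x: "x : I k"
  obtain i q a where xa: "x = (i, q, a)" by (cases x)
  have i: "i : {1..n}" "q < m i" "a < k * c i" using x xa by auto
  have y: "epsp i a \<star>E t i q : carrier E" using E.smult_closed[OF epsp_closed[OF i(1)] t[OF i(1,2)]] .
  show "arr (Eps j) \<star>E \<tau> (delta x) = \<tau> (tr k (Es 1 (es j (delta x))))"
  proof (cases "j = i")
   case True
   have "arr (Eps j) \<star>E \<tau> (delta x) = epsp i (Suc a) \<star>E t i q"
    using d[OF x] epsp_Suc_smult[OF E i(1) t[OF i(1,2)], of a] unfolding xa True by simp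
   moreover have "\<tau> (tr k (Es 1 (es j (delta x)))) = epsp i (Suc a) \<star>E t i q"
   proof (cases "Suc a < k * c i")
    case s: True
    hence sI: "(i, q, Suc a) : I k" using i by simp
    thus ?thesis using d[OF sI] tr_id[OF delta_V[OF sI]] unfolding xa True es_delta[OF i(2)] by (simp add: Es_delta)
   next
    case s: False
    hence "tr k (delta (i, q, Suc a)) = 0"
     by (intro vec3_eqI) (auto simp: tr_apply delta_apply)
    moreover have "epsp i (Suc a) = \<zero>\<^bsub>H\<^esub>" by (rule epsp_nil[OF i(1)]) (use s in simp)
    ultimately show ?thesis
     using elin_0[OF E \<tau>] E.smult_zero_left[OF t[OF i(1,2)]] unfolding xa True es_delta[OF i(2)] by (simp add: Es_delta)
   qed
   ultimately show ?thesis by simp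
  next
   case False
   have "arr (Eps j) \<star>E \<tau> (delta x) = arr (Eps j) \<star>E (idem j \<star>E (epsp i a \<star>E t i q))"
    using d[OF x] arr_source_smult(1)[OF E Eps_arrow[OF j] y] unfolding xa by simp
   also have "... = \<zero>\<^bsub>E\<^esub>"
    using idem_epsp_smult[OF E i(1) j t[OF i(1,2)], of a] False smult_zero_right[OF E arr_closed[OF Eps_arrow[OF j]]] by simp
   finally show ?thesis
    using elin_0[OF E \<tau>] False lin_0[OF lin_Es] unfolding xa es_delta[OF i(2)] by simp
  qed
 qed
 ultimately have "hloc E \<tau>" using \<tau> unfolding hloc_def by blast
 thus ?thesis using d by (intro exI[of _ \<tau>]) auto
qed

context
 fixes E :: "((path => complex) set, 'v) module" and \<mu> :: "vec3 => 'v"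
 assumes E: "left_module H E" and \<mu>: "hloc E \<mu>" and inj: "inj_on \<mu> (V k)"
begin

interpretation E: left_module H E by (rule E)

definition ti :: "'v => vec3" where "ti x = (SOME v. v : V k & \<mu> v = x)"

lemma ti: assumes "x : \<mu> ` V k" shows "ti x : V k" "\<mu> (ti x) = x"
proof -
 have "EX v. v : V k & \<mu> v = x" using assms by blast
 hence "ti x : V k & \<mu> (ti x) = x" unfolding ti_def by (rule someI_ex)
 thus "ti x : V k" "\<mu> (ti x) = x" by auto
qed

lemma ti_eq: assumes "v : V k" "\<mu> v = x" shows "ti x = v"
proof -
 have x: "x : \<mu> ` V k" using assms by blast
 show ?thesis using inj_onD[OF inj _ ti(1)[OF x] assms(1)] ti(2)[OF x] assms(2) by simp
qed

lemma ti_lin: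
 assumes L: "elin E L" and im: "!!v. v : V k ==> L v : \<mu> ` V k"
 shows "lin (%v. ti (L (tr k v)))"
proof (rule linI)
 have tiV: "ti (L (tr k v)) : V k" "\<mu> (ti (L (tr k v))) = L (tr k v)" for v using ti[OF im[OF tr_V]] by auto
 show "ti (L (tr k (v + w))) = ti (L (tr k v)) + ti (L (tr k w))" for v w
  by (rule ti_eq) (simp_all only: V_sub tiV elinD(2)[OF hlocD(1)[OF \<mu>]] tr_add elinD(2)[OF L])
 show "ti (L (tr k (cs z v))) = cs z (ti (L (tr k v)))" for z v
  by (rule ti_eq) (simp_all only: V_sub tiV elinD(3)[OF hlocD(1)[OF \<mu>]] lin_scale[OF lin_tr] elinD(3)[OF L])
qed

text \<open>Applied in two situations: with \<open>\<mu>\<close> a basis of a whole module, to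
  compare two bases, and with \<open>\<mu>\<close> the submodule of an extension, to turn a map with
  values in the submodule into a matrix.\<close>

lemma gl_pull:
 assumes \<tau>: "hloc E \<tau>" and im: "!!v. v : V k ==> \<tau> v : \<mu> ` V k"
 shows "EX y:gl. ALL v:V k. \<tau> v = \<mu> (tr k (y v))"
proof -
 define u where "u v = ti (\<tau> (tr k v))" for v
 have uV: "u v : V k" "\<mu> (u v) = \<tau> (tr k v)" for v unfolding u_def using ti[OF im[OF tr_V]] by auto
 have lu: "lin u" unfolding u_def by (rule ti_lin[OF hlocD(1)[OF \<tau>] im])
 have e: "u (es i v) = es i (u v)" if v: "v : V k" and i: "i : {1..n}" for i v
 proof -
  have "\<mu> (es i (u v)) = \<tau> (tr k (es i v))"
   using hlocD(2)[OF \<mu> uV(1) i, of v] hlocD(2)[OF \<tau> v i] uV(2)[of v] v by (simp add: tr_id)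
  thus ?thesis unfolding u_def[of "es i v"] by (intro ti_eq) (use uV in auto)
 qed
 have E1: "u (tr k (Es 1 v)) = tr k (Es 1 (u v))" if v: "v : V k" for v
 proof -
  have 1: "u (tr k (Es 1 (es i v))) = tr k (Es 1 (es i (u v)))" if i: "i : {1..n}" for i
  proof -
   have "\<mu> (tr k (Es 1 (es i (u v)))) = \<tau> (tr k (Es 1 (es i v)))"
    using hlocD(3)[OF \<mu> uV(1) i, of v] hlocD(3)[OF \<tau> v i] uV(2)[of v] v by (simp add: tr_id)
   thus ?thesis unfolding u_def[of "tr k (Es 1 (es i v))"] by (intro ti_eq) simp_all
  qed
  have ee: "es i (u (tr k (Es 1 v))) = es i (tr k (Es 1 (u v)))" if i: "i : {1..n}" for i
   unfolding e[OF tr_V i, symmetric] es_commute using 1[OF i] .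
  show ?thesis by (rule Vin_eqI[OF V_Vin[OF uV(1)] tr_Vin ee])
 qed
 from gl_lift[OF lu uV(1) e E1] obtain y where y: "y : gl" and y2: "ALL v:Vin. tr k (y v) = u (tr k v)" by (rule bexE)
 have "\<tau> v = \<mu> (tr k (y v))" if v: "v : V k" for v
  using bspec[OF y2 V_Vin[OF v]] uV(2)[of v] v by (simp add: tr_id)
 thus ?thesis by (intro bexI[OF _ y] ballI)
qed

text \<open>The counterpart of \<open>gl_pull\<close> for arrows. It produces the representation of
  a module in \<open>intw_exists\<close> and the cocycle of an extension in
  \<open>extension_dbl\<close>.\<close>

lemma rep_pull:
 assumes lin: "!!i j h. (i, j, h) : Arr ==> elin E (\<xi> (i, j, h))"
  and im: "!!i j h v. (i, j, h) : Arr ==> v : V k ==> \<xi> (i, j, h) v : \<mu> ` V k"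
  and x: "!!i j h v. (i, j, h) : Arr ==> v : V k ==> idem i \<star>E \<xi> (i, j, h) v = \<xi> (i, j, h) v"
  "!!i j h v. (i, j, h) : Arr ==> v : V k ==> \<xi> (i, j, h) (es j v) = \<xi> (i, j, h) v"
  "!!i j h v. (i, j, h) : Arr ==> v : V k ==> \<xi> (i, j, h) (tr k (Es (r i j) v)) = epsp i (p i j) \<star>E \<xi> (i, j, h) v"
 shows "EX B:rep. ALL a:Arr. ALL v:V k. \<xi> a v = \<mu> (tr k (B a v))"
proof -
 define b where "b a v = ti (\<xi> a (tr k v))" for a v
 have bV: "b (i, j, h) v : V k" "\<mu> (b (i, j, h) v) = \<xi> (i, j, h) (tr k v)" if "(i, j, h) : Arr" for i j h v
  unfolding b_def using ti[OF im[OF that tr_V]] by auto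
 have es: "es i (b (i, j, h) v) = b (i, j, h) v" if a: "(i, j, h) : Arr" for i j h v
  by (rule ti_eq[symmetric, folded b_def, of _ "\<xi> (i, j, h) (tr k v)", unfolded b_def[symmetric]])
   (use bV[OF a] hlocD(2)[OF \<mu> bV(1)[OF a] Arr_D(1)[OF a]] x(1)[OF a tr_V] in auto)
 have "EX B:rep. ALL a:Arr. ALL v:V k. tr k (B a v) = b a v"
 proof (rule rep_lift)
  fix i j h assume a: "(i, j, h) : Arr"
  show "lin (b (i, j, h))" unfolding b_def by (rule ti_lin[OF lin[OF a] im[OF a]])
  fix v assume v: "v : V k"
  show "b (i, j, h) v : V k" by (rule bV(1)[OF a])
  show "es i (b (i, j, h) v) = b (i, j, h) v" by (rule es[OF a])
  show "b (i, j, h) (es j v) = b (i, j, h) v"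
   unfolding b_def using x(2)[OF a v] v by (simp add: tr_id)
  have "\<mu> (tr k (Es (p i j) (b (i, j, h) v))) = \<xi> (i, j, h) (tr k (Es (r i j) v))"
   using hloc_epsp[OF E \<mu> bV(1)[OF a] Arr_D(1)[OF a], of "p i j" v] x(3)[OF a v] bV(2)[OF a, of v] es[OF a, of v] v
   by (simp add: tr_id)
  thus "b (i, j, h) (tr k (Es (r i j) v)) = tr k (Es (p i j) (b (i, j, h) v))"
   unfolding b_def[of _ "tr k (Es (r i j) v)"] by (intro ti_eq) simp_all
 qed
 then obtain B where B: "B : rep" and B2: "ALL a:Arr. ALL v:V k. tr k (B a v) = b a v" by (rule bexE)
 have e: "\<xi> a v = \<mu> (tr k (B a v))" if a: "a : Arr" and v: "v : V k" for a v
 proof -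
  obtain i j h where ah: "a = (i, j, h)" by (cases a)
  show ?thesis using bspec[OF bspec[OF B2 a] v] bV(2)[of i j h v] a v unfolding ah by (simp add: tr_id)
 qed
 show ?thesis by (rule bexI[OF _ B], intro ballI, rule e)
qed

end

text \<open>The three properties are hypotheses of \<open>rep_pull\<close>, here for the true action
  of an arrow. In \<open>rep_props\<close> they are shown for the action prescribed by a
  representation, so the difference of the two can be pulled back as well.\<close>

lemma alpha_props:
 assumes E: "left_module H E" and \<tau>: "hloc E \<tau>" and a: "(i, j, h) : Arr" and v: "v : V k"
 shows "idem i \<star>E (arr (Alpha i j h) \<star>E \<tau> v) = arr (Alpha i j h) \<star>E \<tau> v"
  "arr (Alpha i j h) \<star>E \<tau> (es j v) = arr (Alpha i j h) \<star>E \<tau> v"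
  "arr (Alpha i j h) \<star>E \<tau> (tr k (Es (r i j) v)) = epsp i (p i j) \<star>E (arr (Alpha i j h) \<star>E \<tau> v)"
proof -
 note A = Arr_D[OF a]
 have c: "\<tau> v : carrier E" for v by (rule elinD(1)[OF hlocD(1)[OF \<tau>]])
 show "idem i \<star>E (arr (Alpha i j h) \<star>E \<tau> v) = arr (Alpha i j h) \<star>E \<tau> v"
  using arr_source_smult(2)[OF E A(6) c] by simp
 have s: "arr (Alpha i j h) \<star>E \<tau> (es j v) = arr (Alpha i j h) \<star>E \<tau> v" if "v : V k" for v
  unfolding hlocD(2)[OF \<tau> that A(2), symmetric] using arr_source_smult(1)[OF E A(6) c] by simp
 show "arr (Alpha i j h) \<star>E \<tau> (es j v) = arr (Alpha i j h) \<star>E \<tau> v" by (rule s[OF v])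
 have "arr (Alpha i j h) \<star>E \<tau> (tr k (Es (r i j) v)) = arr (Alpha i j h) \<star>E \<tau> (tr k (Es (r i j) (es j v)))"
  unfolding s[OF tr_V, of "Es (r i j) v", symmetric] es_commute ..
 also have "... = arr (Alpha i j h) \<star>E (epsp j (r i j) \<star>E \<tau> v)"
  unfolding hloc_epsp[OF E \<tau> v A(2)] ..
 also have "... = epsp i (p i j) \<star>E (arr (Alpha i j h) \<star>E \<tau> v)"
  unfolding r_eq p_eq by (rule commutation_smult[OF E A(3-5) c])
 finally show "arr (Alpha i j h) \<star>E \<tau> (tr k (Es (r i j) v)) = epsp i (p i j) \<star>E (arr (Alpha i j h) \<star>E \<tau> v)" .
qed

lemma rep_props:
 assumes E: "left_module H E" and \<tau>: "hloc E \<tau>" and A: "A : rep" and a: "(i, j, h) : Arr" and v: "v : V k"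
 shows "idem i \<star>E \<tau> (tr k (A (i, j, h) v)) = \<tau> (tr k (A (i, j, h) v))"
  "\<tau> (tr k (A (i, j, h) (es j v))) = \<tau> (tr k (A (i, j, h) v))"
  "\<tau> (tr k (A (i, j, h) (tr k (Es (r i j) v)))) = epsp i (p i j) \<star>E \<tau> (tr k (A (i, j, h) v))"
proof -
 note vi = V_Vin[OF v]
 note AV = repD(2)[OF A a vi]
 have e: "es i (tr k (A (i, j, h) v)) = tr k (A (i, j, h) v)" unfolding es_commute repD(3)[OF A a vi] ..
 show "idem i \<star>E \<tau> (tr k (A (i, j, h) v)) = \<tau> (tr k (A (i, j, h) v))"
  unfolding hlocD(2)[OF \<tau> tr_V Arr_D(1)[OF a]] e ..
 show "\<tau> (tr k (A (i, j, h) (es j v))) = \<tau> (tr k (A (i, j, h) v))" unfolding repD(4)[OF A a vi] ..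
 have "tr k (A (i, j, h) (tr k (Es (r i j) v))) = tr k (Es (p i j) (A (i, j, h) v))"
  using dop_tr[OF rep_dop[OF A a], of "Es (r i j) v" k] repD(5)[OF A a vi] vi by simp
 thus "\<tau> (tr k (A (i, j, h) (tr k (Es (r i j) v)))) = epsp i (p i j) \<star>E \<tau> (tr k (A (i, j, h) v))"
  unfolding hloc_epsp[OF E \<tau> tr_V Arr_D(1)[OF a]] e tr_Es_tr[OF AV] by simp
qed

end

lemma sum_delta_apply2:
 "(SUM q<s. SUM a<t. z q a * (if i' = i & q' = s0 + q & a' = a then 1 else 0)) =
  (if i' = i & s0 <= q' & q' < s0 + s & a' < t then z (q' - s0) a' else (0 :: complex))"
 for s t s0 q' a' :: nat
proof -
 have "(SUM a<t. z q a * (if i' = i & q' = s0 + q & a' = a then 1 else 0)) =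
   (if q = q' - s0 then if i' = i & s0 <= q' & a' < t then z q a' else 0 else 0)" for q
 proof -
  have "(SUM a<t. z q a * (if i' = i & q' = s0 + q & a' = a then 1 else 0)) =
    (SUM a<t. if a = a' then if i' = i & q' = s0 + q then z q a' else 0 else 0)"
   by (rule sum.cong) auto
  also have "... = (if q = q' - s0 then if i' = i & s0 <= q' & a' < t then z q a' else 0 else 0)" by auto
  finally show ?thesis .
 qed
 hence "(SUM q<s. SUM a<t. z q a * (if i' = i & q' = s0 + q & a' = a then 1 else 0)) =
   (SUM q<s. if q = q' - s0 then if i' = i & s0 <= q' & a' < t then z q a' else 0 else 0)"
  by simp
 also have "... = (if i' = i & s0 <= q' & q' < s0 + s & a' < t then z (q' - s0) a' else 0)" by auto
 finally show ?thesis .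
qed

section \<open>Bases over the loops and their extension along free quotients\<close>

context gls_model
begin

definition loc :: "((path => complex) set, nat => complex) module => (vec3 => nat => complex) => bool" where
 "loc M \<mu> \<longleftrightarrow> pwm M & hloc M \<mu> & bij_betw \<mu> (V k) (carrier M)"

text \<open>Through the basis \<open>\<mu>\<close> the module is the one defined by \<open>A\<close>
  at level \<open>k\<close>.\<close>

definition intw :: "((path => complex) set, nat => complex) module => (vec3 => nat => complex) =>
  (nat * nat * nat => vec3 => vec3) => bool" where
 "intw M \<mu> A \<longleftrightarrow> loc M \<mu> & A : rep & (ALL i j h. (i, j, h) : Arr -->
   (ALL v:V k. arr (Alpha i j h) \<star>M \<mu> v = \<mu> (tr k (A (i, j, h) v))))"

lemma locD:
 assumes "loc M \<mu>"
 shows "pwm M" "left_module H M" "hloc M \<mu>" "inj_on \<mu> (V k)" "\<mu> ` V k = carrier M" "lin \<mu>" "\<mu> v : carrier M"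
proof -
 show p: "pwm M" and h: "hloc M \<mu>" and "inj_on \<mu> (V k)" "\<mu> ` V k = carrier M"
  using assms by (auto simp: loc_def bij_betw_def)
 show "left_module H M" by (rule pwm_module[OF p])
 show "lin \<mu>" "\<mu> v : carrier M" using hlocD(1)[OF h] unfolding elin_pwm[OF p] by auto
qed

lemma hloc_lin: "pwm M ==> hloc M \<mu> ==> lin \<mu>" "pwm M ==> hloc M \<mu> ==> \<mu> v : carrier M"
 using hlocD(1)[of M \<mu>] elin_pwm[of M \<mu>] by auto

text \<open>Spanned over the loops by the first \<open>s i\<close> basis vectors at each vertex
  \<open>i\<close>. The steps of the standard flag are the case \<open>s = lev j\<close>, see
  \<open>F_Gs\<close>.\<close>

definition Gs :: "(nat => nat) => vec3 set" where
 "Gs s = {v \<in> V k. ALL i q a. s i <= q --> v (i, q, a) = 0}"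

definition cut :: "(nat => nat) => vec3 => vec3" where
 "cut s v = (%(i, q, a). if q < s i then v (i, q, a) else 0)"

text \<open>The counterpart in the model of a combination \<open>hlin\<close>: the array
  \<open>z\<close> is placed on the basis vectors at vertex \<open>i\<close> from index
  \<open>s0\<close> on.\<close>

definition ins :: "nat => nat => nat => (nat => nat => complex) => vec3" where
 "ins i s0 s z = (%(i', q, a). if i' = i & s0 <= q & q < s0 + s & a < k * c i then z (q - s0) a else 0)"

lemma ins_apply: "ins i s0 s z (i', q, a) = (if i' = i & s0 <= q & q < s0 + s & a < k * c i then z (q - s0) a else 0)"
 and cut_apply: "cut s' v (i', q, a) = (if q < s' i' then v (i', q, a) else 0)"
 by (simp_all add: ins_def cut_def)

lemma V_zero: "v : V k ==> \<not> (i : {1..n} & q < m i & a < k * c i) ==> v (i, q, a) = 0"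
 unfolding V_def using I_mem[of i q a k] by blast

lemma VI: "(!!i q a. \<not> (i : {1..n} & q < m i & a < k * c i) ==> v (i, q, a) = 0) ==> v : V k"
 unfolding V_def by (auto simp del: atLeastAtMost_iff)

lemma Gs_V: "v : Gs s ==> v : V k" and Gs_0: "v : Gs s ==> s i <= q ==> v (i, q, a) = 0"
 by (auto simp: Gs_def)

lemma GsI: "v : V k ==> (!!i q a. s i <= q ==> v (i, q, a) = 0) ==> v : Gs s"
 by (simp add: Gs_def)

lemma Gs_sub: "0 : Gs s" "v : Gs s ==> w : Gs s ==> v + w : Gs s" "v : Gs s ==> w : Gs s ==> v - w : Gs s"
  "v : Gs s ==> es i v : Gs s"
 by (auto intro!: GsI simp: Gs_V Gs_0 es_apply)

lemma Gs_sum: "(!!x. x : X ==> F x : Gs s) ==> (SUM x:X. F x) : Gs s"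
 by (induction X rule: infinite_finite_induct) (auto intro: Gs_sub)

lemma cut_Gs: "v : V k ==> cut s v : Gs s"
 by (intro GsI VI) (auto simp: cut_apply V_zero)

lemma ins_Gs:
 assumes i: "i : {1..n}" and s: "s0 + s <= m i" "s0 + s <= s1 i" shows "ins i s0 s z : Gs s1"
 using assms by (intro GsI VI) (auto simp: ins_apply)

lemma ins_sum: "ins i s0 s z = (SUM q<s. \<Sum>a<k * c i. cs (z q a) (delta (i, s0 + q, a)))"
proof (rule vec3_eqI)
 fix i' q' a'
 have "(SUM q<s. \<Sum>a<k * c i. cs (z q a) (delta (i, s0 + q, a))) (i', q', a') =
   (SUM q<s. \<Sum>a<k * c i. z q a * (if i' = i & q' = s0 + q & a' = a then 1 else 0))"
  unfolding sum_fun_apply cs_apply delta_apply by simp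
 thus "ins i s0 s z (i', q', a') = (SUM q<s. \<Sum>a<k * c i. cs (z q a) (delta (i, s0 + q, a))) (i', q', a')"
  unfolding sum_delta_apply2 ins_apply by simp
qed

lemma hlin_ins:
 assumes L: "lin \<mu>" and x: "!!q a. q < s ==> a < k * c i ==> \<mu> (delta (i, s0 + q, a)) = epsp i a \<star>M x q"
 shows "hlin M i s z x = \<mu> (ins i s0 s z)"
 unfolding hlin_def ins_sum lin_sum[OF L] lin_scale[OF L] by (intro sum.cong refl) (simp add: x)

lemma Gs_decomp_vertex:
 assumes v: "v : Gs s1" and i: "es i v = v" and s: "s0 i + s = s1 i"
 shows "v = cut s0 v + ins i (s0 i) s (%q a. v (i, s0 i + q, a))"
proof (rule vec3_eqI)
 fix i' q a
 have z: "v (i', q, a) = 0" if "i' ~= i"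
  using fun_cong[OF i, of "(i', q, a)"] that by (simp add: es_apply)
 have z2: "v (i', q, a) = 0" if "s1 i' <= q" by (rule Gs_0[OF v that])
 have z3: "v (i', q, a) = 0" if "\<not> a < k * c i'" using V_zero[OF Gs_V[OF v]] that by blast
 show "v (i', q, a) = (cut s0 v + ins i (s0 i) s (%q a. v (i, s0 i + q, a))) (i', q, a)"
  using z z2 z3 s by (cases "i' = i") (auto simp: cut_apply ins_apply)
qed

lemma hloc_delta:
 assumes M: "left_module H M" and \<mu>: "hloc M \<mu>" and t: "(i, q, a) : I k"
 shows "\<mu> (delta (i, q, a)) = epsp i a \<star>M \<mu> (delta (i, q, 0))"
proof -
 have i: "i : {1..n}" "q < m i" "a < k * c i" using t by auto
 have "0 < k * c i" using i(3) by (rule le_less_trans[OF le0])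
 hence d0: "delta (i, q, 0) : V k" using delta_V[of "(i, q, 0)" k] i by simp
 show ?thesis
  unfolding hloc_epsp[OF M \<mu> d0 i(1)] es_delta[OF i(2)] using tr_id[OF delta_V[OF t]] by (simp add: Es_delta)
qed

lemma vertex_space_sub:
 assumes M: "pwm M" and W: "submodule W H M" and i: "i : {1..n}"
 shows "w : vertex_space (M\<lparr>carrier := W\<rparr>) i \<longleftrightarrow> w : W & idem i \<star>M w = w"
 using vertex_space_iff[OF pwm_sub[OF M W] i] by simp

lemma hlin_carrier [simp]: "hlin (M\<lparr>carrier := W\<rparr>) i s z x = hlin M i s z x"
 by (simp add: hlin_def)

text \<open>The quotient has the basis vectors with indices from \<open>s0 i\<close> up to
  \<open>s1 i\<close> as a basis. Existence and uniqueness of expansions come from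
  \<open>Gs_decomp_vertex\<close> and the injectivity of \<open>\<mu>\<close>.\<close>

lemma fchar_of_hloc:
 assumes M: "pwm M" and \<mu>: "hloc M \<mu>" and inj: "inj_on \<mu> (V k)" and W: "submodule (\<mu> ` Gs s1) H M"
  and i: "i : {1..n}" and s: "s0 i + s = s1 i" "s1 i <= m i"
 shows "fchar (M\<lparr>carrier := \<mu> ` Gs s1\<rparr>) i s (\<mu> ` Gs s0)"
 unfolding fchar_def
proof (rule exI[of _ "%q. \<mu> (delta (i, s0 i + q, 0))"], intro conjI allI impI ballI)
 note Mm = pwm_module[OF M]
 note L = hloc_lin(1)[OF M \<mu>]
 have KP: "0 < k * c i" by (rule G.c_pos[OF i])
 have dG: "delta (i, s0 i + q, 0) : Gs s1" if "q < s" for q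
 proof (rule GsI)
  show "delta (i, s0 i + q, 0) : V k" using delta_V[of "(i, s0 i + q, 0)" k] that s i KP by simp
 qed (use that s in \<open>auto simp: delta_apply\<close>)
 have esd: "es i (delta (i, s0 i + q, 0)) = delta (i, s0 i + q, 0)" if "q < s" for q
  using es_delta[of "s0 i + q" i i 0] that s by simp
 fix q assume q: "q < s"
 show "\<mu> (delta (i, s0 i + q, 0)) : vertex_space (M\<lparr>carrier := \<mu> ` Gs s1\<rparr>) i"
  unfolding vertex_space_sub[OF M W i] using hlocD(2)[OF \<mu> Gs_V[OF dG[OF q]] i] esd[OF q] dG[OF q] by simp
next
 note Mm = pwm_module[OF M]
 note L = hloc_lin(1)[OF M \<mu>]
 fix w assume "w : vertex_space (M\<lparr>carrier := \<mu> ` Gs s1\<rparr>) i"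
 hence "w : \<mu> ` Gs s1" and we: "idem i \<star>M w = w" unfolding vertex_space_sub[OF M W i] by auto
 then obtain v where v: "v : Gs s1" "w = \<mu> v" by blast
 note vV = Gs_V[OF v(1)]
 have ev: "es i v = v"
  using we hlocD(2)[OF \<mu> vV i] unfolding v(2) by (intro inj_onD[OF inj]) (use vV in auto)
 let ?z = "%q a. v (i, s0 i + q, a)"
 let ?h = "%z. hlin (M\<lparr>carrier := \<mu> ` Gs s1\<rparr>) i s z (%q. \<mu> (delta (i, s0 i + q, 0)))"
 have h: "?h z = \<mu> (ins i (s0 i) s z)" for z
  unfolding hlin_carrier
  by (rule hlin_ins[OF L hloc_delta[OF Mm \<mu>]]) (use i s in auto)
 have iV: "ins i (s0 i) s z : V k" for z using ins_Gs[OF i, of "s0 i" s s1 z] s Gs_V by auto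
 show "EX! z. z : Zs i s & w - ?h z : \<mu> ` Gs s0"
 proof (rule ex1I[of _ ?z], intro conjI)
  show "?z : Zs i s"
   unfolding Zs_def using V_zero[OF vV] Gs_0[OF v(1)] s by (auto simp: not_less)
  have "v - ins i (s0 i) s ?z = cut s0 v" using Gs_decomp_vertex[of v s1 i s0 s, OF v(1) ev s(1)] by (metis add_diff_cancel_right')
  thus "w - ?h ?z : \<mu> ` Gs s0"
   unfolding h v(2) lin_diff[OF L, symmetric] using cut_Gs[OF vV, of s0] by simp
 next
  fix z assume z: "z : Zs i s & w - ?h z : \<mu> ` Gs s0"
  then obtain u where u: "u : Gs s0" "\<mu> (v - ins i (s0 i) s z) = \<mu> u"
   unfolding h v(2) lin_diff[OF L, symmetric] by blast
  have "v - ins i (s0 i) s z = u"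
   by (intro inj_onD[OF inj] u(2)) (use vV iV Gs_V[OF u(1)] in auto)
  hence e: "v (i, s0 i + q, a) - ins i (s0 i) s z (i, s0 i + q, a) = 0" for q a
   using Gs_0[OF u(1), of i "s0 i + q" a] by (metis le_add1 minus_apply)
  show "z = ?z"
  proof (intro ext)
   fix q a
   show "z q a = v (i, s0 i + q, a)"
   proof (cases "q < s & a < k * c i")
    case True thus ?thesis using e[of q a] by (simp add: ins_apply)
   next
    case False
    hence "z q a = 0" using z unfolding Zs_def by blast
    moreover have "v (i, s0 i + q, a) = 0"
     using False V_zero[OF vV, of i "s0 i + q" a] Gs_0[OF v(1), of i "s0 i + q" a] s by (auto simp: not_less)
    ultimately show ?thesis by simp
   qed
  qed
 qed
qed

text \<open>A basis of \<open>W0\<close> is completed to one of \<open>W1\<close> by representatives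
  \<open>x i\<close> of a basis of the free quotient. Injectivity and surjectivity of the extended
  map are read off from the unique expansions in \<open>fchar\<close>.\<close>

lemma hloc_step:
 assumes M: "pwm M" and \<tau>: "hloc M \<tau>" "inj_on \<tau> (Gs s0)" "\<tau> ` Gs s0 = W0"
  and W: "submodule W0 H M" "submodule W1 H M" "W0 \<subseteq> W1"
  and s: "!!i. i : {1..n} ==> s0 i + s i = s1 i & s1 i <= m i" "!!i. s0 i <= s1 i"
  and fc: "!!i. i : {1..n} ==> fchar (M\<lparr>carrier := W1\<rparr>) i (s i) W0"
 shows "\<exists>\<tau>'. hloc M \<tau>' & inj_on \<tau>' (Gs s1) & \<tau>' ` Gs s1 = W1 & (ALL v:Gs s0. \<tau>' v = \<tau> v)"
proof -
 note Mm = pwm_module[OF M]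
 note W0 = W(1)[unfolded submodule_iff[OF M]] and W1 = W(2)[unfolded submodule_iff[OF M]]
 define x where "x i = (SOME x. (ALL q<s i. x q : vertex_space (M\<lparr>carrier := W1\<rparr>) i) \<and>
   (ALL w:vertex_space (M\<lparr>carrier := W1\<rparr>) i. EX! z. z : Zs i (s i) & w - hlin M i (s i) z x : W0))" for i
 have x: "(ALL q<s i. x i q : vertex_space (M\<lparr>carrier := W1\<rparr>) i) \<and>
   (ALL w:vertex_space (M\<lparr>carrier := W1\<rparr>) i. EX! z. z : Zs i (s i) & w - hlin M i (s i) z (x i) : W0)"
  if i: "i : {1..n}" for i
  using someI_ex[OF fc[OF i, unfolded fchar_def hlin_carrier]] unfolding x_def .
 have xc: "x i q : W1" "x i q : carrier M" if "i : {1..n}" "q < s i" for i q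
  using x[OF that(1)] that(2) vertex_space_sub[OF M W(2) that(1)] W1 by auto
 \<comment> \<open>The old basis below \<open>s0 i\<close>, then the representatives of the quotient
   basis; beyond \<open>s1 i\<close> the value does not affect \<open>Gs s1\<close> and is set to
   zero.\<close>
 define t where "t i q = (if q < s0 i then \<tau> (delta (i, q, 0)) else if q < s1 i then x i (q - s0 i) else 0)" for i q
 have tc: "t i q : carrier M" if "i : {1..n}" "q < m i" for i q
  unfolding t_def using hloc_lin(2)[OF M \<tau>(1)] xc[OF that(1)] s(1)[OF that(1)] pwm_closed(1)[OF M] by auto
 obtain \<tau>' where \<tau>': "hloc M \<tau>'" and d: "!!i q a. (i, q, a) : I k ==> \<tau>' (delta (i, q, a)) = epsp i a \<star>M t i q"
  using hloc_exists[where t = t, OF Mm tc] by blast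
 note L = hloc_lin(1)[OF M \<tau>(1)] and L' = hloc_lin(1)[OF M \<tau>']
 have old: "\<tau>' v = \<tau> v" if v: "v : Gs s0" for v
 proof (rule elin_eqI[OF Mm hlocD(1)[OF \<tau>'] hlocD(1)[OF \<tau>(1)]])
  show "finite {y \<in> I k. fst (snd y) < s0 (fst y)}" by simp
  fix y assume y: "y : {y \<in> I k. fst (snd y) < s0 (fst y)}"
  obtain i q a where ya: "y = (i, q, a)" by (cases y)
  have iq: "(i, q, a) : I k" "q < s0 i" using y ya by auto
  show "\<tau>' (delta y) = \<tau> (delta y)"
   unfolding ya d[OF iq(1)] hloc_delta[OF Mm \<tau>(1) iq(1)] t_def using iq(2) by simp
 next
  fix y assume y: "y \<notin> {y \<in> I k. fst (snd y) < s0 (fst y)}"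
  obtain i q a where ya: "y = (i, q, a)" by (cases y)
  show "v y = 0" using y v unfolding ya Gs_def V_def by auto
 qed
 have hl: "hlin M i (s i) z (x i) = \<tau>' (ins i (s0 i) (s i) z)" if i: "i : {1..n}" for i z
 proof (rule hlin_ins[OF L'])
  fix q a assume q: "q < s i" "a < k * c i"
  have "(i, s0 i + q, a) : I k" using i q s(1)[OF i] by auto
  thus "\<tau>' (delta (i, s0 i + q, a)) = epsp i a \<star>M x i q"
   using d q s(1)[OF i] by (simp add: t_def)
 qed
 have hW: "hlin M i (s i) z (x i) : W1" if i: "i : {1..n}" for i z
 proof -
  have cs1: "cs y w : W1" if "w : W1" for y w
   using W1 scalar_closed[of y] pwm_scalar[OF M, of w y] that by (metis subsetD)
  have sm: "(SUM a:X. f a) : W1" if "!!a. a : X ==> f a : W1" for f and X :: "nat set"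
   using that by (induction X rule: infinite_finite_induct) (use W1 in auto)
  show ?thesis unfolding hlin_def
   by (intro sm cs1) (use xc[OF i] W1 epsp_closed[OF i] in auto)
 qed
 have G1: "ins i (s0 i) (s i) z : Gs s1" if i: "i : {1..n}" for i z
  using ins_Gs[OF i, of "s0 i" "s i" s1 z] s(1)[OF i] by simp
 have G01: "v : Gs s1" if "v : Gs s0" for v
  by (rule GsI[OF Gs_V[OF that]]) (use Gs_0[OF that] s(2) le_trans in blast)
 have dec: "\<tau>' (es i v) = \<tau> (cut s0 (es i v)) + hlin M i (s i) (%q a. es i v (i, s0 i + q, a)) (x i)"
  if i: "i : {1..n}" and v: "v : Gs s1" for i v
 proof -
  have e: "es i v = cut s0 (es i v) + ins i (s0 i) (s i) (%q a. es i v (i, s0 i + q, a))"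
   by (rule Gs_decomp_vertex[OF Gs_sub(4)[OF v]]) (use s(1)[OF i] in auto)
  have "\<tau>' (es i v) = \<tau>' (cut s0 (es i v)) + \<tau>' (ins i (s0 i) (s i) (%q a. es i v (i, s0 i + q, a)))"
   unfolding lin_add[OF L', symmetric] e[symmetric] ..
  thus ?thesis unfolding hl[OF i] old[OF cut_Gs[OF Gs_V[OF Gs_sub(4)[OF v]]]] .
 qed
 have into: "\<tau>' v : W1" if v: "v : Gs s1" for v
 proof -
  have 1: "\<tau>' (es i v) : W1" if i: "i : {1..n}" for i
  proof -
   have "\<tau> (cut s0 (es i v)) : W1" using \<tau>(3) W(3) cut_Gs[OF Gs_V[OF Gs_sub(4)[OF v]]] by blast
   thus ?thesis unfolding dec[OF i v] using hW[OF i] W1 by blast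
  qed
  have "(SUM i:X. \<tau>' (es i v)) : W1" if "X \<subseteq> {1..n}" for X
   using finite_subset[OF that finite_atLeastAtMost] that
   by (induction X rule: finite_induct) (use W1 1 in auto)
  from this[OF subset_refl] show ?thesis
   unfolding lin_sum[OF L', symmetric] Vin_expand[OF V_Vin[OF Gs_V[OF v]], symmetric] .
 qed
 \<comment> \<open>A kernel vector gives an expansion of 0 modulo \<open>W0\<close> besides the zero
   one, so its coefficients beyond \<open>s0\<close> vanish; then the injectivity of
   \<open>\<tau>\<close> applies.\<close>
 have ker: "v = 0" if v: "v : Gs s1" and z: "\<tau>' v = 0" for v
 proof -
  have "v (i, q, a) = 0" if q: "s0 i <= q" for i q a
  proof (cases "i : {1..n}")
   case i: True
   let ?z = "%q a. es i v (i, s0 i + q, a)"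
   note G = Gs_sub(4)[OF v, of i]
   have "\<tau>' (es i v) = 0"
    unfolding hlocD(2)[OF \<tau>' Gs_V[OF v] i, symmetric] z by (rule act_0[OF M idem_closed[OF i]])
   hence e: "\<tau> (cut s0 (es i v)) + hlin M i (s i) ?z (x i) = 0" unfolding dec[OF i v] .
   have "0 - hlin M i (s i) ?z (x i) = (\<tau> (cut s0 (es i v)) + hlin M i (s i) ?z (x i)) - hlin M i (s i) ?z (x i)"
    unfolding e ..
   also have "... = \<tau> (cut s0 (es i v))" by (rule add_diff_cancel_right')
   finally have e2: "0 - hlin M i (s i) ?z (x i) = \<tau> (cut s0 (es i v))" .
   have 1: "0 - hlin M i (s i) ?z (x i) : W0"
    unfolding e2 \<tau>(3)[symmetric] by (rule imageI[OF cut_Gs[OF Gs_V[OF G]]])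
   have "hlin M i (s i) (%q a. 0) (x i) = 0" by (simp add: hlin_def)
   hence 2: "0 - hlin M i (s i) (%q a. 0) (x i) : W0" using W0 by simp
   have Z: "?z : Zs i (s i)" "(%q a. 0) : Zs i (s i)"
    unfolding Zs_def using V_zero[OF Gs_V[OF G], of i] Gs_0[OF G, of i] s(1)[OF i] by (auto simp: not_less)
   have "0 : vertex_space (M\<lparr>carrier := W1\<rparr>) i"
    unfolding vertex_space_sub[OF M W(2) i] using W1 act_0[OF M idem_closed[OF i]] by simp
   hence "EX! z. z : Zs i (s i) & 0 - hlin M i (s i) z (x i) : W0" using x[OF i] by (simp only: Ball_def)
   hence "?z = (%q a. 0)" by (rule ex1E) (use 1 2 Z in metis)
   hence "es i v (i, s0 i + (q - s0 i), a) = 0" by metis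
   hence "es i v (i, q, a) = 0" using q by simp
   thus ?thesis using V_zero[OF Gs_V[OF v], of i q a] by (auto simp: es_apply split: if_splits)
  qed (use V_zero[OF Gs_V[OF v]] in blast)
  hence v0: "v : Gs s0" by (intro GsI Gs_V[OF v])
  have "\<tau> v = \<tau> 0" using old[OF v0] z lin_0[OF L] by simp
  thus ?thesis by (rule inj_onD[OF \<tau>(2) _ v0 Gs_sub(1)])
 qed
 have "inj_on \<tau>' (Gs s1)"
 proof (rule inj_onI)
  fix v w assume vw: "v : Gs s1" "w : Gs s1" "\<tau>' v = \<tau>' w"
  hence "v - w = 0" by (intro ker Gs_sub) (simp_all add: lin_diff[OF L'])
  thus "v = w" by simp
 qed
 moreover have "\<tau>' ` Gs s1 = W1"
 proof (intro equalityI subsetI)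
  fix w assume w: "w : W1"
  have "EX v. v : Gs s1 & idem i \<star>M w = \<tau>' v" if i: "i : {1..n}" for i
  proof -
   have wc: "w : carrier M" using w W1 by blast
   have "idem i \<star>M w : vertex_space (M\<lparr>carrier := W1\<rparr>) i"
    unfolding vertex_space_sub[OF M W(2) i]
    using W1 w idem_closed[OF i] act_mult[OF M idem_closed[OF i] idem_closed[OF i] wc] idem_idem[OF i i] by simp
   hence "EX! z. z : Zs i (s i) & idem i \<star>M w - hlin M i (s i) z (x i) : W0" using x[OF i] by (simp only: Ball_def)
   then obtain z where "idem i \<star>M w - hlin M i (s i) z (x i) : \<tau> ` Gs s0" unfolding \<tau>(3) by (rule ex1E) blast
   then obtain u where u: "idem i \<star>M w - hlin M i (s i) z (x i) = \<tau> u" "u : Gs s0" by (rule imageE)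
   have "idem i \<star>M w = \<tau> u + hlin M i (s i) z (x i)" using u(1) by (simp only: diff_eq_eq)
   also have "... = \<tau>' (u + ins i (s0 i) (s i) z)" unfolding hl[OF i] lin_add[OF L'] old[OF u(2)] ..
   finally show ?thesis using Gs_sub(2)[OF G01[OF u(2)] G1[OF i]] by blast
  qed
  then obtain v where v: "!!i. i : {1..n} ==> v i : Gs s1 & idem i \<star>M w = \<tau>' (v i)" by metis
  have "w = (SUM i:{1..n}. idem i \<star>M w)" using act_idem_sum[OF M, of w] w W1 by (metis subsetD)
  also have "... = (SUM i:{1..n}. \<tau>' (v i))" by (rule sum.cong) (use v in auto)
  also have "... = \<tau>' (SUM i:{1..n}. v i)" by (rule lin_sum[OF L', symmetric])
  finally show "w : \<tau>' ` Gs s1" using Gs_sum[of "{1..n}" v s1] v by (metis image_eqI)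
 qed (use into in blast)
 ultimately show ?thesis using \<tau>' old by blast
qed

lemma hloc_zero: assumes M: "pwm M" shows "\<exists>\<tau>. hloc M \<tau>"
 using hloc_exists[OF pwm_module[OF M], of "%i q. 0"] pwm_closed(1)[OF M] by blast

lemma Gs_trivial: "Gs (%i. 0) = {0}"
proof -
 have "v = 0" if "v : Gs (%i. 0)" for v by (rule vec3_eqI) (simp add: Gs_0[OF that])
 thus ?thesis using Gs_sub(1)[of "%i. 0"] by auto
qed

lemma Gs_full: "Gs m = V k"
 using V_zero by (auto intro!: GsI simp: Gs_V not_less)

lemma submodule_zero: "pwm M ==> submodule {0} H M" and submodule_full: "pwm M ==> submodule (carrier M) H M"
 by (simp_all add: submodule_iff act_0 pwm_closed)

text \<open>A single application of \<open>hloc_step\<close>, leading from the zero submodule to the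
  whole module.\<close>

lemma loc_exists:
 assumes M: "pwm M" and r: "has_rank_vector M m" shows "\<exists>\<mu>. loc M \<mu>"
proof -
 obtain \<tau> where \<tau>: "hloc M \<tau>" using hloc_zero[OF M] by blast
 have "\<exists>\<tau>'. hloc M \<tau>' & inj_on \<tau>' (Gs m) & \<tau>' ` Gs m = carrier M & (ALL v:Gs (%i. 0). \<tau>' v = \<tau> v)"
 proof (rule hloc_step[OF M \<tau> _ _ submodule_zero[OF M] submodule_full[OF M], where s = m])
  show "inj_on \<tau> (Gs (%i. 0))" by (simp add: Gs_trivial)
  show "\<tau> ` Gs (%i. 0) = {0}" using lin_0[OF hloc_lin(1)[OF M \<tau>]] by (simp add: Gs_trivial)
  show "{0} \<subseteq> carrier M" using pwm_closed(1)[OF M] by simp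
  fix i assume i: "i : {1..n}"
  have "free_at M i (m i)" using r i by (simp add: has_rank_vector_def)
  thus "fchar (M\<lparr>carrier := carrier M\<rparr>) i (m i) {0}" unfolding free_at_pwm[OF M i] by simp
 qed simp_all
 thus ?thesis using M unfolding Gs_full loc_def bij_betw_def by blast
qed

lemma intwD:
 assumes "intw M \<mu> A"
 shows "loc M \<mu>" "A : rep" "(i, j, h) : Arr ==> v : V k ==> arr (Alpha i j h) \<star>M \<mu> v = \<mu> (tr k (A (i, j, h) v))"
 using assms unfolding intw_def by blast+

lemma intw_exists:
 assumes l: "loc M \<mu>" shows "EX A. intw M \<mu> A"
proof -
 note L = locD[OF l]
 have "EX A:rep. ALL a:Arr. ALL v:V k. (%(i, j, h) v. arr (Alpha i j h) \<star>M \<mu> v) a v = \<mu> (tr k (A a v))"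
 proof (rule rep_pull[OF L(2,3,4)], goal_cases)
  case (1 i j h)
  thus ?case using elin_act[OF L(2) arr_closed[OF Arr_D(6)] hlocD(1)[OF L(3)]] by simp
 next
  case (2 i j h v)
  thus ?case unfolding L(5) using pwm_closed(4)[OF L(1) arr_closed[OF Arr_D(6)] L(7)] by simp
 next
  case (3 i j h v) thus ?case using alpha_props(1)[OF L(2,3)] by simp
 next
  case (4 i j h v) thus ?case using alpha_props(2)[OF L(2,3)] by simp
 next
  case (5 i j h v) thus ?case using alpha_props(3)[OF L(2,3)] by simp
 qed
 then obtain A where A: "A : rep" and e: "ALL a:Arr. ALL v:V k. (%(i, j, h) v. arr (Alpha i j h) \<star>M \<mu> v) a v = \<mu> (tr k (A a v))"
  by (rule bexE)
 have "arr (Alpha i j h) \<star>M \<mu> v = \<mu> (tr k (A (i, j, h) v))" if "(i, j, h) : Arr" "v : V k" for i j h v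
  using bspec[OF bspec[OF e that(1)] that(2)] by simp
 hence "intw M \<mu> A" using l A unfolding intw_def by blast
 thus ?thesis by (rule exI[of _ A])
qed

lemma hloc_twist:
 fixes g :: "vec3 => vec3"
 assumes E: "left_module H E" and \<mu>: "hloc E \<mu>" and g: "g : gl"
 shows "hloc E (%v. \<mu> (tr k (g v)))"
proof -
 have lg: "lin (%v. tr k (g v))" by (rule lin_comp[OF lin_tr glD(1)[OF g]])
 show ?thesis
  unfolding hloc_def
 proof (intro conjI ballI elin_comp[OF E lg hlocD(1)[OF \<mu>]])
  fix v i assume v: "v : V k" and i: "i : {1..n}"
  note vi = V_Vin[OF v]
  have gi: "g (es i v) = es i (g v)" by (rule glD(3)[OF g vi i])
  show "idem i \<star>E \<mu> (tr k (g v)) = \<mu> (tr k (g (es i v)))"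
   unfolding hlocD(2)[OF \<mu> tr_V i] gi es_commute ..
  have "tr k (g (tr k (Es 1 (es i v)))) = tr k (g (Es 1 (es i v)))" by (rule gl_cong[OF g]) (use vi in auto)
  also have "... = tr k (Es 1 (es i (g v)))" using glD(4)[OF g, of "es i v"] vi gi by simp
  also have "... = tr k (Es 1 (es i (tr k (g v))))"
   using tr_Es_tr[of "es i (g v)" k 1] glD(2)[OF g vi] by (simp add: es_commute)
  finally show "arr (Eps i) \<star>E \<mu> (tr k (g v)) = \<mu> (tr k (g (tr k (Es 1 (es i v)))))"
   unfolding hlocD(3)[OF \<mu> tr_V i] by simp
 qed
qed

lemma loc_twist:
 fixes g h :: "vec3 => vec3"
 assumes l: "loc M \<mu>" and g: "invm k g h" shows "loc M (%v. \<mu> (tr k (g v)))"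
proof -
 note L = locD[OF l] and gD = invmD[OF g]
 have "hloc M (%v. \<mu> (tr k (g v)))" by (rule hloc_twist[OF L(2,3) gD(1)])
 moreover have "bij_betw (%v. tr k (g v)) (V k) (V k)"
 proof (rule bij_betw_byWitness[where f' = "%v. tr k (h v)"])
  have *: "tr k (h (tr k (g v))) = v" if "invm k g h" "v : V k" for g h v
  proof -
   note D = invmD[OF that(1)]
   note vi = V_Vin[OF that(2)]
   have "tr k (h (tr k (g v))) = tr k (h (g v))" by (rule gl_cong[OF D(2)]) (use glD(2)[OF D(1) vi] in simp_all)
   thus ?thesis using D(4)[OF vi] tr_id[OF that(2)] by simp
  qed
  show "ALL v:V k. tr k (h (tr k (g v))) = v" "ALL v:V k. tr k (g (tr k (h v))) = v"
   using *[OF g] *[OF invm_sym[OF g]] by auto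
 qed auto
 ultimately show ?thesis
  using l bij_betw_trans[of "%v. tr k (g v)" "V k" "V k" \<mu> "carrier M"] unfolding loc_def by (simp add: comp_def)
qed

text \<open>Either basis is expressed through the other by \<open>gl_pull\<close>; the two matrices
  are inverse to each other modulo level \<open>k\<close> because both bases are injective.\<close>

lemma loc_compare:
 assumes l: "loc M \<mu>" and l': "loc M \<mu>'"
 shows "EX g h. invm k g h & (ALL v:V k. \<mu>' v = \<mu> (tr k (g v)))"
proof -
 have ex: "EX y:gl. ALL v:V k. \<mu>' v = \<mu> (tr k (y v))" if "loc M \<mu>" "loc M \<mu>'" for \<mu> \<mu>'
  using gl_pull[OF locD(2,3,4)[OF that(1)] locD(3)[OF that(2)]] locD(5)[OF that(1)] locD(7)[OF that(2)] by blast
 obtain g where g: "g : gl" "ALL v:V k. \<mu>' v = \<mu> (tr k (g v))" using ex[OF l l'] by (rule bexE)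
 obtain h where h: "h : gl" "ALL v:V k. \<mu> v = \<mu>' (tr k (h v))" using ex[OF l' l] by (rule bexE)
 have inv: "tr k (h (g v)) = tr k v" if v: "v : Vin" and gh: "g : gl" "h : gl" "loc M \<mu>'"
  "ALL v:V k. \<mu>' v = \<mu> (tr k (g v))" "ALL v:V k. \<mu> v = \<mu>' (tr k (h v))" for g h v \<mu> \<mu>'
 proof -
  have 1: "tr k (h (g v)) = tr k (h (tr k (g (tr k v))))"
  proof (rule gl_cong[OF gh(2)])
   show "tr k (g v) = tr k (tr k (g (tr k v)))" using gl_cong[OF gh(1) v tr_Vin, of k k] by simp
  qed (use glD(2)[OF gh(1) v] in simp_all)
  have "\<mu>' (tr k (h (tr k (g (tr k v))))) = \<mu>' (tr k v)"
   using bspec[OF gh(4), of "tr k v"] bspec[OF gh(5), of "tr k (g (tr k v))"] by simp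
  thus ?thesis unfolding 1 by (rule inj_onD[OF locD(4)[OF gh(3)]]) simp_all
 qed
 have "invm k g h" unfolding invm_def
  using g(1) h(1) inv[OF _ g(1) h(1) l' g(2) h(2)] inv[OF _ h(1) g(1) l h(2) g(2)] by simp
 thus ?thesis using g(2) by blast
qed

lemma stable_submodule:
 assumes M: "intw M \<mu> A" and U: "U \<subseteq> V k" "0 : U" "!!x y. x : U ==> y : U ==> x + y : U" "!!z x. x : U ==> cs z x : U"
  "!!i x. i : {1..n} ==> x : U ==> es i x : U" "!!x. x : U ==> tr k (Es 1 x) : U"
  "!!a x. a : Arr ==> x : U ==> tr k (A a x) : U"
 shows "submodule (\<mu> ` U) H M"
proof -
 note D = intwD[OF M]
 note L = locD[OF D(1)]
 have sub: "\<mu> ` U \<subseteq> carrier M" using L(7) by blast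
 have add: "x + y : \<mu> ` U" if xy: "x : \<mu> ` U" "y : \<mu> ` U" for x y
 proof -
  obtain u w where u: "u : U" "w : U" "x = \<mu> u" "y = \<mu> w" using xy by blast
  show ?thesis unfolding u(3,4) lin_add[OF L(6), symmetric] by (rule imageI[OF U(3)[OF u(1,2)]])
 qed
 have "ALL x:\<mu> ` U. h \<star>M x : \<mu> ` U" if h: "h : carrier H" for h
 proof (rule H_induct[OF h], goal_cases)
  case (1 z)
  show ?case
  proof
   fix x assume "x : \<mu> ` U"
   then obtain u where u: "u : U" "x = \<mu> u" by blast
   show "scalar z \<star>M x : \<mu> ` U"
    unfolding u(2) pwm_scalar[OF L(1) L(7)] lin_scale[OF L(6), symmetric] by (rule imageI[OF U(4)[OF u(1)]])
  qed
 next
  case (2 i)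
  show ?case
  proof
   fix x assume "x : \<mu> ` U"
   then obtain u where u: "u : U" "x = \<mu> u" by blast
   show "idem i \<star>M x : \<mu> ` U"
    unfolding u(2) hlocD(2)[OF L(3) subsetD[OF U(1) u(1)] 2] by (rule imageI[OF U(5)[OF 2 u(1)]])
  qed
 next
  case (3 a)
  show ?case
  proof
   fix x assume "x : \<mu> ` U"
   then obtain u where u: "u : U" "x = \<mu> u" by blast
   note uV = subsetD[OF U(1) u(1)]
   show "arr a \<star>M x : \<mu> ` U"
   proof (cases a)
    case (Eps i)
    hence i: "i : {1..n}" using arrow_ends[OF 3] by simp
    show ?thesis unfolding u(2) Eps hlocD(3)[OF L(3) uV i] by (rule imageI[OF U(6)[OF U(5)[OF i u(1)]]])
   next
    case (Alpha i j h)
    hence a: "(i, j, h) : Arr" using 3 by (auto simp: Arr_eq arrows_def)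
    show ?thesis unfolding u(2) Alpha D(3)[OF a uV] by (rule imageI[OF U(7)[OF a u(1)]])
   qed
  qed
 next
  case (4 x y)
  show ?case
  proof
   fix w assume w: "w : \<mu> ` U"
   hence wc: "w : carrier M" using sub by blast
   show "(x \<box>H y) \<star>M w : \<mu> ` U"
    unfolding act_plus[OF L(1) 4(1,2) wc] by (rule add) (use 4(3,4) w in auto)
  qed
 next
  case (5 x y)
  show ?case
  proof
   fix w assume w: "w : \<mu> ` U"
   hence wc: "w : carrier M" using sub by blast
   show "(x \<ast>H y) \<star>M w : \<mu> ` U"
    unfolding act_mult[OF L(1) 5(1,2) wc] using 5(3,4) w by blast
  qed
 qed
 moreover have "0 : \<mu> ` U" using lin_0[OF L(6)] U(2) by (metis image_eqI)
 ultimately show ?thesis unfolding submodule_iff[OF L(1)] using sub add by blast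
qed

end

section \<open>Flags of locally free submodules and flags in the model\<close>

locale gls_flag = gls_model + flag_model
begin

lemma F_Gs: "F k j = Gs (lev j)"
proof (intro equalityI subsetI)
 fix v assume v: "v : F k j"
 show "v : Gs (lev j)"
 proof (rule GsI[OF F_V[OF v]])
  fix i q a assume "lev j i <= q"
  thus "v (i, q, a) = 0" using fun_cong[OF F_Qp[OF v], of "(i, q, a)"] by (simp add: Qp_apply)
 qed
next
 fix v assume v: "v : Gs (lev j)"
 have "Qp j v = v" by (rule vec3_eqI) (use Gs_0[OF v] in \<open>auto simp: Qp_apply not_less\<close>)
 thus "v : F k j" using Gs_V[OF v] by (simp add: F_def)
qed

lemma lev_le: "i : {1..n} ==> j <= l ==> lev j i <= m i"
 using lev_mono[of j l i] lev_l by simp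

lemma submodule_sub:
 assumes M: "pwm M" and "submodule W0 H M" "submodule W1 H M" "W0 \<subseteq> W1"
 shows "submodule W0 H (M\<lparr>carrier := W1\<rparr>)"
 using assms(2,4) unfolding submodule_iff[OF M] submodule_iff[OF pwm_sub[OF M assms(3)]] by auto

text \<open>A basis adapted to the flag is built step by step; each extension keeps the earlier
  values, so the images of the earlier steps persist.\<close>

lemma flag_basis:
 assumes M: "pwm M" and W: "W 0 = {0}" "!!j. j <= l ==> submodule (W j) H M" "!!j. j < l ==> W j \<subseteq> W (Suc j)"
  and fc: "!!j i. j < l ==> i : {1..n} ==> fchar (M\<lparr>carrier := W (Suc j)\<rparr>) i (\<rho> (Suc j) i) (W j)"
  and j: "j <= l"
 shows "\<exists>\<tau>. hloc M \<tau> & inj_on \<tau> (F k j) & (ALL j'<=j. \<tau> ` F k j' = W j')"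
 using j
proof (induction j)
 case 0
 obtain \<tau> where \<tau>: "hloc M \<tau>" using hloc_zero[OF M] by blast
 have "\<tau> ` F k 0 = W 0" unfolding F_0 W(1) image_insert image_empty lin_0[OF hloc_lin(1)[OF M \<tau>]] ..
 hence "ALL j'<=0. \<tau> ` F k j' = W j'" by (metis le_zero_eq)
 moreover have "inj_on \<tau> (F k 0)" unfolding F_0 inj_on_def by blast
 ultimately show ?case using \<tau> by blast
next
 case (Suc j)
 then obtain \<tau> where \<tau>: "hloc M \<tau>" "inj_on \<tau> (F k j)" "ALL j'<=j. \<tau> ` F k j' = W j'" by auto
 have jl: "j < l" "j <= l" using Suc.prems by auto
 have "\<exists>\<tau>'. hloc M \<tau>' & inj_on \<tau>' (Gs (lev (Suc j))) & \<tau>' ` Gs (lev (Suc j)) = W (Suc j) & (ALL v:Gs (lev j). \<tau>' v = \<tau> v)"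
 proof (rule hloc_step[OF M \<tau>(1) _ _ W(2)[OF jl(2)] W(2)[OF Suc.prems] W(3)[OF jl(1)], where s = "\<rho> (Suc j)"])
  show "inj_on \<tau> (Gs (lev j))" "\<tau> ` Gs (lev j) = W j" using \<tau>(2,3) by (auto simp: F_Gs)
  show "lev j i + \<rho> (Suc j) i = lev (Suc j) i & lev (Suc j) i <= m i" if "i : {1..n}" for i
   using lev_le[OF that Suc.prems] by (simp add: lev_Suc)
  show "lev j i <= lev (Suc j) i" for i by (simp add: lev_Suc)
 qed (use fc[OF jl(1)] in simp)
 then obtain \<tau>' where \<tau>': "hloc M \<tau>'" "inj_on \<tau>' (F k (Suc j))" "\<tau>' ` F k (Suc j) = W (Suc j)" "ALL v:F k j. \<tau>' v = \<tau> v"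
  unfolding F_Gs by blast
 have "\<tau>' ` F k j' = W j'" if "j' <= Suc j" for j'
 proof (cases "j' = Suc j")
  case False
  hence j': "j' <= j" using that by simp
  have "\<tau>' ` F k j' = \<tau> ` F k j'" by (rule image_cong[OF refl]) (use \<tau>'(4) F_mono[OF j'] in blast)
  thus ?thesis using \<tau>(3) j' by simp
 qed (use \<tau>'(3) in simp)
 thus ?case using \<tau>'(1,2) by blast
qed

text \<open>Twisting \<open>\<mu>\<close> by the frame of \<open>U\<close> gives a basis that
  carries the standard flag to the given one. All freeness claims then concern segments of this
  basis.\<close>

lemma Flf_set_image:
 assumes M: "intw M \<mu> A" and U: "U : Z k A"
 shows "(\<lambda>j\<in>{0..l}. \<mu> ` U j) : Flf_set M l \<rho>"
proof -
 note D = intwD[OF M]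
 note L = locD[OF D(1)]
 obtain g h where g: "invm k g h" and Ug: "!!j. j <= l ==> U j = fl k g j" by (rule Z_flag[OF U]) (rule that)
 define \<mu>' where "\<mu>' v = \<mu> (tr k (g v))" for v
 have l': "loc M \<mu>'" using loc_twist[OF D(1) g] unfolding \<mu>'_def .
 note L' = locD[OF l']
 have im: "\<mu> ` U j = \<mu>' ` Gs (lev j)" if "j <= l" for j
  unfolding Ug[OF that] fl_def F_Gs[symmetric] \<mu>'_def image_image ..
 have sub: "submodule (\<mu>' ` Gs (lev j)) H M" if j: "j <= l" for j
  unfolding im[OF j, symmetric]
 proof (rule stable_submodule[OF M])
  note Zs = Z_sub[OF U j]
  show "U j \<subseteq> V k" using Zs(5) by blast
  show "es i x : U j" if "i : {1..n}" "x : U j" for i x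
   using Z_es[OF U j that(2,1)] tr_id[of "es i x" k] Zs(5)[OF that(2)] by simp
  show "tr k (Es 1 x) : U j" if "x : U j" for x by (rule Z_Es[OF U j that])
 qed (use Z_sub[OF U j] Z_stable[OF U j] in auto)
 have fc: "fchar (M\<lparr>carrier := \<mu>' ` Gs (lev j)\<rparr>) i s (\<mu>' ` Gs s0)"
  if "j <= l" "i : {1..n}" "s0 i + s = lev j i" for i j s s0
  by (rule fchar_of_hloc[where ?s1.0 = "lev j" and ?s0.0 = s0, OF L'(1,3,4) sub[OF that(1)] that(2,3) lev_le[OF that(2,1)]])
 have t0: "\<mu>' ` Gs (%i. 0) = {0}" using lin_0[OF L'(6)] by (simp add: Gs_trivial)
 show ?thesis
  unfolding Flf_set_def
 proof (intro CollectI conjI ballI)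
  show "(\<lambda>j\<in>{0..l}. \<mu> ` U j) : extensional {0..l}" by simp
  have "Gs (lev 0) = Gs (%i. 0)" by (rule arg_cong[where f = Gs]) (simp add: fun_eq_iff)
  thus "(\<lambda>j\<in>{0..l}. \<mu> ` U j) 0 = {\<zero>\<^bsub>M\<^esub>}" using im[of 0] t0 L(1) by (simp add: pwm_def)
  show "(\<lambda>j\<in>{0..l}. \<mu> ` U j) l = carrier M" using im[of l] L'(5) F_l[of k] by (simp add: F_Gs)
  fix j assume "j : {0..l}"
  hence j: "j <= l" by simp
  show "submodule ((\<lambda>j\<in>{0..l}. \<mu> ` U j) j) H M" using j sub[OF j] im[OF j] by simp
  show "locally_free (M\<lparr>carrier := (\<lambda>j\<in>{0..l}. \<mu> ` U j) j\<rparr>)"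
   unfolding locally_free_def
  proof
   fix i assume i: "i : {1..n}"
   have "fchar (M\<lparr>carrier := \<mu>' ` Gs (lev j)\<rparr>) i (lev j i) {0}" using fc[OF j i, of "%i. 0" "lev j i"] t0 by simp
   thus "EX r. free_at (M\<lparr>carrier := (\<lambda>j\<in>{0..l}. \<mu> ` U j) j\<rparr>) i r"
    using free_at_pwm[OF pwm_sub[OF L(1) sub[OF j]] i] j im[OF j] by auto
  qed
 next
  fix j assume j: "j : {1..l}"
  hence jl: "j <= l" "j - 1 <= l" "j - 1 <= j" by auto
  have lev: "lev (j - 1) i + \<rho> j i = lev j i" for i using lev_Suc[of "j - 1" i] j by simp
  have "F k (j - 1) \<subseteq> F k j" using F_mono[OF jl(3)] by blast
  hence s: "\<mu>' ` Gs (lev (j - 1)) \<subseteq> \<mu>' ` Gs (lev j)" unfolding F_Gs by blast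
  show "(\<lambda>j\<in>{0..l}. \<mu> ` U j) (j - 1) \<subseteq> (\<lambda>j\<in>{0..l}. \<mu> ` U j) j"
   using j s im[OF jl(1)] im[OF jl(2)] jl by simp
  show "has_rank_vector (quotient_module (M\<lparr>carrier := (\<lambda>j\<in>{0..l}. \<mu> ` U j) j\<rparr>) ((\<lambda>j\<in>{0..l}. \<mu> ` U j) (j - 1))) (\<rho> j)"
   unfolding has_rank_vector_def
  proof
   fix i assume i: "i : {1..n}"
   show "free_at (quotient_module (M\<lparr>carrier := (\<lambda>j\<in>{0..l}. \<mu> ` U j) j\<rparr>) ((\<lambda>j\<in>{0..l}. \<mu> ` U j) (j - 1))) i (\<rho> j i)"
    using free_at_quotient[OF pwm_sub[OF L(1) sub[OF jl(1)]] i
      submodule_sub[OF L(1) sub[OF jl(2)] sub[OF jl(1)] s], of "\<rho> j i"]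
     fc[of j i "lev (j - 1)" "\<rho> j i", OF jl(1) i lev] j jl im[OF jl(1)] im[OF jl(2)] by simp
  qed
 qed
qed

text \<open>An adapted basis is one more basis of the module over the loops, and the matrix
  comparing it with \<open>\<mu>\<close> is the frame required in \<open>Z\<close>.\<close>

lemma Flf_set_preimage:
 assumes M: "intw M \<mu> A" and W: "W : Flf_set M l \<rho>"
 shows "EX U:Z k A. W = (\<lambda>j\<in>{0..l}. \<mu> ` U j)"
proof -
 note D = intwD[OF M]
 note L = locD[OF D(1)]
 have W': "W : extensional {0..l}" "W 0 = {0}" "W l = carrier M" "!!j. j <= l ==> submodule (W j) H M"
  "!!j. j : {1..l} ==> W (j - 1) \<subseteq> W j"
  "!!j. j : {1..l} ==> has_rank_vector (quotient_module (M\<lparr>carrier := W j\<rparr>) (W (j - 1))) (\<rho> j)"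
  using W L(1) unfolding Flf_set_def pwm_def by auto
 have inc: "W j \<subseteq> W (Suc j)" if "j < l" for j using W'(5)[of "Suc j"] that by simp
 have "\<exists>\<tau>. hloc M \<tau> & inj_on \<tau> (F k l) & (ALL j'<=l. \<tau> ` F k j' = W j')"
 proof (rule flag_basis[OF L(1) W'(2,4) inc])
  fix j i assume j: "j < l" and i: "i : {1..n}"
  have S: "submodule (W j) H M" "submodule (W (Suc j)) H M" using W'(4) j by auto
  have "free_at (quotient_module (M\<lparr>carrier := W (Suc j)\<rparr>) (W j)) i (\<rho> (Suc j) i)"
   using W'(6)[of "Suc j"] j i by (simp add: has_rank_vector_def)
  thus "fchar (M\<lparr>carrier := W (Suc j)\<rparr>) i (\<rho> (Suc j) i) (W j)"
   using free_at_quotient[OF pwm_sub[OF L(1) S(2)] i submodule_sub[OF L(1) S inc[OF j]]] by simp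
 qed simp_all
 then obtain \<mu>' where \<mu>': "hloc M \<mu>'" "inj_on \<mu>' (F k l)" "!!j. j <= l ==> \<mu>' ` F k j = W j" by blast
 have "loc M \<mu>'" unfolding loc_def bij_betw_def using L(1) \<mu>'(1,2) \<mu>'(3)[of l] W'(3) by (simp add: F_l)
 then obtain g h where g: "invm k g h" "ALL v:V k. \<mu>' v = \<mu> (tr k (g v))" using loc_compare[OF D(1)] by blast
 define U where "U = (\<lambda>j\<in>{0..l}. fl k g j)"
 have UW: "\<mu> ` U j = W j" if j: "j <= l" for j
 proof -
  have "\<mu> ` U j = (%v. \<mu> (tr k (g v))) ` F k j" using j by (simp add: U_def fl_def image_image)
  also have "... = \<mu>' ` F k j" by (rule image_cong[OF refl]) (use g(2) F_V in simp)
  finally show ?thesis using \<mu>'(3)[OF j] by simp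
 qed
 have "U : Z k A"
  unfolding Z_def
 proof (intro CollectI conjI allI impI ballI)
  show "U : extensional {0..l}" by (simp add: U_def)
  show "EX g h. invm k g h & (ALL j<=l. U j = fl k g j)" using g(1) by (intro exI[of _ g] exI[of _ h]) (simp add: U_def)
  fix j a x assume j: "j <= l" and a: "a : Arr" and x: "x : U j"
  obtain i j' h' where ah: "a = (i, j', h')" by (cases a)
  have xV: "x : V k" using x j fl_V by (simp add: U_def)
  have "\<mu> x : W j" using UW[OF j] x by blast
  hence "arr (Alpha i j' h') \<star>M \<mu> x : W j"
   using W'(4)[OF j] arr_closed[OF Arr_D(6)] a unfolding submodule_iff[OF L(1)] ah by blast
  hence "\<mu> (tr k (A a x)) : \<mu> ` U j" unfolding UW[OF j] using D(3) a xV ah by simp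
  then obtain u where u: "\<mu> (tr k (A a x)) = \<mu> u" "u : U j" by (rule imageE)
  have "u : V k" using u(2) j fl_V by (simp add: U_def)
  hence "tr k (A a x) = u" by (intro inj_onD[OF L(4)] u(1)) simp_all
  thus "tr k (A a x) : U j" using u(2) by simp
 qed
 moreover have "W = (\<lambda>j\<in>{0..l}. \<mu> ` U j)"
  using W'(1) UW by (auto simp: fun_eq_iff extensional_def)
 ultimately show ?thesis by blast
qed

end

section \<open>Extensions and rigidity\<close>

context gls_pos
begin

text \<open>Matrix modules live on some \<open>coord_space N\<close>; an enumeration of the finite
  set \<open>J\<close> moves a representation on functions supported in \<open>J\<close>
  there.\<close>

lemma transport_rep:
 fixes E :: "nat => ('x => complex) => 'x => complex" and T :: "arrow => ('x => complex) => 'x => complex"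
 assumes J: "finite J" and VJ: "VJ = {v. ALL t. t \<notin> J --> v t = 0}"
  and lin: "!!i. i : {1..n} ==> lin (E i)" "!!a. a : arrows ==> lin (T a)"
  and closed: "!!i v. i : {1..n} ==> v : VJ ==> E i v : VJ" "!!a v. a : arrows ==> v : VJ ==> T a v : VJ"
  and E_E: "!!i j v. i : {1..n} ==> j : {1..n} ==> v : VJ ==> E i (E j v) = (if i = j then E i v else 0)"
  and E_sum: "!!v. v : VJ ==> (SUM i:{1..n}. E i v) = v"
  and source: "!!a v. a : arrows ==> v : VJ ==> T a (E (arrow_source a) v) = T a v"
  and target: "!!a v. a : arrows ==> v : VJ ==> E (arrow_target a) (T a v) = T a v"
  and nilp: "!!i v. i : {1..n} ==> v : VJ ==> (T (Eps i) ^^ c i) (E i v) = 0"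
  and comm: "!!i j h v. (i, j) : \<Omega> ==> 1 <= h ==> h <= g i j ==> v : VJ ==>
   (T (Eps i) ^^ f j i) (T (Alpha i j h) v) = T (Alpha i j h) ((T (Eps j) ^^ f i j) (E j v))"
 shows "\<exists>M \<mu>. matrix_module M & elin M \<mu> & bij_betw \<mu> VJ (carrier M) \<and>
  (ALL v:VJ. (ALL i:{1..n}. idem i \<star>M \<mu> v = \<mu> (E i v)) & (ALL a:arrows. arr a \<star>M \<mu> v = \<mu> (T a v)))"
proof -
 define N where "N = card J"
 obtain \<nu> where \<nu>: "bij_betw \<nu> {0..<N} J" using ex_bij_betw_nat_finite[OF J] unfolding N_def by blast
 define \<nu>' where "\<nu>' = the_inv_into {0..<N} \<nu>"
 have n1: "\<nu> x : J" "\<nu>' (\<nu> x) = x" if "x < N" for x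
  using \<nu> that the_inv_into_f_f[of \<nu> "{0..<N}" x] unfolding bij_betw_def \<nu>'_def by auto
 have n2: "\<nu>' t < N" "\<nu> (\<nu>' t) = t" if "t : J" for t
  using \<nu> that the_inv_into_into[of \<nu> "{0..<N}" t "{0..<N}"] f_the_inv_into_f[of \<nu> "{0..<N}" t]
  unfolding bij_betw_def \<nu>'_def by auto
 define th where "th v = (%x. if x < N then v (\<nu> x) else 0)" for v :: "'x => complex"
 define ph where "ph w = (%t. if t : J then w (\<nu>' t) else 0)" for w :: "nat => complex"
 have lth: "lin th" and lph: "lin ph" by (auto intro!: linI simp: th_def ph_def fun_eq_iff)
 have thN: "th v : coord_space N" for v by (simp add: th_def coord_space_def)
 have phJ: "ph w : VJ" for w by (simp add: ph_def VJ)
 have pt: "ph (th v) = v" if "v : VJ" for v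
 proof
  show "ph (th v) t = v t" for t using that n2[of t] by (auto simp: ph_def th_def VJ)
 qed
 have tp: "th (ph w) = w" if "w : coord_space N" for w
 proof
  show "th (ph w) x = w x" for x using that n1[of x] by (auto simp: ph_def th_def coord_space_def)
 qed
 have pw: "((%w. th (T (Eps i) (ph w))) ^^ b) (th v) = th ((T (Eps i) ^^ b) v) & (T (Eps i) ^^ b) v : VJ"
  if i: "i : {1..n}" and v: "v : VJ" for i b v
 proof (induction b)
  case (Suc b)
  thus ?case using pt closed(2)[OF Eps_arrow[OF i]] by simp
 qed (simp add: v)
 interpret R: gls_rep n C c \<Omega> N "%i w. th (E i (ph w))" "%a w. th (T a (ph w))"
 proof (unfold_locales, goal_cases)
  case (1 i) show ?case by (rule lin_comp[OF lth lin_comp[OF lin(1)[OF 1] lph]])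
 next
  case (2 a) show ?case by (rule lin_comp[OF lth lin_comp[OF lin(2)[OF 2] lph]])
 next
  case (3 i v) show ?case by (rule thN)
 next
  case (4 a v) show ?case by (rule thN)
 next
  case (5 i j v)
  show ?case unfolding pt[OF closed(1)[OF 5(2) phJ]] E_E[OF 5(1,2) phJ] using lin_0[OF lth] by (auto split: if_splits)
 next
  case (6 v)
  show ?case unfolding lin_sum[OF lth, symmetric] E_sum[OF phJ] by (rule tp[OF 6])
 next
  case (7 a v)
  have s: "arrow_source a : {1..n}" using arrow_ends[OF 7(1)] by simp
  show ?case unfolding pt[OF closed(1)[OF s phJ]] source[OF 7(1) phJ] ..
 next
  case (8 a v)
  show ?case unfolding pt[OF closed(2)[OF 8(1) phJ]] target[OF 8(1) phJ] ..
 next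
  case (9 i v)
  show ?case unfolding conjunct1[OF pw[OF 9(1) closed(1)[OF 9(1) phJ]]] nilp[OF 9(1) phJ] by (rule lin_0[OF lth])
 next
  case (10 i j h v)
  have ij: "i : {1..n}" "j : {1..n}" using om 10(1) by auto
  note a = Alpha_arrow[OF 10(1-3)]
  note w = pw[OF ij(2) closed(1)[OF ij(2) phJ]]
  show ?case
   unfolding conjunct1[OF pw[OF ij(1) closed(2)[OF a phJ]]] conjunct1[OF w] pt[OF conjunct2[OF w]] comm[OF 10(1-3) phJ] ..
 qed
 note M = matrix_pwm[OF R.Mod_matrix]
 show ?thesis
 proof (intro exI conjI ballI)
  show "matrix_module R.RMod" by (rule R.Mod_matrix)
  show "elin R.RMod th" unfolding elin_pwm[OF M] using lth thN by (simp add: R.Mod_simps)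
  show "bij_betw th VJ (carrier R.RMod)"
   by (rule bij_betw_byWitness[where f' = ph]) (use pt tp thN phJ in \<open>auto simp: R.Mod_simps\<close>)
  fix v assume v: "v : VJ"
  show "idem i \<odot>\<^bsub>R.RMod\<^esub> th v = th (E i v)" if i: "i : {1..n}" for i
   using R.Mod_idem[OF i thN, of v] pt[OF v] by simp
  show "arr a \<odot>\<^bsub>R.RMod\<^esub> th v = th (T a v)" if a: "a : arrows" for a
   using R.Mod_arr[OF a thN, of v] pt[OF v] by simp
 qed
qed

lemma lmod_hom_id: assumes "left_module H M" shows "(%x. x) : lmod_hom H M M"
 by (simp add: lmod_hom_def hom_def)

lemma lmod_homD:
 fixes f :: "'v => 'w"
 assumes "f : lmod_hom H M E"
 shows "x : carrier M ==> f x : carrier E" "x : carrier M ==> y : carrier M ==> f (x \<box>M y) = f x \<box>E f y"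
  "h : carrier H ==> x : carrier M ==> f (h \<star>M x) = h \<star>E f x"
 using assms by (auto simp: lmod_hom_def hom_def)

text \<open>Reflexivity of the relation does the work: each extension belongs to its own class, so
  if there is only one class it contains them all.\<close>

lemma rigid_iff:
 "rigid H M \<longleftrightarrow> extensions H M M ~= {} & (ALL x:extensions H M M. ALL y:extensions H M M. (x, y) : yoneda_equiv H M M)"
proof
 have refl: "(x, x) : yoneda_equiv H M M" if "x : extensions H M M" for x
 proof -
  obtain E f g where x: "x = (E, f, g)" by (cases x)
  have "left_module H E" using that x by (simp add: extensions_def)
  thus ?thesis using that lmod_hom_id[of E] unfolding x yoneda_equiv_def by auto
 qed
 assume "rigid H M"
 then obtain k where k: "extensions H M M // yoneda_equiv H M M = {k}" unfolding rigid_def Ext1_def by (rule is_singletonE)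
 have cl: "yoneda_equiv H M M `` {x} = k" if "x : extensions H M M" for x using quotientI[OF that, of "yoneda_equiv H M M"] unfolding k by (rule singletonD)
 have "extensions H M M ~= {}"
 proof
  assume "extensions H M M = {}"
  thus False using k unfolding quotient_def by simp
 qed
 moreover have "(x, y) : yoneda_equiv H M M" if "x : extensions H M M" "y : extensions H M M" for x y
 proof -
  have "y : yoneda_equiv H M M `` {y}" using refl[OF that(2)] by simp
  thus ?thesis unfolding cl[OF that(2)] cl[OF that(1), symmetric] by simp
 qed
 ultimately show "extensions H M M ~= {} & (ALL x:extensions H M M. ALL y:extensions H M M. (x, y) : yoneda_equiv H M M)" by blast
next
 assume r: "extensions H M M ~= {} & (ALL x:extensions H M M. ALL y:extensions H M M. (x, y) : yoneda_equiv H M M)"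
 have "yoneda_equiv H M M `` {x} = extensions H M M" if "x : extensions H M M" for x
 proof -
  have "yoneda_equiv H M M \<subseteq> UNIV \<times> extensions H M M" by (auto simp: yoneda_equiv_def)
  hence "z : extensions H M M" if "(x, z) : yoneda_equiv H M M" for z using that by (rule subsetD[THEN SigmaD2])
  thus ?thesis using r that unfolding Image_singleton by (intro equalityI subsetI) simp_all
 qed
 hence "extensions H M M // yoneda_equiv H M M = {extensions H M M}" using r unfolding quotient_def by simp
 thus "rigid H M" by (simp add: rigid_def Ext1_def is_singleton_def)
qed

end

lemma case_sum_split: "case_sum (%t. u (Inl t)) (%t. u (Inr t)) = u"
 by (rule ext) (simp split: sum.split)

lemma case_sum_add: "case_sum (v + v') (w + w') = case_sum v w + (case_sum v' w' :: 'a + 'b => complex)"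
 and case_sum_cs: "case_sum (cs z x) (cs z y) = cs z (case_sum x y)"
 and case_sum_0: "case_sum 0 0 = (0 :: 'a + 'b => complex)"
 by (rule ext, simp split: sum.split)+

lemma case_sum_sum: "(SUM i:X. case_sum (F i) (G i)) = (case_sum (SUM i:X. F i) (SUM i:X. G i) :: 'a + 'b => complex)"
 by (rule ext) (simp add: sum_fun_apply split: sum.split)

lemma lin_case_sum: assumes "lin P" "lin Q" shows "lin (%u. case_sum (P u) (Q u))"
 by (rule linI) (simp_all only: lin_add[OF assms(1)] lin_add[OF assms(2)] lin_scale[OF assms(1)] lin_scale[OF assms(2)]
   case_sum_add case_sum_cs)

lemma lin_Inl: "lin (%u t. u (Inl t))" and lin_Inr: "lin (%u t. u (Inr t))"
 by (auto intro!: linI)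

text \<open>A module on \<open>V k \<oplus> V k\<close> on which the arrows act by the block matrices of \<open>A\<close>, \<open>B\<close>, \<open>A\<close>.\<close>

locale gls_dbl = gls_model +
 fixes E :: "((path => complex) set, 'v) module" and \<Psi> :: "vec3 => vec3 => 'v"
  and A B :: "nat * nat * nat => vec3 => vec3"
 assumes E: "left_module H E" and A: "A : rep" and B: "B : rep"
  and Psi_closed: "\<Psi> v w : carrier E"
  and Psi_add: "\<Psi> (v + v') (w + w') = \<Psi> v w \<box>E \<Psi> v' w'"
  and Psi_cs: "\<Psi> (cs z v) (cs z w) = scalar z \<star>E \<Psi> v w"
  and Psi_surj: "x : carrier E ==> EX v w. v : V k & w : V k & x = \<Psi> v w"
  and Psi_inj: "v : V k ==> w : V k ==> v' : V k ==> w' : V k ==> \<Psi> v w = \<Psi> v' w' ==> v = v' & w = w'"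
  and Psi_idem: "i : {1..n} ==> v : V k ==> w : V k ==> idem i \<star>E \<Psi> v w = \<Psi> (es i v) (es i w)"
  and Psi_eps: "i : {1..n} ==> v : V k ==> w : V k ==>
   arr (Eps i) \<star>E \<Psi> v w = \<Psi> (tr k (Es 1 (es i v))) (tr k (Es 1 (es i w)))"
  and Psi_alpha: "(i, j, h) : Arr ==> v : V k ==> w : V k ==>
   arr (Alpha i j h) \<star>E \<Psi> v w = \<Psi> (tr k (A (i, j, h) v) + tr k (B (i, j, h) w)) (tr k (A (i, j, h) w))"

context gls_model
begin

abbreviation "dbl \<equiv> gls_dbl n c m Arr p r C k \<Omega>"

lemma arrow_cases:
 assumes "a : arrows"
 obtains i where "i : {1..n}" "a = Eps i" | i j h where "(i, j, h) : Arr" "a = Alpha i j h"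
 using assms unfolding arrows_def Arr_eq by blast

text \<open>In the coordinates \<open>\<Psi>\<close> and \<open>\<Psi>'\<close> the generators act
  by the same formulas, so matching coordinates is a homomorphism.\<close>

lemma dbl_hom:
 assumes X: "dbl X \<Psi> A B" and X': "dbl X' \<Psi>' A B"
 shows "\<exists>\<phi>\<in>lmod_hom H X X'. ALL v:V k. ALL w:V k. \<phi> (\<Psi> v w) = \<Psi>' v w"
proof -
 interpret X: gls_dbl n c m Arr p r C k \<Omega> X \<Psi> A B by (rule X)
 interpret X': gls_dbl n c m Arr p r C k \<Omega> X' \<Psi>' A B by (rule X')
 define \<phi> where "\<phi> x = (SOME y. EX v w. v : V k & w : V k & x = \<Psi> v w & y = \<Psi>' v w)" for x
 have phi: "\<phi> (\<Psi> v w) = \<Psi>' v w" if vw: "v : V k" "w : V k" for v w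
 proof -
  have "EX y v' w'. v' : V k & w' : V k & \<Psi> v w = \<Psi> v' w' & y = \<Psi>' v' w'" using vw by blast
  hence "EX v' w'. v' : V k & w' : V k & \<Psi> v w = \<Psi> v' w' & \<phi> (\<Psi> v w) = \<Psi>' v' w'" unfolding \<phi>_def by (rule someI_ex)
  then obtain v' w' where e: "v' : V k" "w' : V k" "\<Psi> v w = \<Psi> v' w'" "\<phi> (\<Psi> v w) = \<Psi>' v' w'" by (elim exE conjE)
  have "v = v' & w = w'" by (rule X.Psi_inj[OF vw e(1,2,3)])
  thus ?thesis using e(4) by simp
 qed
 have "\<phi> : lmod_hom H X X'"
 proof (rule hom_by_generators[OF X.E X'.E])
  fix x assume x: "x : carrier X"
  obtain v w where v: "v : V k" "w : V k" "x = \<Psi> v w" using X.Psi_surj[OF x] by (elim exE conjE)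
  show "\<phi> x : carrier X'" unfolding v(3) phi[OF v(1,2)] by (rule X'.Psi_closed)
  show "\<phi> (scalar z \<star>X x) = scalar z \<star>X' \<phi> x" for z
   unfolding v(3) X.Psi_cs[symmetric] phi[OF v(1,2)] phi[OF V_sub(4)[OF v(1)] V_sub(4)[OF v(2)]] X'.Psi_cs ..
  show "\<phi> (idem i \<star>X x) = idem i \<star>X' \<phi> x" if i: "i : {1..n}" for i
   unfolding v(3) X.Psi_idem[OF i v(1,2)] phi[OF v(1,2)] phi[OF V_sub(5)[OF v(1)] V_sub(5)[OF v(2)]] X'.Psi_idem[OF i v(1,2)] ..
  show "\<phi> (arr a \<star>X x) = arr a \<star>X' \<phi> x" if a: "a : arrows" for a
  proof (rule arrow_cases[OF a])
   fix i assume i: "i : {1..n}" "a = Eps i"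
   show ?thesis unfolding i(2) v(3) X.Psi_eps[OF i(1) v(1,2)] phi[OF v(1,2)] phi[OF tr_V tr_V] X'.Psi_eps[OF i(1) v(1,2)] ..
  next
   fix i j h assume i: "(i, j, h) : Arr" "a = Alpha i j h"
   show ?thesis unfolding i(2) v(3) X.Psi_alpha[OF i(1) v(1,2)] phi[OF v(1,2)] phi[OF V_sub(2)[OF tr_V tr_V] tr_V] X'.Psi_alpha[OF i(1) v(1,2)] ..
  qed
  fix y assume y: "y : carrier X"
  obtain v' w' where v': "v' : V k" "w' : V k" "y = \<Psi> v' w'" using X.Psi_surj[OF y] by (elim exE conjE)
  show "\<phi> (x \<box>X y) = \<phi> x \<box>X' \<phi> y"
   unfolding v(3) v'(3) X.Psi_add[symmetric] phi[OF v(1,2)] phi[OF v'(1,2)]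
    phi[OF V_sub(2)[OF v(1) v'(1)] V_sub(2)[OF v(2) v'(2)]] X'.Psi_add ..
 qed
 thus ?thesis by (rule rev_bexI) (intro ballI phi)
qed

lemma Eps_power:
 assumes T: "!!v. v : V k ==> T v = tr k (Es 1 (es i v))" and v: "v : V k"
 shows "(T ^^ b) (es i v) = tr k (Es b (es i v))"
proof (induction b)
 case 0
 show ?case using tr_id[of "es i v" k] v by simp
next
 case (Suc b)
 have "(T ^^ Suc b) (es i v) = tr k (Es 1 (es i (tr k (Es b (es i v)))))" using Suc T[OF tr_V] by simp
 also have "... = tr k (Es 1 (tr k (Es b (es i v))))" unfolding es_commute by simp
 also have "... = tr k (Es (Suc b) (es i v))" using tr_Es_tr[of "Es b (es i v)" k 1] V_Vin[OF v] by (simp add: Es_Es)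
 finally show ?case .
qed

lemma tr_Es_nil: "tr k (Es (k * c i) (es i v)) = 0"
 by (rule vec3_eqI) (auto simp: ops_apply)

lemma rep_comm:
 assumes A: "A : rep" and a: "(i, j, h) : Arr" and v: "v : V k"
 shows "tr k (A (i, j, h) (tr k (Es (r i j) (es j v)))) = tr k (Es (p i j) (tr k (A (i, j, h) v)))"
proof -
 have vi: "v : Vin" "es j v : Vin" using V_Vin[OF v] by auto
 have "tr k (A (i, j, h) (tr k (Es (r i j) (es j v)))) = tr k (A (i, j, h) (Es (r i j) (es j v)))"
  using dop_tr[OF rep_dop[OF A a], of "Es (r i j) (es j v)"] vi by simp
 also have "... = tr k (Es (p i j) (A (i, j, h) v))"
  unfolding repD(5)[OF A a vi(2)] repD(4)[OF A a vi(1)] ..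
 also have "... = tr k (Es (p i j) (tr k (A (i, j, h) v)))" using tr_Es_tr[OF repD(2)[OF A a vi(1)]] by simp
 finally show ?thesis .
qed

lemma loc_rank: assumes l: "loc M \<mu>" shows "has_rank_vector M m"
 unfolding has_rank_vector_def
proof
 note L = locD[OF l]
 fix i assume i: "i : {1..n}"
 have s: "submodule (\<mu> ` Gs m) H M" unfolding Gs_full L(5) by (rule submodule_full[OF L(1)])
 have "fchar (M\<lparr>carrier := \<mu> ` Gs m\<rparr>) i (m i) (\<mu> ` Gs (%i. 0))"
  by (rule fchar_of_hloc[OF L(1,3,4) s i]) simp_all
 moreover have "\<mu> ` Gs (%i. 0) = {0}" unfolding Gs_trivial image_insert image_empty lin_0[OF L(6)] ..
 ultimately show "free_at M i (m i)" unfolding free_at_pwm[OF L(1) i] Gs_full L(5) by simp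
qed

lemma model_module:
 assumes A: "A : rep" shows "\<exists>M \<mu>. matrix_module M & intw M \<mu> A"
proof -
 define T where "T a = (case a of Eps i => (%v. tr k (Es 1 (es i v))) | Alpha i j h => (%v. tr k (A (i, j, h) v)))" for a
 have T: "T (Eps i) = (%v. tr k (Es 1 (es i v)))" "T (Alpha i j h) = (%v. tr k (A (i, j, h) v))" for i j h
  by (simp_all add: T_def)
 have "\<exists>M \<mu>. matrix_module M & elin M \<mu> & bij_betw \<mu> (V k) (carrier M) \<and>
  (ALL v:V k. (ALL i:{1..n}. idem i \<star>M \<mu> v = \<mu> (es i v)) & (ALL a:arrows. arr a \<star>M \<mu> v = \<mu> (T a v)))"
 proof (rule transport_rep[OF fin_I V_def lin_es], goal_cases)
  case (1 a)
  show ?case by (rule arrow_cases[OF 1])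
    (use lin_comp[OF lin_tr lin_comp[OF lin_Es lin_es]] lin_comp[OF lin_tr repD(1)[OF A]] in \<open>simp_all add: T\<close>)
 next
  case (3 a v) show ?case by (rule arrow_cases[OF 3(1)]) (simp_all add: T)
 next
  case (5 v) show ?case by (rule Vin_expand[OF V_Vin[OF 5], symmetric])
 next
  case (6 a v)
  show ?case by (rule arrow_cases[OF 6(1)]) (simp_all add: T repD(4)[OF A _ V_Vin[OF 6(2)]])
 next
  case (7 a v)
  show ?case by (rule arrow_cases[OF 7(1)]) (simp_all add: T es_commute repD(3)[OF A _ V_Vin[OF 7(2)]])
 next
  case (8 i v)
  show ?case using Eps_power[of "T (Eps i)" i v "k * c i"] 8 tr_Es_nil by (simp add: T)
 next
  case (9 i j h v)
  hence a: "(i, j, h) : Arr" by (simp add: Arr_eq)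
  have e: "es i (tr k (A (i, j, h) v)) = tr k (A (i, j, h) v)" unfolding es_commute repD(3)[OF A a V_Vin[OF 9(4)]] ..
  have "(T (Eps i) ^^ f j i) (T (Alpha i j h) v) = tr k (Es (p i j) (tr k (A (i, j, h) v)))"
   using Eps_power[of "T (Eps i)" i "tr k (A (i, j, h) v)" "f j i"] e by (simp add: T p_eq)
  also have "... = T (Alpha i j h) ((T (Eps j) ^^ f i j) (es j v))"
   using Eps_power[of "T (Eps j)" j v "f i j"] 9(4) rep_comm[OF A a 9(4)] by (simp add: T r_eq)
  finally show ?case .
 qed simp_all
 then obtain M \<mu> where M: "matrix_module M" "elin M \<mu>" "bij_betw \<mu> (V k) (carrier M)"
  and act: "ALL v:V k. (ALL i:{1..n}. idem i \<star>M \<mu> v = \<mu> (es i v)) & (ALL a:arrows. arr a \<star>M \<mu> v = \<mu> (T a v))"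
  by (elim exE conjE)
 have ar: "arr a \<star>M \<mu> v = \<mu> (T a v)" if "v : V k" "a : arrows" for v a using act that by blast
 have "hloc M \<mu>"
  unfolding hloc_def using M(2) act ar[OF _ Eps_arrow] by (simp add: T)
 hence "intw M \<mu> A"
  unfolding intw_def loc_def using M A matrix_pwm[OF M(1)] ar[OF _ Arr_D(6)] by (simp add: T)
 thus ?thesis using M(1) by blast
qed

text \<open>Pairs of vectors are functions on a disjoint sum of two copies of \<open>I k\<close>.
  The block triangular arrows satisfy the commutation relation because \<open>A\<close> and
  \<open>B\<close> satisfy it separately.\<close>

lemma dbl_exists:
 assumes A: "A : rep" and B: "B : rep" shows "\<exists>(X :: ((path => complex) set, nat => complex) module) \<Psi>. dbl X \<Psi> A B"
proof -
 define L R where "L u = (%t. u (Inl t))" and "R u = (%t. u (Inr t))" for u :: "(nat * nat * nat) + (nat * nat * nat) => complex"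
 have LR: "L (case_sum v w) = v" "R (case_sum v w) = w" "case_sum (L u) (R u) = u" for v w u
  by (simp_all add: L_def R_def case_sum_split)
 have lL: "lin L" and lR: "lin R" unfolding L_def R_def by (rule lin_Inl lin_Inr)+
 define J where "J = Inl ` I k \<union> Inr ` I k"
 define VJ where "VJ = {v :: (nat * nat * nat) + (nat * nat * nat) => complex. ALL t. t \<notin> J --> v t = 0}"
 have VJ: "u : VJ \<longleftrightarrow> L u : V k & R u : V k" for u
 proof
  assume "u : VJ"
  thus "L u : V k & R u : V k" by (auto simp: VJ_def V_def J_def L_def R_def image_iff simp del: split_paired_All)
 next
  assume a: "L u : V k & R u : V k"
  have "u t = 0" if "t \<notin> J" for t
   using a that by (cases t) (auto simp: V_def J_def L_def R_def simp del: split_paired_All)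
  thus "u : VJ" by (simp add: VJ_def)
 qed
 define e where "e i u = case_sum (es i (L u)) (es i (R u))" for i u
 define T where "T a = (case a of Eps i => (%u. case_sum (tr k (Es 1 (es i (L u)))) (tr k (Es 1 (es i (R u)))))
  | Alpha i j h => (%u. case_sum (tr k (A (i, j, h) (L u)) + tr k (B (i, j, h) (R u))) (tr k (A (i, j, h) (R u)))))" for a
 have T: "T (Eps i) = (%u. case_sum (tr k (Es 1 (es i (L u)))) (tr k (Es 1 (es i (R u)))))"
  "T (Alpha i j h) = (%u. case_sum (tr k (A (i, j, h) (L u)) + tr k (B (i, j, h) (R u))) (tr k (A (i, j, h) (R u))))" for i j h
  by (simp_all add: T_def)
 have pw: "(T (Eps i) ^^ b) (case_sum (es i v) (es i w)) = case_sum (tr k (Es b (es i v))) (tr k (Es b (es i w)))"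
  if v: "v : V k" and w: "w : V k" for i b v w
 proof (induction b)
  case 0
  have "tr k (es i v) = es i v" "tr k (es i w) = es i w" using tr_id v w by auto
  thus ?case unfolding funpow.simps id_apply Es_0 by (simp only:)
 next
  case (Suc b)
  have 1: "tr k (Es 1 (es i (tr k (Es b (es i v))))) = tr k (Es (Suc b) (es i v))" if v: "v : V k" for v
  proof -
   have "tr k (Es 1 (es i (tr k (Es b (es i v))))) = tr k (Es 1 (tr k (Es b (es i v))))" unfolding es_commute by simp
   thus ?thesis using tr_Es_tr[of "Es b (es i v)" k 1] V_Vin[OF v] by (simp add: Es_Es)
  qed
  show ?case unfolding funpow.simps o_apply Suc unfolding T LR 1[OF v] 1[OF w] ..
 qed
 have fJ: "finite J" by (simp add: J_def)
 have le: "lin (e i)" for i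
  unfolding e_def by (rule lin_case_sum[OF lin_comp[OF lin_es lL] lin_comp[OF lin_es lR]])
 have "\<exists>M \<mu>. matrix_module M & elin M \<mu> & bij_betw \<mu> VJ (carrier M) \<and>
  (ALL v:VJ. (ALL i:{1..n}. idem i \<star>M \<mu> v = \<mu> (e i v)) & (ALL a:arrows. arr a \<star>M \<mu> v = \<mu> (T a v)))"
 proof (rule transport_rep[OF fJ VJ_def le], goal_cases)
  case (1 a)
  show ?case
  proof (rule arrow_cases[OF 1])
   fix i assume "a = Eps i"
   thus ?thesis
    using lin_case_sum[OF lin_comp[OF lin_tr lin_comp[OF lin_Es lin_comp[OF lin_es lL]]]
      lin_comp[OF lin_tr lin_comp[OF lin_Es lin_comp[OF lin_es lR]]]] by (simp only: T)
  next
   fix i j h assume a: "(i, j, h) : Arr" "a = Alpha i j h"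
   thus ?thesis
    using lin_case_sum[OF lin_plus[OF lin_comp[OF lin_tr lin_comp[OF repD(1)[OF A a(1)] lL]]
       lin_comp[OF lin_tr lin_comp[OF repD(1)[OF B a(1)] lR]]]
      lin_comp[OF lin_tr lin_comp[OF repD(1)[OF A a(1)] lR]]] by (simp only: T)
  qed
 next
  case (2 i v) thus ?case unfolding VJ e_def LR by simp
 next
  case (3 a v)
  show ?case by (rule arrow_cases[OF 3(1)]) (simp_all only: VJ T LR tr_V V_sub(2)[OF tr_V tr_V] simp_thms)
 next
  case (4 i j v)
  show ?case unfolding e_def LR es_es by (cases "i = j") (simp_all only: if_True if_False simp_thms case_sum_0)
 next
  case (5 v)
  hence v: "L v : Vin" "R v : Vin" using VJ V_Vin by auto
  show ?case unfolding e_def case_sum_sum Vin_expand[OF v(1), symmetric] Vin_expand[OF v(2), symmetric] LR ..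
 next
  case (6 a v)
  hence v: "L v : Vin" "R v : Vin" using VJ V_Vin by auto
  show ?case
   by (rule arrow_cases[OF 6(1)])
    (simp_all only: T e_def LR arrow_source.simps es_es if_True simp_thms repD(4)[OF A _ v(1)] repD(4)[OF A _ v(2)] repD(4)[OF B _ v(2)])
 next
  case (7 a v)
  hence v: "L v : Vin" "R v : Vin" using VJ V_Vin by auto
  show ?case
   by (rule arrow_cases[OF 7(1)])
    (simp_all only: T e_def LR arrow_target.simps lin_add[OF lin_es] es_commute es_es if_True simp_thms
     repD(3)[OF A _ v(1)] repD(3)[OF A _ v(2)] repD(3)[OF B _ v(2)])
 next
  case (8 i v)
  hence v: "L v : V k" "R v : V k" using VJ by auto
  show ?case unfolding e_def pw[OF v] tr_Es_nil by (rule case_sum_0)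
 next
  case (9 i j h v)
  hence a: "(i, j, h) : Arr" by (simp add: Arr_eq)
  have v: "L v : V k" "R v : V k" using VJ 9(4) by auto
  have e: "es i (tr k (A (i, j, h) w)) = tr k (A (i, j, h) w)" "es i (tr k (B (i, j, h) w)) = tr k (B (i, j, h) w)"
   if "w : V k" for w
   unfolding es_commute repD(3)[OF A a V_Vin[OF that]] repD(3)[OF B a V_Vin[OF that]] by simp_all
  let ?w = "tr k (A (i, j, h) (L v)) + tr k (B (i, j, h) (R v))"
  have ew: "es i ?w = ?w" unfolding lin_add[OF lin_es] e[OF v(1)] e[OF v(2)] ..
  have "(T (Eps i) ^^ f j i) (T (Alpha i j h) v) =
    case_sum (tr k (Es (p i j) ?w)) (tr k (Es (p i j) (tr k (A (i, j, h) (R v)))))"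
   using pw[of ?w "tr k (A (i, j, h) (R v))" "f j i" i] unfolding ew e(1)[OF v(2)] T p_eq by simp
  also have "... = T (Alpha i j h) ((T (Eps j) ^^ f i j) (e j v))"
   unfolding e_def pw[OF v]
   unfolding T LR r_eq[symmetric] rep_comm[OF A a v(1)] rep_comm[OF A a v(2)] rep_comm[OF B a v(2)]
    lin_add[OF lin_Es] tr_add ..
  finally show ?case .
 qed
 then obtain M \<mu> where M: "matrix_module M" "elin M \<mu>" "bij_betw \<mu> VJ (carrier M)"
  and act: "ALL v:VJ. (ALL i:{1..n}. idem i \<star>M \<mu> v = \<mu> (e i v)) & (ALL a:arrows. arr a \<star>M \<mu> v = \<mu> (T a v))"
  by (elim exE conjE)
 have J: "case_sum v w : VJ" if "v : V k" "w : V k" for v w unfolding VJ LR using that by simp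
 have ai: "idem i \<star>M \<mu> u = \<mu> (e i u)" if "u : VJ" "i : {1..n}" for u i using act that by blast
 have ar: "arr a \<star>M \<mu> u = \<mu> (T a u)" if "u : VJ" "a : arrows" for u a using act that by blast
 have "dbl M (%v w. \<mu> (case_sum v w)) A B"
 proof (intro gls_dbl.intro gls_dbl_axioms.intro gls_model_axioms, goal_cases)
  case 1 show ?case using M(1) by (simp add: matrix_module_def)
 next
  case 2 show ?case by (rule A)
 next
  case 3 show ?case by (rule B)
 next
  case (4 v w) show ?case by (rule elinD(1)[OF M(2)])
 next
  case (5 v v' w w') show ?case unfolding case_sum_add by (rule elinD(2)[OF M(2)])
 next
  case (6 z v w) show ?case unfolding case_sum_cs by (rule elinD(3)[OF M(2)])
 next
  case (7 x)
  then obtain u where u: "u : VJ" "x = \<mu> u" using M(3) by (auto simp: bij_betw_def)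
  show ?case using u(1) unfolding VJ by (intro exI[of _ "L u"] exI[of _ "R u"]) (simp add: LR u(2))
 next
  case (8 v w v' w')
  have "case_sum v w = case_sum v' w'" by (rule inj_onD[OF bij_betw_imp_inj_on[OF M(3)], OF 8(5) J[OF 8(1,2)] J[OF 8(3,4)]])
  hence "L (case_sum v w) = L (case_sum v' w')" "R (case_sum v w) = R (case_sum v' w')" by simp_all
  thus ?case unfolding LR by simp
 next
  case (9 i v w)
  show ?case unfolding ai[OF J[OF 9(2,3)] 9(1)] e_def LR ..
 next
  case (10 i v w)
  show ?case unfolding ar[OF J[OF 10(2,3)] Eps_arrow[OF 10(1)]] T LR ..
 next
  case (11 i j h v w)
  show ?case unfolding ar[OF J[OF 11(2,3)] Arr_D(6)[OF 11(1)]] T LR ..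
 qed
 thus ?thesis by blast
qed

end

context gls_model
begin

lemma hloc_plus:
 assumes E: "left_module H E" and t: "hloc E \<tau>" "hloc E \<tau>'"
 shows "hloc E (%v. \<tau> v \<box>E \<tau>' v)"
proof -
 interpret E: left_module H E by (rule E)
 have c: "\<tau> v : carrier E" "\<tau>' v : carrier E" for v using elinD(1) hlocD(1) t by blast+
 show ?thesis
  unfolding hloc_def
 proof (intro conjI ballI elin_plus[OF E hlocD(1)[OF t(1)] hlocD(1)[OF t(2)]])
  fix v i assume v: "v : V k" and i: "i : {1..n}"
  show "idem i \<star>E (\<tau> v \<box>E \<tau>' v) = \<tau> (es i v) \<box>E \<tau>' (es i v)"
   unfolding E.smult_r_distr[OF idem_closed[OF i] c] hlocD(2)[OF t(1) v i] hlocD(2)[OF t(2) v i] ..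
  show "arr (Eps i) \<star>E (\<tau> v \<box>E \<tau>' v) = \<tau> (tr k (Es 1 (es i v))) \<box>E \<tau>' (tr k (Es 1 (es i v)))"
   unfolding E.smult_r_distr[OF arr_closed[OF Eps_arrow[OF i]] c] hlocD(3)[OF t(1) v i] hlocD(3)[OF t(2) v i] ..
 qed
qed

lemma hloc_scalar:
 assumes E: "left_module H E" and t: "hloc E \<tau>" shows "hloc E (%v. scalar z \<star>E \<tau> v)"
proof -
 have c: "\<tau> v : carrier E" for v by (rule elinD(1)[OF hlocD(1)[OF t]])
 show ?thesis
  unfolding hloc_def
 proof (intro conjI ballI elin_act[OF E scalar_closed hlocD(1)[OF t]])
  fix v i assume v: "v : V k" and i: "i : {1..n}"
  show "idem i \<star>E (scalar z \<star>E \<tau> v) = scalar z \<star>E \<tau> (es i v)"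
   unfolding scalar_act[OF E c idem_closed[OF i]] hlocD(2)[OF t v i] ..
  show "arr (Eps i) \<star>E (scalar z \<star>E \<tau> v) = scalar z \<star>E \<tau> (tr k (Es 1 (es i v)))"
   unfolding scalar_act[OF E c arr_closed[OF Eps_arrow[OF i]]] hlocD(3)[OF t v i] ..
 qed
qed

lemma hloc_hom:
 fixes f :: "'v => 'w"
 assumes f: "f : lmod_hom H M E" and t: "hloc M \<tau>" shows "hloc E (%v. f (\<tau> v))"
proof -
 note T = hlocD[OF t] and F = lmod_homD[OF f]
 have c: "\<tau> v : carrier M" for v by (rule elinD(1)[OF T(1)])
 show ?thesis
  unfolding hloc_def
 proof (intro conjI ballI elinI)
  show "f (\<tau> v) : carrier E" for v by (rule F(1)[OF c])
  show "f (\<tau> (v + w)) = f (\<tau> v) \<box>E f (\<tau> w)" for v w unfolding elinD(2)[OF T(1)] by (rule F(2)[OF c c])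
  show "f (\<tau> (cs z v)) = scalar z \<star>E f (\<tau> v)" for z v unfolding elinD(3)[OF T(1)] by (rule F(3)[OF scalar_closed c])
  fix v i assume v: "v : V k" and i: "i : {1..n}"
  show "idem i \<star>E f (\<tau> v) = f (\<tau> (es i v))" unfolding T(2)[OF v i, symmetric] by (rule F(3)[OF idem_closed[OF i] c, symmetric])
  show "arr (Eps i) \<star>E f (\<tau> v) = f (\<tau> (tr k (Es 1 (es i v))))"
   unfolding T(3)[OF v i, symmetric] by (rule F(3)[OF arr_closed[OF Eps_arrow[OF i]] c, symmetric])
 qed
qed

text \<open>The arrow blocks are upper triangular, so the vectors \<open>\<Psi> v 0\<close> form a
  copy of \<open>M\<close> as a submodule and the second coordinate gives the quotient.\<close>

lemma dbl_extension:
 assumes M: "intw M \<mu> A" and X: "dbl X \<Psi> A B"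
 shows "EX f g. (X, f, g) : extensions H M M & (ALL v:V k. f (\<mu> v) = \<Psi> v 0) \<and>
  (ALL v:V k. ALL w:V k. g (\<Psi> v w) = \<mu> w)"
proof -
 interpret X: gls_dbl n c m Arr p r C k \<Omega> X \<Psi> A B by (rule X)
 note D = intwD[OF M] and L = locD[OF intwD(1)[OF M]]
 define f where "f x = \<Psi> (the_inv_into (V k) \<mu> x) 0" for x
 define g where "g y = \<mu> (SOME w. w : V k & (EX v:V k. y = \<Psi> v w))" for y
 have ft: "f (\<mu> v) = \<Psi> v 0" if "v : V k" for v unfolding f_def the_inv_into_f_f[OF L(4) that] ..
 have gP: "g (\<Psi> v w) = \<mu> w" if vw: "v : V k" "w : V k" for v w
 proof -
  have "EX w'. w' : V k & (EX v':V k. \<Psi> v w = \<Psi> v' w')" using vw by blast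
  hence s: "(SOME w'. w' : V k & (EX v':V k. \<Psi> v w = \<Psi> v' w')) : V k \<and>
   (EX v':V k. \<Psi> v w = \<Psi> v' (SOME w'. w' : V k & (EX v':V k. \<Psi> v w = \<Psi> v' w')))" by (rule someI_ex)
  then obtain v' where "v' : V k" "\<Psi> v w = \<Psi> v' (SOME w'. w' : V k & (EX v':V k. \<Psi> v w = \<Psi> v' w'))" by (elim conjE bexE)
  from X.Psi_inj[OF vw this(1) conjunct1[OF s] this(2)]
  have "w = (SOME w'. w' : V k & (EX v':V k. \<Psi> v w = \<Psi> v' w'))" by (rule conjunct2)
  thus ?thesis unfolding g_def by (rule arg_cong[where f = \<mu>, symmetric])
 qed
 have Mx: "EX v. v : V k & x = \<mu> v" if "x : carrier M" for x using that L(5) by blast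
 have tz: "tr k (B (i, j, h) 0) = 0" "tr k (A (i, j, h) 0) = 0" if "(i, j, h) : Arr" for i j h
  using lin_0[OF repD(1)[OF X.B that]] lin_0[OF repD(1)[OF X.A that]] by simp_all
 have f: "f : lmod_hom H M X"
 proof (rule hom_by_generators[OF L(2) X.E])
  fix x assume "x : carrier M"
  then obtain v where v: "v : V k" "x = \<mu> v" using Mx by blast
  show "f x : carrier X" unfolding v(2) ft[OF v(1)] by (rule X.Psi_closed)
  show "f (scalar z \<star>M x) = scalar z \<star>X f x" for z
   unfolding v(2) elinD(3)[OF hlocD(1)[OF L(3)], symmetric] ft[OF v(1)] ft[OF V_sub(4)[OF v(1)]] X.Psi_cs[symmetric] cs_simps ..
  show "f (idem i \<star>M x) = idem i \<star>X f x" if i: "i : {1..n}" for i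
   unfolding v(2) hlocD(2)[OF L(3) v(1) i] ft[OF v(1)] ft[OF V_sub(5)[OF v(1)]] X.Psi_idem[OF i v(1) V_sub(1)] lin_0[OF lin_es] ..
  show "f (arr a \<star>M x) = arr a \<star>X f x" if a: "a : arrows" for a
  proof (rule arrow_cases[OF a])
   fix i assume i: "i : {1..n}" "a = Eps i"
   show ?thesis
    unfolding i(2) v(2) hlocD(3)[OF L(3) v(1) i(1)] ft[OF v(1)] ft[OF tr_V] X.Psi_eps[OF i(1) v(1) V_sub(1)]
     lin_0[OF lin_es] lin_0[OF lin_Es] tr_zero ..
  next
   fix i j h assume i: "(i, j, h) : Arr" "a = Alpha i j h"
   show ?thesis unfolding i(2) v(2) D(3)[OF i(1) v(1)] ft[OF v(1)] ft[OF tr_V] X.Psi_alpha[OF i(1) v(1) V_sub(1)] tz[OF i(1)] add_0_right ..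
  qed
  fix y assume "y : carrier M"
  then obtain w where w: "w : V k" "y = \<mu> w" using Mx by blast
  show "f (x \<box>M y) = f x \<box>X f y"
   unfolding v(2) w(2) elinD(2)[OF hlocD(1)[OF L(3)], symmetric] ft[OF v(1)] ft[OF w(1)] ft[OF V_sub(2)[OF v(1) w(1)]]
    X.Psi_add[symmetric] add_0_right ..
 qed
 have g: "g : lmod_hom H X M"
 proof (rule hom_by_generators[OF X.E L(2)])
  fix x assume x: "x : carrier X"
  obtain v w where v: "v : V k" "w : V k" "x = \<Psi> v w" using X.Psi_surj[OF x] by (elim exE conjE)
  show "g x : carrier M" unfolding v(3) gP[OF v(1,2)] by (rule L(7))
  show "g (scalar z \<star>X x) = scalar z \<star>M g x" for z
   unfolding v(3) X.Psi_cs[symmetric] gP[OF v(1,2)] gP[OF V_sub(4)[OF v(1)] V_sub(4)[OF v(2)]] by (rule elinD(3)[OF hlocD(1)[OF L(3)]])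
  show "g (idem i \<star>X x) = idem i \<star>M g x" if i: "i : {1..n}" for i
   unfolding v(3) X.Psi_idem[OF i v(1,2)] gP[OF v(1,2)] gP[OF V_sub(5)[OF v(1)] V_sub(5)[OF v(2)]] hlocD(2)[OF L(3) v(2) i] ..
  show "g (arr a \<star>X x) = arr a \<star>M g x" if a: "a : arrows" for a
  proof (rule arrow_cases[OF a])
   fix i assume i: "i : {1..n}" "a = Eps i"
   show ?thesis unfolding i(2) v(3) X.Psi_eps[OF i(1) v(1,2)] gP[OF v(1,2)] gP[OF tr_V tr_V] hlocD(3)[OF L(3) v(2) i(1)] ..
  next
   fix i j h assume i: "(i, j, h) : Arr" "a = Alpha i j h"
   show ?thesis unfolding i(2) v(3) X.Psi_alpha[OF i(1) v(1,2)] gP[OF v(1,2)] gP[OF V_sub(2)[OF tr_V tr_V] tr_V] D(3)[OF i(1) v(2)] ..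
  qed
  fix y assume y: "y : carrier X"
  obtain v' w' where v': "v' : V k" "w' : V k" "y = \<Psi> v' w'" using X.Psi_surj[OF y] by (elim exE conjE)
  show "g (x \<box>X y) = g x \<box>M g y"
   unfolding v(3) v'(3) X.Psi_add[symmetric] gP[OF v(1,2)] gP[OF v'(1,2)] gP[OF V_sub(2)[OF v(1) v'(1)] V_sub(2)[OF v(2) v'(2)]]
   by (rule elinD(2)[OF hlocD(1)[OF L(3)]])
 qed
 have "inj_on f (carrier M)"
 proof (rule inj_onI)
  fix x y assume "x : carrier M" "y : carrier M" and e: "f x = f y"
  then obtain v w where v: "v : V k" "x = \<mu> v" "w : V k" "y = \<mu> w" using Mx by blast
  have "\<Psi> v 0 = \<Psi> w 0" using e unfolding v(2,4) ft[OF v(1)] ft[OF v(3)] .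
  from X.Psi_inj[OF v(1) V_sub(1) v(3) V_sub(1) this] show "x = y" using v by simp
 qed
 moreover have "g ` carrier X = carrier M"
 proof (intro equalityI subsetI)
  fix x assume "x : carrier M"
  then obtain v where v: "v : V k" "x = \<mu> v" using Mx by blast
  have "x = g (\<Psi> 0 v)" unfolding gP[OF V_sub(1) v(1)] by (rule v(2))
  thus "x : g ` carrier X" using X.Psi_closed by blast
 qed (use lmod_homD(1)[OF g] in blast)
 moreover have "f ` carrier M = a_kernel X M g"
 proof -
  have mz: "\<zero>\<^bsub>M\<^esub> = \<mu> 0" using lin_0[OF L(6)] L(1) by (simp add: pwm_def)
  have "a_kernel X M g = {x \<in> carrier X. g x = \<mu> 0}" unfolding a_kernel_def kernel_def mz[symmetric] by simp
  also have "... = (%v. \<Psi> v 0) ` V k"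
  proof (intro equalityI subsetI)
   fix x assume x: "x : {x \<in> carrier X. g x = \<mu> 0}"
   then obtain v w where v: "v : V k" "w : V k" "x = \<Psi> v w" using X.Psi_surj[of x] by blast
   have "\<mu> w = \<mu> 0" using x unfolding v(3) using gP[OF v(1,2)] by simp
   hence "w = 0" by (rule inj_onD[OF L(4) _ v(2) V_sub(1)])
   thus "x : (%v. \<Psi> v 0) ` V k" using v by blast
  next
   fix x assume "x : (%v. \<Psi> v 0) ` V k"
   then obtain v where v: "v : V k" "x = \<Psi> v 0" by blast
   show "x : {x \<in> carrier X. g x = \<mu> 0}" using X.Psi_closed gP[OF v(1) V_sub(1)] unfolding v(2) by simp
  qed
  also have "... = f ` carrier M" unfolding L(5)[symmetric] image_image by (rule image_cong[OF refl]) (simp only: ft)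
  finally show ?thesis ..
 qed
 ultimately have "(X, f, g) : extensions H M M" using X.E f g unfolding extensions_def by simp
 thus ?thesis using ft gP by blast
qed

text \<open>The extension with off-diagonal block \<open>B\<close> must be equivalent to the split
  one. In coordinates an equivalence maps \<open>(0, v)\<close> to \<open>(y v, v)\<close>, and its
  compatibility with the arrows is the equation \<open>y A - A y = B\<close>.\<close>

lemma rigid_imp_adsurj:
 assumes M: "intw M \<mu> A" and rig: "rigid H M" shows "adsurj k A"
 unfolding adsurj_def
proof (intro conjI ballI)
 note D = intwD[OF M] and L = locD[OF intwD(1)[OF M]]
 show A: "A : rep" by (rule D(2))
 fix B assume B: "B : rep"
 obtain X0 :: "((path => complex) set, nat => complex) module" and \<Psi>0 where X0: "dbl X0 \<Psi>0 A (%a v. 0)"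
  using dbl_exists[OF A rep_0] by (elim exE)
 obtain X :: "((path => complex) set, nat => complex) module" and \<Psi> where X: "dbl X \<Psi> A B"
  using dbl_exists[OF A B] by (elim exE)
 interpret X0: gls_dbl n c m Arr p r C k \<Omega> X0 \<Psi>0 A "%a v. 0" by (rule X0)
 interpret X: gls_dbl n c m Arr p r C k \<Omega> X \<Psi> A B by (rule X)
 interpret XE: left_module H X by (rule X.E)
 obtain f0 g0 where f0: "(X0, f0, g0) : extensions H M M" "ALL v:V k. f0 (\<mu> v) = \<Psi>0 v 0" "ALL v:V k. ALL w:V k. g0 (\<Psi>0 v w) = \<mu> w"
  using dbl_extension[OF M X0] by (elim exE conjE)
 obtain f1 g1 where f1: "(X, f1, g1) : extensions H M M" "ALL v:V k. f1 (\<mu> v) = \<Psi> v 0" "ALL v:V k. ALL w:V k. g1 (\<Psi> v w) = \<mu> w"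
  using dbl_extension[OF M X] by (elim exE conjE)
 have "((X0, f0, g0), (X, f1, g1)) : yoneda_equiv H M M" using rig f0(1) f1(1) unfolding rigid_iff by blast
 then obtain \<phi> where \<phi>: "\<phi> : lmod_hom H X0 X" "ALL y:carrier X0. g1 (\<phi> y) = g0 y" unfolding yoneda_equiv_def by blast
 note P = lmod_homD[OF \<phi>(1)]
 have h0: "hloc X0 (%v. \<Psi>0 0 v)"
  unfolding hloc_def
 proof (intro conjI ballI elinI)
  show "\<Psi>0 0 v : carrier X0" for v by (rule X0.Psi_closed)
  show "\<Psi>0 0 (v + w) = \<Psi>0 0 v \<box>X0 \<Psi>0 0 w" for v w using X0.Psi_add[of 0 0 v w] by (simp only: add_0)
  show "\<Psi>0 0 (cs z v) = scalar z \<star>X0 \<Psi>0 0 v" for z v using X0.Psi_cs[of z 0 v] by (simp only: cs_simps)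
  fix v i assume v: "v : V k" and i: "i : {1..n}"
  show "idem i \<star>X0 \<Psi>0 0 v = \<Psi>0 0 (es i v)" using X0.Psi_idem[OF i V_sub(1) v] by (simp only: lin_0[OF lin_es])
  show "arr (Eps i) \<star>X0 \<Psi>0 0 v = \<Psi>0 0 (tr k (Es 1 (es i v)))"
   using X0.Psi_eps[OF i V_sub(1) v] by (simp only: lin_0[OF lin_es] lin_0[OF lin_Es] tr_zero)
 qed
 have hP: "hloc X (%v. \<Psi> 0 v)" "hloc X (%v. \<Psi> v 0)"
  unfolding hloc_def
 proof (safe intro!: elinI)
  show "\<Psi> 0 v : carrier X" "\<Psi> v 0 : carrier X" for v by (rule X.Psi_closed)+
  show "\<Psi> 0 (v + w) = \<Psi> 0 v \<box>X \<Psi> 0 w" for v w using X.Psi_add[of 0 0 v w] by (simp only: add_0)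
  show "\<Psi> (v + w) 0 = \<Psi> v 0 \<box>X \<Psi> w 0" for v w using X.Psi_add[of v w 0 0] by (simp only: add_0)
  show "\<Psi> 0 (cs z v) = scalar z \<star>X \<Psi> 0 v" for z v using X.Psi_cs[of z 0 v] by (simp only: cs_simps)
  show "\<Psi> (cs z v) 0 = scalar z \<star>X \<Psi> v 0" for z v using X.Psi_cs[of z v 0] by (simp only: cs_simps)
  fix v i assume v: "v : V k" and i: "i : {1..n}"
  show "idem i \<star>X \<Psi> 0 v = \<Psi> 0 (es i v)" using X.Psi_idem[OF i V_sub(1) v] by (simp only: lin_0[OF lin_es])
  show "arr (Eps i) \<star>X \<Psi> 0 v = \<Psi> 0 (tr k (Es 1 (es i v)))"
   using X.Psi_eps[OF i V_sub(1) v] by (simp only: lin_0[OF lin_es] lin_0[OF lin_Es] tr_zero)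
  show "idem i \<star>X \<Psi> v 0 = \<Psi> (es i v) 0" using X.Psi_idem[OF i v V_sub(1)] by (simp only: lin_0[OF lin_es])
  show "arr (Eps i) \<star>X \<Psi> v 0 = \<Psi> (tr k (Es 1 (es i v))) 0"
   using X.Psi_eps[OF i v V_sub(1)] by (simp only: lin_0[OF lin_es] lin_0[OF lin_Es] tr_zero)
 qed
 have inj: "inj_on (%v. \<Psi> v 0) (V k)" by (rule inj_onI) (use X.Psi_inj[OF _ V_sub(1) _ V_sub(1)] in blast)
 \<comment> \<open>Subtracting the second copy from its image under the equivalence leaves a value
   in the submodule; \<open>gl_pull\<close> then reads it as a matrix \<open>y\<close>.\<close>
 define \<tau> where "\<tau> v = \<phi> (\<Psi>0 0 v) \<box>X scalar (-1) \<star>X \<Psi> 0 v" for v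
 have ht: "hloc X \<tau>" unfolding \<tau>_def by (rule hloc_plus[OF X.E hloc_hom[OF \<phi>(1) h0] hloc_scalar[OF X.E hP(1)]])
 have ph: "EX u. u : V k & \<phi> (\<Psi>0 0 v) = \<Psi> u v" if v: "v : V k" for v
 proof -
  have "\<phi> (\<Psi>0 0 v) : carrier X" by (rule P(1)[OF X0.Psi_closed])
  from X.Psi_surj[OF this] obtain u w where u: "u : V k" "w : V k" "\<phi> (\<Psi>0 0 v) = \<Psi> u w" by (elim exE conjE)
  have "g1 (\<phi> (\<Psi>0 0 v)) = \<mu> v" using \<phi>(2) X0.Psi_closed f0(3) v V_sub(1) by metis
  hence "\<mu> w = \<mu> v" unfolding u(3) using f1(3) u(1,2) by simp
  hence "w = v" by (rule inj_onD[OF L(4) _ u(2) v])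
  thus ?thesis using u by blast
 qed
 have "EX y:gl. ALL v:V k. \<tau> v = \<Psi> (tr k (y v)) 0"
 proof (rule gl_pull[OF X.E hP(2) inj ht])
  fix v assume v: "v : V k"
  obtain u where u: "u : V k" "\<phi> (\<Psi>0 0 v) = \<Psi> u v" using ph[OF v] by (elim exE conjE)
  have "\<tau> v = \<Psi> (u + cs (-1) 0) (v + cs (-1) v)" unfolding \<tau>_def u(2) X.Psi_add X.Psi_cs ..
  also have "... = \<Psi> u 0" by (simp only: cs_simps add_0_right right_minus)
  finally show "\<tau> v : (%v. \<Psi> v 0) ` V k" using u(1) by blast
 qed
 then obtain y where y: "y : gl" "ALL v:V k. \<tau> v = \<Psi> (tr k (y v)) 0" by (rule bexE)
 have py: "\<phi> (\<Psi>0 0 v) = \<Psi> (tr k (y v)) v" if v: "v : V k" for v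
 proof -
  obtain u where u: "u : V k" "\<phi> (\<Psi>0 0 v) = \<Psi> u v" using ph[OF v] by (elim exE conjE)
  have "\<tau> v = \<Psi> (u + cs (-1) 0) (v + cs (-1) v)" unfolding \<tau>_def u(2) X.Psi_add X.Psi_cs ..
  also have "... = \<Psi> u 0" by (simp only: cs_simps add_0_right right_minus)
  finally have "\<Psi> (tr k (y v)) 0 = \<Psi> u 0" using y(2) v by simp
  hence "tr k (y v) = u" using X.Psi_inj[OF tr_V V_sub(1) u(1) V_sub(1)] by blast
  thus ?thesis using u(2) by simp
 qed
 show "EX y:gl. ALL a:Arr. ALL v:Vin. tr k (y (A a v) - A a (y v)) = tr k (B a v)"
 proof (rule bexI[OF _ y(1)], intro ballI)
  fix a v assume a0: "a : Arr" and v: "v : Vin"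
  obtain i j h where ah: "a = (i, j, h)" by (cases a)
  note a = a0[unfolded ah]
  define w where "w = tr k v"
  have w: "w : V k" by (simp add: w_def)
  have e0: "arr (Alpha i j h) \<star>X0 \<Psi>0 0 w = \<Psi>0 0 (tr k (A (i, j, h) w))"
   using X0.Psi_alpha[OF a V_sub(1) w] by (simp only: lin_0[OF repD(1)[OF A a]] tr_zero add_0)
  have "\<Psi> (tr k (y (tr k (A a w)))) (tr k (A a w)) = arr (Alpha i j h) \<star>X \<Psi> (tr k (y w)) w"
   using P(3)[OF arr_closed[OF Arr_D(6)[OF a]] X0.Psi_closed, of 0 w] unfolding e0 py[OF tr_V] py[OF w] ah .
  also have "... = \<Psi> (tr k (A a (tr k (y w))) + tr k (B a w)) (tr k (A a w))"
   unfolding X.Psi_alpha[OF a tr_V w] ah ..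
  finally have e: "tr k (y (tr k (A a w))) = tr k (A a (tr k (y w))) + tr k (B a w)"
   using X.Psi_inj[OF tr_V tr_V V_sub(2)[OF tr_V tr_V] tr_V] by blast
  have 1: "tr k (y (tr k (A a w))) = tr k (y (A a v))"
   by (rule gl_cong[OF y(1)]) (use rep_cong[OF A a0 tr_Vin v, of k k] rep_Vin[OF A a0 v] in \<open>simp_all add: w_def\<close>)
  have 2: "tr k (A a (tr k (y w))) = tr k (A a (y v))"
   by (rule rep_cong[OF A a0 tr_Vin]) (use gl_cong[OF y(1) tr_Vin v, of k k] glD(2)[OF y(1) v] in \<open>simp_all add: w_def\<close>)
  have 3: "tr k (B a w) = tr k (B a v)" unfolding w_def by (rule rep_cong[OF B a0 tr_Vin v]) simp
  show "tr k (y (A a v) - A a (y v)) = tr k (B a v)"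
   unfolding tr_diff using e unfolding 1 2 3 by (simp only: add_diff_cancel_left')
 qed
qed

text \<open>Every extension splits: freeness over the loops gives a lift of the basis compatible
  with the loops, its failure to commute with the arrows is a representation \<open>B\<close>, and
  writing \<open>B\<close> as a commutator corrects the lift to a splitting.\<close>

lemma extension_dbl:
 fixes f g :: "(nat => complex) => nat => complex"
 assumes M: "intw M \<mu> A" and ad: "adsurj k A" and ext: "(E, f, g) : extensions H M M"
 shows "\<exists>\<Psi>. dbl E \<Psi> A (%a v. 0) & (ALL v:V k. f (\<mu> v) = \<Psi> v 0) & (ALL v:V k. ALL w:V k. g (\<Psi> v w) = \<mu> w)"
proof -
 note D = intwD[OF M] and L = locD[OF intwD(1)[OF M]]
 have E: "left_module H E" and f: "f : lmod_hom H M E" and finj: "inj_on f (carrier M)" and g: "g : lmod_hom H E M"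
  and gs: "g ` carrier E = carrier M" and ker: "f ` carrier M = a_kernel E M g"
  using ext unfolding extensions_def by simp_all
 interpret E: left_module H E by (rule E)
 note F = lmod_homD[OF f] and G = lmod_homD[OF g]
 have mz: "\<zero>\<^bsub>M\<^esub> = 0" using L(1) by (simp add: pwm_def)
 have kerI: "x : f ` carrier M \<longleftrightarrow> x : carrier E & g x = 0" for x
  unfolding ker a_kernel_def kernel_def mz[symmetric] by simp
 define t where "t i q = (SOME x. x : carrier E & g x = \<mu> (delta (i, q, 0)))" for i q
 have t: "t i q : carrier E" "g (t i q) = \<mu> (delta (i, q, 0))" for i q
 proof -
  have "EX x. x : carrier E & g x = \<mu> (delta (i, q, 0))" using gs L(7)[of "delta (i, q, 0)"] by (metis imageE)
  hence "t i q : carrier E & g (t i q) = \<mu> (delta (i, q, 0))" unfolding t_def by (rule someI_ex)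
  thus "t i q : carrier E" "g (t i q) = \<mu> (delta (i, q, 0))" by auto
 qed
 obtain \<tau> where \<tau>: "hloc E \<tau>" and td: "ALL (i, q, a):I k. \<tau> (delta (i, q, a)) = epsp i a \<star>E t i q"
  using hloc_exists[where t = t, OF E t(1)] by (elim exE conjE)
 note tc = elinD(1)[OF hlocD(1)[OF \<tau>]]
 have gt: "g (\<tau> v) = \<mu> v" if v: "v : V k" for v
 proof (rule elin_eqI[OF L(2) hlocD(1)[OF hloc_hom[OF g \<tau>]] hlocD(1)[OF L(3)] fin_I])
  show "x \<notin> I k ==> v x = 0" for x using v unfolding V_def by blast
  fix x assume x: "x : I k"
  obtain i q a where xa: "x = (i, q, a)" by (cases x)
  have i: "i : {1..n}" using x xa by auto
  have "\<tau> (delta (i, q, a)) = epsp i a \<star>E t i q" using bspec[OF td x] unfolding xa by (simp only: prod.case)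
  thus "g (\<tau> (delta x)) = \<mu> (delta x)"
   unfolding xa hloc_delta[OF L(2,3) x[unfolded xa]] using G(3)[OF epsp_closed[OF i] t(1), of a i q] t(2) by simp
 qed
 define \<mu>1 where "\<mu>1 v = f (\<mu> v)" for v
 have h1: "hloc E \<mu>1" unfolding \<mu>1_def by (rule hloc_hom[OF f L(3)])
 note t1c = elinD(1)[OF hlocD(1)[OF h1]]
 have inj1: "inj_on \<mu>1 (V k)" unfolding \<mu>1_def
  using comp_inj_on[OF L(4)] finj L(5) by (simp add: comp_def)
 have im1: "\<mu>1 ` V k = f ` carrier M" unfolding \<mu>1_def L(5)[symmetric] image_image ..
 have g1: "g (\<mu>1 v) = 0" for v using kerI[of "\<mu>1 v"] L(7) unfolding \<mu>1_def by blast
 have al1: "arr (Alpha i j h) \<star>E \<mu>1 v = \<mu>1 (tr k (A (i, j, h) v))" if a: "(i, j, h) : Arr" and v: "v : V k" for i j h v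
  unfolding \<mu>1_def F(3)[OF arr_closed[OF Arr_D(6)[OF a]] L(7), symmetric] D(3)[OF a v] ..
 \<comment> \<open>The failure of \<open>\<tau>\<close> to commute with the arrows. It is killed by
   \<open>g\<close>, so it takes values in the submodule.\<close>
 define \<xi> where "\<xi> = (%(i, j, h) v. arr (Alpha i j h) \<star>E \<tau> v \<box>E scalar (-1) \<star>E \<tau> (tr k (A (i, j, h) v)))"
 have xi: "\<xi> (i, j, h) v = arr (Alpha i j h) \<star>E \<tau> v \<box>E scalar (-1) \<star>E \<tau> (tr k (A (i, j, h) v))" for i j h v
  by (simp add: \<xi>_def)
 have "EX B:rep. ALL a:Arr. ALL v:V k. \<xi> a v = \<mu>1 (tr k (B a v))"
 proof (rule rep_pull[OF E h1 inj1])
  fix i j h assume a: "(i, j, h) : Arr"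
  note ac = arr_closed[OF Arr_D(6)[OF a]]
  note cl = E.smult_closed[OF ac tc] E.smult_closed[OF scalar_closed tc]
  have "elin E (%v. arr (Alpha i j h) \<star>E \<tau> v \<box>E scalar (-1) \<star>E \<tau> (tr k (A (i, j, h) v)))"
   by (rule elin_plus[OF E elin_act[OF E ac hlocD(1)[OF \<tau>]] elin_act[OF E scalar_closed
     elin_comp[OF E lin_comp[OF lin_tr repD(1)[OF D(2) a]] hlocD(1)[OF \<tau>]]]])
  thus "elin E (\<xi> (i, j, h))" by (simp add: \<xi>_def)
  fix v assume v: "v : V k"
  have "g (\<xi> (i, j, h) v) = arr (Alpha i j h) \<star>M \<mu> v \<box>M scalar (-1) \<star>M \<mu> (tr k (A (i, j, h) v))"
   unfolding xi G(2)[OF cl] G(3)[OF ac tc] G(3)[OF scalar_closed tc] gt[OF v] gt[OF tr_V] ..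
  also have "... = \<zero>\<^bsub>M\<^esub>" unfolding D(3)[OF a v] by (rule scalar_smult_minus[OF L(2) L(7)])
  finally have "g (\<xi> (i, j, h) v) = 0" unfolding mz .
  moreover have "\<xi> (i, j, h) v : carrier E" unfolding xi by (rule E.a_closed[OF cl])
  ultimately show "\<xi> (i, j, h) v : \<mu>1 ` V k" unfolding im1 kerI by simp
  note ic = idem_closed[OF Arr_D(1)[OF a]] and ec = epsp_closed[OF Arr_D(1)[OF a]]
  note al = alpha_props[OF E \<tau> a v] and rp = rep_props[OF E \<tau> D(2) a v]
  show "idem i \<star>E \<xi> (i, j, h) v = \<xi> (i, j, h) v"
   unfolding xi E.smult_r_distr[OF ic cl] al(1) scalar_act[OF E tc ic] rp(1) ..
  show "\<xi> (i, j, h) (es j v) = \<xi> (i, j, h) v" unfolding xi al(2) rp(2) ..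
  show "\<xi> (i, j, h) (tr k (Es (r i j) v)) = epsp i (p i j) \<star>E \<xi> (i, j, h) v"
   unfolding xi al(3) rp(3) E.smult_r_distr[OF ec cl] scalar_act[OF E tc ec] ..
 qed
 then obtain B where B: "B : rep" "ALL a:Arr. ALL v:V k. \<xi> a v = \<mu>1 (tr k (B a v))" by (rule bexE)
 obtain y where y: "y : gl" and yB: "!!a v. a : Arr ==> v : Vin ==> tr k (y (A a v) - A a (y v)) = tr k (B a v)"
  by (rule adsurjE[OF ad B(1)]) (rule that)
 \<comment> \<open>The corrected lift, which commutes with all arrows and thus splits the
   extension.\<close>
 define \<sigma> where "\<sigma> v = \<tau> v \<box>E \<mu>1 (tr k (y v))" for v
 have hs: "hloc E \<sigma>" unfolding \<sigma>_def by (rule hloc_plus[OF E \<tau> hloc_twist[OF E h1 y]])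
 note sc = elinD(1)[OF hlocD(1)[OF hs]]
 have gsig: "g (\<sigma> v) = \<mu> v" if v: "v : V k" for v
  unfolding \<sigma>_def G(2)[OF tc t1c] gt[OF v] g1 pwm_plus[OF L(1) L(7) pwm_closed(1)[OF L(1)]] by (rule add_0_right)
 have als: "arr (Alpha i j h) \<star>E \<sigma> v = \<sigma> (tr k (A (i, j, h) v))" if a: "(i, j, h) : Arr" and v: "v : V k" for i j h v
 proof -
  note ac = arr_closed[OF Arr_D(6)[OF a]]
  note vi = V_Vin[OF v]
  let ?A = "A (i, j, h)" and ?B = "B (i, j, h)"
  have "arr (Alpha i j h) \<star>E \<tau> v = \<xi> (i, j, h) v \<box>E \<tau> (tr k (?A v))"
   unfolding xi using scalar_smult_minus[OF E tc, of "tr k (?A v)"] E.smult_closed[OF ac tc] E.smult_closed[OF scalar_closed tc] tc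
   by (simp add: E.add.m_assoc E.add.m_comm[of "scalar (-1) \<star>E \<tau> (tr k (?A v))"])
  also have "\<xi> (i, j, h) v = \<mu>1 (tr k (?B v))" using B(2) a v by simp
  finally have 1: "arr (Alpha i j h) \<star>E \<tau> v = \<mu>1 (tr k (?B v)) \<box>E \<tau> (tr k (?A v))" .
  have 2: "tr k (?B v) + tr k (?A (tr k (y v))) = tr k (y (tr k (?A v)))"
  proof -
   have "tr k (?A (tr k (y v))) = tr k (?A (y v))" by (rule rep_cong[OF D(2) a tr_Vin glD(2)[OF y vi]]) simp
   moreover have "tr k (y (tr k (?A v))) = tr k (y (?A v))" by (rule gl_cong[OF y tr_Vin rep_Vin[OF D(2) a vi]]) simp
   ultimately show ?thesis using yB[OF a vi] unfolding tr_diff by (simp only: diff_add_cancel[symmetric] eq_commute)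
  qed
  have "arr (Alpha i j h) \<star>E \<sigma> v = \<mu>1 (tr k (?B v)) \<box>E \<tau> (tr k (?A v)) \<box>E \<mu>1 (tr k (?A (tr k (y v))))"
   unfolding \<sigma>_def E.smult_r_distr[OF ac tc t1c] 1 al1[OF a tr_V] ..
  also have "... = \<tau> (tr k (?A v)) \<box>E (\<mu>1 (tr k (?B v)) \<box>E \<mu>1 (tr k (?A (tr k (y v)))))"
   using tc t1c by (simp add: E.add.m_ac)
  also have "... = \<sigma> (tr k (?A v))" unfolding elinD(2)[OF hlocD(1)[OF h1], symmetric] 2 \<sigma>_def ..
  finally show ?thesis .
 qed
 define \<Psi> where "\<Psi> v w = \<mu>1 v \<box>E \<sigma> w" for v w
 have gP: "g (\<Psi> v w) = \<mu> w" if "w : V k" for v w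
  unfolding \<Psi>_def G(2)[OF t1c sc] gsig[OF that] g1 pwm_plus[OF L(1) pwm_closed(1)[OF L(1)] L(7)] by (rule add_0)
 note L1 = hlocD(1)[OF h1] and L2 = hlocD(1)[OF hs]
 have "dbl E \<Psi> A (%a v. 0)"
 proof (intro gls_dbl.intro gls_dbl_axioms.intro gls_model_axioms, goal_cases)
  case 1 show ?case by (rule E)
 next
  case 2 show ?case by (rule D(2))
 next
  case 3 show ?case by (rule rep_0)
 next
  case (4 v w) show ?case unfolding \<Psi>_def by (rule E.a_closed[OF t1c sc])
 next
  case (5 v v' w w')
  show ?case unfolding \<Psi>_def elinD(2)[OF L1] elinD(2)[OF L2]
   using t1c[of v] t1c[of v'] sc[of w] sc[of w'] by (simp add: E.add.m_ac)
 next
  case (6 z v w)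
  show ?case unfolding \<Psi>_def elinD(3)[OF L1] elinD(3)[OF L2] E.smult_r_distr[OF scalar_closed t1c sc] ..
 next
  case (7 x)
  have "g x : \<mu> ` V k" unfolding L(5) by (rule G(1)[OF 7])
  then obtain w where w: "w : V k" "g x = \<mu> w" by blast
  let ?y = "x \<box>E scalar (-1) \<star>E \<sigma> w"
  have m: "scalar (-1) \<star>E \<sigma> w : carrier E" by (rule E.smult_closed[OF scalar_closed sc])
  have "g ?y = \<mu> w \<box>M scalar (-1) \<star>M \<mu> w"
   unfolding G(2)[OF 7 m] G(3)[OF scalar_closed sc] gsig[OF w(1)] w(2) ..
  also have "... = 0" unfolding scalar_smult_minus[OF L(2) L(7)] by (rule mz)
  finally have "?y : \<mu>1 ` V k" unfolding im1 kerI using E.a_closed[OF 7 m] by simp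
  then obtain v where v: "v : V k" "?y = \<mu>1 v" by blast
  have "x = ?y \<box>E \<sigma> w"
   using scalar_smult_minus[OF E sc, of w] 7 m sc[of w] by (simp add: E.add.m_assoc E.add.m_comm[of "scalar (-1) \<star>E \<sigma> w"])
  hence "x = \<Psi> v w" unfolding v(2) \<Psi>_def .
  thus ?case using v(1) w(1) by blast
 next
  case (8 v w v' w')
  have "\<mu> w = \<mu> w'" using arg_cong[OF 8(5), of g] unfolding gP[OF 8(2)] gP[OF 8(4)] .
  hence w: "w = w'" by (rule inj_onD[OF L(4) _ 8(2,4)])
  have "\<mu>1 v = \<mu>1 v'" using 8(5) unfolding \<Psi>_def w using t1c sc by simp
  hence "v = v'" by (rule inj_onD[OF inj1 _ 8(1,3)])
  thus ?case using w by simp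
 next
  case (9 i v w)
  show ?case unfolding \<Psi>_def E.smult_r_distr[OF idem_closed[OF 9(1)] t1c sc] hlocD(2)[OF h1 9(2,1)] hlocD(2)[OF hs 9(3,1)] ..
 next
  case (10 i v w)
  show ?case
   unfolding \<Psi>_def E.smult_r_distr[OF arr_closed[OF Eps_arrow[OF 10(1)]] t1c sc] hlocD(3)[OF h1 10(2,1)] hlocD(3)[OF hs 10(3,1)] ..
 next
  case (11 i j h v w)
  show ?case
   unfolding \<Psi>_def E.smult_r_distr[OF arr_closed[OF Arr_D(6)[OF 11(1)]] t1c sc] al1[OF 11(1,2)] als[OF 11(1,3)] tr_zero add_0_right ..
 qed
 moreover have "f (\<mu> v) = \<Psi> v 0" for v
  unfolding \<Psi>_def elin_0[OF E L2] \<mu>1_def[symmetric] using t1c by simp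
 ultimately show ?thesis using gP by (intro exI[of _ \<Psi>]) simp
qed

text \<open>Any two extensions are split in the same coordinates by \<open>extension_dbl\<close>,
  hence equivalent by \<open>dbl_hom\<close>; the split extension itself shows that there is at
  least one.\<close>

lemma adsurj_imp_rigid:
 assumes M: "intw M \<mu> A" and ad: "adsurj k A" shows "rigid H M"
 unfolding rigid_iff
proof (intro conjI ballI)
 note L = locD[OF intwD(1)[OF M]]
 obtain X0 :: "((path => complex) set, nat => complex) module" and \<Psi>0 where X0: "dbl X0 \<Psi>0 A (%a v. 0)"
  using dbl_exists[OF intwD(2)[OF M] rep_0] by (elim exE)
 show "extensions H M M ~= {}" using dbl_extension[OF M X0] by blast
 fix x y assume x: "x : extensions H M M" and y: "y : extensions H M M"
 obtain E f g where xe: "x = (E, f, g)" by (cases x)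
 obtain E' f' g' where ye: "y = (E', f', g')" by (cases y)
 obtain \<Psi> where P: "dbl E \<Psi> A (%a v. 0)" "ALL v:V k. f (\<mu> v) = \<Psi> v 0" "ALL v:V k. ALL w:V k. g (\<Psi> v w) = \<mu> w"
  using extension_dbl[OF M ad x[unfolded xe]] by (elim exE conjE)
 obtain \<Psi>' where P': "dbl E' \<Psi>' A (%a v. 0)" "ALL v:V k. f' (\<mu> v) = \<Psi>' v 0" "ALL v:V k. ALL w:V k. g' (\<Psi>' v w) = \<mu> w"
  using extension_dbl[OF M ad y[unfolded ye]] by (elim exE conjE)
 obtain \<phi> where \<phi>: "\<phi> : lmod_hom H E E'" "ALL v:V k. ALL w:V k. \<phi> (\<Psi> v w) = \<Psi>' v w" using dbl_hom[OF P(1) P'(1)] by (rule bexE)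
 interpret X: gls_dbl n c m Arr p r C k \<Omega> E \<Psi> A "%a v. 0" by (rule P(1))
 have 1: "\<phi> (f x) = f' x" if "x : carrier M" for x
 proof -
  have "x : \<mu> ` V k" unfolding L(5) by (rule that)
  then obtain v where v: "x = \<mu> v" "v : V k" by (rule imageE)
  show ?thesis
   unfolding v(1) bspec[OF P(2) v(2)] bspec[OF P'(2) v(2)] by (rule bspec[OF bspec[OF \<phi>(2) v(2)] V_sub(1)])
 qed
 have 2: "g' (\<phi> z) = g z" if z: "z : carrier E" for z
 proof -
  obtain v w where v: "v : V k" "w : V k" "z = \<Psi> v w" using X.Psi_surj[OF z] by (elim exE conjE)
  show ?thesis
   unfolding v(3) bspec[OF bspec[OF \<phi>(2) v(1)] v(2)] bspec[OF bspec[OF P(3) v(1)] v(2)] by (rule bspec[OF bspec[OF P'(3) v(1)] v(2)])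
 qed
 show "(x, y) : yoneda_equiv H M M"
  unfolding xe ye yoneda_equiv_def mem_Collect_eq prod.case
  by (intro conjI x[unfolded xe] y[unfolded ye] bexI[OF _ \<phi>(1)] ballI 1 2)
qed

end

section \<open>Homotopy invariance of the Euler characteristic\<close>

lemma int_independent_iso:
 assumes G: "comm_group G" and K: "comm_group K" and h: "h : iso G K" and S: "int_independent G S"
 shows "int_independent K (h ` S)" "card (h ` S) = card S"
proof -
 interpret G: comm_group G by (rule G)
 interpret K: comm_group K by (rule K)
 have hom: "h : hom G K" and inj: "inj_on h (carrier G)" using h by (auto simp: iso_def bij_betw_def)
 interpret gh: group_hom G K h by (intro group_hom.intro group_hom_axioms.intro hom G.is_group K.is_group)
 have fin: "finite S" and sub: "S \<subseteq> carrier G"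
  and ind: "!!z :: _ => int. (\<Otimes>\<^bsub>G\<^esub>s\<in>S. s [^]\<^bsub>G\<^esub> z s) = \<one>\<^bsub>G\<^esub> ==> (ALL s:S. z s = 0)"
  using S unfolding int_independent_def by blast+
 have injS: "inj_on h S" by (rule inj_on_subset[OF inj sub])
 show "card (h ` S) = card S" by (rule card_image[OF injS])
 have fp: "h (\<Otimes>\<^bsub>G\<^esub>s\<in>X. x s) = (\<Otimes>\<^bsub>K\<^esub>s\<in>X. h (x s))" if "finite X" "x : X \<rightarrow> carrier G" for x X
  using that
 proof (induction X rule: finite_induct)
  case (insert s X)
  hence x: "x : X \<rightarrow> carrier G" "x s : carrier G" by auto
  have hx: "(%s. h (x s)) : X \<rightarrow> carrier K" by (rule funcsetI) (rule gh.hom_closed[OF funcset_mem[OF x(1)]])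
  have hx2: "h (x s) : carrier K" by (rule gh.hom_closed[OF x(2)])
  show ?case
   using insert.IH[OF x(1)] G.finprod_insert[OF insert.hyps x] K.finprod_insert[OF insert.hyps hx hx2]
    gh.hom_mult[OF x(2) G.finprod_closed[OF x(1)]] by simp
 qed simp
 show "int_independent K (h ` S)"
  unfolding int_independent_def
 proof (intro conjI allI impI)
  show "finite (h ` S)" using fin by simp
  show "h ` S \<subseteq> carrier K" using sub gh.hom_closed by blast
  fix z :: "_ => int" assume e: "(\<Otimes>\<^bsub>K\<^esub>s\<in>h ` S. s [^]\<^bsub>K\<^esub> z s) = \<one>\<^bsub>K\<^esub>"
  have pc: "(%s. s [^]\<^bsub>G\<^esub> z (h s)) : S \<rightarrow> carrier G" using sub by (auto intro: G.int_pow_closed)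
  have "h (\<Otimes>\<^bsub>G\<^esub>s\<in>S. s [^]\<^bsub>G\<^esub> z (h s)) = (\<Otimes>\<^bsub>K\<^esub>s\<in>S. h (s [^]\<^bsub>G\<^esub> z (h s)))" by (rule fp[OF fin pc])
  also have "... = (\<Otimes>\<^bsub>K\<^esub>s\<in>S. h s [^]\<^bsub>K\<^esub> z (h s))"
   by (rule K.finprod_cong') (use sub gh.hom_int_pow gh.hom_closed in \<open>auto intro!: K.int_pow_closed\<close>)
  also have "... = (\<Otimes>\<^bsub>K\<^esub>s\<in>h ` S. s [^]\<^bsub>K\<^esub> z s)"
   by (rule K.finprod_reindex[OF _ injS, symmetric]) (use sub gh.hom_closed in \<open>auto intro!: K.int_pow_closed\<close>)
  finally have "h (\<Otimes>\<^bsub>G\<^esub>s\<in>S. s [^]\<^bsub>G\<^esub> z (h s)) = h \<one>\<^bsub>G\<^esub>" unfolding e by simp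
  hence "(\<Otimes>\<^bsub>G\<^esub>s\<in>S. s [^]\<^bsub>G\<^esub> z (h s)) = \<one>\<^bsub>G\<^esub>"
   by (intro inj_onD[OF inj]) (auto intro!: G.finprod_closed pc)
  hence "ALL s:S. z (h s) = 0" by (rule ind)
  thus "ALL s:h ` S. z s = 0" by blast
 qed
qed

text \<open>The two sets under \<open>Sup\<close> are equal, which settles the claim also where they
  are unbounded.\<close>

lemma abelian_group_rank_iso:
 assumes G: "comm_group G" and K: "comm_group K" and i: "G \<cong> K"
 shows "abelian_group_rank G = abelian_group_rank K"
proof -
 have le: "{card S | S. int_independent G S} \<subseteq> {card S | S. int_independent K S}"
  if "comm_group G" "comm_group K" "G \<cong> K" for G :: "('x, 'y) monoid_scheme" and K :: "('z, 'w) monoid_scheme"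
 proof -
  obtain h where h: "h : iso G K" using \<open>G \<cong> K\<close> unfolding is_iso_def by blast
  show ?thesis
  proof
   fix d assume "d : {card S | S. int_independent G S}"
   then obtain S where S: "int_independent G S" "d = card S" by blast
   show "d : {card S | S. int_independent K S}"
    using int_independent_iso[OF that(1,2) h S(1)] S(2) by (intro CollectI exI[of _ "h ` S"]) simp
  qed
 qed
 have "K \<cong> G" by (rule group.iso_sym[OF comm_group.axioms(2)[OF G] i])
 hence "{card S | S. int_independent G S} = {card S | S. int_independent K S}"
  using le[OF G K i] le[OF K G] by blast
 thus ?thesis unfolding abelian_group_rank_def by simp
qed

lemma euler_characteristic_homotopy:
 assumes "X homotopy_equivalent_space Y" shows "euler_characteristic X = euler_characteristic Y"
proof -
 have "betti_number q X = betti_number q Y" for q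
  unfolding betti_number_def
  by (rule abelian_group_rank_iso[OF abelian_homology_group abelian_homology_group
    homotopy_equivalent_space_imp_isomorphic_homology_groups[OF assms]])
 thus ?thesis unfolding euler_characteristic_def by simp
qed

section \<open>The flag variety is homeomorphic to the space of projections\<close>

lemma topspace_grassmannian: "topspace (grassmannian S) = (\<Union>d. frame_span d ` frames S d)"
proof
 show "topspace (grassmannian S) \<subseteq> (\<Union>d. frame_span d ` frames S d)"
  using openin_grassmannian[of S "topspace (grassmannian S)"] unfolding open_in_grassmannian_def by simp
 have "open_in_grassmannian S (\<Union>d. frame_span d ` frames S d)"
  unfolding open_in_grassmannian_def
 proof (intro conjI allI subset_refl)
  fix d
  have "{b \<in> frames S d. frame_span d b : (\<Union>d. frame_span d ` frames S d)} = frames S d" by blast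
  thus "openin (top_of_set (frames S d)) {b \<in> frames S d. frame_span d b : (\<Union>d. frame_span d ` frames S d)}" by simp
 qed
 thus "(\<Union>d. frame_span d ` frames S d) \<subseteq> topspace (grassmannian S)"
  unfolding openin_grassmannian[symmetric] by (rule openin_subset)
qed

lemma continuous_map_euclidean_fun:
 fixes F :: "'x => 'a => 'b::topological_space"
 shows "continuous_map X euclidean F \<longleftrightarrow> (ALL a. continuous_map X euclidean (%x. F x a))"
 using continuous_map_componentwise_UNIV[of X "%_. euclidean" F] unfolding euclidean_product_topology .

text \<open>The universal property of the quotient topology: continuity is tested on frames.\<close>

lemma continuous_map_grassmannian:
 fixes F :: "(nat => complex) set => 'b::topological_space"
 assumes "!!d. continuous_on (frames S d) (%b. F (frame_span d b))"
 shows "continuous_map (grassmannian S) euclidean F"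
 unfolding continuous_map_def
proof (intro conjI allI impI)
 fix O' :: "'b set" assume "openin euclidean O'"
 hence O': "open O'" by simp
 show "openin (grassmannian S) {x \<in> topspace (grassmannian S). F x : O'}"
  unfolding openin_grassmannian open_in_grassmannian_def topspace_grassmannian
 proof (intro conjI allI)
  fix d
  have "{b \<in> frames S d. frame_span d b : {x \<in> \<Union>d. frame_span d ` frames S d. F x : O'}} =
    frames S d Int (%b. F (frame_span d b)) -` O'" by blast
  thus "openin (top_of_set (frames S d)) {b \<in> frames S d. frame_span d b : {x \<in> \<Union>d. frame_span d ` frames S d. F x : O'}}"
   using continuous_openin_preimage_gen[OF assms O'] by simp
 qed blast
qed simp

context gls_flag
begin

context
 fixes M :: "((path => complex) set, nat => complex) module" and \<mu> A
 assumes mat: "matrix_module M" and M: "intw M \<mu> A"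
begin

abbreviation "bk \<equiv> the_inv_into (V k) \<mu>"

lemma bk: "v : V k ==> bk (\<mu> v) = v" "w : carrier M ==> bk w : V k" "w : carrier M ==> \<mu> (bk w) = w"
proof -
 note L = locD[OF intwD(1)[OF M]]
 show "v : V k ==> bk (\<mu> v) = v" by (rule the_inv_into_f_f[OF L(4)])
 show "w : carrier M ==> bk w : V k" using the_inv_into_into[OF L(4) _ subset_refl, of w] L(5) by simp
 show "w : carrier M ==> \<mu> (bk w) = w" using f_the_inv_into_f[OF L(4), of w] L(5) by simp
qed

lemma bk_sum: assumes "!!x. x : X ==> w x : carrier M"
 shows "bk (SUM x:X. cs (z x) (w x)) = (SUM x:X. cs (z x) (bk (w x)))"
proof -
 note L = locD[OF intwD(1)[OF M]]
 have "(SUM x:X. cs (z x) (w x)) = \<mu> (SUM x:X. cs (z x) (bk (w x)))"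
  unfolding lin_sum[OF L(6)] lin_scale[OF L(6)] by (rule sum.cong) (simp_all only: bk(3)[OF assms])
 moreover have "(SUM x:X. cs (z x) (bk (w x))) : V k" by (intro V_sum V_sub(4) bk(2) assms)
 ultimately show ?thesis using bk(1) by simp
qed

lemma bk_continuous:
 fixes F :: "'u::topological_space => nat => complex"
 assumes F: "!!u. u : S ==> F u : carrier M" "!!x. continuous_on S (%u. F u x)"
 shows "conton S (%u. bk (F u))"
proof -
 obtain N where N: "carrier M = coord_space N" using mat unfolding matrix_module_def by blast
 have d: "delta x : carrier M" if "x < N" for x using that unfolding N coord_space_def by (simp add: delta_apply)
 have e: "bk (F u) = (SUM x<N. cs (F u x) (bk (delta x)))" if u: "u : S" for u
 proof -
  have "F u = (SUM x<N. cs (F u x) (delta x))"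
   by (rule delta_expand) (use F(1)[OF u] in \<open>auto simp: N coord_space_def\<close>)
  hence "bk (F u) = bk (SUM x<N. cs (F u x) (delta x))" by (rule arg_cong)
  also have "... = (SUM x<N. cs (F u x) (bk (delta x)))" by (rule bk_sum) (simp add: d)
  finally show ?thesis .
 qed
 have "conton S (%u. SUM x<N. cs (F u x) (bk (delta x)))"
  by (intro conton_sum conton_cs F(2) conton_const)
 thus ?thesis unfolding conton_def by (simp add: e cong: continuous_on_cong)
qed

lemma theta_continuous:
 fixes F :: "'u::topological_space => vec3"
 assumes F: "!!u. u : S ==> F u : V k" "conton S F" shows "continuous_on S (%u. \<mu> (F u) x)"
proof -
 note L = locD[OF intwD(1)[OF M]]
 have e: "\<mu> (F u) x = (SUM t:I k. F u t * \<mu> (delta t) x)" if u: "u : S" for u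
  using fun_cong[OF V_lin_expand[OF F(1)[OF u] L(6)], of x] unfolding sum_fun_apply cs_apply .
 have "continuous_on S (%u. SUM t:I k. F u t * \<mu> (delta t) x)"
  by (intro continuous_intros contonD[OF F(2)])
 thus ?thesis by (simp add: e cong: continuous_on_cong)
qed

definition pb :: "(nat => complex) set => vec3 set" where
 "pb W = {v \<in> V k. \<mu> v : W}"

lemma pb_image: assumes "U \<subseteq> V k" shows "pb (\<mu> ` U) = U"
proof (intro equalityI subsetI)
 fix v assume "v : pb (\<mu> ` U)"
 then obtain u where u: "v : V k" "\<mu> v = \<mu> u" "u : U" unfolding pb_def by blast
 have "u : V k" using u(3) assms by blast
 hence "v = u" by (rule inj_onD[OF locD(4)[OF intwD(1)[OF M]], OF u(2,1)])
 thus "v : U" using u(3) by simp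
qed (use assms in \<open>auto simp: pb_def\<close>)

lemma frames_carrier: "b : frames (carrier M) d ==> a < d ==> b a : carrier M"
 by (simp add: frames_def)

lemma frame_span_cs: "frame_span d b = {(SUM a<d. cs (z a) (b a)) | z. True}"
proof -
 have "(%x. SUM a<d. z a * b a x) = (SUM a<d. cs (z a) (b a))" for z by (rule ext) (simp add: sum_fun_apply)
 thus ?thesis unfolding frame_span_def by simp
qed

lemma pb_frame:
 assumes b: "b : frames (carrier M) d"
 shows "pb (frame_span d b) = lspan {..<d} (%a. bk (b a))"
proof -
 note L = locD[OF intwD(1)[OF M]]
 note c = frames_carrier[OF b]
 have "frame_span d b = \<mu> ` lspan {..<d} (%a. bk (b a))"
 proof -
  have "(SUM a<d. cs (z a) (b a)) = \<mu> (SUM a<d. cs (z a) (bk (b a)))" for z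
   unfolding lin_sum[OF L(6)] lin_scale[OF L(6)] by (rule sum.cong) (simp_all add: bk(3)[OF c])
  thus ?thesis unfolding frame_span_cs lspan_def by auto
 qed
 moreover have "lspan {..<d} (%a. bk (b a)) \<subseteq> V k" by (rule lspan_V) (simp add: bk(2) c)
 ultimately show ?thesis using pb_image by simp
qed

lemma frame_indep:
 assumes b: "b : frames (carrier M) d" shows "indep {..<d} (%a. bk (b a))"
 unfolding indep_def
proof (intro allI impI)
 note L = locD[OF intwD(1)[OF M]]
 fix z assume "(SUM a<d. cs (z a) (bk (b a))) = 0"
 hence "\<mu> (SUM a<d. cs (z a) (bk (b a))) = 0" using lin_0[OF L(6)] by simp
 moreover have "\<mu> (SUM a<d. cs (z a) (bk (b a))) = (SUM a<d. cs (z a) (b a))"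
  unfolding lin_sum[OF L(6)] lin_scale[OF L(6)] by (rule sum.cong) (simp_all add: bk(3)[OF frames_carrier[OF b]])
 ultimately have z: "(SUM a<d. cs (z a) (b a)) = 0" by simp
 have "(SUM a<d. z a * b a x) = 0" for x using fun_cong[OF z, of x] unfolding sum_fun_apply cs_apply zero_fun_apply .
 hence "ALL a<d. z a = 0" using b unfolding frames_def by blast
 thus "ALL a:{..<d}. z a = 0" by simp
qed

text \<open>On frames the pulled back subspace is spanned by the pulled back basis vectors, which
  stay independent, so the continuity of the Gram matrix formula applies.\<close>

lemma proj_continuous: "continuous_map (grassmannian (carrier M)) euclidean (%W. PJ k (pb W) v t)"
proof (rule continuous_map_grassmannian)
 fix d
 have coord: "continuous_on (frames (carrier M) d) (%b. b a x)" for a x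
  by (rule continuous_on_product_then_coordinatewise[OF continuous_on_product_then_coordinatewise[OF continuous_on_id]])
 have "conton (frames (carrier M) d) (%b. PJ k (lspan {..<d} (%a. bk (b a))) v)"
 proof (rule PJ_continuous[OF finite_lessThan])
  show "bk (b a) : V k" if "b : frames (carrier M) d" "a : {..<d}" for b a
   using that by (intro bk(2) frames_carrier) auto
  show "indep {..<d} (%a. bk (b a))" if "b : frames (carrier M) d" for b by (rule frame_indep[OF that])
  show "conton (frames (carrier M) d) (%b. bk (b a))" if "a : {..<d}" for a
   by (rule bk_continuous[OF _ coord]) (use that frames_carrier in auto)
 qed
 hence "continuous_on (frames (carrier M) d) (%b. PJ k (lspan {..<d} (%a. bk (b a))) v t)" by (rule contonD)
 thus "continuous_on (frames (carrier M) d) (%b. PJ k (pb (frame_span d b)) v t)"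
  by (simp add: pb_frame cong: continuous_on_cong)
qed

text \<open>Locally the frame \<open>g u\<close> provides a continuous ordered basis of the
  subspace, that is, a lift to \<open>frames\<close> with the constant dimension \<open>d\<close>.
  Composing it with the quotient map shows that preimages of open sets are open.\<close>

lemma flag_continuous:
 assumes j: "j <= l"
 shows "continuous_map (top_of_set (PP k A)) (grassmannian (carrier M)) (%u. \<mu> ` un k u j)"
proof -
 note L = locD[OF intwD(1)[OF M]]
 define d where "d = card (FI k j)"
 obtain \<nu> where \<nu>: "bij_betw \<nu> {..<d} (FI k j)"
  using ex_bij_betw_nat_finite[OF fin_FI, of k j] unfolding d_def atLeast0LessThan by blast
 define b where "b g = (%a. if a < d then \<mu> (fb k g (\<nu> a)) else (%_. 0))" for g
 have bf: "b g : frames (carrier M) d & frame_span d (b g) = \<mu> ` fl k g j" if g: "invm k g h" for g h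
 proof -
  note gl = glD(1)[OF invmD(1)[OF g]]
  have s: "(SUM a<d. cs (z a) (b g a)) = \<mu> (SUM t:FI k j. cs (z (the_inv_into {..<d} \<nu> t)) (fb k g t))" for z
  proof -
   have "(SUM a<d. cs (z a) (b g a)) = (SUM a<d. \<mu> (cs (z a) (fb k g (\<nu> a))))"
    by (rule sum.cong) (simp_all add: b_def lin_scale[OF L(6)])
   also have "... = \<mu> (SUM a<d. cs (z a) (fb k g (\<nu> a)))" by (rule lin_sum[OF L(6), symmetric])
   also have "(SUM a<d. cs (z a) (fb k g (\<nu> a))) = (SUM t:FI k j. cs (z (the_inv_into {..<d} \<nu> t)) (fb k g t))"
    by (rule sum.reindex_bij_betw[OF \<nu>, symmetric, THEN trans[rotated]] sum.reindex_bij_witness[of _ "the_inv_into {..<d} \<nu>" \<nu>])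
     (use \<nu> in \<open>auto simp: bij_betw_def the_inv_into_f_f f_the_inv_into_f intro: the_inv_into_into[of \<nu> "{..<d}" _ "{..<d}", simplified]\<close>)
   finally show ?thesis .
  qed
  have "b g : frames (carrier M) d"
   unfolding frames_def
  proof (intro CollectI conjI allI impI)
   fix z :: "nat => complex" and a assume z: "ALL x. (SUM a<d. z a * b g a x) = 0" and a: "a < d"
   have "(SUM a<d. cs (z a) (b g a)) = 0" by (rule ext) (use z in \<open>simp add: sum_fun_apply\<close>)
   hence "\<mu> (SUM t:FI k j. cs (z (the_inv_into {..<d} \<nu> t)) (fb k g t)) = \<mu> 0" unfolding s lin_0[OF L(6)] .
   hence "(SUM t:FI k j. cs (z (the_inv_into {..<d} \<nu> t)) (fb k g t)) = 0"
    by (intro inj_onD[OF L(4)]) (auto intro!: V_sum)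
   hence "ALL t:FI k j. z (the_inv_into {..<d} \<nu> t) = 0"
    by (rule mp[OF spec[OF fb_indep[OF g, of j, unfolded indep_def], of "%t. z (the_inv_into {..<d} \<nu> t)"]])
   moreover have "\<nu> a : FI k j" "the_inv_into {..<d} \<nu> (\<nu> a) = a"
    using a \<nu> the_inv_into_f_f[of \<nu> "{..<d}" a] by (auto simp: bij_betw_def)
   ultimately show "z a = 0" by metis
  qed (use L(7) in \<open>auto simp: b_def\<close>)
  moreover have "frame_span d (b g) = \<mu> ` fl k g j"
  proof (intro equalityI subsetI)
   fix x assume "x : frame_span d (b g)"
   then obtain z where z: "x = (SUM a<d. cs (z a) (b g a))" unfolding frame_span_cs by blast
   show "x : \<mu> ` fl k g j"
    unfolding z s fl_span[OF gl] lspan_def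
    by (rule imageI, rule CollectI, rule exI[of _ "%t. z (the_inv_into {..<d} \<nu> t)"], rule conjI[OF refl TrueI])
  next
   fix x assume "x : \<mu> ` fl k g j"
   then obtain y where y: "x = \<mu> y" "y : lspan (FI k j) (fb k g)" unfolding fl_span[OF gl] by (rule imageE)
   then obtain w where w': "y = (SUM t:FI k j. cs (w t) (fb k g t))" unfolding lspan_def by blast
   note w = y(1)[unfolded w']
   have "(SUM t:FI k j. cs (w (\<nu> (the_inv_into {..<d} \<nu> t))) (fb k g t)) = (SUM t:FI k j. cs (w t) (fb k g t))"
    by (rule sum.cong) (use \<nu> f_the_inv_into_f[of \<nu> "{..<d}"] in \<open>auto simp: bij_betw_def\<close>)
   hence "x = (SUM a<d. cs (w (\<nu> a)) (b g a))" unfolding s[of "%a. w (\<nu> a)"] w by (rule arg_cong[OF sym])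
   thus "x : frame_span d (b g)" unfolding frame_span_cs by (intro CollectI exI[of _ "%a. w (\<nu> a)"] conjI TrueI)
  qed
  ultimately show ?thesis by blast
 qed
 show ?thesis
  unfolding continuous_map_def
 proof (intro conjI allI impI)
  have T: "\<mu> ` un k u j : topspace (grassmannian (carrier M))" if u: "u : PP k A" for u
  proof -
   obtain g h where g: "invm k g h" "!!j. j <= l ==> un k u j = fl k g j" by (rule Z_flag[OF un_Z[OF u]]) (rule that)
   show ?thesis unfolding topspace_grassmannian g(2)[OF j] using bf[OF g(1)] by blast
  qed
  thus "(%u. \<mu> ` un k u j) : topspace (top_of_set (PP k A)) \<rightarrow> topspace (grassmannian (carrier M))" by auto
  fix W assume "openin (grassmannian (carrier M)) W"
  hence W: "openin (top_of_set (frames (carrier M) d)) {b \<in> frames (carrier M) d. frame_span d b : W}"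
   unfolding openin_grassmannian open_in_grassmannian_def by blast
  show "openin (top_of_set (PP k A)) {u \<in> topspace (top_of_set (PP k A)). \<mu> ` un k u j : W}"
  proof (subst openin_subopen, intro ballI)
   fix u0 assume "u0 : {u \<in> topspace (top_of_set (PP k A)). \<mu> ` un k u j : W}"
   hence u0: "u0 : PP k A" "\<mu> ` un k u0 j : W" by auto
   obtain W0 g g' where W0: "open W0" "u0 : W0" and gc: "opcont (W0 Int PP k A) g"
    and g: "!!u. u : W0 Int PP k A ==> invm k (g u) (g' u)"
    and gu: "!!u j. u : W0 Int PP k A ==> j <= l ==> un k u j = fl k (g u) j"
    by (rule local_frame[OF u0(1)]) (rule that)
   let ?S = "W0 Int PP k A"
   have cb: "continuous_on ?S (%u. b (g u))"
   proof (intro continuous_on_coordinatewise_then_product)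
    fix a x
    show "continuous_on ?S (%u. b (g u) a x)"
    proof (cases "a < d")
     case True
     have "\<nu> a : FI k j" using \<nu> True by (auto simp: bij_betw_def)
     hence "delta (\<nu> a) : Vin" using F_Vin[OF F_delta] by blast
     hence "conton ?S (%u. fb k (g u) (\<nu> a))" unfolding fb_def by (intro conton_ops(1) opcontD[OF gc])
     hence "continuous_on ?S (%u. \<mu> (fb k (g u) (\<nu> a)) x)" by (intro theta_continuous) simp_all
     thus ?thesis using True by (simp add: b_def)
    qed (simp add: b_def)
   qed
   have bS: "(%u. b (g u)) : ?S \<rightarrow> frames (carrier M) d" using bf[OF g] by blast
   let ?T = "?S Int (%u. b (g u)) -` {b \<in> frames (carrier M) d. frame_span d b : W}"
   have "openin (top_of_set ?S) ?T" by (rule continuous_openin_preimage[OF cb bS W])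
   moreover have "openin (top_of_set (PP k A)) ?S" using openin_open_Int[OF W0(1), of "PP k A"] by (simp add: Int_commute)
   ultimately have "openin (top_of_set (PP k A)) ?T" by (rule openin_trans)
   moreover have "frame_span d (b (g u)) = \<mu> ` un k u j" if "u : ?S" for u using bf[OF g[OF that]] gu[OF that j] by simp
   ultimately show "EX T. openin (top_of_set (PP k A)) T & u0 : T & T \<subseteq> {u \<in> topspace (top_of_set (PP k A)). \<mu> ` un k u j : W}"
    using u0 W0(2) bf[OF g] by (intro exI[of _ ?T]) auto
  qed
 qed
qed

text \<open>Both the product of Grassmannians and the space of projection matrices test continuity
  componentwise, so \<open>flag_continuous\<close> and \<open>proj_continuous\<close>
  suffice.\<close>

lemma Flf_homeomorphic: "Flf M l \<rho> homeomorphic_space top_of_set (PP k A)"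
proof -
 note L = locD[OF intwD(1)[OF M]]
 define to where "to u = (\<lambda>j\<in>{0..l}. \<mu> ` un k u j)" for u
 define from' where "from' W = pr k (\<lambda>j\<in>{0..l}. pb (W j))" for W :: "nat => (nat => complex) set"
 have toF: "to u : Flf_set M l \<rho>" if "u : PP k A" for u
  unfolding to_def by (rule Flf_set_image[OF M un_Z[OF that]])
 have pbU: "(\<lambda>j\<in>{0..l}. pb ((\<lambda>j\<in>{0..l}. \<mu> ` U j) j)) = U" if U: "U : Z k A" for U
 proof
  fix j
  show "(\<lambda>j\<in>{0..l}. pb ((\<lambda>j\<in>{0..l}. \<mu> ` U j) j)) j = U j"
  proof (cases "j <= l")
   case True
   have "U j \<subseteq> V k" using Z_sub(5)[OF U True] by blast
   thus ?thesis using True pb_image by simp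
  next
   case False
   thus ?thesis using Z_ext[OF U] by (simp add: extensional_def)
  qed
 qed
 have ft: "from' (to u) = u" if u: "u : PP k A" for u
  unfolding from'_def to_def pbU[OF un_Z[OF u]] by (rule pr_un[OF u])
 have Fl: "EX U. U : Z k A & W = (\<lambda>j\<in>{0..l}. \<mu> ` U j)" if "W : Flf_set M l \<rho>" for W
  using Flf_set_preimage[OF M that] by blast
 have tf: "from' W : PP k A & to (from' W) = W" if W: "W : Flf_set M l \<rho>" for W
 proof -
  obtain U where U: "U : Z k A" "W = (\<lambda>j\<in>{0..l}. \<mu> ` U j)" using Fl[OF W] by (elim exE conjE)
  have fW: "from' W = pr k U" unfolding from'_def U(2) pbU[OF U(1)] ..
  show ?thesis unfolding fW to_def un_pr[OF U(1)] U(2)[symmetric] using U(1) by (simp add: PP_def)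
 qed
 have cto: "continuous_map (top_of_set (PP k A)) (Flf M l \<rho>) to"
  unfolding Flf_def continuous_map_in_subtopology continuous_map_componentwise
 proof (intro conjI ballI)
  show "continuous_map (top_of_set (PP k A)) (grassmannian (carrier M)) (%u. to u j)" if "j : {0..l}" for j
   using flag_continuous[of j] that by (simp add: to_def)
 qed (use toF in \<open>auto simp: to_def\<close>)
 have cfrom: "continuous_map (Flf M l \<rho>) (top_of_set (PP k A)) from'"
  unfolding continuous_map_in_subtopology
 proof
  show "continuous_map (Flf M l \<rho>) euclidean from'"
  proof (subst continuous_map_euclidean_fun, rule allI, subst continuous_map_euclidean_fun, rule allI,
    subst continuous_map_euclidean_fun, rule allI)
   fix j s t
   show "continuous_map (Flf M l \<rho>) euclidean (%W. from' W j s t)"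
   proof (cases "j <= l")
    case True
    hence "j : {0..l}" by simp
    hence "continuous_map (Flf M l \<rho>) (grassmannian (carrier M)) (%W. W j)"
     unfolding Flf_def by (intro continuous_map_from_subtopology continuous_map_product_projection)
    from continuous_map_compose[OF this proj_continuous[of "delta s" t]]
    show ?thesis using True by (simp add: from'_def pr_def comp_def)
   qed (simp add: from'_def pr_def)
  qed
  show "from' : topspace (Flf M l \<rho>) \<rightarrow> PP k A" using tf by (auto simp: Flf_def)
 qed
 have "homeomorphic_maps (Flf M l \<rho>) (top_of_set (PP k A)) from' to"
  unfolding homeomorphic_maps_def using cto cfrom ft tf by (auto simp: Flf_def)
 thus ?thesis unfolding homeomorphic_space_def by blast
qed

end

section \<open>Independence of the level\<close>

lemma rigid_iff_adsurj:
 "(EX M. matrix_module M & rigid H M & has_rank_vector M m) \<longleftrightarrow> (EX A. adsurj k A)"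
proof
 assume "EX M. matrix_module M & rigid H M & has_rank_vector M m"
 then obtain M where M: "matrix_module M" "rigid H M" "has_rank_vector M m" by (elim exE conjE)
 obtain \<mu> where l: "loc M \<mu>" using loc_exists[OF matrix_pwm[OF M(1)] M(3)] by (elim exE)
 obtain A where A: "intw M \<mu> A" using intw_exists[OF l] by (elim exE)
 show "EX A. adsurj k A" by (rule exI[of _ A]) (rule rigid_imp_adsurj[OF A M(2)])
next
 assume "EX A. adsurj k A"
 then obtain A where A: "adsurj k A" by (elim exE)
 obtain M \<mu> where M: "matrix_module M" "intw M \<mu> A" using model_module[OF adsurj_rep[OF A]] by (elim exE conjE)
 show "EX M. matrix_module M & rigid H M & has_rank_vector M m"
  by (intro exI[of _ M] conjI M(1) adsurj_imp_rigid[OF M(2) A] loc_rank[OF intwD(1)[OF M(2)]])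
qed

text \<open>The module picked by \<open>rigid_module\<close> comes with some representation
  \<open>A\<close> of its own. By \<open>adsurj_unique\<close> it can be described by the prescribed
  \<open>B\<close> instead, which may be the same at all levels.\<close>

lemma Flf_rigid_homeomorphic:
 assumes m: "m = (%i. SUM j = 1..l. \<rho> j i)" and B: "adsurj k B"
 shows "Flf_rigid l \<rho> homeomorphic_space top_of_set (PP k B)"
proof -
 have ex: "EX M. matrix_module M & rigid H M & has_rank_vector M m" unfolding rigid_iff_adsurj using B by (rule exI[where x = B])
 define M where "M = rigid_module m"
 have M: "matrix_module M & rigid H M & has_rank_vector M m"
  using someI_ex[OF ex] ex unfolding M_def rigid_module_def by (simp only: if_True)
 obtain \<mu> where lo: "loc M \<mu>" using loc_exists[OF matrix_pwm] M by blast
 obtain A where A: "intw M \<mu> A" using intw_exists[OF lo] by (elim exE)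
 note AD = intwD[OF A] and L = locD[OF lo]
 have "isom k B A" by (rule adsurj_unique[OF B rigid_imp_adsurj[OF A]]) (use M in simp)
 then obtain g h where g: "invm k g h" "ALL a:Arr. ALL v:Vin. tr k (g (B a v)) = tr k (A a (g v))" unfolding isom_def by (elim exE conjE)
 note Br = adsurj_rep[OF B]
 have "intw M (%v. \<mu> (tr k (g v))) B"
  unfolding intw_def
 proof (intro conjI allI impI ballI loc_twist[OF lo g(1)] Br)
  fix i j h v assume a: "(i, j, h) : Arr" and v: "v : V k"
  note vi = V_Vin[OF v]
  have "tr k (A (i, j, h) (tr k (g v))) = tr k (A (i, j, h) (g v))"
   by (rule rep_cong[OF AD(2) a tr_Vin glD(2)[OF invmD(1)[OF g(1)] vi]]) simp
  also have "... = tr k (g (B (i, j, h) v))" using g(2) a vi by simp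
  also have "... = tr k (g (tr k (B (i, j, h) v)))"
   by (rule gl_cong[OF invmD(1)[OF g(1)] rep_Vin[OF Br a vi] tr_Vin]) simp
  finally show "arr (Alpha i j h) \<star>M \<mu> (tr k (g v)) = \<mu> (tr k (g (tr k (B (i, j, h) v))))"
   unfolding AD(3)[OF a tr_V] by simp
 qed
 from Flf_homeomorphic[OF _ this] M show ?thesis unfolding Flf_rigid_def M_def m by blast
qed

lemma zero_pwm: "pwm zero_module"
proof -
 have z: "carrier zero_module = {0}" "\<zero>\<^bsub>zero_module\<^esub> = 0" "v \<oplus>\<^bsub>zero_module\<^esub> w = 0" "h \<odot>\<^bsub>zero_module\<^esub> v = 0" for v w h
  by (simp_all add: zero_module_def zero_fun_def)
 have "abelian_group zero_module" by (rule abelian_groupI) (simp_all only: z singleton_iff bex_simps, auto simp: z)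
 hence "left_module H zero_module"
  by (intro left_module.intro left_module_axioms.intro HR.ring_axioms) (simp_all only: z singleton_iff)
 thus ?thesis unfolding pwm_def by (simp add: z fun_eq_iff)
qed

text \<open>For zero ranks the zero representation is \<open>adsurj\<close>, so here some rank
  \<open>\<rho> j i\<close> is nonzero, and the zero module has no subquotient free of that rank.
  The empty space is written out in a form free of \<open>k\<close>, so that two levels give
  literally equal spaces.\<close>

lemma Flf_rigid_empty:
 assumes m: "m = (%i. SUM j = 1..l. \<rho> j i)" and no: "\<nexists>A. adsurj k A"
 shows "Flf_rigid l \<rho> = subtopology (product_topology (%_. grassmannian {%_. 0}) {0..l}) {}"
proof -
 have "EX i:{1..n}. m i ~= 0"
 proof (rule ccontr)
  assume "\<not> (EX i:{1..n}. m i ~= 0)"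
  hence I: "I k = {}" by (auto simp: I_def)
  have "tr k v = tr k w" for v w unfolding tr_def I by simp
  hence "adsurj k (%a v. 0)" unfolding adsurj_def using rep_0 gl_id by blast
  thus False using no by blast
 qed
 then obtain i where i: "i : {1..n}" "(SUM j = 1..l. \<rho> j i) ~= 0" unfolding m by blast
 then obtain j where j: "j : {1..l}" "\<rho> j i ~= 0" by (meson sum.neutral)
 have car: "carrier zero_module = {0}" by (simp add: zero_module_def zero_fun_def)
 have "W \<notin> Flf_set zero_module l \<rho>" for W
 proof
  assume W: "W : Flf_set zero_module l \<rho>"
  have S: "submodule (W j) H zero_module" "submodule (W (j - 1)) H zero_module" "W (j - 1) \<subseteq> W j"
   and fr: "free_at (quotient_module (zero_module\<lparr>carrier := W j\<rparr>) (W (j - 1))) i (\<rho> j i)"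
   using W j(1) i(1) unfolding Flf_set_def has_rank_vector_def by auto
  note Q = pwm_sub[OF zero_pwm S(1)]
  have Wj: "W j = {0}" "W (j - 1) = {0}"
   using S(1,2) unfolding submodule_iff[OF zero_pwm] car by auto
  have "fchar (zero_module\<lparr>carrier := W j\<rparr>) i (\<rho> j i) (W (j - 1))"
   using fr free_at_quotient[OF Q i(1) submodule_sub[OF zero_pwm S(2,1,3)]] by simp
  then obtain x where x: "ALL w:vertex_space (zero_module\<lparr>carrier := W j\<rparr>) i.
    EX! z. z : Zs i (\<rho> j i) & w - hlin (zero_module\<lparr>carrier := W j\<rparr>) i (\<rho> j i) z x : W (j - 1)"
   unfolding fchar_def by (elim exE conjE)
  have "0 : vertex_space (zero_module\<lparr>carrier := W j\<rparr>) i"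
   unfolding vertex_space_sub[OF zero_pwm S(1) i(1)] unfolding Wj using act_0[OF zero_pwm idem_closed[OF i(1)]] by simp
  hence u: "EX! z. z : Zs i (\<rho> j i) & 0 - hlin (zero_module\<lparr>carrier := W j\<rparr>) i (\<rho> j i) z x : W (j - 1)"
   using x by (rule bspec[rotated])
  have h0: "hlin (zero_module\<lparr>carrier := W j\<rparr>) i (\<rho> j i) z x = 0" for z
  proof -
   have 0: "h \<odot>\<^bsub>zero_module\<lparr>carrier := W j\<rparr>\<^esub> v = 0" for h v by (simp add: zero_module_def zero_fun_def)
   show ?thesis unfolding hlin_def 0 cs_simps by (simp only: sum.neutral_const)
  qed
  have all: "0 - hlin (zero_module\<lparr>carrier := W j\<rparr>) i (\<rho> j i) z x : W (j - 1)" for z unfolding h0 unfolding Wj by simp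
  \<comment> \<open>A nonzero coefficient array that competes with the zero array in expanding 0,
    contradicting uniqueness.\<close>
  define z1 :: "nat => nat => complex" where "z1 = (%q a. if q = 0 & a = 0 then 1 else 0)"
  have "z1 : Zs i (\<rho> j i)" "(%q a. 0) : Zs i (\<rho> j i)"
   using j(2) G.c_pos[OF i(1)] by (auto simp: Zs_def z1_def)
  hence "z1 = (%q a. 0)" using u all by (metis (no_types, lifting))
  hence "z1 0 0 = 0" by (rule fun_cong[OF fun_cong])
  thus False by (simp add: z1_def)
 qed
 hence "Flf_set zero_module l \<rho> = {}" by blast
 moreover have "\<not> (EX M. matrix_module M & rigid H M & has_rank_vector M m)" unfolding rigid_iff_adsurj by (rule no)
 hence "rigid_module m = zero_module" unfolding rigid_module_def by (rule if_not_P)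
 moreover have "carrier zero_module = {%_. 0}" by (simp add: zero_module_def)
 ultimately show ?thesis unfolding Flf_rigid_def Flf_def m by simp
qed

lemma PP_levels:
 assumes A: "adsurj k A" and K: "0 < K"
 shows "top_of_set (PP K A) homotopy_equivalent_space top_of_set (PP 1 A)"
 using K
proof (induction K)
 case (Suc K)
 show ?case
 proof (cases "K = 0")
  case True
  thus ?thesis using homotopy_equivalent_space_refl by simp
 next
  case False
  have "top_of_set (PP (Suc K) A) homotopy_equivalent_space top_of_set (PP K A)"
   using False adsurj_level[OF A k_pos] by (intro PP_homotopy_equivalent) auto
  thus ?thesis using Suc False homotopy_eqv_trans by blast
 qed
qed simp

end

text \<open>After division by the gcd the cofactors are coprime, so one of them divides
  \<open>c\<close>. For the absolute values of \<open>C i j\<close> and \<open>C j i\<close> this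
  yields the common factor \<open>e\<close> that makes \<open>D k\<close> central.\<close>

lemma symmetrizer_factors:
 fixes a b :: nat
 assumes "c * a = d * b" "0 < a" "0 < b"
 shows "EX e. c = b div gcd a b * e & d = a div gcd a b * e"
proof -
 let ?g = "gcd a b"
 have g: "0 < ?g" using assms by simp
 obtain a' b' where ab: "a = a' * ?g" "b = b' * ?g" "coprime a' b'" using gcd_coprime_exists[of a b] g by auto
 have a': "a div ?g = a'" "b div ?g = b'" using ab(1,2) g by (metis nonzero_mult_div_cancel_right less_numeral_extra(3))+
 have "c * a' * ?g = d * b' * ?g" using assms(1) ab(1,2) by (metis mult.assoc)
 hence e: "c * a' = d * b'" using g by (metis mult_cancel2 less_numeral_extra(3))
 hence "b' dvd c * a'" by simp
 hence "b' dvd c" using ab(3) by (metis coprime_commute coprime_dvd_mult_left_iff)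
 then obtain e' where e': "c = b' * e'" by (rule dvdE)
 have "0 < b'" using ab(2) assms(3) by (metis gr0I mult_zero_left less_irrefl)
 moreover have "b' * (e' * a') = b' * d" using e unfolding e' by (simp add: ac_simps)
 ultimately have "d = a' * e'" by (simp add: ac_simps)
 thus ?thesis unfolding a' using e' by blast
qed

lemma gls_flag_of_cartan:
 assumes s: "symmetrizer n C c" and o: "orientation n C \<Omega>" and K: "1 <= K"
  and m: "m = (%i. SUM j = 1..l. \<rho> j i)"
 shows "gls_flag n c m {(i, j, h). (i, j) : \<Omega> & 1 <= h & h <= gls.g C i j} (%i j. gls.f C j i) (gls.f C) C K \<Omega> l \<rho>"
proof -
 let ?A = "{(i, j, h). (i, j) : \<Omega> & 1 <= h & h <= gls.g C i j}"
 have om: "\<Omega> \<subseteq> {1..n} \<times> {1..n}" using o by (simp add: orientation_def)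
 have "finite ?A"
 proof (rule finite_subset)
  show "?A \<subseteq> (%((i, j), h). (i, j, h)) ` (SIGMA (i, j) : \<Omega>. {1..gls.g C i j})" by (force simp: image_iff)
  show "finite ((%((i, j), h). (i, j, h)) ` (SIGMA (i, j) : \<Omega>. {1..gls.g C i j}))"
   by (intro finite_imageI finite_SigmaI finite_subset[OF om]) auto
 qed
 moreover have "i : {1..n} & j : {1..n} & 0 < gls.f C j i & 0 < gls.f C i j & (EX e. c i = gls.f C j i * e & c j = gls.f C i j * e)"
  if a: "(i, j) : \<Omega>" for i j
 proof -
  have ij: "i : {1..n}" "j : {1..n}" using om a by auto
  have neg: "C i j < 0" using o ij a unfolding orientation_def by blast
  have e: "int (c i) * C i j = int (c j) * C j i" and cp: "0 < c i" "0 < c j" using s ij unfolding symmetrizer_def by auto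
  have "int (c i) * C i j < 0" using neg cp by (simp add: mult_pos_neg)
  hence neg': "C j i < 0" unfolding e using cp by (simp add: mult_less_0_iff)
  define a' b' where "a' = nat \<bar>C i j\<bar>" and "b' = nat \<bar>C j i\<bar>"
  have ab: "0 < a'" "0 < b'" using neg neg' by (simp_all add: a'_def b'_def)
  have g1: "gls.g C i j = gcd a' b'" unfolding gls.g_def a'_def b'_def gcd_int_def by simp
  have g2: "gls.g C j i = gcd a' b'" unfolding gls.g_def a'_def b'_def gcd_int_def by (subst gcd.commute) simp
  note gg = g1 g2
  have ff: "gls.f C i j = a' div gcd a' b'" "gls.f C j i = b' div gcd a' b'"
   unfolding gls.f_def gg by (simp_all add: a'_def b'_def)
  have "int (c i * a') = int (c j * b')" using e neg neg' by (simp add: a'_def b'_def)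
  hence "c i * a' = c j * b'" by (rule of_nat_eq_iff[THEN iffD1])
  from symmetrizer_factors[OF this ab] have "EX e. c i = gls.f C j i * e & c j = gls.f C i j * e" unfolding ff .
  moreover have "0 < gls.f C i j" "0 < gls.f C j i"
   unfolding ff using ab by (simp_all add: div_greater_zero_iff dvd_imp_le)
  ultimately show ?thesis using ij by blast
 qed
 moreover have "0 < c i" if "i : {1..n}" for i using s that unfolding symmetrizer_def by blast
 ultimately have P: "power_series_model n c ?A (%i j. gls.f C j i) (gls.f C)"
  by (intro power_series_model.intro) auto
 have G: "gls_pos n (%i. K * c i) \<Omega>"
  using om s K unfolding symmetrizer_def by (intro gls_pos.intro) auto
 have K0: "0 < K" using K by simp
 show ?thesis
  unfolding gls_flag_def gls_model_def gls_model_axioms_def flag_model_def flag_model_axioms_def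
  by (intro conjI P G K0 allI impI refl) (simp_all add: m)
qed

theorem corollary1p3:
  fixes n l k k' :: nat
    and C :: "nat \<Rightarrow> nat \<Rightarrow> int"
    and c :: "nat \<Rightarrow> nat"
    and \<Omega> :: "(nat \<times> nat) set"
    and \<r> :: "nat \<Rightarrow> nat \<Rightarrow> nat"
  assumes "generalized_cartan_matrix n C"
    and "symmetrizer n C c"
    and "orientation n C \<Omega>"
    and "l \<ge> 2"
    and "k \<ge> 1" and "k' \<ge> 1"
  shows "euler_characteristic (gls.Flf_rigid n C (\<lambda>i. k * c i) \<Omega> l \<r>) =
         euler_characteristic (gls.Flf_rigid n C (\<lambda>i. k' * c i) \<Omega> l \<r>)"
proof -
 define m where "m = (%i. SUM j = 1..l. \<r> j i)"
 define Arr where "Arr = {(i, j, h). (i, j) : \<Omega> & 1 <= h & h <= gls.g C i j}"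
 interpret X: gls_flag n c m Arr "%i j. gls.f C j i" "gls.f C" C k \<Omega> l \<r>
  unfolding Arr_def by (rule gls_flag_of_cartan[OF assms(2,3,5) m_def])
 \<comment> \<open>Both interpretations share one power series model, as the ranks and the numbers
   \<open>gls.f C i j\<close> do not involve \<open>k\<close>; they differ only in the level. Hence
   constants of \<open>X\<close> can be used at level \<open>k'\<close> too.\<close>
 interpret Y: gls_flag n c m Arr "%i j. gls.f C j i" "gls.f C" C k' \<Omega> l \<r>
  unfolding Arr_def by (rule gls_flag_of_cartan[OF assms(2,3,6) m_def])
 show ?thesis
 \<comment> \<open>By \<open>adsurj_level\<close> a rigid module exists at both levels or at
   neither. In the first case both flag varieties are compared with level 1 of the same
   \<open>A\<close>.\<close>
 proof (cases "EX A. X.adsurj k A")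
  case True
  then obtain A where A: "X.adsurj k A" by (elim exE)
  have A': "X.adsurj k' A" by (rule X.adsurj_level[OF A X.k_pos])
  have "gls.Flf_rigid n C (%i. k * c i) \<Omega> l \<r> homotopy_equivalent_space top_of_set (X.PP k A)"
   by (rule homeomorphic_imp_homotopy_equivalent_space[OF X.Flf_rigid_homeomorphic[OF m_def A]])
  also have "top_of_set (X.PP k A) homotopy_equivalent_space top_of_set (X.PP 1 A)" by (rule X.PP_levels[OF A X.k_pos])
  also have "top_of_set (X.PP 1 A) homotopy_equivalent_space top_of_set (X.PP k' A)"
   using X.PP_levels[OF A Y.k_pos] homotopy_equivalent_space_sym by blast
  also have "top_of_set (X.PP k' A) homotopy_equivalent_space gls.Flf_rigid n C (%i. k' * c i) \<Omega> l \<r>"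
   using homeomorphic_imp_homotopy_equivalent_space[OF Y.Flf_rigid_homeomorphic[OF m_def A']]
    homotopy_equivalent_space_sym by blast
  finally show ?thesis by (rule euler_characteristic_homotopy)
 next
  case False
  have no: "\<nexists>A. X.adsurj k' A" using False X.adsurj_level[OF _ Y.k_pos] by blast
  show ?thesis unfolding X.Flf_rigid_empty[OF m_def False] Y.Flf_rigid_empty[OF m_def no] ..
 qed
qed

end
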